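(* Let $p$ be an odd prime and $k$ an algebraically closed field of characteristic $p$. Let $P$ be an extraspecial group of order $p^3$ and exponent $p$, let $H$ be a quaternion group of order $8$ acting on $P$ with $Z(H)$ acting trivially, and with the two generators of $H$ inverting the two generators of $P$ (as made precise in the context). Set $G=P\rtimes H$. The basic algebra of the associated graded $\mathrm{gr}_*(kP)$ of $kP$ is given by generators $x,y,z$, subject to the relations $$x^p=0,\quad y^p=0,\quad xy-yx=z,\quad xz-zx=0,\quad yz-zy=0$$ (these imply $z^p=0$), while the basic algebra of the associated graded $\mathrm{gr}_*(kGe)$ of the non-principal block $e$ of $kG$ is given by generators $\mathsf x,\mathsf y,\mathsf z$, subject to the relations $$\mathsf x^p=0,\quad \mathsf y^p=0,\quad \mathsf x\mathsf y+\mathsf y\mathsf x=\mathsf z,\quad \mathsf x\mathsf z+\mathsf z\mathsf x=0,\quad \mathsf y\mathsf z+\mathsf z\mathsf y=0$$ (these imply $\mathsf z^p=0$).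
   Context: $P=\langle g,h,c\mid g^p=h^p=c^p=1,\ [g,h]=c,\ [g,c]=[h,c]=1\rangle$ and $H=\langle s,t\mid s^4=1,\ s^2=t^2,\ ts=s^{-1}t\rangle\cong Q_8$, acting by $g^s=g^{-1}$, $g^t=g$, $h^s=h$, $h^t=h^{-1}$ (hence $c^s=c^t=c^{-1}$, and $Z(H)=\langle s^2\rangle$ acts trivially). The group algebra $kG$ has exactly two blocks, the principal block idempotent $\frac12(1+s^2)$ and the non-principal one $e=\frac12(1-s^2)$. For a finite-dimensional algebra $A$ with Jacobson radical $J(A)$, $\mathrm{gr}_*(A)=\bigoplus_{n\ge0}J^n(A)/J^{n+1}(A)$ with $J^0(A)=A$. Presentations are as associative unital $k$-algebras.
   Formalization: The relation z^p = 0 is listed among the defining relations in both presentations, because it does not follow from the others (x = d/dT, y = T, z = 1 on k[T]/(T^p) satisfy them), so the presentations as printed define infinite-dimensional algebras. *)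

theory Defs
  imports
    "HOL-Computational_Algebra.Polynomial"
    "HOL-Algebra.Generated_Groups"
    "HOL-Algebra.Ideal_Product"
    "HOL-Algebra.QuotRing"
    "HOL-Algebra.Module"
begin

text \<open>
  The field \<open>k\<close> is a type \<open>'k\<close>; a \<open>k\<close>-algebra is a value of the record type
  \<open>('k, 'a) module\<close> of HOL-Algebra, of which the multiplicative unit is also used.
  The argument of type \<open>'k itself\<close> below only selects the coefficient field.
\<close>

section \<open>Monoid algebras, group algebras, free algebras\<close>

definition monoid_algebra ::
  "'k::field itself \<Rightarrow> ('m, 'b) monoid_scheme \<Rightarrow> ('k, 'm \<Rightarrow> 'k) module" where
  "monoid_algebra k M =
     \<lparr>carrier = {a. finite {u. a u \<noteq> 0} \<and> (\<forall>u. u \<notin> carrier M \<longrightarrow> a u = 0)},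
      mult = (\<lambda>a b w. \<Sum>(u, v) \<in> {(u, v). a u \<noteq> 0 \<and> b v \<noteq> 0 \<and> u \<otimes>\<^bsub>M\<^esub> v = w}. a u * b v),
      one = (\<lambda>u. if u = \<one>\<^bsub>M\<^esub> then 1 else 0),
      zero = (\<lambda>u. 0),
      add = (\<lambda>a b u. a u + b u),
      module.smult = (\<lambda>r a u. r * a u)\<rparr>"

definition single :: "'m \<Rightarrow> 'm \<Rightarrow> 'k::field" where
  "single u = (\<lambda>v. if v = u then 1 else 0)"

definition augmentation :: "('m \<Rightarrow> 'k::field) \<Rightarrow> 'k" where
  "augmentation a = (\<Sum>u | a u \<noteq> 0. a u)"

definition free_monoid :: "'v list monoid" where
  "free_monoid = \<lparr>carrier = UNIV, mult = (@), one = []\<rparr>"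

abbreviation free_algebra :: "'k::field itself \<Rightarrow> ('k, 'v list \<Rightarrow> 'k) module" where
  "free_algebra k \<equiv> monoid_algebra k free_monoid"

section \<open>Isomorphisms, quotients, presentations\<close>

definition algebra_isomorphic :: "('k, 'a) module \<Rightarrow> ('k, 'b) module \<Rightarrow> bool" where
  "algebra_isomorphic A B \<longleftrightarrow>
     (\<exists>\<phi> \<in> ring_iso A B. \<forall>r. \<forall>a \<in> carrier A. \<phi> (r \<odot>\<^bsub>A\<^esub> a) = r \<odot>\<^bsub>B\<^esub> \<phi> a)"

definition quotient_algebra :: "('k, 'a) module \<Rightarrow> 'a set \<Rightarrow> ('k, 'a set) module" where
  "quotient_algebra A I =
     ring.extend (A Quot I) \<lparr>module.smult = (\<lambda>r X. \<Union>a\<in>X. I +>\<^bsub>A\<^esub> (r \<odot>\<^bsub>A\<^esub> a))\<rparr>"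

definition presented_algebra ::
  "'k::field itself \<Rightarrow> ('v list \<Rightarrow> 'k) set \<Rightarrow> ('k, ('v list \<Rightarrow> 'k) set) module" where
  "presented_algebra k R = quotient_algebra (free_algebra k) (Idl\<^bsub>free_algebra k\<^esub> R)"

section \<open>Jacobson radical and associated graded algebra\<close>

definition left_ideal :: "'a set \<Rightarrow> ('a, 'b) ring_scheme \<Rightarrow> bool" where
  "left_ideal L A \<longleftrightarrow> additive_subgroup L A \<and> (\<forall>a \<in> carrier A. \<forall>x \<in> L. a \<otimes>\<^bsub>A\<^esub> x \<in> L)"

definition maximal_left_ideal :: "'a set \<Rightarrow> ('a, 'b) ring_scheme \<Rightarrow> bool" where
  "maximal_left_ideal L A \<longleftrightarrow> left_ideal L A \<and> L \<noteq> carrier A \<and>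
     (\<forall>L'. left_ideal L' A \<and> L \<subseteq> L' \<longrightarrow> L' = L \<or> L' = carrier A)"

definition jacobson_radical :: "('a, 'b) ring_scheme \<Rightarrow> 'a set" where
  "jacobson_radical A = carrier A \<inter> \<Inter>{L. maximal_left_ideal L A}"

primrec radical_power :: "('a, 'b) ring_scheme \<Rightarrow> nat \<Rightarrow> 'a set" where
  "radical_power A 0 = carrier A"
| "radical_power A (Suc n) = ideal_prod A (radical_power A n) (jacobson_radical A)"

text \<open>
  An element of \<open>gr(A)\<close> is a finitely supported family \<open>f\<close> with \<open>f n\<close> a coset of
  \<open>J^(n+1)\<close> in \<open>J^n\<close>.  The product of \<open>a + J^(i+1)\<close> and \<open>b + J^(j+1)\<close> is the coset
  \<open>ab + J^(i+j+1)\<close>; sums of such cosets are formed in \<open>A/J^(i+j+1)\<close>.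
\<close>
definition graded_algebra :: "('k, 'a) module \<Rightarrow> ('k, nat \<Rightarrow> 'a set) module" where
  "graded_algebra A = (let J = radical_power A in
     \<lparr>carrier = {f. (\<forall>n. \<exists>a \<in> J n. f n = J (Suc n) +>\<^bsub>A\<^esub> a) \<and> finite {n. f n \<noteq> J (Suc n)}},
      mult = (\<lambda>f g n. \<Oplus>\<^bsub>A Quot J (Suc n)\<^esub> i \<in> {..n}. rcoset_mult A (J (Suc n)) (f i) (g (n - i))),
      one = (\<lambda>n. if n = 0 then J (Suc 0) +>\<^bsub>A\<^esub> \<one>\<^bsub>A\<^esub> else J (Suc n)),
      zero = (\<lambda>n. J (Suc n)),
      add = (\<lambda>f g n. f n <+>\<^bsub>A\<^esub> g n),
      module.smult = (\<lambda>r f n. \<Union>a\<in>f n. J (Suc n) +>\<^bsub>A\<^esub> (r \<odot>\<^bsub>A\<^esub> a))\<rparr>)"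

section \<open>Idempotents, blocks, basic algebras\<close>

definition idempotent :: "('a, 'b) ring_scheme \<Rightarrow> 'a \<Rightarrow> bool" where
  "idempotent A e \<longleftrightarrow> e \<in> carrier A \<and> e \<otimes>\<^bsub>A\<^esub> e = e"

definition orthogonal :: "('a, 'b) ring_scheme \<Rightarrow> 'a \<Rightarrow> 'a \<Rightarrow> bool" where
  "orthogonal A e f \<longleftrightarrow> e \<otimes>\<^bsub>A\<^esub> f = \<zero>\<^bsub>A\<^esub> \<and> f \<otimes>\<^bsub>A\<^esub> e = \<zero>\<^bsub>A\<^esub>"

definition central :: "('a, 'b) ring_scheme \<Rightarrow> 'a \<Rightarrow> bool" where
  "central A z \<longleftrightarrow> (\<forall>a \<in> carrier A. z \<otimes>\<^bsub>A\<^esub> a = a \<otimes>\<^bsub>A\<^esub> z)"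

definition primitive_idempotent :: "('a, 'b) ring_scheme \<Rightarrow> 'a \<Rightarrow> bool" where
  "primitive_idempotent A e \<longleftrightarrow> idempotent A e \<and> e \<noteq> \<zero>\<^bsub>A\<^esub> \<and>
     (\<forall>f g. idempotent A f \<and> idempotent A g \<and> orthogonal A f g \<and> e = f \<oplus>\<^bsub>A\<^esub> g
        \<longrightarrow> f = \<zero>\<^bsub>A\<^esub> \<or> g = \<zero>\<^bsub>A\<^esub>)"

definition block_idempotent :: "('a, 'b) ring_scheme \<Rightarrow> 'a \<Rightarrow> bool" where
  "block_idempotent A e \<longleftrightarrow> idempotent A e \<and> central A e \<and> e \<noteq> \<zero>\<^bsub>A\<^esub> \<and>
     (\<forall>f g. idempotent A f \<and> central A f \<and> idempotent A g \<and> central A g \<and>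
        orthogonal A f g \<and> e = f \<oplus>\<^bsub>A\<^esub> g \<longrightarrow> f = \<zero>\<^bsub>A\<^esub> \<or> g = \<zero>\<^bsub>A\<^esub>)"

text \<open>
  The principal block is the block that acts as the identity on the trivial module,
  so the other block idempotents are those of augmentation \<open>0\<close>.
\<close>
definition nonprincipal_block_idempotent ::
  "'k::field itself \<Rightarrow> ('g, 'b) monoid_scheme \<Rightarrow> ('g \<Rightarrow> 'k) \<Rightarrow> bool" where
  "nonprincipal_block_idempotent k G e \<longleftrightarrow>
     block_idempotent (monoid_algebra k G) e \<and> augmentation e = 0"

text \<open>
  The algebra \<open>eAe\<close> with unit \<open>e\<close>.  For a central idempotent \<open>e\<close> it is the ideal \<open>Ae\<close>;
  in particular this is the block algebra \<open>kGe\<close> of a block idempotent \<open>e\<close>.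
\<close>
definition corner_algebra :: "('k, 'a) module \<Rightarrow> 'a \<Rightarrow> ('k, 'a) module" where
  "corner_algebra A e =
     A\<lparr>carrier := {e \<otimes>\<^bsub>A\<^esub> a \<otimes>\<^bsub>A\<^esub> e | a. a \<in> carrier A}, one := e\<rparr>"

definition complete_primitive_idempotents :: "('a, 'b) ring_scheme \<Rightarrow> 'a set \<Rightarrow> bool" where
  "complete_primitive_idempotents A E \<longleftrightarrow>
     finite E \<and> (\<forall>e \<in> E. primitive_idempotent A e) \<and>
     (\<forall>e \<in> E. \<forall>f \<in> E. e \<noteq> f \<longrightarrow> orthogonal A e f) \<and>
     (\<Oplus>\<^bsub>A\<^esub> e \<in> E. e) = \<one>\<^bsub>A\<^esub>"

definition right_ideal_gen :: "('a, 'b) ring_scheme \<Rightarrow> 'a \<Rightarrow> 'a set" where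
  "right_ideal_gen A e = {e \<otimes>\<^bsub>A\<^esub> a | a. a \<in> carrier A}"

text \<open>\<open>eA\<close> and \<open>fA\<close> are isomorphic right \<open>A\<close>-modules.\<close>
definition isomorphic_projectives :: "('a, 'b) ring_scheme \<Rightarrow> 'a \<Rightarrow> 'a \<Rightarrow> bool" where
  "isomorphic_projectives A e f \<longleftrightarrow>
     (\<exists>\<phi>. bij_betw \<phi> (right_ideal_gen A e) (right_ideal_gen A f) \<and>
        (\<forall>x \<in> right_ideal_gen A e. \<forall>y \<in> right_ideal_gen A e. \<phi> (x \<oplus>\<^bsub>A\<^esub> y) = \<phi> x \<oplus>\<^bsub>A\<^esub> \<phi> y) \<and>
        (\<forall>x \<in> right_ideal_gen A e. \<forall>a \<in> carrier A. \<phi> (x \<otimes>\<^bsub>A\<^esub> a) = \<phi> x \<otimes>\<^bsub>A\<^esub> a))"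

text \<open>
  A sum of members of a primitive decomposition of \<open>1\<close>, one for each isomorphism class of
  indecomposable projective modules.
\<close>
definition basic_idempotent :: "('a, 'b) ring_scheme \<Rightarrow> 'a \<Rightarrow> bool" where
  "basic_idempotent A \<epsilon> \<longleftrightarrow>
     (\<exists>E B. complete_primitive_idempotents A E \<and> B \<subseteq> E \<and>
        (\<forall>e \<in> B. \<forall>f \<in> B. e \<noteq> f \<longrightarrow> \<not> isomorphic_projectives A e f) \<and>
        (\<forall>e \<in> E. \<exists>f \<in> B. isomorphic_projectives A e f) \<and>
        \<epsilon> = (\<Oplus>\<^bsub>A\<^esub> e \<in> B. e))"

text \<open>
  The basic algebra of a finite-dimensional algebra is only defined up to isomorphism:
  it does not depend on the choice of the basic idempotent.
\<close>
definition is_basic_algebra_of :: "('k, 'b) module \<Rightarrow> ('k, 'a) module \<Rightarrow> bool" where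
  "is_basic_algebra_of B A \<longleftrightarrow>
     (\<exists>\<epsilon>. basic_idempotent A \<epsilon> \<and> algebra_isomorphic (corner_algebra A \<epsilon>) B)"

section \<open>The group\<close>

abbreviation grp_conj :: "('g, 'b) monoid_scheme \<Rightarrow> 'g \<Rightarrow> 'g \<Rightarrow> 'g" where
  "grp_conj G a u \<equiv> inv\<^bsub>G\<^esub> u \<otimes>\<^bsub>G\<^esub> a \<otimes>\<^bsub>G\<^esub> u"

abbreviation grp_comm :: "('g, 'b) monoid_scheme \<Rightarrow> 'g \<Rightarrow> 'g \<Rightarrow> 'g" where
  "grp_comm G a b \<equiv> inv\<^bsub>G\<^esub> a \<otimes>\<^bsub>G\<^esub> inv\<^bsub>G\<^esub> b \<otimes>\<^bsub>G\<^esub> a \<otimes>\<^bsub>G\<^esub> b"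

text \<open>
  Both presentations are rendered by generators satisfying the relations together with the
  orders of the presented groups, \<open>p^3\<close> and \<open>8\<close>; this determines \<open>P\<close> and \<open>H\<close> up to
  isomorphism (and makes \<open>P\<close> extraspecial of exponent \<open>p\<close>).  The semidirect product is an
  internal one, so that \<open>a^u = u^-1 a u\<close> in \<open>G\<close>.
\<close>
definition extraspecial_quaternion_setup ::
  "nat \<Rightarrow> ('g, 'b) monoid_scheme \<Rightarrow> 'g set \<Rightarrow> 'g set \<Rightarrow> 'g \<Rightarrow> 'g \<Rightarrow> 'g \<Rightarrow> 'g \<Rightarrow> 'g \<Rightarrow> bool" where
  "extraspecial_quaternion_setup p G P H g h c s t \<longleftrightarrow>
     group G \<and> {g, h, c, s, t} \<subseteq> carrier G \<and>
     \<comment> \<open>the group \<open>P\<close>\<close>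
     P = generate G {g, h, c} \<and> card P = p ^ 3 \<and>
     g [^]\<^bsub>G\<^esub> p = \<one>\<^bsub>G\<^esub> \<and> h [^]\<^bsub>G\<^esub> p = \<one>\<^bsub>G\<^esub> \<and> c [^]\<^bsub>G\<^esub> p = \<one>\<^bsub>G\<^esub> \<and>
     grp_comm G g h = c \<and> grp_comm G g c = \<one>\<^bsub>G\<^esub> \<and> grp_comm G h c = \<one>\<^bsub>G\<^esub> \<and>
     \<comment> \<open>the group \<open>H\<close>\<close>
     H = generate G {s, t} \<and> card H = 8 \<and>
     s [^]\<^bsub>G\<^esub> (4::nat) = \<one>\<^bsub>G\<^esub> \<and> s [^]\<^bsub>G\<^esub> (2::nat) = t [^]\<^bsub>G\<^esub> (2::nat) \<and>
     t \<otimes>\<^bsub>G\<^esub> s = inv\<^bsub>G\<^esub> s \<otimes>\<^bsub>G\<^esub> t \<and>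
     \<comment> \<open>\<open>G\<close> is the semidirect product of \<open>P\<close> and \<open>H\<close> for the given action\<close>
     P \<lhd> G \<and> P \<inter> H = {\<one>\<^bsub>G\<^esub>} \<and> P <#>\<^bsub>G\<^esub> H = carrier G \<and>
     grp_conj G g s = inv\<^bsub>G\<^esub> g \<and> grp_conj G g t = g \<and>
     grp_conj G h s = h \<and> grp_conj G h t = inv\<^bsub>G\<^esub> h"

definition nonprincipal_idempotent ::
  "'k::field itself \<Rightarrow> ('g, 'b) monoid_scheme \<Rightarrow> 'g \<Rightarrow> 'g \<Rightarrow> 'k" where
  "nonprincipal_idempotent k G s = (let A = monoid_algebra k G in
     (1 / 2) \<odot>\<^bsub>A\<^esub> (\<one>\<^bsub>A\<^esub> \<ominus>\<^bsub>A\<^esub> single (s [^]\<^bsub>G\<^esub> (2::nat))))"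

section \<open>The relations\<close>

datatype letter = X | Y | Z

text \<open>
  The relation \<open>z^p = 0\<close> has to be listed: it is not a consequence of the other relations.
  Indeed \<open>x = d/dT\<close>, \<open>y = T\<close> and \<open>z = 1\<close> on \<open>k[T]/(T^p)\<close>, where \<open>k\<close> has
  characteristic \<open>p\<close>, satisfy all the other relations of the first set; and with
  \<open>2\<times>2\<close> matrices \<open>a\<close>, \<open>b\<close> such that \<open>a^2 = b^2 = 1\<close> and \<open>ab = -ba\<close>, the operators
  \<open>x \<otimes> a\<close>, \<open>y \<otimes> b\<close>, \<open>z \<otimes> ab\<close> satisfy those of the second set
  (\<open>p\<close> odd).
\<close>
definition commutator_relations :: "'k::field itself \<Rightarrow> nat \<Rightarrow> (letter list \<Rightarrow> 'k) set" where
  "commutator_relations k p =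
     (let F = free_algebra k; x = single [X]; y = single [Y]; z = single [Z] in
       {x [^]\<^bsub>F\<^esub> p, y [^]\<^bsub>F\<^esub> p, z [^]\<^bsub>F\<^esub> p,
        (x \<otimes>\<^bsub>F\<^esub> y \<ominus>\<^bsub>F\<^esub> y \<otimes>\<^bsub>F\<^esub> x) \<ominus>\<^bsub>F\<^esub> z,
        x \<otimes>\<^bsub>F\<^esub> z \<ominus>\<^bsub>F\<^esub> z \<otimes>\<^bsub>F\<^esub> x,
        y \<otimes>\<^bsub>F\<^esub> z \<ominus>\<^bsub>F\<^esub> z \<otimes>\<^bsub>F\<^esub> y})"

definition anticommutator_relations :: "'k::field itself \<Rightarrow> nat \<Rightarrow> (letter list \<Rightarrow> 'k) set" where
  "anticommutator_relations k p =
     (let F = free_algebra k; x = single [X]; y = single [Y]; z = single [Z] in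
       {x [^]\<^bsub>F\<^esub> p, y [^]\<^bsub>F\<^esub> p, z [^]\<^bsub>F\<^esub> p,
        (x \<otimes>\<^bsub>F\<^esub> y \<oplus>\<^bsub>F\<^esub> y \<otimes>\<^bsub>F\<^esub> x) \<ominus>\<^bsub>F\<^esub> z,
        x \<otimes>\<^bsub>F\<^esub> z \<oplus>\<^bsub>F\<^esub> z \<otimes>\<^bsub>F\<^esub> x,
        y \<otimes>\<^bsub>F\<^esub> z \<oplus>\<^bsub>F\<^esub> z \<otimes>\<^bsub>F\<^esub> y})"

end

theory Submission
  imports Defs "HOL-Algebra.UnivPoly"
begin

text \<open>
  Put \<open>x = (g - g^-1)/2\<close>, \<open>y = (h - h^-1)/2\<close>, \<open>z = (c - c^-1)/2\<close> in \<open>kP\<close>.  They are exact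
  eigenvectors for the conjugation by \<open>s\<close> and \<open>t\<close>, and the elements of weight at least \<open>n\<close>,
  where \<open>x\<close>, \<open>y\<close> have weight 1 and \<open>z\<close> has weight 2, form the \<open>n\<close>-th power of the radical; so
  the relations hold in the associated graded algebra.  In \<open>kGe\<close> put \<open>S = se\<close>, \<open>T = te\<close>.  Then
  \<open>xT\<close>, \<open>yS\<close>, \<open>zST\<close> commute with the matrix algebra \<open>kHe\<close>, anticommute where \<open>x\<close>, \<open>y\<close>, \<open>z\<close>
  commute, and cutting down by the primitive idempotent \<open>(e + \<iota>S)/2\<close>, \<open>\<iota>^2 = -1\<close>, gives the basic
  algebra.  The presented algebras are spanned by \<open>p^3\<close> monomials, so a dimension count finishes
  the proof.
\<close>

section \<open>Associative algebras\<close>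

text \<open>Why half differences: g - 1 is an eigenvector of the conjugations only modulo the square
  of the radical, so S and T would commute with the corrected generators only up to higher terms;
  with exact eigenvectors they commute exactly. The p-th powers vanish exactly too, since g - g^-1 =
  g^-1 (g^2 - 1) and (g^2 - 1)^p = g^(2p) - 1. The price is that xy - yx = z holds only modulo the
  cube of the radical, which is all that a relation in degree 2 of the graded algebra asks for.

  The sign: (xT)(yS) = xy ST and (yS)(xT) = - yx ST, so a commutator turns into an anticommutator. A
  scalar \<sigma> = 1 or -1 lets one argument serve both algebras.

  Independence in the graded algebra is the delicate point. A relation between classes of monomials
  of weight n says that a combination of them lies in the next power of the radical, hence equals a
  combination of monomials of larger weight; independence in the ungraded algebra then kills all
  coefficients. For kP the latter is a dimension count; for kGe it is inherited from kP, because kGe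
  is free over kP on e, S, T, ST.\<close>

locale assoc_algebra = ring A for A :: "('k::field, 'a) module" (structure) +
  assumes smult_closed [simp, intro]: "a \<in> carrier A \<Longrightarrow> r \<odot> a \<in> carrier A"
    and smult_l_distr: "a \<in> carrier A \<Longrightarrow> (r + s) \<odot> a = r \<odot> a \<oplus> s \<odot> a"
    and smult_r_distr: "\<lbrakk>a \<in> carrier A; b \<in> carrier A\<rbrakk> \<Longrightarrow> r \<odot> (a \<oplus> b) = r \<odot> a \<oplus> r \<odot> b"
    and smult_smult: "a \<in> carrier A \<Longrightarrow> r \<odot> (s \<odot> a) = (r * s) \<odot> a"
    and smult_one [simp]: "a \<in> carrier A \<Longrightarrow> 1 \<odot> a = a"
    and smult_mult_l: "\<lbrakk>a \<in> carrier A; b \<in> carrier A\<rbrakk> \<Longrightarrow> (r \<odot> a) \<otimes> b = r \<odot> (a \<otimes> b)"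
    and smult_mult_r: "\<lbrakk>a \<in> carrier A; b \<in> carrier A\<rbrakk> \<Longrightarrow> a \<otimes> (r \<odot> b) = r \<odot> (a \<otimes> b)"

definition algebra_hom :: "('k, 'a) module \<Rightarrow> ('k, 'b) module \<Rightarrow> ('a \<Rightarrow> 'b) \<Rightarrow> bool" where
  "algebra_hom A B \<phi> \<longleftrightarrow>
     \<phi> \<in> ring_hom A B \<and> (\<forall>r. \<forall>a \<in> carrier A. \<phi> (r \<odot>\<^bsub>A\<^esub> a) = r \<odot>\<^bsub>B\<^esub> \<phi> a)"

context assoc_algebra
begin

lemma smult_zero_l [simp]: "a \<in> carrier A \<Longrightarrow> 0 \<odot> a = \<zero>"
  using smult_l_distr[of a 0 0] by (metis add.l_cancel_one add_0 smult_closed)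

lemma smult_zero_r [simp]: "r \<odot> \<zero> = \<zero>"
  using smult_r_distr[of \<zero> \<zero> r] by (metis add.l_cancel_one smult_closed zero_closed l_zero)

lemma smult_minus_l: "a \<in> carrier A \<Longrightarrow> (- r) \<odot> a = \<ominus> (r \<odot> a)"
  using smult_l_distr[of a "- r" r] by (simp add: minus_equality)

lemma smult_minus_r: "a \<in> carrier A \<Longrightarrow> r \<odot> (\<ominus> a) = \<ominus> (r \<odot> a)"
  using smult_r_distr[of "\<ominus> a" a r] by (simp add: minus_equality l_neg)

lemma smult_minus_one: "a \<in> carrier A \<Longrightarrow> (- 1) \<odot> a = \<ominus> a"
  by (simp add: smult_minus_l)

lemma smult_diff: "\<lbrakk>a \<in> carrier A; b \<in> carrier A\<rbrakk> \<Longrightarrow> r \<odot> (a \<ominus> b) = r \<odot> a \<ominus> r \<odot> b"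
  by (simp add: minus_eq smult_r_distr smult_minus_r)

lemma smult_l_diff: "a \<in> carrier A \<Longrightarrow> (r - s) \<odot> a = r \<odot> a \<ominus> s \<odot> a"
  using smult_l_distr[of a r "- s"] by (simp add: minus_eq smult_minus_l)

lemma smult_pow: "a \<in> carrier A \<Longrightarrow> (r \<odot> a) [^] (n::nat) = r ^ n \<odot> (a [^] n)"
  by (induction n) (simp_all add: smult_mult_l smult_mult_r smult_smult mult.commute)

lemma smult_finsum:
  "f \<in> T \<rightarrow> carrier A \<Longrightarrow> r \<odot> (\<Oplus>t\<in>T. f t) = (\<Oplus>t\<in>T. r \<odot> f t)"
proof (induction T rule: infinite_finite_induct)
  case (insert t T)
  then show ?case by (simp add: smult_r_distr Pi_iff finsum_closed)
qed simp_all

text \<open>The shape \<open>l + r * m\<close> covers sums, differences and scalar multiples of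
  linear combinations at once: take \<open>r\<close> to be 1 or -1, or \<open>l\<close> to be
  0.\<close>

lemma finsum_smult_add:
  assumes "f \<in> T \<rightarrow> carrier A"
  shows "(\<Oplus>t\<in>T. (l t + r * m t) \<odot> f t) = (\<Oplus>t\<in>T. l t \<odot> f t) \<oplus> r \<odot> (\<Oplus>t\<in>T. m t \<odot> f t)"
proof -
  have "(\<Oplus>t\<in>T. (l t + r * m t) \<odot> f t) = (\<Oplus>t\<in>T. l t \<odot> f t \<oplus> r \<odot> (m t \<odot> f t))"
    by (rule finsum_cong') (use assms in \<open>auto simp: smult_l_distr smult_smult Pi_iff\<close>)
  also have "\<dots> = (\<Oplus>t\<in>T. l t \<odot> f t) \<oplus> (\<Oplus>t\<in>T. r \<odot> (m t \<odot> f t))"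
    by (rule finsum_addf) (use assms in \<open>auto simp: Pi_iff\<close>)
  also have "(\<Oplus>t\<in>T. r \<odot> (m t \<odot> f t)) = r \<odot> (\<Oplus>t\<in>T. m t \<odot> f t)"
    by (rule smult_finsum[symmetric]) (use assms in \<open>auto simp: Pi_iff\<close>)
  finally show ?thesis .
qed

lemma finsum_smult_delta:
  assumes "finite T" "t \<in> T" "f \<in> T \<rightarrow> carrier A"
  shows "(\<Oplus>u\<in>T. (if u = t then r else 0) \<odot> f u) = r \<odot> f t"
proof -
  have "(\<Oplus>u\<in>T. (if u = t then r else 0) \<odot> f u) = (\<Oplus>u\<in>T. if t = u then r \<odot> f u else \<zero>)"
    by (rule finsum_cong') (use assms in \<open>auto simp: Pi_iff\<close>)
  then show ?thesis
    using finsum_singleton[of t T "\<lambda>u. r \<odot> f u"] assms by (auto simp: Pi_iff)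
qed

end

section \<open>Monoid algebras\<close>

lemma in_monoid_algebra_iff:
  "a \<in> carrier (monoid_algebra k M) \<longleftrightarrow>
     finite {u. a u \<noteq> 0} \<and> (\<forall>u. u \<notin> carrier M \<longrightarrow> a u = 0)"
  by (simp add: monoid_algebra_def)

lemma monoid_algebra_sel [simp]:
  "one (monoid_algebra k M) = single \<one>\<^bsub>M\<^esub>"
  "zero (monoid_algebra k M) = (\<lambda>u. 0)"
  "add (monoid_algebra k M) = (\<lambda>a b u. a u + b u)"
  "module.smult (monoid_algebra k M) = (\<lambda>r a u. r * a u)"
  by (simp_all add: monoid_algebra_def single_def fun_eq_iff)

text \<open>The sums may run over any finite sets containing the supports. Additivity compares
  products of elements with different supports, so a common index set is needed.\<close>

lemma monoid_algebra_mult: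
  assumes "finite S" "finite T" "{u. a u \<noteq> 0} \<subseteq> S" "{v. b v \<noteq> 0} \<subseteq> T"
  shows "(a \<otimes>\<^bsub>monoid_algebra k M\<^esub> b) w =
           (\<Sum>u\<in>S. \<Sum>v\<in>T. if u \<otimes>\<^bsub>M\<^esub> v = w then a u * b v else 0)"
proof -
  have "(a \<otimes>\<^bsub>monoid_algebra k M\<^esub> b) w =
      (\<Sum>(u, v) \<in> {(u, v). a u \<noteq> 0 \<and> b v \<noteq> 0 \<and> u \<otimes>\<^bsub>M\<^esub> v = w}. a u * b v)"
    by (simp add: monoid_algebra_def)
  also have "\<dots> = (\<Sum>(u, v) \<in> S \<times> T. if u \<otimes>\<^bsub>M\<^esub> v = w then a u * b v else 0)"
    by (rule sum.mono_neutral_cong_left) (use assms in \<open>auto split: if_splits\<close>)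
  finally show ?thesis
    by (simp add: sum.cartesian_product)
qed

lemma single_in_monoid_algebra [simp]:
  "u \<in> carrier M \<Longrightarrow> single u \<in> carrier (monoid_algebra k M)"
  by (auto simp: in_monoid_algebra_iff single_def)

lemma monoid_algebra_lin_closed:
  assumes "a \<in> carrier (monoid_algebra k M)" "b \<in> carrier (monoid_algebra k M)"
  shows "(\<lambda>v. a v + r * b v) \<in> carrier (monoid_algebra k M)"
proof -
  have "finite {v. a v + r * b v \<noteq> 0}"
    by (rule finite_subset[of _ "{v. a v \<noteq> 0} \<union> {v. b v \<noteq> 0}"])
       (use assms in \<open>auto simp: in_monoid_algebra_iff\<close>)
  then show ?thesis
    using assms by (simp add: in_monoid_algebra_iff)
qed

lemma monoid_algebra_mult_lin_l:
  assumes "a \<in> carrier (monoid_algebra k M)" "b \<in> carrier (monoid_algebra k M)"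
    "c \<in> carrier (monoid_algebra k M)"
  shows "(\<lambda>v. a v + r * b v) \<otimes>\<^bsub>monoid_algebra k M\<^esub> c =
    (\<lambda>w. (a \<otimes>\<^bsub>monoid_algebra k M\<^esub> c) w + r * (b \<otimes>\<^bsub>monoid_algebra k M\<^esub> c) w)"
proof
  fix w
  let ?S = "{v. a v \<noteq> 0} \<union> {v. b v \<noteq> 0}" and ?T = "{v. c v \<noteq> 0}"
  have fin: "finite ?S" "finite ?T"
    using assms by (auto simp: in_monoid_algebra_iff)
  have "((\<lambda>v. a v + r * b v) \<otimes>\<^bsub>monoid_algebra k M\<^esub> c) w =
      (\<Sum>u\<in>?S. \<Sum>v\<in>?T. if u \<otimes>\<^bsub>M\<^esub> v = w then (a u + r * b u) * c v else 0)"
    by (rule monoid_algebra_mult) (use fin in auto)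
  also have "\<dots> = (\<Sum>u\<in>?S. \<Sum>v\<in>?T. if u \<otimes>\<^bsub>M\<^esub> v = w then a u * c v else 0) +
      r * (\<Sum>u\<in>?S. \<Sum>v\<in>?T. if u \<otimes>\<^bsub>M\<^esub> v = w then b u * c v else 0)"
    unfolding sum_distrib_left sum.distrib[symmetric]
    by (intro sum.cong refl) (auto simp: algebra_simps)
  also have "(\<Sum>u\<in>?S. \<Sum>v\<in>?T. if u \<otimes>\<^bsub>M\<^esub> v = w then a u * c v else 0) =
      (a \<otimes>\<^bsub>monoid_algebra k M\<^esub> c) w"
    by (rule monoid_algebra_mult[symmetric]) (use fin in auto)
  also have "(\<Sum>u\<in>?S. \<Sum>v\<in>?T. if u \<otimes>\<^bsub>M\<^esub> v = w then b u * c v else 0) =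
      (b \<otimes>\<^bsub>monoid_algebra k M\<^esub> c) w"
    by (rule monoid_algebra_mult[symmetric]) (use fin in auto)
  finally show "((\<lambda>v. a v + r * b v) \<otimes>\<^bsub>monoid_algebra k M\<^esub> c) w =
      (a \<otimes>\<^bsub>monoid_algebra k M\<^esub> c) w + r * (b \<otimes>\<^bsub>monoid_algebra k M\<^esub> c) w" .
qed

lemma monoid_algebra_mult_lin_r:
  assumes "a \<in> carrier (monoid_algebra k M)" "b \<in> carrier (monoid_algebra k M)"
    "c \<in> carrier (monoid_algebra k M)"
  shows "c \<otimes>\<^bsub>monoid_algebra k M\<^esub> (\<lambda>v. a v + r * b v) =
    (\<lambda>w. (c \<otimes>\<^bsub>monoid_algebra k M\<^esub> a) w + r * (c \<otimes>\<^bsub>monoid_algebra k M\<^esub> b) w)"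
proof
  fix w
  let ?S = "{v. a v \<noteq> 0} \<union> {v. b v \<noteq> 0}" and ?T = "{v. c v \<noteq> 0}"
  have fin: "finite ?S" "finite ?T"
    using assms by (auto simp: in_monoid_algebra_iff)
  have "(c \<otimes>\<^bsub>monoid_algebra k M\<^esub> (\<lambda>v. a v + r * b v)) w =
      (\<Sum>u\<in>?T. \<Sum>v\<in>?S. if u \<otimes>\<^bsub>M\<^esub> v = w then c u * (a v + r * b v) else 0)"
    by (rule monoid_algebra_mult) (use fin in auto)
  also have "\<dots> = (\<Sum>u\<in>?T. \<Sum>v\<in>?S. if u \<otimes>\<^bsub>M\<^esub> v = w then c u * a v else 0) +
      r * (\<Sum>u\<in>?T. \<Sum>v\<in>?S. if u \<otimes>\<^bsub>M\<^esub> v = w then c u * b v else 0)"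
    unfolding sum_distrib_left sum.distrib[symmetric]
    by (intro sum.cong refl) (auto simp: algebra_simps)
  also have "(\<Sum>u\<in>?T. \<Sum>v\<in>?S. if u \<otimes>\<^bsub>M\<^esub> v = w then c u * a v else 0) =
      (c \<otimes>\<^bsub>monoid_algebra k M\<^esub> a) w"
    by (rule monoid_algebra_mult[symmetric]) (use fin in auto)
  also have "(\<Sum>u\<in>?T. \<Sum>v\<in>?S. if u \<otimes>\<^bsub>M\<^esub> v = w then c u * b v else 0) =
      (c \<otimes>\<^bsub>monoid_algebra k M\<^esub> b) w"
    by (rule monoid_algebra_mult[symmetric]) (use fin in auto)
  finally show "(c \<otimes>\<^bsub>monoid_algebra k M\<^esub> (\<lambda>v. a v + r * b v)) w =
      (c \<otimes>\<^bsub>monoid_algebra k M\<^esub> a) w + r * (c \<otimes>\<^bsub>monoid_algebra k M\<^esub> b) w" .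
qed

lemma single_mult_single:
  "single u \<otimes>\<^bsub>monoid_algebra k M\<^esub> single v = single (u \<otimes>\<^bsub>M\<^esub> v)"
proof
  fix w
  show "(single u \<otimes>\<^bsub>monoid_algebra k M\<^esub> single v) w = single (u \<otimes>\<^bsub>M\<^esub> v) w"
    by (subst monoid_algebra_mult[of "{u}" "{v}"]) (auto simp: single_def)
qed

lemma monoid_algebra_zero_mult:
  "(\<lambda>u. 0) \<otimes>\<^bsub>monoid_algebra k M\<^esub> c = (\<lambda>u. 0)"
  "c \<otimes>\<^bsub>monoid_algebra k M\<^esub> (\<lambda>u. 0) = (\<lambda>u. 0)"
  by (simp_all add: monoid_algebra_def)

text \<open>Linear extension as an induction rule. Multilinear identities are thereby reduced to
  basis elements, one argument at a time.\<close>

lemma monoid_algebra_induct [consumes 1, case_names zero add]: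
  assumes "a \<in> carrier (monoid_algebra k M)"
    and zero: "P (\<lambda>u. 0)"
    and add: "\<And>b r u. \<lbrakk>b \<in> carrier (monoid_algebra k M); u \<in> carrier M; P b\<rbrakk>
      \<Longrightarrow> P (\<lambda>v. b v + r * single u v)"
  shows "P a"
proof -
  \<comment> \<open>The induction is on a finite set containing the support, not on the support
    itself, since erasing the coefficient at \<open>u\<close> need not shrink the support.\<close>
  have "finite S \<Longrightarrow> \<forall>a\<in>carrier (monoid_algebra k M). {u. a u \<noteq> 0} \<subseteq> S \<longrightarrow> P a" for S
  proof (induction S rule: finite_induct)
    case empty
    have "P a" if "\<forall>u. a u = 0" for a
      using zero that by (metis ext)
    then show ?case by auto
  next
    case (insert u S)
    show ?case
    proof (intro ballI impI)
      fix a assume a: "a \<in> carrier (monoid_algebra k M)" "{v. a v \<noteq> 0} \<subseteq> insert u S"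
      let ?b = "a(u := 0)"
      have "finite {v. ?b v \<noteq> 0}"
        by (rule finite_subset[of _ "{v. a v \<noteq> 0}"]) (use a in \<open>auto simp: in_monoid_algebra_iff\<close>)
      then have b: "?b \<in> carrier (monoid_algebra k M)"
        using a by (simp add: in_monoid_algebra_iff)
      have "{v. ?b v \<noteq> 0} \<subseteq> S" using a by auto
      with insert.IH b have Pb: "P ?b" by blast
      have eq: "a = (\<lambda>v. ?b v + a u * single u v)"
        by (auto simp: single_def)
      show "P a"
      proof (cases "u \<in> carrier M")
        case True
        then show ?thesis by (subst eq) (rule add[OF b True Pb])
      next
        case False
        then have "?b = a" using a by (auto simp: in_monoid_algebra_iff)
        with Pb show ?thesis by simp
      qed
    qed
  qed
  then show ?thesis
    using assms(1) by (auto simp: in_monoid_algebra_iff)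
qed

context monoid
begin

lemma monoid_algebra_mult_closed:
  assumes "a \<in> carrier (monoid_algebra k G)" "b \<in> carrier (monoid_algebra k G)"
  shows "a \<otimes>\<^bsub>monoid_algebra k G\<^esub> b \<in> carrier (monoid_algebra k G)"
  using assms(1)
proof (induction rule: monoid_algebra_induct)
  case zero
  then show ?case
    by (simp add: monoid_algebra_zero_mult in_monoid_algebra_iff)
next
  case (add c r u)
  have "single u \<otimes>\<^bsub>monoid_algebra k G\<^esub> b \<in> carrier (monoid_algebra k G)"
    using assms(2)
  proof (induction rule: monoid_algebra_induct)
    case zero
    then show ?case
      by (simp add: monoid_algebra_zero_mult in_monoid_algebra_iff)
  next
    case (add d s v)
    then show ?case
      using \<open>u \<in> carrier G\<close>
      by (simp add: monoid_algebra_mult_lin_r single_mult_single monoid_algebra_lin_closed)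
  qed
  with add assms(2) show ?case
    by (simp add: monoid_algebra_mult_lin_l monoid_algebra_lin_closed)
qed

text \<open>Three nested inductions, one for each factor, leave associativity of the monoid on basis
  elements.\<close>

lemma monoid_algebra_assoc:
  assumes "a \<in> carrier (monoid_algebra k G)" "b \<in> carrier (monoid_algebra k G)"
    "c \<in> carrier (monoid_algebra k G)"
  shows "(a \<otimes>\<^bsub>monoid_algebra k G\<^esub> b) \<otimes>\<^bsub>monoid_algebra k G\<^esub> c =
    a \<otimes>\<^bsub>monoid_algebra k G\<^esub> (b \<otimes>\<^bsub>monoid_algebra k G\<^esub> c)"
  using assms(1)
proof (induction rule: monoid_algebra_induct)
  case (add a r u)
  have "(single u \<otimes>\<^bsub>monoid_algebra k G\<^esub> b) \<otimes>\<^bsub>monoid_algebra k G\<^esub> c =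
    single u \<otimes>\<^bsub>monoid_algebra k G\<^esub> (b \<otimes>\<^bsub>monoid_algebra k G\<^esub> c)"
    using assms(2)
  proof (induction rule: monoid_algebra_induct)
    case (add b s v)
    have "(single u \<otimes>\<^bsub>monoid_algebra k G\<^esub> single v) \<otimes>\<^bsub>monoid_algebra k G\<^esub> c =
      single u \<otimes>\<^bsub>monoid_algebra k G\<^esub> (single v \<otimes>\<^bsub>monoid_algebra k G\<^esub> c)"
      using assms(3)
    proof (induction rule: monoid_algebra_induct)
      case (add c q w)
      then show ?case
        using \<open>u \<in> carrier G\<close> \<open>v \<in> carrier G\<close>
        by (simp add: monoid_algebra_mult_lin_r single_mult_single monoid_algebra_mult_closed m_assoc)
    qed (simp add: monoid_algebra_zero_mult)
    with add \<open>u \<in> carrier G\<close> \<open>c \<in> carrier (monoid_algebra k G)\<close> show ?case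
      by (simp add: monoid_algebra_mult_lin_r monoid_algebra_mult_lin_l monoid_algebra_mult_closed)
  qed (simp add: monoid_algebra_zero_mult)
  with add assms show ?case
    by (simp add: monoid_algebra_mult_lin_r monoid_algebra_mult_lin_l monoid_algebra_mult_closed)
qed (simp add: monoid_algebra_zero_mult)

lemma monoid_algebra_unit:
  assumes "a \<in> carrier (monoid_algebra k G)"
  shows "single \<one> \<otimes>\<^bsub>monoid_algebra k G\<^esub> a = a" "a \<otimes>\<^bsub>monoid_algebra k G\<^esub> single \<one> = a"
  using assms
  by (induction rule: monoid_algebra_induct)
     (simp_all add: monoid_algebra_zero_mult monoid_algebra_mult_lin_l monoid_algebra_mult_lin_r
       single_mult_single)

lemma monoid_algebra_algebra: "assoc_algebra (monoid_algebra k G)"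
proof -
  let ?K = "monoid_algebra k G"
  have lin: "(\<lambda>v. a v + r * b v) \<in> carrier ?K" if "a \<in> carrier ?K" "b \<in> carrier ?K" for a b r
    using that by (rule monoid_algebra_lin_closed)
  have zero: "(\<lambda>u. 0) \<in> carrier ?K"
    by (simp add: in_monoid_algebra_iff)
  have add: "(\<lambda>v. a v + b v) \<in> carrier ?K" if "a \<in> carrier ?K" "b \<in> carrier ?K" for a b
    using lin[OF that, of 1] by simp
  have smult: "(\<lambda>v. r * a v) \<in> carrier ?K" if "a \<in> carrier ?K" for a r
    using lin[OF zero that, of r] by simp
  have minus: "\<exists>y\<in>carrier ?K. y \<oplus>\<^bsub>?K\<^esub> a = \<zero>\<^bsub>?K\<^esub>" if "a \<in> carrier ?K" for a
    using smult[OF that, of "- 1"] by (intro bexI[of _ "\<lambda>v. - 1 * a v"]) simp_all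
  have "abelian_group ?K"
    by (rule abelian_groupI) (use zero add minus in \<open>simp_all add: fun_eq_iff algebra_simps\<close>)
  moreover have "Group.monoid ?K"
    by (rule monoidI)
      (simp_all add: monoid_algebra_mult_closed monoid_algebra_assoc monoid_algebra_unit)
  ultimately have "ring ?K"
  proof (rule ringI)
    fix a b c assume "a \<in> carrier ?K" "b \<in> carrier ?K" "c \<in> carrier ?K"
    then show "(a \<oplus>\<^bsub>?K\<^esub> b) \<otimes>\<^bsub>?K\<^esub> c = a \<otimes>\<^bsub>?K\<^esub> c \<oplus>\<^bsub>?K\<^esub> b \<otimes>\<^bsub>?K\<^esub> c"
      "c \<otimes>\<^bsub>?K\<^esub> (a \<oplus>\<^bsub>?K\<^esub> b) = c \<otimes>\<^bsub>?K\<^esub> a \<oplus>\<^bsub>?K\<^esub> c \<otimes>\<^bsub>?K\<^esub> b"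
      using monoid_algebra_mult_lin_l[of a k G b c 1] monoid_algebra_mult_lin_r[of a k G b c 1]
      by simp_all
  qed
  moreover have "(r \<odot>\<^bsub>?K\<^esub> a) \<otimes>\<^bsub>?K\<^esub> b = r \<odot>\<^bsub>?K\<^esub> (a \<otimes>\<^bsub>?K\<^esub> b)"
      "a \<otimes>\<^bsub>?K\<^esub> (r \<odot>\<^bsub>?K\<^esub> b) = r \<odot>\<^bsub>?K\<^esub> (a \<otimes>\<^bsub>?K\<^esub> b)"
    if "a \<in> carrier ?K" "b \<in> carrier ?K" for r a b
    using monoid_algebra_mult_lin_l[OF zero that, of r] monoid_algebra_mult_lin_r[OF zero that(2,1), of r]
    by (simp_all add: monoid_algebra_zero_mult)
  ultimately show ?thesis
    by (intro assoc_algebra.intro assoc_algebra_axioms.intro)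
       (simp_all add: smult algebra_simps)
qed

lemma monoid_algebra_finsum:
  assumes "finite T" "f \<in> T \<rightarrow> carrier (monoid_algebra k G)"
  shows "(\<Oplus>\<^bsub>monoid_algebra k G\<^esub>t\<in>T. f t) = (\<lambda>u. \<Sum>t\<in>T. f t u)"
proof -
  interpret K: assoc_algebra "monoid_algebra k G" by (rule monoid_algebra_algebra)
  show ?thesis
    using assms
  proof (induction rule: finite_induct)
    case (insert t T)
    then show ?case by (subst K.finsum_insert) (auto simp: Pi_iff)
  qed simp
qed

lemma monoid_algebra_a_inv:
  assumes "a \<in> carrier (monoid_algebra k G)"
  shows "\<ominus>\<^bsub>monoid_algebra k G\<^esub> a = (\<lambda>u. - a u)"
proof -
  interpret K: assoc_algebra "monoid_algebra k G" by (rule monoid_algebra_algebra)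
  show ?thesis
    using K.smult_minus_one[OF assms] by simp
qed

end

definition algebra_lift :: "('k::field, 'a) module \<Rightarrow> ('m \<Rightarrow> 'a) \<Rightarrow> ('m \<Rightarrow> 'k) \<Rightarrow> 'a" where
  "algebra_lift A f a = (\<Oplus>\<^bsub>A\<^esub>u\<in>{u. a u \<noteq> 0}. a u \<odot>\<^bsub>A\<^esub> f u)"

context assoc_algebra
begin

lemma algebra_lift_eq:
  assumes "finite S" "{u. a u \<noteq> 0} \<subseteq> S" "f \<in> S \<rightarrow> carrier A"
  shows "algebra_lift A f a = (\<Oplus>u\<in>S. a u \<odot> f u)"
  unfolding algebra_lift_def
  by (rule add.finprod_mono_neutral_cong_left) (use assms in \<open>auto simp: Pi_iff\<close>)

lemma algebra_lift_zero [simp]: "algebra_lift A f (\<lambda>u. 0) = \<zero>"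
  by (simp add: algebra_lift_def)

lemma algebra_lift_single [simp]: "f u \<in> carrier A \<Longrightarrow> algebra_lift A f (single u) = f u"
  by (subst algebra_lift_eq[of "{u}"]) (auto simp: single_def)

lemma algebra_lift_lin:
  assumes "a \<in> carrier (monoid_algebra k M)" "b \<in> carrier (monoid_algebra k M)"
    "f \<in> carrier M \<rightarrow> carrier A"
  shows "algebra_lift A f (\<lambda>v. a v + r * b v) = algebra_lift A f a \<oplus> r \<odot> algebra_lift A f b"
proof -
  let ?S = "{v. a v \<noteq> 0} \<union> {v. b v \<noteq> 0}"
  have S: "finite ?S" "f \<in> ?S \<rightarrow> carrier A"
    using assms by (auto simp: in_monoid_algebra_iff Pi_iff)
  have "algebra_lift A f (\<lambda>v. a v + r * b v) = (\<Oplus>u\<in>?S. (a u + r * b u) \<odot> f u)"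
    by (rule algebra_lift_eq) (use S in auto)
  also have "\<dots> = (\<Oplus>u\<in>?S. a u \<odot> f u) \<oplus> r \<odot> (\<Oplus>u\<in>?S. b u \<odot> f u)"
    by (rule finsum_smult_add) (use S in auto)
  also have "(\<Oplus>u\<in>?S. a u \<odot> f u) = algebra_lift A f a"
    by (rule algebra_lift_eq[symmetric]) (use S in auto)
  also have "(\<Oplus>u\<in>?S. b u \<odot> f u) = algebra_lift A f b"
    by (rule algebra_lift_eq[symmetric]) (use S in auto)
  finally show ?thesis .
qed

lemma algebra_lift_closed:
  assumes "a \<in> carrier (monoid_algebra k M)" "f \<in> carrier M \<rightarrow> carrier A"
  shows "algebra_lift A f a \<in> carrier A"
proof -
  have "{u. a u \<noteq> 0} \<subseteq> carrier M" using assms by (auto simp: in_monoid_algebra_iff)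
  with assms show ?thesis
    unfolding algebra_lift_def by (intro finsum_closed) (auto simp: Pi_iff)
qed

text \<open>The universal property of a monoid algebra. Multiplicativity is known on the basis and
  spreads by an induction in each factor. For the free monoid this is evaluation of noncommutative
  polynomials.\<close>

lemma algebra_lift_hom:
  assumes M: "Group.monoid M" and f: "f \<in> carrier M \<rightarrow> carrier A"
    and f_one: "f \<one>\<^bsub>M\<^esub> = \<one>"
    and f_mult: "\<And>u v. \<lbrakk>u \<in> carrier M; v \<in> carrier M\<rbrakk> \<Longrightarrow> f (u \<otimes>\<^bsub>M\<^esub> v) = f u \<otimes> f v"
  shows "algebra_hom (monoid_algebra k M) A (algebra_lift A f)"
proof -
  interpret M: Group.monoid M by (rule M)
  interpret K: assoc_algebra "monoid_algebra k M" by (rule M.monoid_algebra_algebra)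
  let ?K = "monoid_algebra k M" and ?L = "algebra_lift A f"
  note lin = algebra_lift_lin[where k = k, OF _ _ f] and closed = algebra_lift_closed[where k = k, OF _ f]
  have fc: "f u \<in> carrier A" if "u \<in> carrier M" for u using f that by auto
  have "?L (a \<otimes>\<^bsub>?K\<^esub> b) = ?L a \<otimes> ?L b" if "a \<in> carrier ?K" "b \<in> carrier ?K" for a b
    using that(1)
  proof (induction rule: monoid_algebra_induct)
    case (add a r u)
    have "?L (single u \<otimes>\<^bsub>?K\<^esub> b) = f u \<otimes> ?L b"
      using that(2)
    proof (induction rule: monoid_algebra_induct)
      case (add b s v)
      with \<open>u \<in> carrier M\<close> show ?case
        by (simp add: monoid_algebra_mult_lin_r single_mult_single lin f_mult r_distr closed fc
            smult_mult_r M.monoid_algebra_mult_closed)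
    qed (use \<open>u \<in> carrier M\<close> in \<open>simp add: monoid_algebra_zero_mult fc\<close>)
    with add that(2) show ?case
      by (simp add: monoid_algebra_mult_lin_l lin l_distr closed fc
          smult_mult_l M.monoid_algebra_mult_closed)
  qed (use that closed in \<open>simp add: monoid_algebra_zero_mult\<close>)
  moreover have "?L (a \<oplus>\<^bsub>?K\<^esub> b) = ?L a \<oplus> ?L b" if "a \<in> carrier ?K" "b \<in> carrier ?K" for a b
    using lin[OF that, of 1] closed[OF that(2)] by simp
  moreover have "?L (r \<odot>\<^bsub>?K\<^esub> a) = r \<odot> ?L a" if "a \<in> carrier ?K" for r a
    using lin[OF K.zero_closed that, of r] closed[OF that] by simp
  ultimately show ?thesis
    by (auto simp: algebra_hom_def ring_hom_def f_one fc closed)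
qed

end

section \<open>Homomorphisms, surjective images and quotient algebras\<close>

lemma algebra_homD:
  assumes "algebra_hom A B \<phi>"
  shows "a \<in> carrier A \<Longrightarrow> \<phi> a \<in> carrier B"
    and "\<lbrakk>a \<in> carrier A; b \<in> carrier A\<rbrakk> \<Longrightarrow> \<phi> (a \<otimes>\<^bsub>A\<^esub> b) = \<phi> a \<otimes>\<^bsub>B\<^esub> \<phi> b"
    and "\<lbrakk>a \<in> carrier A; b \<in> carrier A\<rbrakk> \<Longrightarrow> \<phi> (a \<oplus>\<^bsub>A\<^esub> b) = \<phi> a \<oplus>\<^bsub>B\<^esub> \<phi> b"
    and "\<phi> \<one>\<^bsub>A\<^esub> = \<one>\<^bsub>B\<^esub>"
    and "a \<in> carrier A \<Longrightarrow> \<phi> (r \<odot>\<^bsub>A\<^esub> a) = r \<odot>\<^bsub>B\<^esub> \<phi> a"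
  using assms by (auto simp: algebra_hom_def ring_hom_def Pi_iff)

text \<open>Algebra laws pass to surjective images, so quotients and the graded algebra need no
  computation with cosets. Preservation of zero is assumed because \<open>B\<close> is not yet known
  to be a ring, where it would be automatic.\<close>

lemma (in assoc_algebra) algebra_hom_image:
  assumes hom: "algebra_hom A B \<phi>" and surj: "\<phi> ` carrier A = carrier B"
    and zero: "\<phi> \<zero> = \<zero>\<^bsub>B\<^esub>"
  shows "assoc_algebra B"
proof -
  note h = algebra_homD[OF hom]
  have ring: "ring B"
    using ring_hom_imp_img_ring[of \<phi> B] hom surj zero by (simp add: algebra_hom_def)
  have img: "\<exists>a'. a' \<in> carrier A \<and> a = \<phi> a'" if "a \<in> carrier B" for a
    using that surj by blast
  show ?thesis
  proof (intro assoc_algebra.intro assoc_algebra_axioms.intro ring)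
    fix a b r s
    assume a: "a \<in> carrier B"
    then obtain a' where a': "a' \<in> carrier A" "a = \<phi> a'" using img by blast
    then show "r \<odot>\<^bsub>B\<^esub> a \<in> carrier B" "1 \<odot>\<^bsub>B\<^esub> a = a"
      "r \<odot>\<^bsub>B\<^esub> (s \<odot>\<^bsub>B\<^esub> a) = (r * s) \<odot>\<^bsub>B\<^esub> a" "(r + s) \<odot>\<^bsub>B\<^esub> a = r \<odot>\<^bsub>B\<^esub> a \<oplus>\<^bsub>B\<^esub> s \<odot>\<^bsub>B\<^esub> a"
      by (simp_all add: h(1) h(3) h(5)[symmetric] smult_smult flip: h(3))
        (simp_all add: smult_l_distr)
    assume b: "b \<in> carrier B"
    then obtain b' where b': "b' \<in> carrier A" "b = \<phi> b'" using img by blast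
    with a' show "r \<odot>\<^bsub>B\<^esub> (a \<oplus>\<^bsub>B\<^esub> b) = r \<odot>\<^bsub>B\<^esub> a \<oplus>\<^bsub>B\<^esub> r \<odot>\<^bsub>B\<^esub> b"
      "(r \<odot>\<^bsub>B\<^esub> a) \<otimes>\<^bsub>B\<^esub> b = r \<odot>\<^bsub>B\<^esub> (a \<otimes>\<^bsub>B\<^esub> b)" "a \<otimes>\<^bsub>B\<^esub> (r \<odot>\<^bsub>B\<^esub> b) = r \<odot>\<^bsub>B\<^esub> (a \<otimes>\<^bsub>B\<^esub> b)"
      by (simp_all add: h(1) flip: h(2,3,5))
        (simp_all add: smult_r_distr smult_mult_l smult_mult_r)
  qed
qed

lemma algebra_hom_zero:
  assumes "assoc_algebra A" "assoc_algebra B" "algebra_hom A B \<phi>"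
  shows "\<phi> \<zero>\<^bsub>A\<^esub> = \<zero>\<^bsub>B\<^esub>"
proof -
  interpret A: assoc_algebra A by fact
  interpret B: assoc_algebra B by fact
  show ?thesis
    using algebra_homD(5)[OF assms(3), of "\<zero>\<^bsub>A\<^esub>" 0] algebra_homD(1)[OF assms(3), of "\<zero>\<^bsub>A\<^esub>"]
    by simp
qed

lemma algebra_hom_minus:
  assumes "assoc_algebra A" "assoc_algebra B" "algebra_hom A B \<phi>" "a \<in> carrier A" "b \<in> carrier A"
  shows "\<phi> (a \<ominus>\<^bsub>A\<^esub> b) = \<phi> a \<ominus>\<^bsub>B\<^esub> \<phi> b"
proof -
  interpret A: assoc_algebra A by fact
  interpret B: assoc_algebra B by fact
  have "\<phi> (\<ominus>\<^bsub>A\<^esub> b) = \<ominus>\<^bsub>B\<^esub> \<phi> b"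
    using algebra_homD(5)[OF assms(3), of b "- 1"] algebra_homD(1)[OF assms(3), of b] assms(5)
    by (simp add: A.smult_minus_one B.smult_minus_one)
  then show ?thesis
    using assms(4,5) by (simp add: A.minus_eq B.minus_eq algebra_homD[OF assms(3)])
qed

lemma algebra_hom_pow:
  assumes "assoc_algebra A" "assoc_algebra B" "algebra_hom A B \<phi>" "a \<in> carrier A"
  shows "\<phi> (a [^]\<^bsub>A\<^esub> (n::nat)) = \<phi> a [^]\<^bsub>B\<^esub> n"
proof -
  interpret A: assoc_algebra A by fact
  interpret B: assoc_algebra B by fact
  show ?thesis
    using assms(4) by (induction n) (simp_all add: algebra_homD[OF assms(3)])
qed

lemma algebra_hom_finsum:
  assumes "assoc_algebra A" "assoc_algebra B" "algebra_hom A B \<phi>" "f \<in> T \<rightarrow> carrier A"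
  shows "\<phi> (\<Oplus>\<^bsub>A\<^esub>t\<in>T. f t) = (\<Oplus>\<^bsub>B\<^esub>t\<in>T. \<phi> (f t))"
proof -
  interpret A: assoc_algebra A by fact
  interpret B: assoc_algebra B by fact
  show ?thesis
    using assms(4)
  proof (induction T rule: infinite_finite_induct)
    case (insert t T)
    then have "(\<lambda>t. \<phi> (f t)) \<in> T \<rightarrow> carrier B" "\<phi> (f t) \<in> carrier B"
      by (auto simp: algebra_homD[OF assms(3)] Pi_iff)
    with insert show ?case
      by (simp add: A.finsum_insert B.finsum_insert algebra_homD[OF assms(3)] Pi_iff)
  qed (simp_all add: algebra_hom_zero[OF assms(1-3)])
qed

text \<open>Two images of \<open>F\<close> under maps with the same fibres are isomorphic. One
  direction of \<open>eq\<close> makes the induced map well defined, the other makes it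
  injective.\<close>

lemma algebra_isomorphic_of_surj_homs:
  assumes "assoc_algebra F" "algebra_hom F B \<psi>" "\<psi> ` carrier F = carrier B"
    "algebra_hom F Q \<pi>" "\<pi> ` carrier F = carrier Q"
    and eq: "\<And>a b. \<lbrakk>a \<in> carrier F; b \<in> carrier F\<rbrakk> \<Longrightarrow> \<psi> a = \<psi> b \<longleftrightarrow> \<pi> a = \<pi> b"
  shows "algebra_isomorphic B Q"
proof -
  interpret F: assoc_algebra F by fact
  \<comment> \<open>An arbitrary preimage in \<open>F\<close> is chosen; by \<open>eq\<close> its
    image in \<open>Q\<close> does not depend on the choice.\<close>
  define \<theta> where "\<theta> = (\<lambda>b. \<pi> (SOME a. a \<in> carrier F \<and> \<psi> a = b))"
  have \<theta>: "\<theta> (\<psi> a) = \<pi> a" if "a \<in> carrier F" for a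
  proof -
    have "(SOME a'. a' \<in> carrier F \<and> \<psi> a' = \<psi> a) \<in> carrier F \<and>
        \<psi> (SOME a'. a' \<in> carrier F \<and> \<psi> a' = \<psi> a) = \<psi> a"
      by (rule someI[of _ a]) (use that in simp)
    then show ?thesis using that eq by (auto simp: \<theta>_def)
  qed
  have img: "\<exists>a. a \<in> carrier F \<and> b = \<psi> a" if "b \<in> carrier B" for b
    using that assms(3) by blast
  note h = algebra_homD[OF assms(2)] and k = algebra_homD[OF assms(4)]
  have "\<theta> \<in> ring_iso B Q"
  proof (rule ring_iso_memI)
    fix b assume "b \<in> carrier B"
    then obtain a where a: "a \<in> carrier F" "b = \<psi> a" using img by blast
    then show "\<theta> b \<in> carrier Q" by (simp add: \<theta> k)
    fix b' assume "b' \<in> carrier B"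
    then obtain a' where a': "a' \<in> carrier F" "b' = \<psi> a'" using img by blast
    have "b \<otimes>\<^bsub>B\<^esub> b' = \<psi> (a \<otimes>\<^bsub>F\<^esub> a')" "b \<oplus>\<^bsub>B\<^esub> b' = \<psi> (a \<oplus>\<^bsub>F\<^esub> a')"
      using a a' by (simp_all add: h)
    then show "\<theta> (b \<otimes>\<^bsub>B\<^esub> b') = \<theta> b \<otimes>\<^bsub>Q\<^esub> \<theta> b'" "\<theta> (b \<oplus>\<^bsub>B\<^esub> b') = \<theta> b \<oplus>\<^bsub>Q\<^esub> \<theta> b'"
      using a a' by (simp_all add: \<theta> k)
  next
    show "\<theta> \<one>\<^bsub>B\<^esub> = \<one>\<^bsub>Q\<^esub>"
      by (simp add: \<theta> k flip: h(4))
    show "bij_betw \<theta> (carrier B) (carrier Q)"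
    proof (rule bij_betwI')
      fix b b' assume "b \<in> carrier B" "b' \<in> carrier B"
      then obtain a a' where "a \<in> carrier F" "b = \<psi> a" "a' \<in> carrier F" "b' = \<psi> a'"
        using img by blast
      then show "\<theta> b = \<theta> b' \<longleftrightarrow> b = b'" by (simp add: \<theta> eq)
    next
      fix b assume "b \<in> carrier B"
      then obtain a where "a \<in> carrier F" "b = \<psi> a" using img by blast
      then show "\<theta> b \<in> carrier Q" by (simp add: \<theta> k)
    next
      fix q assume "q \<in> carrier Q"
      then obtain a where "a \<in> carrier F" "q = \<pi> a" using assms(5) by blast
      then show "\<exists>b\<in>carrier B. q = \<theta> b"
        by (intro bexI[of _ "\<psi> a"]) (simp_all add: \<theta> h)
    qed
  qed
  moreover have "\<theta> (r \<odot>\<^bsub>B\<^esub> b) = r \<odot>\<^bsub>Q\<^esub> \<theta> b" if "b \<in> carrier B" for r b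
  proof -
    obtain a where "a \<in> carrier F" "b = \<psi> a" using img \<open>b \<in> carrier B\<close> by blast
    then show ?thesis by (simp add: \<theta> k flip: h(5))
  qed
  ultimately show ?thesis
    unfolding algebra_isomorphic_def by blast
qed

lemma (in ring) minus_eq_zero_iff:
  assumes "a \<in> carrier R" "b \<in> carrier R"
  shows "a \<ominus> b = \<zero> \<longleftrightarrow> a = b"
  using assms by (metis minus_eq r_neg minus_equality minus_minus a_inv_closed)

lemma (in ideal) rcos_eq_iff:
  assumes "a \<in> carrier R" "b \<in> carrier R"
  shows "I +> a = I +> b \<longleftrightarrow> a \<ominus> b \<in> I"
proof
  assume "I +> a = I +> b"
  then have "a \<in> I +> b" using a_rcos_self[OF assms(1)] by simp
  then obtain i where "i \<in> I" "a = i \<oplus> b" by (auto simp: a_r_coset_def')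
  then show "a \<ominus> b \<in> I"
    using assms by (simp add: minus_eq a_assoc r_neg)
next
  assume "a \<ominus> b \<in> I"
  then have "(a \<ominus> b) \<oplus> b \<in> I +> b" by (auto simp: a_r_coset_def')
  then have "a \<in> I +> b" using assms by (simp add: minus_eq a_assoc l_neg)
  then show "I +> a = I +> b" using a_repr_independence[OF _ assms(2) is_additive_subgroup[THEN additive_subgroup.a_subgroup]] by simp
qed

context assoc_algebra
begin

text \<open>Scaling by \<open>r\<close> is multiplication by the ring element
  \<open>r \<odot> \<one>\<close>, so every ring ideal is a subspace.\<close>

lemma ideal_smult_closed:
  assumes "ideal I A" "a \<in> I"
  shows "r \<odot> a \<in> I"
  using assms ideal.I_l_closed[of I A a "r \<odot> \<one>"] ideal.Icarr[of I A a]
  by (simp add: smult_mult_l)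

text \<open>The scalar multiple of a coset is defined as a union of cosets, one for each
  representative; all of them coincide.\<close>

lemma rcos_smult:
  assumes "ideal I A" "a \<in> carrier A"
  shows "(\<Union>b\<in>I +> a. I +> (r \<odot> b)) = I +> (r \<odot> a)"
proof -
  interpret I: ideal I A by fact
  have "I +> (r \<odot> b) = I +> (r \<odot> a)" if "b \<in> I +> a" for b
  proof -
    from that obtain i where i: "i \<in> I" "b = i \<oplus> a" by (auto simp: a_r_coset_def')
    then have "r \<odot> b \<ominus> r \<odot> a = r \<odot> i"
      using assms(2) I.Icarr by (simp add: smult_r_distr minus_eq a_assoc r_neg)
    then show ?thesis
      using i assms I.Icarr by (simp add: I.rcos_eq_iff ideal_smult_closed)
  qed
  then show ?thesis
    using I.a_rcos_self[OF assms(2)] by blast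
qed

lemma quotient_algebra_hom:
  assumes "ideal I A"
  shows "algebra_hom A (quotient_algebra A I) ((+>) I)"
    and "((+>) I) ` carrier A = carrier (quotient_algebra A I)"
    and "assoc_algebra (quotient_algebra A I)"
proof -
  interpret I: ideal I A by fact
  show hom: "algebra_hom A (quotient_algebra A I) ((+>) I)"
    using I.rcos_ring_hom
    by (auto simp: algebra_hom_def ring_hom_def quotient_algebra_def ring.defs rcos_smult assms)
  show surj: "((+>) I) ` carrier A = carrier (quotient_algebra A I)"
    by (auto simp: quotient_algebra_def ring.defs FactRing_simps)
  have "I +> \<zero> = \<zero>\<^bsub>quotient_algebra A I\<^esub>"
    using I.a_rcos_const[OF I.zero_closed] by (simp add: quotient_algebra_def ring.defs FactRing_def)
  with hom surj show "assoc_algebra (quotient_algebra A I)"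
    by (rule algebra_hom_image)
qed

end

section \<open>Linear spans of indexed families\<close>

definition lspan :: "('k, 'a) module \<Rightarrow> 't set \<Rightarrow> ('t \<Rightarrow> 'a) \<Rightarrow> 'a set" where
  "lspan A T f = {\<Oplus>\<^bsub>A\<^esub>t\<in>T. l t \<odot>\<^bsub>A\<^esub> f t | l. True}"

context assoc_algebra
begin

lemma lspan_lin:
  assumes "f \<in> T \<rightarrow> carrier A" "a \<in> lspan A T f" "b \<in> lspan A T f"
  shows "a \<oplus> r \<odot> b \<in> lspan A T f"
proof -
  obtain l m where "a = (\<Oplus>t\<in>T. l t \<odot> f t)" "b = (\<Oplus>t\<in>T. m t \<odot> f t)"
    using assms(2,3) by (auto simp: lspan_def)
  then have "a \<oplus> r \<odot> b = (\<Oplus>t\<in>T. (l t + r * m t) \<odot> f t)"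
    using finsum_smult_add[OF assms(1)] by simp
  then show ?thesis by (auto simp: lspan_def)
qed

lemma lspan_zero: "f \<in> T \<rightarrow> carrier A \<Longrightarrow> \<zero> \<in> lspan A T f"
proof -
  assume f: "f \<in> T \<rightarrow> carrier A"
  then have "(\<Oplus>t\<in>T. 0 \<odot> f t) = (\<Oplus>t\<in>T. \<zero>)"
    by (intro finsum_cong') (auto simp: Pi_iff)
  then show ?thesis by (auto simp: lspan_def intro!: exI[of _ "\<lambda>_. 0"])
qed

lemma lspan_closed: "f \<in> T \<rightarrow> carrier A \<Longrightarrow> lspan A T f \<subseteq> carrier A"
  unfolding lspan_def by (auto intro!: finsum_closed simp: Pi_iff)

lemma lspan_add:
  assumes "f \<in> T \<rightarrow> carrier A" "a \<in> lspan A T f" "b \<in> lspan A T f"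
  shows "a \<oplus> b \<in> lspan A T f"
  using lspan_lin[OF assms, of 1] lspan_closed[OF assms(1)] assms(3) by auto

lemma lspan_smult:
  assumes "f \<in> T \<rightarrow> carrier A" "a \<in> lspan A T f"
  shows "r \<odot> a \<in> lspan A T f"
  using lspan_lin[OF assms(1) lspan_zero[OF assms(1)] assms(2), of r]
    lspan_closed[OF assms(1)] assms(2) by auto

lemma lspan_gen:
  assumes "finite T" "f \<in> T \<rightarrow> carrier A" "t \<in> T"
  shows "f t \<in> lspan A T f"
  unfolding lspan_def
  by (rule CollectI, rule exI[of _ "\<lambda>u. if u = t then 1 else 0"])
    (use finsum_smult_delta[OF assms(1,3,2), of 1] assms in \<open>auto simp: Pi_iff\<close>)

lemma lspan_finsum:
  assumes "f \<in> T \<rightarrow> carrier A" "finite S" "\<And>s. s \<in> S \<Longrightarrow> h s \<in> lspan A T f"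
  shows "(\<Oplus>s\<in>S. h s) \<in> lspan A T f"
  using assms(2,3)
proof (induction S rule: finite_induct)
  case (insert s S)
  moreover have "h \<in> insert s S \<rightarrow> carrier A"
    using insert.prems lspan_closed[OF assms(1)] by auto
  ultimately show ?case
    by (subst finsum_insert) (auto intro: lspan_add[OF assms(1)])
qed (simp add: lspan_zero[OF assms(1)])

lemma lspan_mult_l:
  assumes "f \<in> T \<rightarrow> carrier A" "finite T" "a \<in> carrier A" "\<And>t. t \<in> T \<Longrightarrow> a \<otimes> f t \<in> lspan A T f"
    and "b \<in> lspan A T f"
  shows "a \<otimes> b \<in> lspan A T f"
proof -
  obtain l where "b = (\<Oplus>t\<in>T. l t \<odot> f t)" using assms(5) by (auto simp: lspan_def)
  then have "a \<otimes> b = (\<Oplus>t\<in>T. a \<otimes> (l t \<odot> f t))"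
    using assms by (simp add: finsum_rdistr Pi_iff)
  also have "\<dots> = (\<Oplus>t\<in>T. l t \<odot> (a \<otimes> f t))"
    by (rule finsum_cong') (use assms in \<open>auto simp: Pi_iff smult_mult_r\<close>)
  also have "\<dots> \<in> lspan A T f"
    by (rule lspan_finsum) (use assms in \<open>auto intro: lspan_smult\<close>)
  finally show ?thesis .
qed

end

section \<open>The algebra on three skew-commuting generators\<close>

definition mono3 :: "('a, 'm) monoid_scheme \<Rightarrow> 'a \<Rightarrow> 'a \<Rightarrow> 'a \<Rightarrow> nat \<times> nat \<times> nat \<Rightarrow> 'a" where
  "mono3 A x y z = (\<lambda>(i, j, k). x [^]\<^bsub>A\<^esub> i \<otimes>\<^bsub>A\<^esub> (y [^]\<^bsub>A\<^esub> j \<otimes>\<^bsub>A\<^esub> z [^]\<^bsub>A\<^esub> k))"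

definition exps :: "nat \<Rightarrow> (nat \<times> nat \<times> nat) set" where
  "exps p = {..<p} \<times> {..<p} \<times> {..<p}"

lemma finite_exps [simp]: "finite (exps p)"
  by (simp add: exps_def)

definition word_eval :: "('a, 'm) monoid_scheme \<Rightarrow> ('v \<Rightarrow> 'a) \<Rightarrow> 'v list \<Rightarrow> 'a" where
  "word_eval A v w = foldr (\<lambda>l a. v l \<otimes>\<^bsub>A\<^esub> a) w \<one>\<^bsub>A\<^esub>"

lemma word_eval_simps [simp]:
  "word_eval A v [] = \<one>\<^bsub>A\<^esub>"
  "word_eval A v (l # w) = v l \<otimes>\<^bsub>A\<^esub> word_eval A v w"
  by (simp_all add: word_eval_def)

text \<open>Here \<sigma> is 1 for kP and -1 for the block. The relation xy - \<sigma> yx = z is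
  solved for yx, using that \<sigma> is its own inverse; the three equations then are rewrite rules
  that sort every word into the order x, y, z.\<close>

locale skew_triple = assoc_algebra A for A :: "('k::field, 'a) module" (structure) +
  fixes x y z :: 'a and \<sigma> :: 'k
  assumes xyz [simp]: "x \<in> carrier A" "y \<in> carrier A" "z \<in> carrier A"
    and sigma: "\<sigma> * \<sigma> = 1"
    and yx: "y \<otimes> x = \<sigma> \<odot> (x \<otimes> y \<ominus> z)"
    and zx: "z \<otimes> x = \<sigma> \<odot> (x \<otimes> z)"
    and zy: "z \<otimes> y = \<sigma> \<odot> (y \<otimes> z)"
begin

lemma mono3_closed [simp]: "mono3 A x y z t \<in> carrier A"
  by (simp add: mono3_def split: prod.split)

lemma z_pow_x: "z \<otimes> x [^] (i::nat) = \<sigma> ^ i \<odot> (x [^] i \<otimes> z)"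
proof (induction i)
  case (Suc i)
  have "z \<otimes> x [^] Suc i = (z \<otimes> x [^] i) \<otimes> x" by (simp add: m_assoc)
  also have "\<dots> = \<sigma> ^ i \<odot> (x [^] i \<otimes> (z \<otimes> x))"
    by (simp add: Suc.IH smult_mult_l m_assoc)
  finally show ?case
    by (simp add: zx smult_mult_r smult_smult m_assoc mult.commute)
qed simp

lemma z_pow_y: "z \<otimes> y [^] (i::nat) = \<sigma> ^ i \<odot> (y [^] i \<otimes> z)"
proof (induction i)
  case (Suc i)
  have "z \<otimes> y [^] Suc i = (z \<otimes> y [^] i) \<otimes> y" by (simp add: m_assoc)
  also have "\<dots> = \<sigma> ^ i \<odot> (y [^] i \<otimes> (z \<otimes> y))"
    by (simp add: Suc.IH smult_mult_l m_assoc)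
  finally show ?case
    by (simp add: zy smult_mult_r smult_smult m_assoc mult.commute)
qed simp

text \<open>Moving y past a power of x leaves one correction term with z. Only its shape matters for
  spanning, so the coefficient stays existential. For \<open>i = 0\<close> the truncated exponent
  \<open>i - 1\<close> is harmless, as \<open>c = 0\<close> is a witness.\<close>

lemma y_pow_x:
  "\<exists>c. y \<otimes> x [^] (i::nat) = \<sigma> ^ i \<odot> (x [^] i \<otimes> y) \<oplus> c \<odot> (x [^] (i - 1) \<otimes> z)"
proof (induction i)
  case 0
  show ?case by (rule exI[of _ 0]) simp
next
  case (Suc i)
  then obtain c where c: "y \<otimes> x [^] i = \<sigma> ^ i \<odot> (x [^] i \<otimes> y) \<oplus> c \<odot> (x [^] (i - 1) \<otimes> z)"
    by blast
  define d where "d = (if i = 0 then 0 else c * \<sigma>)"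
  have tail: "c \<odot> (x [^] (i - 1) \<otimes> z) \<otimes> x = d \<odot> (x [^] i \<otimes> z)" if "i \<noteq> 0"
  proof -
    from that obtain i' where i': "i = Suc i'" by (cases i) auto
    show ?thesis
      by (simp add: i' d_def smult_mult_l m_assoc zx smult_mult_r smult_smult)
  qed
  \<comment> \<open>For \<open>i = 0\<close> the coefficient provided by the hypothesis is unknown,
    but the equation y = y + cz itself forces the correction to vanish.\<close>
  have tail': "c \<odot> (x [^] (i - 1) \<otimes> z) = \<zero>" if "i = 0"
  proof -
    have "y \<oplus> c \<odot> z = y" using c that by simp
    then have "c \<odot> z = \<zero>" by (metis add.l_cancel_one smult_closed xyz(2,3))
    then show ?thesis using that by simp
  qed
  have "y \<otimes> x [^] Suc i = (y \<otimes> x [^] i) \<otimes> x" by (simp add: m_assoc)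
  also have "\<dots> = \<sigma> ^ i \<odot> (x [^] i \<otimes> (y \<otimes> x)) \<oplus> c \<odot> (x [^] (i - 1) \<otimes> z) \<otimes> x"
    by (simp add: c l_distr smult_mult_l m_assoc)
  also have "c \<odot> (x [^] (i - 1) \<otimes> z) \<otimes> x = d \<odot> (x [^] i \<otimes> z)"
    using tail tail' by (cases "i = 0") (simp_all add: d_def)
  also have "\<sigma> ^ i \<odot> (x [^] i \<otimes> (y \<otimes> x)) =
      \<sigma> ^ Suc i \<odot> (x [^] Suc i \<otimes> y) \<ominus> \<sigma> ^ Suc i \<odot> (x [^] i \<otimes> z)"
    by (simp add: yx smult_mult_r smult_smult smult_r_distr r_distr minus_eq m_assoc r_minus
        smult_minus_r mult.commute)
  finally have "y \<otimes> x [^] Suc i =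
      \<sigma> ^ Suc i \<odot> (x [^] Suc i \<otimes> y) \<oplus> (d - \<sigma> ^ Suc i) \<odot> (x [^] i \<otimes> z)"
    by (simp only: smult_l_diff m_closed nat_pow_closed xyz)
      (simp add: minus_eq a_ac)
  then show ?case by (intro exI[of _ "d - \<sigma> ^ Suc i"]) simp
qed

lemma lspan_mono3:
  assumes "x [^] p = \<zero>" "y [^] p = \<zero>" "z [^] p = \<zero>"
  shows "mono3 A x y z (i, j, k) \<in> lspan A (exps p) (mono3 A x y z)"
proof (cases "(i, j, k) \<in> exps p")
  case True
  then show ?thesis by (intro lspan_gen) auto
next
  case False
  have pow: "a [^] n = \<zero>" if "a [^] p = \<zero>" "p \<le> n" "a \<in> carrier A" for a and n :: nat
  proof -
    have "a [^] (p + (n - p)) = a [^] p \<otimes> a [^] (n - p)"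
      by (rule nat_pow_mult[symmetric]) fact
    then show ?thesis using that by simp
  qed
  have "mono3 A x y z (i, j, k) = \<zero>"
    using False assms by (auto simp: mono3_def exps_def not_less pow)
  then show ?thesis by (simp add: lspan_zero)
qed

text \<open>The span of the ordered monomials is stable under left multiplication by each letter: x
  already stands in front, z moves past x and y at the cost of powers of \<sigma>, and y moves past
  x with the correction of \<open>y_pow_x\<close>, which is again an ordered monomial up to a
  scalar.\<close>

lemma word_eval_in_lspan:
  assumes "x [^] p = \<zero>" "y [^] p = \<zero>" "z [^] p = \<zero>"
  shows "word_eval A (case_letter x y z) w \<in> lspan A (exps p) (mono3 A x y z)"
proof (induction w)
  case Nil
  show ?case using lspan_mono3[OF assms, of 0 0 0] by (simp add: mono3_def)
next
  case (Cons l w)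
  let ?L = "lspan A (exps p) (mono3 A x y z)"
  note mono = lspan_mono3[OF assms] and smult = lspan_smult[of "mono3 A x y z" "exps p"]
    and add = lspan_add[of "mono3 A x y z" "exps p"]
  have "x \<otimes> mono3 A x y z (i, j, k) = mono3 A x y z (Suc i, j, k)" for i j k
    unfolding mono3_def by (simp add: nat_pow_Suc2 m_assoc del: nat_pow_Suc Group.nat_pow_Suc)
  then have X: "x \<otimes> mono3 A x y z t \<in> ?L" for t
    using mono by (cases t) simp
  have Zij: "z \<otimes> mono3 A x y z (i, j, k) = (\<sigma> ^ i * \<sigma> ^ j) \<odot> mono3 A x y z (i, j, Suc k)" for i j k
  proof -
    have "z \<otimes> mono3 A x y z (i, j, k) = (z \<otimes> x [^] i) \<otimes> (y [^] j \<otimes> z [^] k)"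
      by (simp add: mono3_def m_assoc)
    also have "\<dots> = \<sigma> ^ i \<odot> (x [^] i \<otimes> ((z \<otimes> y [^] j) \<otimes> z [^] k))"
      by (simp add: z_pow_x smult_mult_l m_assoc)
    also have "\<dots> = (\<sigma> ^ i * \<sigma> ^ j) \<odot> mono3 A x y z (i, j, Suc k)"
      unfolding mono3_def
      by (simp add: z_pow_y smult_mult_l smult_mult_r smult_smult m_assoc nat_pow_Suc2 del: nat_pow_Suc Group.nat_pow_Suc)
    finally show ?thesis .
  qed
  then have Z: "z \<otimes> mono3 A x y z t \<in> ?L" for t
    using mono smult by (cases t) simp
  have Y: "y \<otimes> mono3 A x y z t \<in> ?L" for t
  proof -
    obtain i j k where t: "t = (i, j, k)" by (cases t)
    obtain c where c: "y \<otimes> x [^] i = \<sigma> ^ i \<odot> (x [^] i \<otimes> y) \<oplus> c \<odot> (x [^] (i - 1) \<otimes> z)"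
      using y_pow_x by blast
    have "y \<otimes> mono3 A x y z t = (y \<otimes> x [^] i) \<otimes> (y [^] j \<otimes> z [^] k)"
      by (simp add: t mono3_def m_assoc)
    also have "\<dots> = \<sigma> ^ i \<odot> (x [^] i \<otimes> (y \<otimes> (y [^] j \<otimes> z [^] k))) \<oplus>
        c \<odot> (x [^] (i - 1) \<otimes> ((z \<otimes> y [^] j) \<otimes> z [^] k))"
      by (simp add: c l_distr smult_mult_l m_assoc)
    also have "x [^] i \<otimes> (y \<otimes> (y [^] j \<otimes> z [^] k)) = mono3 A x y z (i, Suc j, k)"
      unfolding mono3_def by (simp add: nat_pow_Suc2 m_assoc del: nat_pow_Suc Group.nat_pow_Suc)
    also have "x [^] (i - 1) \<otimes> ((z \<otimes> y [^] j) \<otimes> z [^] k) =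
        \<sigma> ^ j \<odot> mono3 A x y z (i - 1, j, Suc k)"
      unfolding mono3_def
      by (simp add: z_pow_y smult_mult_l smult_mult_r m_assoc nat_pow_Suc2 del: nat_pow_Suc Group.nat_pow_Suc)
    finally show ?thesis by (simp add: mono smult add)
  qed
  have "case_letter x y z l \<otimes> mono3 A x y z t \<in> ?L" for t
    using X Y Z by (cases l) simp_all
  moreover have "case_letter x y z l \<in> carrier A" by (cases l) simp_all
  ultimately show ?case
    using lspan_mult_l[OF _ finite_exps _ _ Cons.IH] by simp
qed

end

section \<open>The presented algebra, with both sets of relations as the cases \<sigma> = 1 and
  \<sigma> = -1\<close>

definition skew_relations :: "nat \<Rightarrow> 'k \<Rightarrow> (letter list \<Rightarrow> 'k::field) set" where
  "skew_relations p \<sigma> =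
     (let F = free_algebra TYPE('k); x = single [X]; y = single [Y]; z = single [Z] in
       {x [^]\<^bsub>F\<^esub> p, y [^]\<^bsub>F\<^esub> p, z [^]\<^bsub>F\<^esub> p,
        (x \<otimes>\<^bsub>F\<^esub> y \<ominus>\<^bsub>F\<^esub> \<sigma> \<odot>\<^bsub>F\<^esub> (y \<otimes>\<^bsub>F\<^esub> x)) \<ominus>\<^bsub>F\<^esub> z,
        x \<otimes>\<^bsub>F\<^esub> z \<ominus>\<^bsub>F\<^esub> \<sigma> \<odot>\<^bsub>F\<^esub> (z \<otimes>\<^bsub>F\<^esub> x),
        y \<otimes>\<^bsub>F\<^esub> z \<ominus>\<^bsub>F\<^esub> \<sigma> \<odot>\<^bsub>F\<^esub> (z \<otimes>\<^bsub>F\<^esub> y)})"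

lemma free_monoid_monoid: "Group.monoid free_monoid"
  by (rule monoidI) (simp_all add: free_monoid_def)

lemma free_algebra_algebra: "assoc_algebra (free_algebra k)"
  by (rule monoid.monoid_algebra_algebra[OF free_monoid_monoid])

lemma word_in_free_algebra [simp]: "single w \<in> carrier (free_algebra k)"
  by (rule single_in_monoid_algebra) (simp add: free_monoid_def)

lemma commutator_relations_eq: "commutator_relations TYPE('k::field) p = skew_relations p (1::'k)"
proof -
  interpret F: assoc_algebra "free_algebra TYPE('k)" by (rule free_algebra_algebra)
  show ?thesis
    unfolding commutator_relations_def skew_relations_def Let_def
    by (simp del: monoid_algebra_sel)
qed

lemma anticommutator_relations_eq:
  "anticommutator_relations TYPE('k::field) p = skew_relations p (- 1 :: 'k)"
proof -
  interpret F: assoc_algebra "free_algebra TYPE('k)" by (rule free_algebra_algebra)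
  show ?thesis
    unfolding anticommutator_relations_def skew_relations_def Let_def
    by (simp add: F.smult_minus_one F.minus_eq del: monoid_algebra_sel)
qed

lemma (in assoc_algebra) skew_tripleI:
  fixes \<sigma> :: 'k
  assumes c: "x \<in> carrier A" "y \<in> carrier A" "z \<in> carrier A" and sigma: "\<sigma> * \<sigma> = 1"
    and rel: "(x \<otimes> y \<ominus> \<sigma> \<odot> (y \<otimes> x)) \<ominus> z = \<zero>" "x \<otimes> z \<ominus> \<sigma> \<odot> (z \<otimes> x) = \<zero>"
      "y \<otimes> z \<ominus> \<sigma> \<odot> (z \<otimes> y) = \<zero>"
  shows "skew_triple A x y z \<sigma>"
proof -
  have "x \<otimes> y \<ominus> \<sigma> \<odot> (y \<otimes> x) = z"
    using rel(1) c by (metis minus_eq_zero_iff m_closed smult_closed minus_closed)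
  then have "x \<otimes> y \<ominus> z = x \<otimes> y \<ominus> (x \<otimes> y \<ominus> \<sigma> \<odot> (y \<otimes> x))" by simp
  also have "\<dots> = \<sigma> \<odot> (y \<otimes> x)"
    using c by (simp add: minus_eq minus_add minus_minus r_neg1 r_neg2)
  finally have "\<sigma> \<odot> (x \<otimes> y \<ominus> z) = y \<otimes> x"
    using c sigma by (simp add: smult_smult)
  moreover have "x \<otimes> z = \<sigma> \<odot> (z \<otimes> x)" "y \<otimes> z = \<sigma> \<odot> (z \<otimes> y)"
    using rel(2,3) c by (metis minus_eq_zero_iff m_closed smult_closed)+
  ultimately show ?thesis
    using c sigma by unfold_locales (simp_all add: smult_smult)
qed

text \<open>The relations already reduce the presented algebra to the span of the p^3 ordered
  monomials. If these are a basis in \<open>B\<close>, then evaluation of the free algebra in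
  \<open>B\<close> cannot have a larger kernel than the ideal of the relations.\<close>

theorem presented_algebra_of_basis:
  fixes B :: "('k::field, 'b) module" and \<sigma> :: 'k
  assumes B: "skew_triple B x y z \<sigma>"
    and pows: "x [^]\<^bsub>B\<^esub> p = \<zero>\<^bsub>B\<^esub>" "y [^]\<^bsub>B\<^esub> p = \<zero>\<^bsub>B\<^esub>" "z [^]\<^bsub>B\<^esub> p = \<zero>\<^bsub>B\<^esub>"
    and span: "carrier B \<subseteq> lspan B (exps p) (mono3 B x y z)"
    and indep: "\<And>l. (\<Oplus>\<^bsub>B\<^esub>t\<in>exps p. l t \<odot>\<^bsub>B\<^esub> mono3 B x y z t) = \<zero>\<^bsub>B\<^esub> \<Longrightarrow> \<forall>t\<in>exps p. l t = 0"
  shows "algebra_isomorphic B (presented_algebra TYPE('k) (skew_relations p \<sigma>))"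
proof -
  interpret B: skew_triple B x y z \<sigma> by fact
  define F :: "('k, letter list \<Rightarrow> 'k) module" where "F = free_algebra TYPE('k)"
  define x' y' z' where "x' = (single [X] :: letter list \<Rightarrow> 'k)"
    and "y' = (single [Y] :: letter list \<Rightarrow> 'k)" and "z' = (single [Z] :: letter list \<Rightarrow> 'k)"
  interpret F: assoc_algebra F unfolding F_def by (rule free_algebra_algebra)
  have F_carrier: "single w \<in> carrier F" for w
    by (simp add: F_def del: monoid_algebra_sel)
  then have xyz': "x' \<in> carrier F" "y' \<in> carrier F" "z' \<in> carrier F"
    by (simp_all add: x'_def y'_def z'_def)
  define v where "v = case_letter x y z"
  have v: "v l \<in> carrier B" for l by (cases l) (simp_all add: v_def)
  have we: "word_eval B v w \<in> carrier B" for w by (induction w) (simp_all add: v)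
  have we_append: "word_eval B v (w @ w') = word_eval B v w \<otimes>\<^bsub>B\<^esub> word_eval B v w'" for w w'
    by (induction w) (simp_all add: v we B.m_assoc)
  define \<psi> where "\<psi> = algebra_lift B (word_eval B v)"
  have \<psi>: "algebra_hom F B \<psi>"
    unfolding F_def \<psi>_def
    by (rule B.algebra_lift_hom[OF free_monoid_monoid])
      (simp_all add: free_monoid_def we we_append)
  have \<psi>_gen: "\<psi> x' = x" "\<psi> y' = y" "\<psi> z' = z"
    by (simp_all add: \<psi>_def x'_def y'_def z'_def we v v_def)
  note \<psi>h = algebra_homD[OF \<psi>]
  note \<psi>h' = algebra_hom_minus[OF F.assoc_algebra_axioms B.assoc_algebra_axioms \<psi>]
    algebra_hom_pow[OF F.assoc_algebra_axioms B.assoc_algebra_axioms \<psi>]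
    algebra_hom_zero[OF F.assoc_algebra_axioms B.assoc_algebra_axioms \<psi>]
  let ?R = "skew_relations p \<sigma>"
  have R_eq: "?R = {x' [^]\<^bsub>F\<^esub> p, y' [^]\<^bsub>F\<^esub> p, z' [^]\<^bsub>F\<^esub> p,
        (x' \<otimes>\<^bsub>F\<^esub> y' \<ominus>\<^bsub>F\<^esub> \<sigma> \<odot>\<^bsub>F\<^esub> (y' \<otimes>\<^bsub>F\<^esub> x')) \<ominus>\<^bsub>F\<^esub> z',
        x' \<otimes>\<^bsub>F\<^esub> z' \<ominus>\<^bsub>F\<^esub> \<sigma> \<odot>\<^bsub>F\<^esub> (z' \<otimes>\<^bsub>F\<^esub> x'),
        y' \<otimes>\<^bsub>F\<^esub> z' \<ominus>\<^bsub>F\<^esub> \<sigma> \<odot>\<^bsub>F\<^esub> (z' \<otimes>\<^bsub>F\<^esub> y')}"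
    by (simp only: skew_relations_def Let_def F_def x'_def y'_def z'_def)
  have R_sub: "?R \<subseteq> carrier F"
    using xyz' by (simp add: R_eq)
  define I where "I = Idl\<^bsub>F\<^esub> ?R"
  have I: "ideal I F" unfolding I_def by (rule F.genideal_ideal[OF R_sub])
  interpret I: ideal I F by (rule I)
  have R_I: "?R \<subseteq> I" unfolding I_def by (rule F.genideal_self[OF R_sub])
  define K where "K = {a \<in> carrier F. \<psi> a = \<zero>\<^bsub>B\<^esub>}"
  have rhr: "ring_hom_ring F B \<psi>"
    by (intro ring_hom_ringI2 F.ring_axioms B.ring_axioms) (use \<psi> in \<open>simp add: algebra_hom_def\<close>)
  have "ideal K F"
    using ring_hom_ring.kernel_is_ideal[OF rhr] by (simp add: K_def a_kernel_def')
  moreover have "?R \<subseteq> K"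
  proof -
    have "\<sigma> \<odot>\<^bsub>B\<^esub> (y \<otimes>\<^bsub>B\<^esub> x) = x \<otimes>\<^bsub>B\<^esub> y \<ominus>\<^bsub>B\<^esub> z" "\<sigma> \<odot>\<^bsub>B\<^esub> (z \<otimes>\<^bsub>B\<^esub> x) = x \<otimes>\<^bsub>B\<^esub> z"
      "\<sigma> \<odot>\<^bsub>B\<^esub> (z \<otimes>\<^bsub>B\<^esub> y) = y \<otimes>\<^bsub>B\<^esub> z"
      by (simp_all add: B.yx B.zx B.zy B.smult_smult B.sigma)
    moreover have "x \<otimes>\<^bsub>B\<^esub> y \<ominus>\<^bsub>B\<^esub> (x \<otimes>\<^bsub>B\<^esub> y \<ominus>\<^bsub>B\<^esub> z) \<ominus>\<^bsub>B\<^esub> z = \<zero>\<^bsub>B\<^esub>"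
      by (simp add: B.minus_eq B.minus_add B.minus_minus B.r_neg1 B.r_neg2 B.r_neg)
    ultimately show ?thesis
      using xyz' by (simp add: R_eq K_def \<psi>h \<psi>h' \<psi>_gen pows B.minus_eq_zero_iff)
  qed
  ultimately have I_K: "I \<subseteq> K" unfolding I_def by (rule F.genideal_minimal)
  define Q where "Q = quotient_algebra F I"
  define \<pi> where "\<pi> = (+>\<^bsub>F\<^esub>) I"
  have \<pi>: "algebra_hom F Q \<pi>" "\<pi> ` carrier F = carrier Q" and Q: "assoc_algebra Q"
    unfolding Q_def \<pi>_def using F.quotient_algebra_hom[OF I] by auto
  interpret Q: assoc_algebra Q by (rule Q)
  note \<pi>h = algebra_homD[OF \<pi>(1)]
  note \<pi>h' = algebra_hom_minus[OF F.assoc_algebra_axioms Q.assoc_algebra_axioms \<pi>(1)]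
    algebra_hom_pow[OF F.assoc_algebra_axioms Q.assoc_algebra_axioms \<pi>(1)]
    algebra_hom_zero[OF F.assoc_algebra_axioms Q.assoc_algebra_axioms \<pi>(1)]
  have \<pi>_eq: "\<pi> a = \<pi> b \<longleftrightarrow> a \<ominus>\<^bsub>F\<^esub> b \<in> I" if "a \<in> carrier F" "b \<in> carrier F" for a b
    unfolding \<pi>_def by (rule I.rcos_eq_iff[OF that])
  have \<pi>_R: "\<pi> r = \<zero>\<^bsub>Q\<^esub>" if "r \<in> ?R" for r
    using that R_I R_sub \<pi>_eq[of r "\<zero>\<^bsub>F\<^esub>"] I.Icarr by (auto simp: \<pi>h'(3) F.minus_eq)
  \<comment> \<open>The quotient by the relations obeys the rewrite rules as well, so its words
    collapse to combinations of ordered monomials.\<close>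
  interpret Q: skew_triple Q "\<pi> x'" "\<pi> y'" "\<pi> z'" \<sigma>
  proof (rule Q.skew_tripleI)
    have "\<pi> ((x' \<otimes>\<^bsub>F\<^esub> y' \<ominus>\<^bsub>F\<^esub> \<sigma> \<odot>\<^bsub>F\<^esub> (y' \<otimes>\<^bsub>F\<^esub> x')) \<ominus>\<^bsub>F\<^esub> z') = \<zero>\<^bsub>Q\<^esub>"
      "\<pi> (x' \<otimes>\<^bsub>F\<^esub> z' \<ominus>\<^bsub>F\<^esub> \<sigma> \<odot>\<^bsub>F\<^esub> (z' \<otimes>\<^bsub>F\<^esub> x')) = \<zero>\<^bsub>Q\<^esub>"
      "\<pi> (y' \<otimes>\<^bsub>F\<^esub> z' \<ominus>\<^bsub>F\<^esub> \<sigma> \<odot>\<^bsub>F\<^esub> (z' \<otimes>\<^bsub>F\<^esub> y')) = \<zero>\<^bsub>Q\<^esub>"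
      by (rule \<pi>_R; simp add: R_eq)+
    then show "(\<pi> x' \<otimes>\<^bsub>Q\<^esub> \<pi> y' \<ominus>\<^bsub>Q\<^esub> \<sigma> \<odot>\<^bsub>Q\<^esub> (\<pi> y' \<otimes>\<^bsub>Q\<^esub> \<pi> x')) \<ominus>\<^bsub>Q\<^esub> \<pi> z' = \<zero>\<^bsub>Q\<^esub>"
      "\<pi> x' \<otimes>\<^bsub>Q\<^esub> \<pi> z' \<ominus>\<^bsub>Q\<^esub> \<sigma> \<odot>\<^bsub>Q\<^esub> (\<pi> z' \<otimes>\<^bsub>Q\<^esub> \<pi> x') = \<zero>\<^bsub>Q\<^esub>"
      "\<pi> y' \<otimes>\<^bsub>Q\<^esub> \<pi> z' \<ominus>\<^bsub>Q\<^esub> \<sigma> \<odot>\<^bsub>Q\<^esub> (\<pi> z' \<otimes>\<^bsub>Q\<^esub> \<pi> y') = \<zero>\<^bsub>Q\<^esub>"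
      using xyz' by (simp_all only: \<pi>h \<pi>h' F.m_closed F.smult_closed F.minus_closed)
  qed (use xyz' in \<open>simp_all add: \<pi>h B.sigma\<close>)
  have Q_pows: "\<pi> x' [^]\<^bsub>Q\<^esub> p = \<zero>\<^bsub>Q\<^esub>" "\<pi> y' [^]\<^bsub>Q\<^esub> p = \<zero>\<^bsub>Q\<^esub>" "\<pi> z' [^]\<^bsub>Q\<^esub> p = \<zero>\<^bsub>Q\<^esub>"
    using \<pi>_R xyz' by (simp_all add: R_eq flip: \<pi>h'(2))
  have \<pi>_word: "\<pi> (single w) = word_eval Q (case_letter (\<pi> x') (\<pi> y') (\<pi> z')) w" for w
  proof (induction w)
    case Nil
    have "single [] = \<one>\<^bsub>F\<^esub>" by (simp add: F_def free_monoid_def)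
    then show ?case by (simp add: \<pi>h)
  next
    case (Cons l w)
    have "(single (l # w) :: letter list \<Rightarrow> 'k) = single [l] \<otimes>\<^bsub>F\<^esub> single w"
      by (simp add: F_def single_mult_single) (simp add: free_monoid_def)
    then have "\<pi> (single (l # w)) = \<pi> (single [l]) \<otimes>\<^bsub>Q\<^esub> \<pi> (single w)"
      by (simp add: \<pi>h F_carrier)
    then show ?case
      using Cons.IH by (cases l) (simp_all add: x'_def y'_def z'_def)
  qed
  let ?m = "mono3 F x' y' z'"
  have m_closed: "?m t \<in> carrier F" for t
    using xyz' by (simp add: mono3_def split: prod.split)
  have \<pi>_m: "\<pi> (?m t) = mono3 Q (\<pi> x') (\<pi> y') (\<pi> z') t" and \<psi>_m: "\<psi> (?m t) = mono3 B x y z t" for t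
    using xyz' by (simp_all add: mono3_def \<pi>h \<pi>h' \<psi>h \<psi>h' \<psi>_gen split: prod.split)
  have lin: "\<pi> (\<Oplus>\<^bsub>F\<^esub>t\<in>exps p. l t \<odot>\<^bsub>F\<^esub> ?m t) =
        (\<Oplus>\<^bsub>Q\<^esub>t\<in>exps p. l t \<odot>\<^bsub>Q\<^esub> mono3 Q (\<pi> x') (\<pi> y') (\<pi> z') t)"
      "\<psi> (\<Oplus>\<^bsub>F\<^esub>t\<in>exps p. l t \<odot>\<^bsub>F\<^esub> ?m t) = (\<Oplus>\<^bsub>B\<^esub>t\<in>exps p. l t \<odot>\<^bsub>B\<^esub> mono3 B x y z t)" for l
    using algebra_hom_finsum[OF F.assoc_algebra_axioms Q.assoc_algebra_axioms \<pi>(1),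
        of "\<lambda>t. l t \<odot>\<^bsub>F\<^esub> ?m t" "exps p"]
      algebra_hom_finsum[OF F.assoc_algebra_axioms B.assoc_algebra_axioms \<psi>,
        of "\<lambda>t. l t \<odot>\<^bsub>F\<^esub> ?m t" "exps p"]
    by (simp_all add: m_closed \<pi>h \<pi>_m \<psi>h \<psi>_m)
  have \<pi>_span: "\<pi> a \<in> lspan Q (exps p) (mono3 Q (\<pi> x') (\<pi> y') (\<pi> z'))" if "a \<in> carrier F" for a
    using that unfolding F_def
  proof (induction rule: monoid_algebra_induct)
    case zero
    have "\<pi> (\<lambda>u. 0) = \<zero>\<^bsub>Q\<^esub>" using \<pi>h'(3) by (simp add: F_def)
    then show ?case by (simp add: Q.lspan_zero)
  next
    case (add b r u)
    have "(\<lambda>v. b v + r * single u v) = b \<oplus>\<^bsub>F\<^esub> r \<odot>\<^bsub>F\<^esub> single u" by (simp add: F_def)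
    then have "\<pi> (\<lambda>v. b v + r * single u v) = \<pi> b \<oplus>\<^bsub>Q\<^esub> r \<odot>\<^bsub>Q\<^esub> \<pi> (single u)"
      using add.hyps F_carrier by (simp add: \<pi>h flip: F_def)
    then show ?case
      using add Q.word_eval_in_lspan[OF Q_pows] by (simp add: Q.lspan_lin \<pi>_word)
  qed
  \<comment> \<open>Modulo \<open>I\<close> an element of the kernel is a combination of ordered
    monomials; its image in \<open>B\<close> is zero, so independence there makes every coefficient
    zero.\<close>
  have K_I: "a \<in> I" if "a \<in> K" for a
  proof -
    have a: "a \<in> carrier F" "\<psi> a = \<zero>\<^bsub>B\<^esub>" using that by (auto simp: K_def)
    obtain l where l: "\<pi> a = \<pi> (\<Oplus>\<^bsub>F\<^esub>t\<in>exps p. l t \<odot>\<^bsub>F\<^esub> ?m t)"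
      using \<pi>_span[OF a(1)] by (auto simp: lspan_def lin)
    define b where "b = (\<Oplus>\<^bsub>F\<^esub>t\<in>exps p. l t \<odot>\<^bsub>F\<^esub> ?m t)"
    have b: "b \<in> carrier F" unfolding b_def by (intro F.finsum_closed) (simp add: m_closed)
    have ab: "a \<ominus>\<^bsub>F\<^esub> b \<in> I" using l \<pi>_eq[OF a(1) b] by (simp add: b_def)
    then have "\<psi> (a \<ominus>\<^bsub>F\<^esub> b) = \<zero>\<^bsub>B\<^esub>" using I_K by (auto simp: K_def)
    then have "\<psi> b = \<zero>\<^bsub>B\<^esub>"
      using a b by (simp add: \<psi>h' B.minus_eq \<psi>h)
    then have "\<forall>t\<in>exps p. l t = 0"
      using indep by (simp add: b_def lin)
    then have "b = (\<Oplus>\<^bsub>F\<^esub>t\<in>exps p. \<zero>\<^bsub>F\<^esub>)"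
      unfolding b_def by (intro F.finsum_cong') (simp_all add: m_closed)
    then have "b = \<zero>\<^bsub>F\<^esub>" by simp
    then show ?thesis using ab a by (simp add: F.minus_eq)
  qed
  have "algebra_isomorphic B Q"
  proof (rule algebra_isomorphic_of_surj_homs[OF F.assoc_algebra_axioms \<psi> _ \<pi>])
    show "\<psi> ` carrier F = carrier B"
    proof
      show "carrier B \<subseteq> \<psi> ` carrier F"
      proof
        fix b assume "b \<in> carrier B"
        then obtain l where "b = (\<Oplus>\<^bsub>B\<^esub>t\<in>exps p. l t \<odot>\<^bsub>B\<^esub> mono3 B x y z t)"
          using span by (auto simp: lspan_def)
        then have "b = \<psi> (\<Oplus>\<^bsub>F\<^esub>t\<in>exps p. l t \<odot>\<^bsub>F\<^esub> ?m t)" by (simp add: lin)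
        moreover have "(\<Oplus>\<^bsub>F\<^esub>t\<in>exps p. l t \<odot>\<^bsub>F\<^esub> ?m t) \<in> carrier F"
          by (intro F.finsum_closed) (simp add: m_closed)
        ultimately show "b \<in> \<psi> ` carrier F" by blast
      qed
    qed (auto simp: \<psi>h)
  next
    fix a b assume ab: "a \<in> carrier F" "b \<in> carrier F"
    have "\<psi> a = \<psi> b \<longleftrightarrow> a \<ominus>\<^bsub>F\<^esub> b \<in> K"
      using ab by (simp add: K_def \<psi>h' \<psi>h B.minus_eq_zero_iff)
    also have "\<dots> \<longleftrightarrow> \<pi> a = \<pi> b" using \<pi>_eq[OF ab] K_I I_K by blast
    finally show "\<psi> a = \<psi> b \<longleftrightarrow> \<pi> a = \<pi> b" .
  qed
  then show ?thesis
    by (simp add: presented_algebra_def Q_def I_def F_def)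
qed

section \<open>Corner algebras and associated graded algebras\<close>

lemma (in assoc_algebra) in_corner_iff:
  assumes "idempotent A e"
  shows "a \<in> carrier (corner_algebra A e) \<longleftrightarrow> a \<in> carrier A \<and> e \<otimes> a = a \<and> a \<otimes> e = a"
proof
  assume "a \<in> carrier (corner_algebra A e)"
  then obtain b where b: "b \<in> carrier A" "a = e \<otimes> b \<otimes> e" by (auto simp: corner_algebra_def)
  have e: "e \<in> carrier A" "e \<otimes> e = e" using assms by (auto simp: idempotent_def)
  have "e \<otimes> (e \<otimes> b \<otimes> e) = (e \<otimes> e) \<otimes> b \<otimes> e" "e \<otimes> b \<otimes> e \<otimes> e = e \<otimes> b \<otimes> (e \<otimes> e)"
    using e(1) b(1) by (simp_all add: m_assoc)
  then show "a \<in> carrier A \<and> e \<otimes> a = a \<and> a \<otimes> e = a"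
    using b e by simp
next
  assume a: "a \<in> carrier A \<and> e \<otimes> a = a \<and> a \<otimes> e = a"
  then have "e \<otimes> a \<otimes> e = a" by simp
  with a show "a \<in> carrier (corner_algebra A e)"
    by (auto simp: corner_algebra_def intro!: exI[of _ a])
qed

lemma corner_algebra_sel [simp]:
  "one (corner_algebra A e) = e"
  "zero (corner_algebra A e) = zero A"
  "add (corner_algebra A e) = add A"
  "mult (corner_algebra A e) = mult A"
  "module.smult (corner_algebra A e) = module.smult A"
  by (simp_all add: corner_algebra_def)

lemma (in assoc_algebra) corner_algebra_algebra:
  assumes e: "idempotent A e"
  shows "assoc_algebra (corner_algebra A e)"
proof -
  let ?C = "corner_algebra A e"
  note iff = in_corner_iff[OF e]
  have e': "e \<in> carrier A" "e \<otimes> e = e" using e by (auto simp: idempotent_def)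
  have minus: "\<exists>b\<in>carrier ?C. b \<oplus>\<^bsub>?C\<^esub> a = \<zero>\<^bsub>?C\<^esub>" if "a \<in> carrier ?C" for a
    using that e' by (intro bexI[of _ "\<ominus> a"]) (auto simp: iff l_neg r_minus l_minus)
  have "abelian_group ?C"
    by (rule abelian_groupI) (use e' minus in \<open>auto simp: iff l_distr r_distr a_ac\<close>)
  moreover have "Group.monoid ?C"
    by (rule monoidI) (use e' in \<open>auto simp: iff m_assoc\<close>, simp_all add: m_assoc[symmetric])
  ultimately have "ring ?C"
    by (rule ringI) (auto simp: iff l_distr r_distr)
  then show ?thesis
    by (rule assoc_algebra.intro, unfold_locales)
      (use e' in \<open>auto simp: iff smult_mult_l smult_mult_r smult_l_distr smult_r_distr smult_smult\<close>)
qed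

text \<open>The radical is defined through maximal left ideals. That it is a two-sided ideal is
  taken as an assumption, which each application discharges by computing the radical
  explicitly.\<close>

locale radical_algebra = assoc_algebra A for A :: "('k::field, 'a) module" (structure) +
  assumes radical_ideal: "ideal (jacobson_radical A) A"
begin

section \<open>Powers of the radical\<close>

abbreviation "J \<equiv> radical_power A"

abbreviation gr where "gr \<equiv> graded_algebra A"

lemma radical_power_ideal: "ideal (J n) A"
  by (induction n) (simp_all add: oneideal ideal_prod_is_ideal radical_ideal)

lemma radical_power_one: "J 1 = jacobson_radical A"
proof
  have "a \<in> jacobson_radical A" if "a \<in> J 1" for a
    using ideal_prod_inter[OF oneideal radical_ideal] that by auto
  then show "J 1 \<subseteq> jacobson_radical A" by blast
  show "jacobson_radical A \<subseteq> J 1"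
  proof
    fix a assume "a \<in> jacobson_radical A"
    then have "\<one> \<otimes> a \<in> J 1" by (auto intro!: ideal_prod.prod)
    then show "a \<in> J 1"
      using ideal.Icarr[OF radical_ideal \<open>a \<in> jacobson_radical A\<close>] by simp
  qed
qed

text \<open>Powers are built by multiplying by the radical on the right only; associativity of ideal
  products splits them at any place.\<close>

lemma radical_power_add: "J (m + n) = ideal_prod A (J m) (J n)"
proof (induction n)
  case 0
  show ?case by (simp add: ideal_prod_one radical_power_ideal)
next
  case (Suc n)
  then show ?case
    by (simp add: ideal_prod_assoc radical_power_ideal radical_ideal)
qed

lemma radical_power_closed [simp, dest]: "a \<in> J n \<Longrightarrow> a \<in> carrier A"
  by (rule ideal.Icarr[OF radical_power_ideal])

lemma radical_power_mult: "\<lbrakk>a \<in> J m; b \<in> J n\<rbrakk> \<Longrightarrow> a \<otimes> b \<in> J (m + n)"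
  unfolding radical_power_add by (rule ideal_prod.prod)

lemma radical_power_antimono: "m \<le> n \<Longrightarrow> J n \<subseteq> J m"
proof (induction rule: dec_induct)
  case (step n)
  have "J (Suc n) \<subseteq> J n"
    using ideal_prod_inter[OF radical_power_ideal[of n] radical_ideal] by auto
  with step show ?case by blast
qed simp

declare radical_power.simps(2) [simp del]

lemma radical_power_le: "\<lbrakk>a \<in> J n; m \<le> n\<rbrakk> \<Longrightarrow> a \<in> J m"
  using radical_power_antimono by blast

lemma radical_power_subgroup: "additive_subgroup (J n) A"
  by (rule ideal.axioms(1)[OF radical_power_ideal])

lemma radical_power_zero [simp]: "\<zero> \<in> J n"
  by (rule additive_subgroup.zero_closed[OF radical_power_subgroup])

lemma radical_power_plus: "\<lbrakk>a \<in> J n; b \<in> J n\<rbrakk> \<Longrightarrow> a \<oplus> b \<in> J n"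
  by (rule additive_subgroup.a_closed[OF radical_power_subgroup])

lemma radical_power_uminus: "a \<in> J n \<Longrightarrow> \<ominus> a \<in> J n"
  by (rule additive_subgroup.a_inv_closed[OF radical_power_subgroup])

lemma radical_power_lmult: "\<lbrakk>a \<in> J n; b \<in> carrier A\<rbrakk> \<Longrightarrow> b \<otimes> a \<in> J n"
  by (rule ideal.I_l_closed[OF radical_power_ideal])

lemma radical_power_rmult: "\<lbrakk>a \<in> J n; b \<in> carrier A\<rbrakk> \<Longrightarrow> a \<otimes> b \<in> J n"
  by (rule ideal.I_r_closed[OF radical_power_ideal])

lemma radical_power_smult: "a \<in> J n \<Longrightarrow> r \<odot> a \<in> J n"
  by (rule ideal_smult_closed[OF radical_power_ideal])

lemma radical_power_minus: "\<lbrakk>a \<in> J n; b \<in> J n\<rbrakk> \<Longrightarrow> a \<ominus> b \<in> J n"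
  by (simp add: minus_eq radical_power_plus radical_power_uminus)

lemma radical_power_pow: "a \<in> J n \<Longrightarrow> a [^] (k::nat) \<in> J (k * n)"
proof (induction k)
  case (Suc k)
  from radical_power_mult[OF Suc.IH[OF Suc.prems] Suc.prems] show ?case by (simp add: add.commute)
qed simp

lemma radical_power_finsum:
  "\<lbrakk>finite T; \<And>t. t \<in> T \<Longrightarrow> f t \<in> J n\<rbrakk> \<Longrightarrow> (\<Oplus>t\<in>T. f t) \<in> J n"
proof (induction T rule: finite_induct)
  case (insert t T)
  have "(\<Oplus>t\<in>insert t T. f t) = f t \<oplus> (\<Oplus>t\<in>T. f t)"
    by (rule finsum_insert) (use insert in auto)
  with insert show ?case by (simp add: radical_power_plus)
qed simp

lemma coset_eq_iff:
  assumes "a \<in> carrier A" "b \<in> carrier A"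
  shows "J n +> a = J n +> b \<longleftrightarrow> a \<ominus> b \<in> J n"
  by (rule ideal.rcos_eq_iff[OF radical_power_ideal assms])

lemma coset_zero: "J n +> \<zero> = J n"
  by (rule a_rcos_zero) (simp_all add: radical_power_ideal)
text \<open>The Rees algebra: polynomials over \<open>A\<close> whose n-th coefficient lies in
  \<open>J n\<close>. The graded algebra is its image under taking coefficients modulo
  \<open>J (Suc n)\<close>, so that identities can be checked on representatives instead of in a
  different quotient ring for each degree.\<close>

definition rees_algebra :: "('k, nat \<Rightarrow> 'a) module" where
  "rees_algebra =
     \<lparr>carrier = {q. (\<forall>n. q n \<in> J n) \<and> finite {n. q n \<noteq> \<zero>}},
      mult = (\<lambda>q r n. \<Oplus>i\<in>{..n}. q i \<otimes> r (n - i)),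
      one = (\<lambda>n. if n = 0 then \<one> else \<zero>),
      zero = (\<lambda>n. \<zero>),
      add = (\<lambda>q r n. q n \<oplus> r n),
      module.smult = (\<lambda>c q n. c \<odot> q n)\<rparr>"

lemma in_rees_iff: "q \<in> carrier rees_algebra \<longleftrightarrow> (\<forall>n. q n \<in> J n) \<and> finite {n. q n \<noteq> \<zero>}"
  by (simp add: rees_algebra_def)

lemma rees_sel [simp]:
  "mult rees_algebra = (\<lambda>q r n. \<Oplus>i\<in>{..n}. q i \<otimes> r (n - i))"
  "one rees_algebra = (\<lambda>n. if n = 0 then \<one> else \<zero>)"
  "zero rees_algebra = (\<lambda>n. \<zero>)"
  "add rees_algebra = (\<lambda>q r n. q n \<oplus> r n)"
  "module.smult rees_algebra = (\<lambda>c q n. c \<odot> q n)"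
  by (simp_all add: rees_algebra_def)

lemma bound_iff_finite: "(\<exists>n. bound \<zero> n q) \<longleftrightarrow> finite {n::nat. q n \<noteq> \<zero>}"
proof
  assume "\<exists>n. bound \<zero> n q"
  then obtain n where "bound \<zero> n q" by blast
  then have "{n. q n \<noteq> \<zero>} \<subseteq> {..n}" by (auto intro: bound_below)
  then show "finite {n. q n \<noteq> \<zero>}" by (rule finite_subset) simp
next
  assume "finite {n. q n \<noteq> \<zero>}"
  then obtain k where "\<forall>n\<in>{n. q n \<noteq> \<zero>}. n \<le> k"
    using finite_nat_set_iff_bounded_le by blast
  then have "bound \<zero> k q" by (intro bound.intro) (metis leD mem_Collect_eq)
  then show "\<exists>n. bound \<zero> n q" ..
qed

lemma rees_up: "q \<in> carrier rees_algebra \<Longrightarrow> q \<in> up A"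
  by (auto simp: in_rees_iff up_def bound_iff_finite)

lemma rees_mult_closed:
  assumes "q \<in> carrier rees_algebra" "r \<in> carrier rees_algebra"
  shows "(\<lambda>n. \<Oplus>i\<in>{..n}. q i \<otimes> r (n - i)) \<in> carrier rees_algebra"
proof -
  have "(\<lambda>n. \<Oplus>i\<in>{..n}. q i \<otimes> r (n - i)) \<in> up A"
    by (rule up_mult_closed) (use assms in \<open>simp_all add: rees_up\<close>)
  moreover have "(\<Oplus>i\<in>{..n}. q i \<otimes> r (n - i)) \<in> J n" for n
  proof (rule radical_power_finsum)
    fix i assume "i \<in> {..n}"
    then show "q i \<otimes> r (n - i) \<in> J n"
      using assms radical_power_mult[of "q i" i "r (n - i)" "n - i"] by (simp add: in_rees_iff)
  qed simp
  ultimately show ?thesis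
    by (simp add: in_rees_iff up_def bound_iff_finite)
qed

lemma rees_algebra_algebra: "assoc_algebra rees_algebra"
proof -
  \<comment> \<open>Sums and products agree with those of the polynomial ring \<open>UP A\<close>,
    from which associativity and distributivity are inherited.\<close>
  interpret UP: UP_ring A "UP A" by (simp add: UP_ring.intro ring_axioms)
  have U: "q \<in> carrier (UP A)" if "q \<in> carrier rees_algebra" for q
    using rees_up[OF that] by (simp add: UP_def)
  have mult: "q \<otimes>\<^bsub>rees_algebra\<^esub> r = q \<otimes>\<^bsub>UP A\<^esub> r"
    if "q \<in> carrier rees_algebra" "r \<in> carrier rees_algebra" for q r
    using rees_up[OF that(1)] rees_up[OF that(2)] by (simp add: UP_def)
  have one: "\<one>\<^bsub>rees_algebra\<^esub> = \<one>\<^bsub>UP A\<^esub>" by (simp add: UP_def)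
  have mult_closed: "q \<otimes>\<^bsub>rees_algebra\<^esub> r \<in> carrier rees_algebra"
    if "q \<in> carrier rees_algebra" "r \<in> carrier rees_algebra" for q r
    using rees_mult_closed[OF that] by simp
  have add: "q \<oplus>\<^bsub>rees_algebra\<^esub> r = q \<oplus>\<^bsub>UP A\<^esub> r"
    if "q \<in> carrier rees_algebra" "r \<in> carrier rees_algebra" for q r
    using rees_up[OF that(1)] rees_up[OF that(2)] by (simp add: UP_def)
  have add_closed: "q \<oplus>\<^bsub>rees_algebra\<^esub> r \<in> carrier rees_algebra"
    if "q \<in> carrier rees_algebra" "r \<in> carrier rees_algebra" for q r
  proof -
    have "{n. q n \<oplus> r n \<noteq> \<zero>} \<subseteq> {n. q n \<noteq> \<zero>} \<union> {n. r n \<noteq> \<zero>}" by auto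
    with that show ?thesis
      by (auto simp: in_rees_iff radical_power_plus intro: finite_subset)
  qed
  have smult_closed: "c \<odot>\<^bsub>rees_algebra\<^esub> q \<in> carrier rees_algebra"
    if "q \<in> carrier rees_algebra" for c q
  proof -
    have "{n. c \<odot> q n \<noteq> \<zero>} \<subseteq> {n. q n \<noteq> \<zero>}" by auto
    with that show ?thesis
      by (auto simp: in_rees_iff radical_power_smult intro: finite_subset)
  qed
  have carr [simp]: "q n \<in> carrier A" if "q \<in> carrier rees_algebra" for q n
    using that by (auto simp: in_rees_iff)
  have "abelian_group rees_algebra"
  proof (rule abelian_groupI)
    show "\<zero>\<^bsub>rees_algebra\<^esub> \<in> carrier rees_algebra" by (simp add: in_rees_iff)
    fix q assume q: "q \<in> carrier rees_algebra"
    show "\<exists>r\<in>carrier rees_algebra. r \<oplus>\<^bsub>rees_algebra\<^esub> q = \<zero>\<^bsub>rees_algebra\<^esub>"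
      using smult_closed[OF q, of "- 1"] q
      by (intro bexI[of _ "(- 1) \<odot>\<^bsub>rees_algebra\<^esub> q"]) (simp_all add: smult_minus_one l_neg)
  qed (use add_closed in \<open>simp_all add: a_ac fun_eq_iff\<close>)
  moreover have "Group.monoid rees_algebra"
  proof (rule monoidI)
    fix q r s
    assume qrs: "q \<in> carrier rees_algebra" "r \<in> carrier rees_algebra" "s \<in> carrier rees_algebra"
    then show "(q \<otimes>\<^bsub>rees_algebra\<^esub> r) \<otimes>\<^bsub>rees_algebra\<^esub> s =
        q \<otimes>\<^bsub>rees_algebra\<^esub> (r \<otimes>\<^bsub>rees_algebra\<^esub> s)"
      using UP.UP_m_assoc[of q r s] mult[OF mult_closed[OF qrs(1,2)] qrs(3)]
        mult[OF qrs(1) mult_closed[OF qrs(2,3)]] mult[OF qrs(1,2)] mult[OF qrs(2,3)]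
      by (simp add: U del: rees_sel)
  next
    show "\<one>\<^bsub>rees_algebra\<^esub> \<in> carrier rees_algebra" by (simp add: in_rees_iff)
  next
    fix q assume q: "q \<in> carrier rees_algebra"
    have "\<one>\<^bsub>rees_algebra\<^esub> \<in> carrier rees_algebra" by (simp add: in_rees_iff)
    then show "\<one>\<^bsub>rees_algebra\<^esub> \<otimes>\<^bsub>rees_algebra\<^esub> q = q" "q \<otimes>\<^bsub>rees_algebra\<^esub> \<one>\<^bsub>rees_algebra\<^esub> = q"
      using q monoid.l_one[OF ring.is_monoid[OF UP.UP_ring], of q]
        monoid.r_one[OF ring.is_monoid[OF UP.UP_ring], of q]
      by (simp_all add: mult U one del: rees_sel)
  qed (rule mult_closed)
  ultimately have "ring rees_algebra"
  proof (rule ringI)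
    fix q r s
    assume qrs: "q \<in> carrier rees_algebra" "r \<in> carrier rees_algebra" "s \<in> carrier rees_algebra"
    then show "(q \<oplus>\<^bsub>rees_algebra\<^esub> r) \<otimes>\<^bsub>rees_algebra\<^esub> s =
        q \<otimes>\<^bsub>rees_algebra\<^esub> s \<oplus>\<^bsub>rees_algebra\<^esub> r \<otimes>\<^bsub>rees_algebra\<^esub> s"
      "s \<otimes>\<^bsub>rees_algebra\<^esub> (q \<oplus>\<^bsub>rees_algebra\<^esub> r) =
        s \<otimes>\<^bsub>rees_algebra\<^esub> q \<oplus>\<^bsub>rees_algebra\<^esub> s \<otimes>\<^bsub>rees_algebra\<^esub> r"
      using UP.UP_l_distr[of q r s] UP.UP_r_distr[of q r s]
        mult[OF add_closed[OF qrs(1,2)] qrs(3)] mult[OF qrs(3) add_closed[OF qrs(1,2)]]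
        mult[OF qrs(1,3)] mult[OF qrs(2,3)] mult[OF qrs(3,1)] mult[OF qrs(3,2)] add[OF qrs(1,2)]
        add[OF mult_closed[OF qrs(1,3)] mult_closed[OF qrs(2,3)]]
        add[OF mult_closed[OF qrs(3,1)] mult_closed[OF qrs(3,2)]]
      by (simp_all add: U del: rees_sel)
  qed
  moreover have "(c \<odot>\<^bsub>rees_algebra\<^esub> q) \<otimes>\<^bsub>rees_algebra\<^esub> r = c \<odot>\<^bsub>rees_algebra\<^esub> (q \<otimes>\<^bsub>rees_algebra\<^esub> r)"
    "q \<otimes>\<^bsub>rees_algebra\<^esub> (c \<odot>\<^bsub>rees_algebra\<^esub> r) = c \<odot>\<^bsub>rees_algebra\<^esub> (q \<otimes>\<^bsub>rees_algebra\<^esub> r)"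
    if "q \<in> carrier rees_algebra" "r \<in> carrier rees_algebra" for c q r
    using that by (auto simp: fun_eq_iff smult_finsum smult_mult_l smult_mult_r intro!: finsum_cong')
  ultimately show ?thesis
    by (intro assoc_algebra.intro assoc_algebra_axioms.intro smult_closed)
      (simp_all add: fun_eq_iff smult_l_distr smult_r_distr smult_smult)
qed

section \<open>From the Rees algebra onto the associated graded algebra\<close>

definition symbol :: "(nat \<Rightarrow> 'a) \<Rightarrow> nat \<Rightarrow> 'a set" where
  "symbol q = (\<lambda>n. J (Suc n) +> q n)"

lemma gr_sel:
  "carrier gr = {f. (\<forall>n. \<exists>a \<in> J n. f n = J (Suc n) +> a) \<and> finite {n. f n \<noteq> J (Suc n)}}"
  "mult gr = (\<lambda>f g n. \<Oplus>\<^bsub>A Quot J (Suc n)\<^esub> i \<in> {..n}. rcoset_mult A (J (Suc n)) (f i) (g (n - i)))"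
  "one gr = (\<lambda>n. if n = 0 then J (Suc 0) +> \<one> else J (Suc n))"
  "zero gr = (\<lambda>n. J (Suc n))"
  "add gr = (\<lambda>f g n. f n <+> g n)"
  "module.smult gr = (\<lambda>r f n. \<Union>a\<in>f n. J (Suc n) +> (r \<odot> a))"
  by (simp_all add: graded_algebra_def Let_def)

text \<open>Changing the representatives by u and v changes the product by uv + ub + av, all of
  whose terms lie in the power of order i + j + 1. That order is a separate variable
  \<open>m\<close> so that the lemma applies to i and n - i without arithmetic in the goal.\<close>

lemma rcoset_mult_radical_power:
  assumes "a \<in> J i" "b \<in> J j" "Suc (i + j) = m"
  shows "rcoset_mult A (J m) (J (Suc i) +> a) (J (Suc j) +> b) = J m +> a \<otimes> b"
proof -
  have "J m +> a' \<otimes> b' = J m +> a \<otimes> b"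
    if "a' \<in> J (Suc i) +> a" "b' \<in> J (Suc j) +> b" for a' b'
  proof -
    from that obtain u v
      where u: "u \<in> J (Suc i)" "a' = u \<oplus> a" and v: "v \<in> J (Suc j)" "b' = v \<oplus> b"
      by (auto simp: a_r_coset_def')
    have carr: "a \<in> carrier A" "b \<in> carrier A" "u \<in> carrier A" "v \<in> carrier A"
      using assms u v radical_power_closed by blast+
    have "u \<otimes> v \<in> J m"
      using radical_power_le[OF radical_power_mult[OF u(1) v(1)], of m] assms(3) by simp
    moreover have "u \<otimes> b \<in> J m" "a \<otimes> v \<in> J m"
      using radical_power_mult[OF u(1) assms(2)] radical_power_mult[OF assms(1) v(1)] assms(3)
      by simp_all
    ultimately have "u \<otimes> v \<oplus> u \<otimes> b \<oplus> a \<otimes> v \<in> J m"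
      by (intro radical_power_plus)
    moreover have "a' \<otimes> b' \<ominus> a \<otimes> b = u \<otimes> v \<oplus> u \<otimes> b \<oplus> a \<otimes> v"
      unfolding u(2) v(2) using carr by algebra
    ultimately show ?thesis
      using carr u v by (subst coset_eq_iff) simp_all
  qed
  moreover have "a \<in> J (Suc i) +> a" "b \<in> J (Suc j) +> b"
    using assms radical_power_zero by (force simp: a_r_coset_def')+
  ultimately show ?thesis
    unfolding rcoset_mult_def by blast
qed

lemma symbol_surj: "symbol ` carrier rees_algebra = carrier gr"
proof
  have "{n. symbol q n \<noteq> J (Suc n)} \<subseteq> {n. q n \<noteq> \<zero>}" for q
    by (auto simp: symbol_def coset_zero)
  then have "finite {n. symbol q n \<noteq> J (Suc n)}" if "finite {n. q n \<noteq> \<zero>}" for q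
    using that finite_subset by blast
  then show "symbol ` carrier rees_algebra \<subseteq> carrier gr"
    by (auto simp: gr_sel in_rees_iff symbol_def)
  show "carrier gr \<subseteq> symbol ` carrier rees_algebra"
  proof
    fix f assume "f \<in> carrier gr"
    then have f: "\<forall>n. \<exists>a. a \<in> J n \<and> f n = J (Suc n) +> a" "finite {n. f n \<noteq> J (Suc n)}"
      by (auto simp: gr_sel)
    obtain q where q: "\<And>n. q n \<in> J n" "\<And>n. f n = J (Suc n) +> q n"
      using f(1) by metis
    \<comment> \<open>Lifts of trivial classes are reset to zero, since an arbitrary choice of lifts
      could have infinite support.\<close>
    define r where "r = (\<lambda>n. if f n = J (Suc n) then \<zero> else q n)"
    have "{n. r n \<noteq> \<zero>} \<subseteq> {n. f n \<noteq> J (Suc n)}" by (auto simp: r_def)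
    then have "r \<in> carrier rees_algebra"
      using q f(2) by (auto simp: in_rees_iff r_def intro: finite_subset)
    moreover have "f n = symbol r n" for n
      using q(2)[of n] by (simp add: symbol_def r_def coset_zero)
    then have "f = symbol r" by (rule ext)
    ultimately show "f \<in> symbol ` carrier rees_algebra" by blast
  qed
qed

lemma symbol_mult:
  assumes "q \<in> carrier rees_algebra" "r \<in> carrier rees_algebra"
  shows "symbol (q \<otimes>\<^bsub>rees_algebra\<^esub> r) = symbol q \<otimes>\<^bsub>gr\<^esub> symbol r"
proof
  fix n
  let ?Q = "A Quot J (Suc n)"
  interpret I: ideal "J (Suc n)" A by (rule radical_power_ideal)
  interpret Q: ring ?Q by (rule I.quotient_is_ring)
  have qr: "q i \<in> J i" "r i \<in> J i" for i using assms by (auto simp: in_rees_iff)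
  have carr: "q i \<otimes> r j \<in> carrier A" for i j using qr radical_power_closed by blast
  have hom: "(+>) (J (Suc n)) \<in> ring_hom A ?Q" by (rule I.rcos_ring_hom)
  have "(\<Oplus>\<^bsub>?Q\<^esub>i\<in>T. J (Suc n) +> h i) = J (Suc n) +> (\<Oplus>i\<in>T. h i)"
    if "finite T" "\<And>i. h i \<in> carrier A" for T :: "nat set" and h
    using that(1)
  proof (induction T rule: finite_induct)
    case empty
    have "\<zero>\<^bsub>?Q\<^esub> = J (Suc n)" by (simp add: FactRing_def)
    then show ?case by (simp add: coset_zero)
  next
    case (insert t T)
    have c: "J (Suc n) +> h i \<in> carrier ?Q" for i
      using ring_hom_closed[OF hom] that(2) by simp
    have "(\<Oplus>\<^bsub>?Q\<^esub>i\<in>insert t T. J (Suc n) +> h i) =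
        (J (Suc n) +> h t) \<oplus>\<^bsub>?Q\<^esub> (\<Oplus>\<^bsub>?Q\<^esub>i\<in>T. J (Suc n) +> h i)"
      using insert.hyps c by (intro Q.finsum_insert) auto
    also have "\<dots> = J (Suc n) +> (h t \<oplus> (\<Oplus>i\<in>T. h i))"
      unfolding insert.IH using that(2) by (intro ring_hom_add[OF hom, symmetric] finsum_closed) auto
    also have "h t \<oplus> (\<Oplus>i\<in>T. h i) = (\<Oplus>i\<in>insert t T. h i)"
      using insert.hyps that(2) by (intro finsum_insert[symmetric]) auto
    finally show ?case .
  qed
  from this[of "{..n}" "\<lambda>i. q i \<otimes> r (n - i)"]
  have "symbol (q \<otimes>\<^bsub>rees_algebra\<^esub> r) n = (\<Oplus>\<^bsub>?Q\<^esub>i\<in>{..n}. J (Suc n) +> q i \<otimes> r (n - i))"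
    by (simp add: symbol_def carr)
  also have "\<dots> = (\<Oplus>\<^bsub>?Q\<^esub>i\<in>{..n}. rcoset_mult A (J (Suc n)) (symbol q i) (symbol r (n - i)))"
  proof (rule Q.finsum_cong')
    show "(\<lambda>i. rcoset_mult A (J (Suc n)) (symbol q i) (symbol r (n - i))) \<in> {..n} \<rightarrow> carrier ?Q"
    proof
      fix i assume "i \<in> {..n}"
      then show "rcoset_mult A (J (Suc n)) (symbol q i) (symbol r (n - i)) \<in> carrier ?Q"
        unfolding symbol_def
        using qr ring_hom_closed[OF hom, of "q i \<otimes> r (n - i)"] carr
        by (subst rcoset_mult_radical_power) simp_all
    qed
    fix i assume "i \<in> {..n}"
    then show "J (Suc n) +> q i \<otimes> r (n - i) =
        rcoset_mult A (J (Suc n)) (symbol q i) (symbol r (n - i))"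
      unfolding symbol_def using qr by (subst rcoset_mult_radical_power) simp_all
  qed simp
  finally show "symbol (q \<otimes>\<^bsub>rees_algebra\<^esub> r) n = (symbol q \<otimes>\<^bsub>gr\<^esub> symbol r) n"
    by (simp add: gr_sel)
qed

lemma symbol_hom: "algebra_hom rees_algebra gr symbol"
proof -
  have carr: "q n \<in> carrier A" if "q \<in> carrier rees_algebra" for q n
    using that by (auto simp: in_rees_iff)
  have "symbol \<in> ring_hom rees_algebra gr"
  proof (rule ring_hom_memI)
    fix q assume q: "q \<in> carrier rees_algebra"
    then show "symbol q \<in> carrier gr" using symbol_surj by blast
    fix r assume r: "r \<in> carrier rees_algebra"
    show "symbol (q \<otimes>\<^bsub>rees_algebra\<^esub> r) = symbol q \<otimes>\<^bsub>gr\<^esub> symbol r"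
      using q r by (rule symbol_mult)
    show "symbol (q \<oplus>\<^bsub>rees_algebra\<^esub> r) = symbol q \<oplus>\<^bsub>gr\<^esub> symbol r"
      using carr[OF q] carr[OF r] ideal.a_rcos_sum[OF radical_power_ideal]
      by (simp add: symbol_def gr_sel)
  next
    show "symbol \<one>\<^bsub>rees_algebra\<^esub> = \<one>\<^bsub>gr\<^esub>"
      by (rule ext) (simp add: symbol_def gr_sel coset_zero)
  qed
  then show ?thesis
    using carr rcos_smult[OF radical_power_ideal]
    by (simp add: algebra_hom_def symbol_def gr_sel)
qed

lemma gr_algebra: "assoc_algebra gr"
  by (rule assoc_algebra.algebra_hom_image[OF rees_algebra_algebra symbol_hom symbol_surj])
    (simp add: symbol_def gr_sel coset_zero)

lemma symbol_eq_iff: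
  assumes "q \<in> carrier rees_algebra" "r \<in> carrier rees_algebra"
  shows "symbol q = symbol r \<longleftrightarrow> (\<forall>n. q n \<ominus> r n \<in> J (Suc n))"
proof -
  have "q n \<in> carrier A" "r n \<in> carrier A" for n
    using assms by (auto simp: in_rees_iff)
  then show ?thesis
    by (simp add: symbol_def fun_eq_iff coset_eq_iff)
qed

end

lemma (in ring) diff_diff_cancel:
  "\<lbrakk>a \<in> carrier R; b \<in> carrier R\<rbrakk> \<Longrightarrow> a \<ominus> (a \<ominus> b) = b"
  by algebra

context radical_algebra
begin

text \<open>An idempotent of the graded algebra without degree 0 part is zero. In degree n it equals
  the sum of the q_i q_(n-i); for i < n the factor q_i has higher order by induction, and for i = n
  the factor q_0 lies in the radical.\<close>

lemma idempotent_symbol_eq_zero: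
  assumes q: "q \<in> carrier rees_algebra" "q 0 \<in> J 1" and idem: "symbol q \<otimes>\<^bsub>gr\<^esub> symbol q = symbol q"
  shows "symbol q = \<zero>\<^bsub>gr\<^esub>"
proof -
  interpret R: assoc_algebra rees_algebra by (rule rees_algebra_algebra)
  have carr: "q n \<in> J n" for n using q by (simp add: in_rees_iff)
  have qq: "q \<otimes>\<^bsub>rees_algebra\<^esub> q \<in> carrier rees_algebra" using q by (intro R.m_closed)
  have "symbol (q \<otimes>\<^bsub>rees_algebra\<^esub> q) = symbol q"
    using idem by (simp add: symbol_mult q del: rees_sel)
  then have eq: "(\<Oplus>i\<in>{..n}. q i \<otimes> q (n - i)) \<ominus> q n \<in> J (Suc n)" for n
    using symbol_eq_iff[OF qq q(1)] by simp
  have "q n \<in> J (Suc n)" for n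
  proof (induction n rule: less_induct)
    case (less n)
    have S: "(\<Oplus>i\<in>{..n}. q i \<otimes> q (n - i)) \<in> J (Suc n)"
    proof (rule radical_power_finsum)
      fix i assume "i \<in> {..n}"
      then consider "i < n" | "i = n" by fastforce
      then show "q i \<otimes> q (n - i) \<in> J (Suc n)"
      proof cases
        case 1
        then show ?thesis using radical_power_mult[OF less.IH[OF 1] carr[of "n - i"]] by simp
      next
        case 2
        then show ?thesis using radical_power_mult[OF carr[of n] q(2)] by simp
      qed
    qed simp
    have "(\<Oplus>i\<in>{..n}. q i \<otimes> q (n - i)) \<ominus> ((\<Oplus>i\<in>{..n}. q i \<otimes> q (n - i)) \<ominus> q n) \<in> J (Suc n)"
      by (rule radical_power_minus[OF S eq])
    moreover have "(\<Oplus>i\<in>{..n}. q i \<otimes> q (n - i)) \<in> carrier A" "q n \<in> carrier A"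
      using carr radical_power_closed by (blast intro: finsum_closed m_closed)+
    then have "(\<Oplus>i\<in>{..n}. q i \<otimes> q (n - i)) \<ominus> ((\<Oplus>i\<in>{..n}. q i \<otimes> q (n - i)) \<ominus> q n) = q n"
      by (rule diff_diff_cancel)
    ultimately show ?case by simp
  qed
  then have "symbol q = symbol \<zero>\<^bsub>rees_algebra\<^esub>"
    using q R.zero_closed
    by (subst symbol_eq_iff) (simp_all add: minus_eq radical_power_closed[OF carr])
  then show ?thesis
    using algebra_hom_zero[OF rees_algebra_algebra gr_algebra symbol_hom] by simp
qed

section \<open>Homogeneous elements and primitive idempotents of the graded algebra\<close>

definition homog :: "nat \<Rightarrow> 'a \<Rightarrow> nat \<Rightarrow> 'a set" where
  "homog n a = symbol (\<lambda>m. if m = n then a else \<zero>)"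

lemma homog_rees: "a \<in> J n \<Longrightarrow> (\<lambda>m. if m = n then a else \<zero>) \<in> carrier rees_algebra"
  by (auto simp: in_rees_iff)

lemma homog_closed: "a \<in> J n \<Longrightarrow> homog n a \<in> carrier gr"
  unfolding homog_def using algebra_homD(1)[OF symbol_hom homog_rees] by blast

lemma homog_eq_iff:
  assumes "a \<in> J n" "b \<in> J n"
  shows "homog n a = homog n b \<longleftrightarrow> a \<ominus> b \<in> J (Suc n)"
  unfolding homog_def
  by (subst symbol_eq_iff) (auto simp: homog_rees assms minus_eq)

lemma homog_zero: "homog n \<zero> = \<zero>\<^bsub>gr\<^esub>"
  using algebra_hom_zero[OF rees_algebra_algebra gr_algebra symbol_hom]
  by (simp add: homog_def if_distrib cong: if_cong)

lemma homog_eq_zero_iff: "a \<in> J n \<Longrightarrow> homog n a = \<zero>\<^bsub>gr\<^esub> \<longleftrightarrow> a \<in> J (Suc n)"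
  using homog_eq_iff[of a n \<zero>] by (simp add: homog_zero minus_eq)

lemma homog_one: "homog 0 \<one> = \<one>\<^bsub>gr\<^esub>"
  using algebra_homD(4)[OF symbol_hom] by (simp add: homog_def)

lemma homog_add:
  assumes "a \<in> J n" "b \<in> J n"
  shows "homog n (a \<oplus> b) = homog n a \<oplus>\<^bsub>gr\<^esub> homog n b"
  unfolding homog_def algebra_homD(3)[OF symbol_hom homog_rees[OF assms(1)] homog_rees[OF assms(2)], symmetric]
  by (rule arg_cong[of _ _ symbol]) auto

lemma homog_smult: "a \<in> J n \<Longrightarrow> homog n (r \<odot> a) = r \<odot>\<^bsub>gr\<^esub> homog n a"
  unfolding homog_def
  by (subst algebra_homD(5)[OF symbol_hom homog_rees, symmetric])
    (auto intro!: arg_cong[of _ _ symbol])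

lemma homog_mult:
  assumes "a \<in> J m" "b \<in> J n"
  shows "homog m a \<otimes>\<^bsub>gr\<^esub> homog n b = homog (m + n) (a \<otimes> b)"
proof -
  have carr: "a \<in> carrier A" "b \<in> carrier A" using assms radical_power_closed by blast+
  have "(\<Oplus>i\<in>{..k}. (if i = m then a else \<zero>) \<otimes> (if k - i = n then b else \<zero>)) =
      (if k = m + n then a \<otimes> b else \<zero>)" for k
  proof (cases "m \<le> k")
    case True
    have "(\<Oplus>i\<in>{..k}. (if i = m then a else \<zero>) \<otimes> (if k - i = n then b else \<zero>)) =
        (\<Oplus>i\<in>{..k}. if m = i then a \<otimes> (if k - i = n then b else \<zero>) else \<zero>)"
      by (rule finsum_cong') (use carr in auto)
    also have "\<dots> = a \<otimes> (if k - m = n then b else \<zero>)"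
      by (rule finsum_singleton) (use carr True in auto)
    finally show ?thesis using True carr by auto
  next
    case False
    have "(\<Oplus>i\<in>{..k}. (if i = m then a else \<zero>) \<otimes> (if k - i = n then b else \<zero>)) =
        (\<Oplus>i\<in>{..k}. \<zero>)"
      by (rule finsum_cong') (use carr False in auto)
    then show ?thesis using False by simp
  qed
  then show ?thesis
    unfolding homog_def
      algebra_homD(2)[OF symbol_hom homog_rees[OF assms(1)] homog_rees[OF assms(2)], symmetric]
    by (simp add: fun_eq_iff)
qed

lemma homog_minus:
  assumes "a \<in> J n" "b \<in> J n"
  shows "homog n (a \<ominus> b) = homog n a \<ominus>\<^bsub>gr\<^esub> homog n b"
proof -
  interpret gr: assoc_algebra gr by (rule gr_algebra)
  have "homog n (\<ominus> b) = \<ominus>\<^bsub>gr\<^esub> homog n b"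
    using homog_smult[OF assms(2), of "- 1"] assms
    by (simp add: smult_minus_one gr.smult_minus_one homog_closed)
  then show ?thesis
    using assms by (simp add: minus_eq gr.minus_eq homog_add radical_power_uminus)
qed

lemma homog_idempotent:
  assumes "idempotent A \<epsilon>"
  shows "idempotent gr (homog 0 \<epsilon>)"
  using assms by (simp add: idempotent_def homog_mult homog_closed)

text \<open>The hypothesis \<open>local\<close> says that the corner of \<epsilon> is k\<epsilon>
  modulo the radical. If the class of \<epsilon> is a sum of orthogonal idempotents f and g, then
  the degree 0 part of f is r\<epsilon> with r^2 = r. For r = 0 the summand f vanishes, for r = 1
  the summand g does.\<close>

lemma homog_primitive:
  assumes idem: "idempotent A \<epsilon>" and notin: "\<epsilon> \<notin> jacobson_radical A"
    and local: "\<And>a. a \<in> carrier A \<Longrightarrow> \<exists>r. \<epsilon> \<otimes> a \<otimes> \<epsilon> \<ominus> r \<odot> \<epsilon> \<in> jacobson_radical A"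
  shows "primitive_idempotent gr (homog 0 \<epsilon>)"
proof -
  interpret gr: assoc_algebra gr by (rule gr_algebra)
  interpret R: assoc_algebra rees_algebra by (rule rees_algebra_algebra)
  have \<epsilon>: "\<epsilon> \<in> carrier A" "\<epsilon> \<otimes> \<epsilon> = \<epsilon>" using idem by (auto simp: idempotent_def)
  let ?e = "homog 0 \<epsilon>"
  have e: "?e \<in> carrier gr" "?e \<noteq> \<zero>\<^bsub>gr\<^esub>"
    using \<epsilon> notin by (simp_all add: homog_closed homog_eq_zero_iff radical_power_one flip: One_nat_def)
  have "f = \<zero>\<^bsub>gr\<^esub> \<or> g = \<zero>\<^bsub>gr\<^esub>"
    if f: "idempotent gr f" and g: "idempotent gr g" and orth: "orthogonal gr f g"
      and sum: "?e = f \<oplus>\<^bsub>gr\<^esub> g" for f g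
  proof -
    have f': "f \<in> carrier gr" "f \<otimes>\<^bsub>gr\<^esub> f = f" and g': "g \<in> carrier gr" "g \<otimes>\<^bsub>gr\<^esub> g = g"
      and fg: "f \<otimes>\<^bsub>gr\<^esub> g = \<zero>\<^bsub>gr\<^esub>" "g \<otimes>\<^bsub>gr\<^esub> f = \<zero>\<^bsub>gr\<^esub>"
      using f g orth by (auto simp: idempotent_def orthogonal_def)
    have ef: "?e \<otimes>\<^bsub>gr\<^esub> f = f" "f \<otimes>\<^bsub>gr\<^esub> ?e = f"
      unfolding sum using f' g' fg by (simp_all add: gr.l_distr gr.r_distr)
    obtain q where q: "q \<in> carrier rees_algebra" "f = symbol q"
      using f'(1) symbol_surj by blast
    have q0: "q 0 \<in> carrier A" using q by (auto simp: in_rees_iff)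
    have "symbol (\<lambda>m. if m = 0 then \<epsilon> else \<zero>) \<otimes>\<^bsub>gr\<^esub> symbol q \<otimes>\<^bsub>gr\<^esub>
        symbol (\<lambda>m. if m = 0 then \<epsilon> else \<zero>) = symbol q"
      using ef q(2) by (simp add: homog_def)
    moreover have er: "(\<lambda>m. if m = 0 then \<epsilon> else \<zero>) \<in> carrier rees_algebra"
      using homog_rees[of \<epsilon> 0] \<epsilon> by simp
    ultimately have "symbol ((\<lambda>m. if m = 0 then \<epsilon> else \<zero>) \<otimes>\<^bsub>rees_algebra\<^esub> q \<otimes>\<^bsub>rees_algebra\<^esub>
        (\<lambda>m. if m = 0 then \<epsilon> else \<zero>)) = symbol q"
      using q R.m_closed[OF er q(1)] by (simp add: symbol_mult del: rees_sel)
    then have "((\<lambda>m. if m = 0 then \<epsilon> else \<zero>) \<otimes>\<^bsub>rees_algebra\<^esub> q \<otimes>\<^bsub>rees_algebra\<^esub>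
        (\<lambda>m. if m = 0 then \<epsilon> else \<zero>)) 0 \<ominus> q 0 \<in> J 1"
      using q er symbol_eq_iff[OF R.m_closed[OF R.m_closed[OF er q(1)] er] q(1)]
      by (simp del: rees_sel)
    then have eqe: "\<epsilon> \<otimes> q 0 \<otimes> \<epsilon> \<ominus> q 0 \<in> J 1"
      using \<epsilon> q0 by simp
    obtain r where r: "\<epsilon> \<otimes> q 0 \<otimes> \<epsilon> \<ominus> r \<odot> \<epsilon> \<in> J 1"
      using local[OF q0] unfolding radical_power_one by blast
    have "(\<epsilon> \<otimes> q 0 \<otimes> \<epsilon> \<ominus> r \<odot> \<epsilon>) \<ominus> (\<epsilon> \<otimes> q 0 \<otimes> \<epsilon> \<ominus> q 0) \<in> J 1"
      by (rule radical_power_minus[OF r eqe])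
    moreover have "(\<epsilon> \<otimes> q 0 \<otimes> \<epsilon> \<ominus> r \<odot> \<epsilon>) \<ominus> (\<epsilon> \<otimes> q 0 \<otimes> \<epsilon> \<ominus> q 0) = q 0 \<ominus> r \<odot> \<epsilon>"
      using \<epsilon>(1) q0 smult_closed[OF \<epsilon>(1), of r] by algebra
    ultimately have qr: "q 0 \<ominus> r \<odot> \<epsilon> \<in> J 1" by simp
    have "symbol (q \<otimes>\<^bsub>rees_algebra\<^esub> q) = symbol q"
      using f'(2) q by (simp add: symbol_mult del: rees_sel)
    then have "(q \<otimes>\<^bsub>rees_algebra\<^esub> q) 0 \<ominus> q 0 \<in> J 1"
      using symbol_eq_iff[OF R.m_closed[OF q(1) q(1)] q(1)] by (simp del: rees_sel)
    then have qq: "q 0 \<otimes> q 0 \<ominus> q 0 \<in> J 1"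
      using q0 by simp
    define d where "d = q 0 \<ominus> r \<odot> \<epsilon>"
    have d: "d \<in> J 1" "d \<in> carrier A" using qr radical_power_closed by (auto simp: d_def)
    have q0d: "q 0 = d \<oplus> r \<odot> \<epsilon>"
      using q0 \<epsilon>(1) by (simp add: d_def minus_eq a_assoc l_neg)
    \<comment> \<open>With q_0 = d + r\<epsilon>, removing from q_0^2 - q_0 every term that contains
      the radical element d leaves (r\<epsilon>)^2 - r\<epsilon>.\<close>
    have "(q 0 \<otimes> q 0 \<ominus> q 0) \<ominus> (d \<otimes> q 0 \<oplus> (r \<odot> \<epsilon>) \<otimes> d \<ominus> d) \<in> J 1"
      by (rule radical_power_minus[OF qq radical_power_minus[OF radical_power_plus[OF
            radical_power_rmult[OF d(1) q0] radical_power_lmult[OF d(1) smult_closed[OF \<epsilon>(1)]]] d(1)]])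
    moreover have "(q 0 \<otimes> q 0 \<ominus> q 0) \<ominus> (d \<otimes> q 0 \<oplus> (r \<odot> \<epsilon>) \<otimes> d \<ominus> d) =
        (r \<odot> \<epsilon>) \<otimes> (r \<odot> \<epsilon>) \<ominus> r \<odot> \<epsilon>"
      unfolding q0d using d(2) smult_closed[OF \<epsilon>(1), of r] by algebra
    moreover have "(r \<odot> \<epsilon>) \<otimes> (r \<odot> \<epsilon>) \<ominus> r \<odot> \<epsilon> = (r * r - r) \<odot> \<epsilon>"
      using \<epsilon> by (simp add: smult_mult_l smult_mult_r smult_smult smult_l_diff)
    ultimately have *: "(r * r - r) \<odot> \<epsilon> \<in> J 1" by simp
    have "r * r - r = 0"
    proof (rule ccontr)
      assume "r * r - r \<noteq> 0"
      then have "\<epsilon> = inverse (r * r - r) \<odot> ((r * r - r) \<odot> \<epsilon>)"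
        using \<epsilon>(1) by (simp add: smult_smult)
      with radical_power_smult[OF *] notin show False by (metis radical_power_one)
    qed
    then have "r = 0 \<or> r = 1" by (simp add: mult_cancel_left1)
    then show ?thesis
    proof
      assume "r = 0"
      then have "q 0 \<in> J 1" using qr q0 \<epsilon>(1) by (simp add: minus_eq)
      then show ?thesis using idempotent_symbol_eq_zero[OF q(1)] f'(2) q(2) by auto
    next
      \<comment> \<open>The degree 0 part of g is \<epsilon> - q_0 modulo the radical, hence
        trivial, and g is killed in the same way as f was for r = 0.\<close>
      assume r1: "r = 1"
      obtain q' where q': "q' \<in> carrier rees_algebra" "g = symbol q'"
        using g'(1) symbol_surj by blast
      have q'0: "q' 0 \<in> carrier A" using q' by (auto simp: in_rees_iff)
      have "symbol (\<lambda>m. if m = 0 then \<epsilon> else \<zero>) = symbol (q \<oplus>\<^bsub>rees_algebra\<^esub> q')"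
        using sum q q' algebra_homD(3)[OF symbol_hom q(1) q'(1)] by (simp add: homog_def)
      then have "\<forall>n. (if n = 0 then \<epsilon> else \<zero>) \<ominus> (q n \<oplus> q' n) \<in> J (Suc n)"
        using symbol_eq_iff[OF er R.a_closed[OF q(1) q'(1)]] by simp
      from spec[OF this, of 0] have "\<epsilon> \<ominus> (q 0 \<oplus> q' 0) \<in> J 1"
        by simp
      then have "\<ominus> (\<epsilon> \<ominus> (q 0 \<oplus> q' 0) \<oplus> (q 0 \<ominus> \<epsilon>)) \<in> J 1"
        using qr \<epsilon>(1) r1 by (intro radical_power_uminus[OF radical_power_plus]) auto
      moreover have "\<ominus> (\<epsilon> \<ominus> (q 0 \<oplus> q' 0) \<oplus> (q 0 \<ominus> \<epsilon>)) = q' 0"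
        using q0 q'0 \<epsilon>(1) by algebra
      ultimately have "q' 0 \<in> J 1" by simp
      then show ?thesis using idempotent_symbol_eq_zero[OF q'(1)] g'(2) q'(2) by auto
    qed
  qed
  then show ?thesis
    using e homog_idempotent[OF idem] by (auto simp: primitive_idempotent_def)
qed

end

text \<open>Left multiplication by the unit \<open>u\<close> commutes with the right action and
  carries aR onto bR when b is the conjugate of a by u.\<close>

lemma (in ring) isomorphic_projectives_conj:
  assumes c: "u \<in> carrier R" "v \<in> carrier R" "a \<in> carrier R" "b \<in> carrier R"
    and uv: "u \<otimes> v = \<one>" "v \<otimes> u = \<one>" and ua: "u \<otimes> a = b \<otimes> u"
  shows "isomorphic_projectives R a b"
  unfolding isomorphic_projectives_def
proof (intro exI[of _ "\<lambda>x. u \<otimes> x"] conjI)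
  have vb: "v \<otimes> b = a \<otimes> v"
  proof -
    have "v \<otimes> b = v \<otimes> (b \<otimes> u) \<otimes> v" using c uv by (simp add: m_assoc)
    also have "\<dots> = (v \<otimes> u) \<otimes> a \<otimes> v" using c by (simp add: ua[symmetric] m_assoc)
    finally show ?thesis using c uv by simp
  qed
  have uv': "u \<otimes> (v \<otimes> x) = x" "v \<otimes> (u \<otimes> x) = x" if "x \<in> carrier R" for x
    using c uv that by (simp_all flip: m_assoc)
  have mem: "x \<in> carrier R" if "x \<in> right_ideal_gen R d" "d \<in> carrier R" for x d
    using that by (auto simp: right_ideal_gen_def)
  show "bij_betw ((\<otimes>) u) (right_ideal_gen R a) (right_ideal_gen R b)"
  proof (rule bij_betw_byWitness[where f' = "\<lambda>x. v \<otimes> x"])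
    show "\<forall>x\<in>right_ideal_gen R a. v \<otimes> (u \<otimes> x) = x" "\<forall>x\<in>right_ideal_gen R b. u \<otimes> (v \<otimes> x) = x"
      using mem c uv' by blast+
    have "u \<otimes> (a \<otimes> x) = b \<otimes> (u \<otimes> x)" "v \<otimes> (b \<otimes> x) = a \<otimes> (v \<otimes> x)" if "x \<in> carrier R" for x
      using that c ua vb by (simp_all flip: m_assoc)
    then show "(\<otimes>) u ` right_ideal_gen R a \<subseteq> right_ideal_gen R b"
      "(\<otimes>) v ` right_ideal_gen R b \<subseteq> right_ideal_gen R a"
      using c by (auto simp: right_ideal_gen_def)
  qed
  show "\<forall>x\<in>right_ideal_gen R a. \<forall>y\<in>right_ideal_gen R a. u \<otimes> (x \<oplus> y) = u \<otimes> x \<oplus> u \<otimes> y"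
    "\<forall>x\<in>right_ideal_gen R a. \<forall>c\<in>carrier R. u \<otimes> (x \<otimes> c) = u \<otimes> x \<otimes> c"
    using mem c by (auto simp: r_distr m_assoc)
qed

section \<open>Recognising the Jacobson radical\<close>

text \<open>The geometric series: the partial sum b of the first m powers satisfies b(1 - a) = 1 -
  a^m.\<close>

lemma (in ring) left_inverse_of_nilpotent:
  assumes "a \<in> carrier R" "a [^] (n::nat) = \<zero>"
  shows "\<exists>b\<in>carrier R. b \<otimes> (\<one> \<ominus> a) = \<one>"
proof -
  have "\<exists>b\<in>carrier R. b \<otimes> (\<one> \<ominus> a) = \<one> \<ominus> a [^] m" for m :: nat
  proof (induction m)
    case 0
    show ?case by (rule bexI[of _ \<zero>]) (simp_all add: assms minus_eq r_neg)
  next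
    case (Suc m)
    then obtain b where b: "b \<in> carrier R" "b \<otimes> (\<one> \<ominus> a) = \<one> \<ominus> a [^] m" by blast
    have "(b \<oplus> a [^] m) \<otimes> (\<one> \<ominus> a) = b \<otimes> (\<one> \<ominus> a) \<oplus> (a [^] m \<ominus> a [^] m \<otimes> a)"
      using b(1) assms(1) by (simp add: l_distr r_distr r_minus minus_eq minus_add a_ac)
    also have "\<dots> = \<one> \<ominus> a [^] Suc m"
      unfolding b(2) nat_pow_Suc using assms(1) nat_pow_closed[OF assms(1), of m] by algebra
    finally show ?case using b assms by (intro bexI[of _ "b \<oplus> a [^] m"]) simp_all
  qed
  from this[of n] assms show ?thesis by (simp add: minus_eq)
qed

text \<open>The family \<open>LL\<close> bounds the radical from above. From below, a nil ideal N
  lies in every maximal left ideal L: otherwise L + N is everything, 1 = l + m, and l = 1 - m is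
  left invertible, so L would contain 1.\<close>

lemma (in ring) jacobson_radical_eqI:
  assumes N: "ideal N R" and nil: "\<And>a. a \<in> N \<Longrightarrow> \<exists>n::nat. a [^] n = \<zero>"
    and LL: "LL \<noteq> {}" "\<And>L. L \<in> LL \<Longrightarrow> maximal_left_ideal L R" "\<Inter>LL \<subseteq> N"
  shows "jacobson_radical R = N"
proof
  show "jacobson_radical R \<subseteq> N"
    using LL unfolding jacobson_radical_def by blast
  interpret N: ideal N R by (rule N)
  have "N \<subseteq> L" if L: "maximal_left_ideal L R" for L
  proof (rule ccontr)
    assume "\<not> N \<subseteq> L"
    have Ll: "left_ideal L R" "L \<noteq> carrier R"
      and Lmax: "\<And>L'. left_ideal L' R \<Longrightarrow> L \<subseteq> L' \<Longrightarrow> L' = L \<or> L' = carrier R"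
      using L by (auto simp: maximal_left_ideal_def)
    interpret L: additive_subgroup L R using Ll by (simp add: left_ideal_def)
    have mem: "l \<oplus> m \<in> L <+>\<^bsub>R\<^esub> N" if "l \<in> L" "m \<in> N" for l m
      using that by (auto simp: set_add_def')
    have LN: "additive_subgroup (L <+>\<^bsub>R\<^esub> N) R"
      using add_additive_subgroups[OF L.additive_subgroup_axioms N.additive_subgroup_axioms] .
    have "left_ideal (L <+>\<^bsub>R\<^esub> N) R"
      unfolding left_ideal_def
    proof (intro conjI LN ballI)
      fix a x assume a: "a \<in> carrier R" and "x \<in> L <+>\<^bsub>R\<^esub> N"
      then obtain l m where lm: "l \<in> L" "m \<in> N" "x = l \<oplus> m"
        by (auto simp: set_add_def')
      then have "a \<otimes> x = a \<otimes> l \<oplus> a \<otimes> m"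
        using a L.a_subset N.a_subset by (auto simp: r_distr)
      moreover have "a \<otimes> l \<in> L" "a \<otimes> m \<in> N"
        using Ll a lm N.I_l_closed by (auto simp: left_ideal_def)
      ultimately show "a \<otimes> x \<in> L <+>\<^bsub>R\<^esub> N" using mem by simp
    qed
    moreover have "l \<in> L <+>\<^bsub>R\<^esub> N" if "l \<in> L" for l
      using mem[OF that N.zero_closed] that L.a_subset by auto
    then have "L \<subseteq> L <+>\<^bsub>R\<^esub> N" by blast
    moreover have "m \<in> L <+>\<^bsub>R\<^esub> N" if "m \<in> N" for m
      using mem[OF L.zero_closed that] that N.a_subset by auto
    then have "L <+>\<^bsub>R\<^esub> N \<noteq> L" using \<open>\<not> N \<subseteq> L\<close> by blast
    ultimately have "L <+>\<^bsub>R\<^esub> N = carrier R" using Lmax by blast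
    then have "\<one> \<in> L <+>\<^bsub>R\<^esub> N" by simp
    then obtain l m where lm: "l \<in> L" "m \<in> N" "\<one> = l \<oplus> m"
      by (auto simp: set_add_def')
    have "l \<in> carrier R" "m \<in> carrier R" using lm L.a_subset N.a_subset by auto
    then have "l = (l \<oplus> m) \<ominus> m" by algebra
    then have "l = \<one> \<ominus> m" by (simp only: lm(3))
    moreover obtain b where b: "b \<in> carrier R" "b \<otimes> (\<one> \<ominus> m) = \<one>"
      using nil[OF lm(2)] left_inverse_of_nilpotent[OF \<open>m \<in> carrier R\<close>] by blast
    ultimately have "\<one> \<in> L" using Ll lm(1) by (metis left_ideal_def)
    then have "a \<in> L" if "a \<in> carrier R" for a
      using Ll that by (metis left_ideal_def r_one)
    then show False using Ll(2) L.a_subset by blast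
  qed
  then show "N \<subseteq> jacobson_radical R"
    using N.a_subset by (auto simp: jacobson_radical_def)
qed

text \<open>The set is the annihilator of the class of \<epsilon> in R\<epsilon> modulo N. The
  hypothesis \<open>simple\<close> says that each nonzero element of this module generates the class
  of \<epsilon>, so the module is simple and the annihilator of a generator is maximal.\<close>

lemma (in ring) maximal_left_ideal_annihilator:
  assumes N: "ideal N R" and \<epsilon>: "\<epsilon> \<in> carrier R" "\<epsilon> \<otimes> \<epsilon> = \<epsilon>" "\<epsilon> \<notin> N"
    and simple: "\<And>b. \<lbrakk>b \<in> carrier R; b \<otimes> \<epsilon> \<notin> N\<rbrakk> \<Longrightarrow> \<exists>a\<in>carrier R. a \<otimes> (b \<otimes> \<epsilon>) \<ominus> \<epsilon> \<in> N"
  shows "maximal_left_ideal {a \<in> carrier R. a \<otimes> \<epsilon> \<in> N} R"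
proof -
  interpret N: ideal N R by (rule N)
  let ?L = "{a \<in> carrier R. a \<otimes> \<epsilon> \<in> N}"
  have "additive_subgroup ?L R"
  proof (rule additive_subgroup.intro, rule add.subgroupI)
    show "?L \<noteq> {}" using \<epsilon>(1) by (auto intro!: exI[of _ \<zero>])
  qed (use \<epsilon>(1) in \<open>auto simp: l_distr l_minus simp flip: a_inv_def\<close>)
  then have "left_ideal ?L R"
    using \<epsilon>(1) N.I_l_closed by (auto simp: left_ideal_def m_assoc)
  moreover have "\<one> \<notin> ?L" using \<epsilon> by simp
  then have "?L \<noteq> carrier R" by blast
  moreover have "L' = ?L \<or> L' = carrier R" if L': "left_ideal L' R" "?L \<subseteq> L'" for L'
  proof (rule ccontr)
    assume contra: "\<not> (L' = ?L \<or> L' = carrier R)"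
    interpret L': additive_subgroup L' R using L' by (simp add: left_ideal_def)
    obtain b where b: "b \<in> L'" "b \<notin> ?L" using contra L' by blast
    have bc: "b \<in> carrier R" using b(1) L'.a_subset by blast
    \<comment> \<open>Since c - c\<epsilon> is annihilated by \<epsilon> on the right, a larger left
      ideal is determined by its elements of the form c\<epsilon>; it is everything once it contains
      \<epsilon>.\<close>
    have kill: "c \<ominus> c \<otimes> \<epsilon> \<in> L'" if c: "c \<in> carrier R" for c
    proof -
      have "(c \<ominus> c \<otimes> \<epsilon>) \<otimes> \<epsilon> = c \<otimes> \<epsilon> \<ominus> c \<otimes> (\<epsilon> \<otimes> \<epsilon>)"
        using c \<epsilon>(1) by algebra
      then have "(c \<ominus> c \<otimes> \<epsilon>) \<otimes> \<epsilon> = \<zero>" using c \<epsilon> by (simp add: minus_eq r_neg)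
      then show ?thesis using L'(2) c \<epsilon>(1) by auto
    qed
    have NL: "N \<subseteq> L'" using L'(2) \<epsilon>(1) N.I_r_closed N.a_subset by auto
    have "b \<ominus> (b \<ominus> b \<otimes> \<epsilon>) \<in> L'"
      using b kill[OF bc] by (simp add: minus_eq)
    moreover have "b \<ominus> (b \<ominus> b \<otimes> \<epsilon>) = b \<otimes> \<epsilon>" using bc \<epsilon>(1) by algebra
    ultimately have b\<epsilon>: "b \<otimes> \<epsilon> \<in> L'" by simp
    obtain a where a: "a \<in> carrier R" "a \<otimes> (b \<otimes> \<epsilon>) \<ominus> \<epsilon> \<in> N"
      using simple[OF bc] b(2) bc by blast
    have "a \<otimes> (b \<otimes> \<epsilon>) \<in> L'" using a(1) b\<epsilon> L'(1) by (simp add: left_ideal_def)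
    then have "a \<otimes> (b \<otimes> \<epsilon>) \<ominus> (a \<otimes> (b \<otimes> \<epsilon>) \<ominus> \<epsilon>) \<in> L'"
      using a(2) NL by (auto simp: minus_eq)
    moreover have "a \<otimes> (b \<otimes> \<epsilon>) \<ominus> (a \<otimes> (b \<otimes> \<epsilon>) \<ominus> \<epsilon>) = \<epsilon>"
      using a(1) bc \<epsilon>(1) by algebra
    ultimately have "\<epsilon> \<in> L'" by simp
    have "c \<in> L'" if c: "c \<in> carrier R" for c
    proof -
      have "c \<otimes> \<epsilon> \<oplus> (c \<ominus> c \<otimes> \<epsilon>) \<in> L'"
        using \<open>\<epsilon> \<in> L'\<close> kill[OF c] L'(1) c by (auto simp: left_ideal_def)
      moreover have "c \<otimes> \<epsilon> \<oplus> (c \<ominus> c \<otimes> \<epsilon>) = c" using c \<epsilon>(1) by algebra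
      ultimately show ?thesis by simp
    qed
    then show False using contra L'.a_subset by blast
  qed
  ultimately show ?thesis by (auto simp: maximal_left_ideal_def)
qed

section \<open>Algebras whose radical is generated by a skew triple\<close>

lemma (in ring) plus_diff_cancel:
  "\<lbrakk>a \<in> carrier R; b \<in> carrier R\<rbrakk> \<Longrightarrow> b \<oplus> (a \<ominus> b) = a"
  by algebra

lemma (in assoc_algebra) skew_commute_pow:
  fixes m n :: nat
  assumes "u \<in> carrier A" "v \<in> carrier A" "u \<otimes> v = \<sigma> \<odot> (v \<otimes> u)"
  shows "u [^] m \<otimes> v [^] n = \<sigma> ^ (m * n) \<odot> (v [^] n \<otimes> u [^] m)"
proof -
  have 1: "u \<otimes> v [^] n = \<sigma> ^ n \<odot> (v [^] n \<otimes> u)" for n :: nat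
  proof (induction n)
    case (Suc n)
    have "u \<otimes> v [^] Suc n = (u \<otimes> v [^] n) \<otimes> v" using assms by (simp add: m_assoc)
    also have "\<dots> = \<sigma> ^ n \<odot> (v [^] n \<otimes> (u \<otimes> v))"
      using assms(1,2) by (simp add: Suc.IH smult_mult_l m_assoc)
    finally show ?case
      using assms by (simp add: smult_mult_r smult_smult m_assoc mult.commute)
  qed (use assms in simp)
  show ?thesis
  proof (induction m)
    case (Suc m)
    have "u [^] Suc m \<otimes> v [^] n = u [^] m \<otimes> (u \<otimes> v [^] n)" using assms by (simp add: m_assoc)
    also have "\<dots> = \<sigma> ^ n \<odot> ((u [^] m \<otimes> v [^] n) \<otimes> u)"
      using assms(1,2) by (simp add: 1 smult_mult_r m_assoc)
    finally show ?case
      using assms(1,2) by (simp add: Suc.IH smult_mult_l smult_smult m_assoc power_add mult.commute)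
  qed (use assms in simp)
qed

fun weight :: "nat \<times> nat \<times> nat \<Rightarrow> nat" where
  "weight (i, j, k) = i + j + 2 * k"

text \<open>The conditions \<open>ax\<close>, \<open>ay\<close>, \<open>az\<close> move any
  coefficient from the left of a generator to its right with an error in zA only, so the right ideal
  xA + yA + zA is two-sided. Condition \<open>yx\<close> asks for commutation only modulo zA,
  because in kP the commutator of x and y is a multiple of z but z itself only to lowest
  order.\<close>

locale triple_radical = assoc_algebra A for A :: "('k::field, 'a) module" (structure) +
  fixes x y z :: 'a and \<sigma> :: 'k and p :: nat
  assumes xyz [simp]: "x \<in> carrier A" "y \<in> carrier A" "z \<in> carrier A"
    and sigma: "\<sigma> * \<sigma> = 1"
    and ax: "a \<in> carrier A \<Longrightarrow> \<exists>b\<in>carrier A. \<exists>c\<in>carrier A. a \<otimes> x = x \<otimes> b \<oplus> z \<otimes> c"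
    and ay: "a \<in> carrier A \<Longrightarrow> \<exists>b\<in>carrier A. \<exists>c\<in>carrier A. a \<otimes> y = y \<otimes> b \<oplus> z \<otimes> c"
    and az: "a \<in> carrier A \<Longrightarrow> \<exists>b\<in>carrier A. a \<otimes> z = z \<otimes> b"
    and yx: "\<exists>c\<in>carrier A. y \<otimes> x = \<sigma> \<odot> (x \<otimes> y) \<oplus> z \<otimes> c"
    and zx: "z \<otimes> x = \<sigma> \<odot> (x \<otimes> z)"
    and zy: "z \<otimes> y = \<sigma> \<odot> (y \<otimes> z)"
    and xp: "x [^] p = \<zero>" and yp: "y [^] p = \<zero>" and zp: "z [^] p = \<zero>"
begin

abbreviation "xmon \<equiv> mono3 A x y z"

lemma mon_closed [simp]: "xmon t \<in> carrier A"
  by (simp add: mono3_def split: prod.split)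

lemma mon_eq_zero:
  assumes "t \<notin> exps p"
  shows "xmon t = \<zero>"
proof -
  have pow: "a [^] n = \<zero>" if "a [^] p = \<zero>" "p \<le> n" "a \<in> carrier A" for a and n :: nat
  proof -
    have "a [^] (p + (n - p)) = a [^] p \<otimes> a [^] (n - p)"
      by (rule nat_pow_mult[symmetric]) fact
    then show ?thesis using that by simp
  qed
  obtain i j k where t: "t = (i, j, k)" by (cases t)
  then consider "p \<le> i" | "p \<le> j" | "p \<le> k" using assms by (fastforce simp: exps_def)
  then show ?thesis
    by cases (simp_all add: t mono3_def pow[OF xp] pow[OF yp] pow[OF zp])
qed

text \<open>A companion of \<open>filtration\<close> without x. Moving a coefficient past y and z
  never creates an x, so the correction terms produced by reordering y and x can be expanded here
  and put behind x^i y^j z without any further reordering of x.\<close>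

inductive_set yz_filtration :: "nat \<Rightarrow> 'a set" for n where
  base: "\<lbrakk>n \<le> j + 2 * k; a \<in> carrier A\<rbrakk> \<Longrightarrow> y [^] j \<otimes> (z [^] k \<otimes> a) \<in> yz_filtration n"
| add: "\<lbrakk>u \<in> yz_filtration n; v \<in> yz_filtration n\<rbrakk> \<Longrightarrow> u \<oplus> v \<in> yz_filtration n"

text \<open>The right module generated by the ordered monomials of weight at least \<open>n\<close>.
  It will turn out to be the n-th power of the radical.\<close>

inductive_set filtration :: "nat \<Rightarrow> 'a set" for n where
  base: "\<lbrakk>n \<le> weight t; a \<in> carrier A\<rbrakk> \<Longrightarrow> xmon t \<otimes> a \<in> filtration n"
| add: "\<lbrakk>u \<in> filtration n; v \<in> filtration n\<rbrakk> \<Longrightarrow> u \<oplus> v \<in> filtration n"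

lemma yz_filtration_closed: "u \<in> yz_filtration n \<Longrightarrow> u \<in> carrier A"
  by (induction rule: yz_filtration.induct) simp_all

lemma filtration_closed: "u \<in> filtration n \<Longrightarrow> u \<in> carrier A"
  by (induction rule: filtration.induct) simp_all

lemma filtration_rmult: "\<lbrakk>u \<in> filtration n; a \<in> carrier A\<rbrakk> \<Longrightarrow> u \<otimes> a \<in> filtration n"
proof (induction rule: filtration.induct)
  case (base t b)
  then show ?case using filtration.base[of n t "b \<otimes> a"] by (simp add: m_assoc)
next
  case (add u v)
  then show ?case by (simp add: filtration_closed l_distr filtration.add)
qed

lemma filtration_smult: "u \<in> filtration n \<Longrightarrow> r \<odot> u \<in> filtration n"
  using filtration_rmult[of u n "r \<odot> \<one>"] by (simp add: filtration_closed smult_mult_r)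

lemma yz_filtration_rmult: "\<lbrakk>u \<in> yz_filtration n; a \<in> carrier A\<rbrakk> \<Longrightarrow> u \<otimes> a \<in> yz_filtration n"
proof (induction rule: yz_filtration.induct)
  case (base j k b)
  then show ?case using yz_filtration.base[of n j k "b \<otimes> a"] by (simp add: m_assoc)
next
  case (add u v)
  then show ?case by (simp add: yz_filtration_closed l_distr yz_filtration.add)
qed

lemma yz_filtration_z: "u \<in> yz_filtration n \<Longrightarrow> u \<otimes> z \<in> yz_filtration (n + 2)"
proof (induction rule: yz_filtration.induct)
  case (base j k a)
  obtain b where b: "b \<in> carrier A" "a \<otimes> z = z \<otimes> b" using az base by blast
  have "y [^] j \<otimes> (z [^] k \<otimes> a) \<otimes> z = y [^] j \<otimes> (z [^] k \<otimes> (a \<otimes> z))"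
    using base by (simp add: m_assoc)
  also have "\<dots> = y [^] j \<otimes> (z [^] Suc k \<otimes> b)"
    using b by (simp add: m_assoc)
  also have "\<dots> \<in> yz_filtration (n + 2)"
    using base b by (intro yz_filtration.base) auto
  finally show ?case .
next
  case (add u v)
  then show ?case by (simp add: yz_filtration_closed l_distr yz_filtration.add)
qed

lemma yz_filtration_y: "u \<in> yz_filtration n \<Longrightarrow> u \<otimes> y \<in> yz_filtration (Suc n)"
proof (induction rule: yz_filtration.induct)
  case (base j k a)
  obtain b c where b: "b \<in> carrier A" "c \<in> carrier A" "a \<otimes> y = y \<otimes> b \<oplus> z \<otimes> c"
    using ay base by blast
  have "y [^] j \<otimes> (z [^] k \<otimes> a) \<otimes> y = y [^] j \<otimes> (z [^] k \<otimes> (a \<otimes> y))"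
    using base by (simp add: m_assoc)
  also have "\<dots> = y [^] j \<otimes> ((z [^] k \<otimes> y [^] (1::nat)) \<otimes> b) \<oplus> y [^] j \<otimes> (z [^] Suc k \<otimes> c)"
    using b by (simp add: m_assoc r_distr)
  also have "y [^] j \<otimes> ((z [^] k \<otimes> y [^] (1::nat)) \<otimes> b) = y [^] Suc j \<otimes> (z [^] k \<otimes> (\<sigma> ^ k \<odot> b))"
    using b skew_commute_pow[OF xyz(3,2) zy, of k 1]
    by (simp add: smult_mult_l smult_mult_r m_assoc)
  also have "\<dots> \<oplus> y [^] j \<otimes> (z [^] Suc k \<otimes> c) \<in> yz_filtration (Suc n)"
    using base b by (intro yz_filtration.add yz_filtration.base) auto
  finally show ?case .
next
  case (add u v)
  then show ?case by (simp add: yz_filtration_closed l_distr yz_filtration.add)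
qed

lemma mult_yz_filtration:
  assumes "a \<in> carrier A"
  shows "a \<otimes> (y [^] l \<otimes> z [^] k) \<in> yz_filtration (l + 2 * k)"
proof -
  have "a \<otimes> y [^] l \<in> yz_filtration l" for l :: nat
  proof (induction l)
    case 0
    then show ?case using yz_filtration.base[of 0 0 0 a] assms by simp
  next
    case (Suc l)
    then show ?case using yz_filtration_y[OF Suc] assms by (simp add: m_assoc)
  qed
  then have y: "a \<otimes> y [^] l \<in> yz_filtration l" .
  have "a \<otimes> y [^] l \<otimes> z [^] k \<in> yz_filtration (l + 2 * k)"
  proof (induction k)
    case 0
    then show ?case using y assms by simp
  next
    case (Suc k)
    have "a \<otimes> y [^] l \<otimes> z [^] k \<otimes> z \<in> yz_filtration (l + 2 * k + 2)"
      by (intro yz_filtration_z Suc)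
    then show ?case using assms by (simp add: m_assoc add.assoc)
  qed
  then show ?thesis using assms by (simp add: m_assoc)
qed

text \<open>The 2 in the bound is the weight of the extra z, which passes the powers of y at the
  cost of a power of \<sigma>.\<close>

lemma xyz_mult_filtration:
  assumes "u \<in> yz_filtration n" "m \<le> i + j + n + 2"
  shows "x [^] i \<otimes> (y [^] j \<otimes> (z \<otimes> u)) \<in> filtration m"
  using assms
proof (induction rule: yz_filtration.induct)
  case (base j' k a)
  have sk: "z \<otimes> y [^] j' = \<sigma> ^ j' \<odot> (y [^] j' \<otimes> z)"
    using skew_commute_pow[OF xyz(3,2) zy, of 1 j'] by simp
  have "x [^] i \<otimes> (y [^] j \<otimes> (z \<otimes> (y [^] j' \<otimes> (z [^] k \<otimes> a)))) =
      x [^] i \<otimes> (y [^] j \<otimes> ((z \<otimes> y [^] j') \<otimes> (z [^] k \<otimes> a)))"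
    using base by (simp add: m_assoc)
  also have "\<dots> = \<sigma> ^ j' \<odot> (x [^] i \<otimes> ((y [^] j \<otimes> y [^] j') \<otimes> ((z \<otimes> z [^] k) \<otimes> a)))"
    using base by (simp add: sk smult_mult_l smult_mult_r m_assoc)
  also have "\<dots> = \<sigma> ^ j' \<odot> (xmon (i, j + j', Suc k) \<otimes> a)"
    using base by (simp add: mono3_def nat_pow_mult m_assoc nat_pow_Suc2 del: nat_pow_Suc Group.nat_pow_Suc)
  also have "\<dots> \<in> filtration m"
    using base by (intro filtration_smult filtration.base) auto
  finally show ?case .
next
  case (add u v)
  then show ?case by (simp add: yz_filtration_closed r_distr filtration.add)
qed

text \<open>Each y that passes x trades the pair yx, of weight 2, for xy or for a multiple of z,
  also of weight 2; hence sorting never lowers the filtration degree. This is why z must be given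
  weight 2.\<close>

lemma y_pow_x_mult_filtration:
  assumes "a \<in> carrier A" "m \<le> Suc (i + j + l + 2 * k)"
  shows "x [^] i \<otimes> (y [^] j \<otimes> (x \<otimes> (y [^] l \<otimes> (z [^] k \<otimes> a)))) \<in> filtration m"
  using assms(2)
proof (induction j arbitrary: l)
  case 0
  have "x [^] i \<otimes> (x \<otimes> (y [^] l \<otimes> (z [^] k \<otimes> a))) = xmon (Suc i, l, k) \<otimes> a"
    using assms(1) by (simp add: mono3_def m_assoc)
  also have "\<dots> \<in> filtration m"
    using 0 assms by (intro filtration.base) auto
  finally show ?case using assms(1) by simp
next
  case (Suc j)
  let ?t = "y [^] l \<otimes> (z [^] k \<otimes> a)"
  have t: "?t \<in> carrier A" using assms(1) by simp
  obtain c where c: "c \<in> carrier A" "y \<otimes> x = \<sigma> \<odot> (x \<otimes> y) \<oplus> z \<otimes> c" using yx by blast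
  have "x [^] i \<otimes> (y [^] Suc j \<otimes> (x \<otimes> ?t)) = x [^] i \<otimes> (y [^] j \<otimes> ((y \<otimes> x) \<otimes> ?t))"
    using t by (simp add: m_assoc)
  also have "\<dots> = \<sigma> \<odot> (x [^] i \<otimes> (y [^] j \<otimes> (x \<otimes> (y \<otimes> ?t)))) \<oplus> x [^] i \<otimes> (y [^] j \<otimes> (z \<otimes> (c \<otimes> ?t)))"
    using t c by (simp add: l_distr r_distr smult_mult_l smult_mult_r m_assoc)
  also have "y \<otimes> ?t = y [^] Suc l \<otimes> (z [^] k \<otimes> a)"
    using assms(1) by (simp add: m_assoc nat_pow_Suc2 del: nat_pow_Suc Group.nat_pow_Suc)
  also have "\<sigma> \<odot> (x [^] i \<otimes> (y [^] j \<otimes> (x \<otimes> (y [^] Suc l \<otimes> (z [^] k \<otimes> a)))))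
      \<oplus> x [^] i \<otimes> (y [^] j \<otimes> (z \<otimes> (c \<otimes> ?t))) \<in> filtration m"
  proof (intro filtration.add filtration_smult)
    show "x [^] i \<otimes> (y [^] j \<otimes> (x \<otimes> (y [^] Suc l \<otimes> (z [^] k \<otimes> a)))) \<in> filtration m"
      using Suc.prems by (intro Suc.IH) simp
    have "c \<otimes> (y [^] l \<otimes> z [^] k) \<otimes> a \<in> yz_filtration (l + 2 * k)"
      by (intro yz_filtration_rmult mult_yz_filtration c assms)
    then have "c \<otimes> ?t \<in> yz_filtration (l + 2 * k)"
      using c assms(1) by (simp add: m_assoc)
    then show "x [^] i \<otimes> (y [^] j \<otimes> (z \<otimes> (c \<otimes> ?t))) \<in> filtration m"
      by (rule xyz_mult_filtration) (use Suc.prems in auto)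
  qed
  finally show ?case .
qed

section \<open>The ideal generated by the triple, as a nil ideal\<close>

definition rad :: "'a set" where
  "rad = {x \<otimes> a \<oplus> (y \<otimes> b \<oplus> z \<otimes> c) | a b c. a \<in> carrier A \<and> b \<in> carrier A \<and> c \<in> carrier A}"

lemma radI: "\<lbrakk>a \<in> carrier A; b \<in> carrier A; c \<in> carrier A\<rbrakk> \<Longrightarrow> x \<otimes> a \<oplus> (y \<otimes> b \<oplus> z \<otimes> c) \<in> rad"
  by (auto simp: rad_def)

text \<open>A coefficient standing between a monomial and a generator is first moved to the right of
  the generator. The error terms carry z and gain weight 2, where only 1 is required.\<close>

lemma filtration_mult_rad:
  assumes "u \<in> filtration n" "d \<in> rad"
  shows "u \<otimes> d \<in> filtration (Suc n)"
  using assms(1)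
proof (induction rule: filtration.induct)
  case (base t e)
  obtain i j k where t: "t = (i, j, k)" by (cases t)
  obtain a b c where d: "a \<in> carrier A" "b \<in> carrier A" "c \<in> carrier A"
      "d = x \<otimes> a \<oplus> (y \<otimes> b \<oplus> z \<otimes> c)"
    using assms(2) by (auto simp: rad_def)
  obtain a1 a2 where a: "a1 \<in> carrier A" "a2 \<in> carrier A" "e \<otimes> x = x \<otimes> a1 \<oplus> z \<otimes> a2"
    using ax base by blast
  obtain b1 b2 where b: "b1 \<in> carrier A" "b2 \<in> carrier A" "e \<otimes> y = y \<otimes> b1 \<oplus> z \<otimes> b2"
    using ay base by blast
  obtain c1 where c: "c1 \<in> carrier A" "e \<otimes> z = z \<otimes> c1"
    using az base by blast
  have Z: "xmon t \<otimes> (z \<otimes> f) \<in> filtration (Suc n)" if "f \<in> carrier A" for f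
  proof -
    have "xmon t \<otimes> (z \<otimes> f) = xmon (i, j, Suc k) \<otimes> f"
      using that by (simp add: t mono3_def m_assoc)
    also have "\<dots> \<in> filtration (Suc n)"
      using base t that by (intro filtration.base) auto
    finally show ?thesis .
  qed
  have Y: "xmon t \<otimes> (y \<otimes> f) \<in> filtration (Suc n)" if "f \<in> carrier A" for f
  proof -
    have "xmon t \<otimes> (y \<otimes> f) = x [^] i \<otimes> (y [^] j \<otimes> ((z [^] k \<otimes> y [^] (1::nat)) \<otimes> f))"
      using that by (simp add: t mono3_def m_assoc)
    also have "\<dots> = \<sigma> ^ k \<odot> (xmon (i, Suc j, k) \<otimes> f)"
      using that skew_commute_pow[OF xyz(3,2) zy, of k 1]
      by (simp add: mono3_def smult_mult_l smult_mult_r m_assoc)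
    also have "\<dots> \<in> filtration (Suc n)"
      using base t that by (intro filtration_smult filtration.base) auto
    finally show ?thesis .
  qed
  have X: "xmon t \<otimes> (x \<otimes> f) \<in> filtration (Suc n)" if "f \<in> carrier A" for f
  proof -
    have "xmon t \<otimes> (x \<otimes> f) = x [^] i \<otimes> (y [^] j \<otimes> ((z [^] k \<otimes> x [^] (1::nat)) \<otimes> f))"
      using that by (simp add: t mono3_def m_assoc)
    also have "\<dots> = \<sigma> ^ k \<odot> (x [^] i \<otimes> (y [^] j \<otimes> (x \<otimes> (y [^] (0::nat) \<otimes> (z [^] k \<otimes> f)))))"
      using that skew_commute_pow[OF xyz(3,1) zx, of k 1]
      by (simp add: smult_mult_l smult_mult_r m_assoc)
    also have "\<dots> \<in> filtration (Suc n)"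
      using base t that by (intro filtration_smult y_pow_x_mult_filtration) auto
    finally show ?thesis .
  qed
  have "xmon t \<otimes> e \<otimes> d = xmon t \<otimes> ((e \<otimes> x) \<otimes> a) \<oplus> (xmon t \<otimes> ((e \<otimes> y) \<otimes> b) \<oplus> xmon t \<otimes> ((e \<otimes> z) \<otimes> c))"
    using base d by (simp add: r_distr m_assoc)
  also have "\<dots> = (xmon t \<otimes> (x \<otimes> (a1 \<otimes> a)) \<oplus> xmon t \<otimes> (z \<otimes> (a2 \<otimes> a))) \<oplus>
      ((xmon t \<otimes> (y \<otimes> (b1 \<otimes> b)) \<oplus> xmon t \<otimes> (z \<otimes> (b2 \<otimes> b))) \<oplus> xmon t \<otimes> (z \<otimes> (c1 \<otimes> c)))"
    using a b c d by (simp add: r_distr l_distr m_assoc)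
  also have "\<dots> \<in> filtration (Suc n)"
    using a b c d by (intro filtration.add X Y Z) auto
  finally show ?case .
next
  case (add u v)
  have "d \<in> carrier A" using assms(2) by (auto simp: rad_def)
  with add show ?case by (simp add: filtration_closed l_distr filtration.add)
qed

text \<open>A monomial with all exponents below p has weight at most 4(p - 1), because z counts
  twice; beyond that some p-th power of a generator occurs.\<close>

lemma filtration_eq_zero:
  assumes "u \<in> filtration n" "4 * p \<le> n"
  shows "u = \<zero>"
  using assms(1)
proof (induction rule: filtration.induct)
  case (base t a)
  have "t \<notin> exps p"
    using base(1) assms(2) by (cases t) (auto simp: exps_def)
  then show ?case using base(2) by (simp add: mon_eq_zero)
qed simp

lemma rad_closed: "a \<in> rad \<Longrightarrow> a \<in> carrier A"
  by (auto simp: rad_def)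

lemma rad_nilpotent:
  assumes "a \<in> rad"
  shows "a [^] (4 * p) = \<zero>"
proof -
  have "a [^] n \<in> filtration n" for n :: nat
  proof (induction n)
    case 0
    show ?case using filtration.base[of 0 "(0, 0, 0)" \<one>] by (simp add: mono3_def)
  next
    case (Suc n)
    then show ?case using filtration_mult_rad assms by simp
  qed
  then show ?thesis by (intro filtration_eq_zero[of _ "4 * p"]) auto
qed

lemma idempotent_in_rad:
  assumes "a \<in> rad" "a \<otimes> a = a"
  shows "a = \<zero>"
proof -
  have a: "a \<in> carrier A" using assms(1) by (rule rad_closed)
  have pow: "a [^] Suc n = a" for n
    using a assms(2) by (induction n) simp_all
  have "a [^] Suc (4 * p) = \<zero>"
    using a rad_nilpotent[OF assms(1)] by simp
  with pow[of "4 * p"] show ?thesis by simp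
qed

lemma rad_add:
  assumes "u \<in> rad" "v \<in> rad"
  shows "u \<oplus> v \<in> rad"
proof -
  obtain a b c where u: "a \<in> carrier A" "b \<in> carrier A" "c \<in> carrier A"
      "u = x \<otimes> a \<oplus> (y \<otimes> b \<oplus> z \<otimes> c)"
    using assms(1) by (auto simp: rad_def)
  obtain a' b' c' where v: "a' \<in> carrier A" "b' \<in> carrier A" "c' \<in> carrier A"
      "v = x \<otimes> a' \<oplus> (y \<otimes> b' \<oplus> z \<otimes> c')"
    using assms(2) by (auto simp: rad_def)
  have "u \<oplus> v = x \<otimes> (a \<oplus> a') \<oplus> (y \<otimes> (b \<oplus> b') \<oplus> z \<otimes> (c \<oplus> c'))"
    unfolding u(4) v(4) using u(1-3) v(1-3) xyz by algebra
  then show ?thesis using u v by (simp add: radI)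
qed

lemma rad_rmult:
  assumes "u \<in> rad" "d \<in> carrier A"
  shows "u \<otimes> d \<in> rad"
proof -
  obtain a b c where *: "a \<in> carrier A" "b \<in> carrier A" "c \<in> carrier A"
      "u = x \<otimes> a \<oplus> (y \<otimes> b \<oplus> z \<otimes> c)"
    using assms by (auto simp: rad_def)
  have "u \<otimes> d = x \<otimes> (a \<otimes> d) \<oplus> (y \<otimes> (b \<otimes> d) \<oplus> z \<otimes> (c \<otimes> d))"
    using * assms(2) by (simp add: l_distr m_assoc)
  then show ?thesis using * assms(2) by (simp add: radI)
qed

lemma rad_gens: "a \<in> carrier A \<Longrightarrow> x \<otimes> a \<in> rad" "a \<in> carrier A \<Longrightarrow> y \<otimes> a \<in> rad"
  "a \<in> carrier A \<Longrightarrow> z \<otimes> a \<in> rad" "x \<in> rad" "y \<in> rad" "z \<in> rad"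
  using radI[of a \<zero> \<zero>] radI[of \<zero> a \<zero>] radI[of \<zero> \<zero> a]
    radI[of \<one> \<zero> \<zero>] radI[of \<zero> \<one> \<zero>] radI[of \<zero> \<zero> \<one>] by simp_all

lemma rad_lmult:
  assumes "u \<in> rad" "d \<in> carrier A"
  shows "d \<otimes> u \<in> rad"
proof -
  obtain a b c where *: "a \<in> carrier A" "b \<in> carrier A" "c \<in> carrier A"
      "u = x \<otimes> a \<oplus> (y \<otimes> b \<oplus> z \<otimes> c)"
    using assms by (auto simp: rad_def)
  have "d \<otimes> x \<in> rad" "d \<otimes> y \<in> rad" "d \<otimes> z \<in> rad"
    using ax[OF assms(2)] ay[OF assms(2)] az[OF assms(2)] by (auto intro!: rad_gens rad_add)
  then have "d \<otimes> x \<otimes> a \<oplus> (d \<otimes> y \<otimes> b \<oplus> d \<otimes> z \<otimes> c) \<in> rad"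
    using * by (intro rad_add[OF rad_rmult rad_add[OF rad_rmult rad_rmult]])
  also have "d \<otimes> x \<otimes> a \<oplus> (d \<otimes> y \<otimes> b \<oplus> d \<otimes> z \<otimes> c) = d \<otimes> u"
    using * assms(2) by (simp add: r_distr m_assoc)
  finally show ?thesis .
qed

lemma rad_ideal: "ideal rad A"
proof (rule idealI[OF ring_axioms])
  show "subgroup rad (add_monoid A)"
  proof (rule add.subgroupI)
    show "rad \<subseteq> carrier A" using rad_closed by blast
    show "rad \<noteq> {}" using rad_gens(4) by blast
    fix u v assume u: "u \<in> rad" "v \<in> rad"
    show "\<ominus> u \<in> rad"
      using rad_rmult[OF u(1), of "\<ominus> \<one>"] rad_closed[OF u(1)] by (simp add: r_minus)
    show "u \<oplus> v \<in> rad" using u by (rule rad_add)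
  qed
qed (simp_all add: rad_lmult rad_rmult)

lemma jacobson_radical_eq_rad:
  assumes "LL \<noteq> {}" "\<And>L. L \<in> LL \<Longrightarrow> maximal_left_ideal L A" "\<Inter>LL \<subseteq> rad"
  shows "jacobson_radical A = rad"
  by (rule jacobson_radical_eqI[OF rad_ideal _ assms]) (use rad_nilpotent in blast)

end

text \<open>What the passage to the graded algebra needs: \<open>z_in\<close> and
  \<open>xy_in\<close> turn the commutation rule into the exact relation in degree 2, and
  \<epsilon>, which commutes with the triple, has a corner that is scalar modulo the radical. For kP
  the idempotent is 1.\<close>

locale triple_radical_corner = triple_radical A x y z \<sigma> p
  for A :: "('k::field, 'a) module" (structure) and x y z \<sigma> p +
  fixes \<epsilon> :: 'a
  assumes jacobson: "jacobson_radical A = rad"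
    and z_in: "z \<in> radical_power A 2"
    and xy_in: "(x \<otimes> y \<ominus> \<sigma> \<odot> (y \<otimes> x)) \<ominus> z \<in> radical_power A 3"
    and eps: "idempotent A \<epsilon>"
    and eps_comm: "\<epsilon> \<otimes> x = x \<otimes> \<epsilon>" "\<epsilon> \<otimes> y = y \<otimes> \<epsilon>" "\<epsilon> \<otimes> z = z \<otimes> \<epsilon>"
    and eps_local: "a \<in> carrier A \<Longrightarrow> \<exists>r. \<epsilon> \<otimes> a \<otimes> \<epsilon> \<ominus> r \<odot> \<epsilon> \<in> rad"

sublocale triple_radical_corner \<subseteq> radical_algebra A
  by (intro radical_algebra.intro radical_algebra_axioms.intro assoc_algebra_axioms)
    (simp add: jacobson rad_ideal)

context triple_radical_corner
begin

lemma eps_closed [simp]: "\<epsilon> \<in> carrier A" and eps_eps [simp]: "\<epsilon> \<otimes> \<epsilon> = \<epsilon>"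
  using eps by (auto simp: idempotent_def)

text \<open>One inclusion is \<open>filtration_mult_rad\<close> repeated. For the other, z lies in
  \<open>J 2\<close>, so a monomial lies in the power given by its weight.\<close>

lemma radical_power_eq_filtration: "J n = filtration n"
proof
  show "J n \<subseteq> filtration n"
  proof (induction n)
    case 0
    have "a \<in> filtration 0" if "a \<in> carrier A" for a
      using filtration.base[of 0 "(0, 0, 0)" a] that by (simp add: mono3_def)
    then show ?case by auto
  next
    case (Suc n)
    have "a \<in> filtration (Suc n)" if "a \<in> ideal_prod A (J n) rad" for a
      using that
    proof (induction rule: ideal_prod.induct)
      case (prod i j)
      then show ?case using Suc.IH by (intro filtration_mult_rad) auto
    qed (rule filtration.add)
    then show ?case by (auto simp: radical_power.simps(2) jacobson)
  qed
  have gens: "x \<in> J 1" "y \<in> J 1"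
    unfolding radical_power_one jacobson by (rule rad_gens)+
  have mon_in: "xmon t \<in> J (weight t)" for t
  proof -
    obtain i j k where t: "t = (i, j, k)" by (cases t)
    have "x [^] i \<in> J (i * 1)" "y [^] j \<in> J (j * 1)" "z [^] k \<in> J (k * 2)"
      by (rule radical_power_pow gens z_in)+
    then have "xmon t \<in> J (i * 1 + (j * 1 + k * 2))"
      unfolding t mono3_def by (simp only: prod.case) (intro radical_power_mult)
    then show ?thesis by (simp add: t mult.commute add.assoc)
  qed
  show "filtration n \<subseteq> J n"
  proof
    fix u assume "u \<in> filtration n"
    then show "u \<in> J n"
    proof (induction rule: filtration.induct)
      case (base t a)
      then show ?case
        using radical_power_le[OF mon_in[of t]] by (intro radical_power_rmult) auto
    qed (rule radical_power_plus)
  qed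
qed

lemma mon_in_radical_power: "weight t = n \<Longrightarrow> xmon t \<in> J n"
  using filtration.base[of n t \<one>] by (simp add: radical_power_eq_filtration)

lemma eps_pow:
  assumes "u \<in> carrier A" "\<epsilon> \<otimes> u = u \<otimes> \<epsilon>"
  shows "\<epsilon> \<otimes> u [^] (n::nat) = u [^] n \<otimes> \<epsilon>"
proof (induction n)
  case (Suc n)
  have "\<epsilon> \<otimes> u [^] Suc n = (\<epsilon> \<otimes> u [^] n) \<otimes> u" using assms by (simp add: m_assoc)
  also have "\<dots> = u [^] n \<otimes> (\<epsilon> \<otimes> u)" using assms(1) by (simp add: Suc.IH m_assoc)
  finally show ?case using assms by (simp add: m_assoc)
qed simp

lemma eps_mon: "\<epsilon> \<otimes> xmon t = xmon t \<otimes> \<epsilon>"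
proof -
  obtain i j k where t: "t = (i, j, k)" by (cases t)
  have "\<epsilon> \<otimes> xmon t = (\<epsilon> \<otimes> x [^] i) \<otimes> (y [^] j \<otimes> z [^] k)" by (simp add: t mono3_def m_assoc)
  also have "\<dots> = x [^] i \<otimes> (\<epsilon> \<otimes> (y [^] j \<otimes> z [^] k))" by (simp add: eps_pow eps_comm m_assoc)
  also have "\<epsilon> \<otimes> (y [^] j \<otimes> z [^] k) = (\<epsilon> \<otimes> y [^] j) \<otimes> z [^] k" by (simp add: m_assoc)
  also have "\<dots> = y [^] j \<otimes> (\<epsilon> \<otimes> z [^] k)" by (simp add: eps_pow eps_comm m_assoc)
  also have "x [^] i \<otimes> (y [^] j \<otimes> (\<epsilon> \<otimes> z [^] k)) = xmon t \<otimes> \<epsilon>"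
    by (simp add: t mono3_def eps_pow eps_comm m_assoc)
  finally show ?thesis .
qed

abbreviation "xmone t \<equiv> xmon t \<otimes> \<epsilon>"

text \<open>The leading part of a corner element. \<epsilon> commutes with the monomials, so only
  \<epsilon>a\<epsilon> for the coefficient a matters; it is a scalar multiple of \<epsilon> up to a
  radical element, which raises the order by one.\<close>

lemma corner_mod_radical_power:
  assumes "v \<in> J n"
  shows "\<exists>l. (\<forall>t. l t \<noteq> 0 \<longrightarrow> weight t = n) \<and>
    \<epsilon> \<otimes> v \<otimes> \<epsilon> \<ominus> (\<Oplus>t\<in>exps p. l t \<odot> xmone t) \<in> J (Suc n)"
  using assms unfolding radical_power_eq_filtration[of n]
proof (induction rule: filtration.induct)
  case (base t a)
  show ?case
  proof (cases "weight t = n \<and> t \<in> exps p")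
    case True
    obtain r where r: "\<epsilon> \<otimes> a \<otimes> \<epsilon> \<ominus> r \<odot> \<epsilon> \<in> J 1"
      using eps_local[OF base(2)] by (auto simp: radical_power_one jacobson simp del: One_nat_def)
    define l where "l = (\<lambda>u. if u = t then r else 0)"
    have "(\<Oplus>u\<in>exps p. l u \<odot> xmone u) = r \<odot> xmone t"
      unfolding l_def by (rule finsum_smult_delta) (use True in auto)
    moreover have "\<epsilon> \<otimes> (xmon t \<otimes> a) \<otimes> \<epsilon> = xmon t \<otimes> (\<epsilon> \<otimes> a \<otimes> \<epsilon>)"
      using base(2) by (simp add: m_assoc[symmetric] eps_mon)
    ultimately have "\<epsilon> \<otimes> (xmon t \<otimes> a) \<otimes> \<epsilon> \<ominus> (\<Oplus>u\<in>exps p. l u \<odot> xmone u) =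
        xmon t \<otimes> (\<epsilon> \<otimes> a \<otimes> \<epsilon> \<ominus> r \<odot> \<epsilon>)"
      using base(2) by (simp add: r_distr minus_eq r_minus smult_mult_r)
    moreover have "xmon t \<otimes> (\<epsilon> \<otimes> a \<otimes> \<epsilon> \<ominus> r \<odot> \<epsilon>) \<in> J (n + 1)"
      using True by (intro radical_power_mult mon_in_radical_power r) simp
    ultimately show ?thesis
      using True by (intro exI[of _ l]) (auto simp: l_def)
  next
    case False
    have "xmon t \<otimes> a \<in> J (Suc n)"
    proof (cases "t \<in> exps p")
      case True
      with False base show ?thesis
        unfolding radical_power_eq_filtration by (intro filtration.base) auto
    next
      case False
      with base(2) show ?thesis by (simp add: mon_eq_zero)
    qed
    then have "\<epsilon> \<otimes> (xmon t \<otimes> a) \<otimes> \<epsilon> \<in> J (Suc n)"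
      by (intro radical_power_rmult[OF radical_power_lmult]) auto
    moreover have "(\<Oplus>u\<in>exps p. 0 \<odot> xmone u) = \<zero>"
      by simp
    ultimately show ?thesis
      using base(2) by (intro exI[of _ "\<lambda>_. 0"]) (simp add: minus_eq)
  qed
next
  case (add u v)
  obtain l l' where l: "\<forall>t. l t \<noteq> 0 \<longrightarrow> weight t = n" "\<forall>t. l' t \<noteq> 0 \<longrightarrow> weight t = n"
      "\<epsilon> \<otimes> u \<otimes> \<epsilon> \<ominus> (\<Oplus>t\<in>exps p. l t \<odot> xmone t) \<in> J (Suc n)"
      "\<epsilon> \<otimes> v \<otimes> \<epsilon> \<ominus> (\<Oplus>t\<in>exps p. l' t \<odot> xmone t) \<in> J (Suc n)"
    using add.IH by blast
  have uv: "u \<in> carrier A" "v \<in> carrier A"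
    using add.hyps by (auto intro: filtration_closed)
  have "(\<Oplus>t\<in>exps p. (l t + 1 * l' t) \<odot> xmone t) =
      (\<Oplus>t\<in>exps p. l t \<odot> xmone t) \<oplus> 1 \<odot> (\<Oplus>t\<in>exps p. l' t \<odot> xmone t)"
    by (rule finsum_smult_add) simp
  moreover have fc: "(\<Oplus>t\<in>exps p. h t \<odot> xmone t) \<in> carrier A" for h
    by (rule finsum_closed) simp
  ultimately have "(\<Oplus>t\<in>exps p. (l t + l' t) \<odot> xmone t) =
      (\<Oplus>t\<in>exps p. l t \<odot> xmone t) \<oplus> (\<Oplus>t\<in>exps p. l' t \<odot> xmone t)" by simp
  then have "\<epsilon> \<otimes> (u \<oplus> v) \<otimes> \<epsilon> \<ominus> (\<Oplus>t\<in>exps p. (l t + l' t) \<odot> xmone t) =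
      (\<epsilon> \<otimes> u \<otimes> \<epsilon> \<ominus> (\<Oplus>t\<in>exps p. l t \<odot> xmone t)) \<oplus>
      (\<epsilon> \<otimes> v \<otimes> \<epsilon> \<ominus> (\<Oplus>t\<in>exps p. l' t \<odot> xmone t))"
    using uv fc by (simp add: r_distr l_distr minus_eq minus_add a_ac)
  then have "\<epsilon> \<otimes> (u \<oplus> v) \<otimes> \<epsilon> \<ominus> (\<Oplus>t\<in>exps p. (l t + l' t) \<odot> xmone t) \<in> J (Suc n)"
    using radical_power_plus[OF l(3,4)] by simp
  moreover have "\<forall>t. l t + l' t \<noteq> 0 \<longrightarrow> weight t = n" using l(1,2) by force
  ultimately show ?case by (intro exI[of _ "\<lambda>t. l t + l' t"]) simp
qed

text \<open>Leading parts are split off one order at a time. The process ends because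
  \<open>J n\<close> vanishes from n = 4p on, whence the induction on
  \<open>4 * p - n\<close>.\<close>

lemma corner_eq_lincomb:
  "v \<in> J n \<Longrightarrow> \<exists>l. (\<forall>t. l t \<noteq> 0 \<longrightarrow> n \<le> weight t) \<and> \<epsilon> \<otimes> v \<otimes> \<epsilon> = (\<Oplus>t\<in>exps p. l t \<odot> xmone t)"
proof (induction "4 * p - n" arbitrary: n v)
  case 0
  then have "v = \<zero>"
    using filtration_eq_zero by (simp add: radical_power_eq_filtration)
  moreover have "(\<Oplus>u\<in>exps p. 0 \<odot> xmone u) = \<zero>"
    by simp
  ultimately show ?case by (intro exI[of _ "\<lambda>_. 0"]) simp
next
  case (Suc d)
  obtain l where l: "\<forall>t. l t \<noteq> 0 \<longrightarrow> weight t = n"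
      "\<epsilon> \<otimes> v \<otimes> \<epsilon> \<ominus> (\<Oplus>t\<in>exps p. l t \<odot> xmone t) \<in> J (Suc n)"
    using corner_mod_radical_power[OF Suc.prems] by blast
  let ?s = "\<Oplus>t\<in>exps p. l t \<odot> xmone t"
  let ?w = "\<epsilon> \<otimes> v \<otimes> \<epsilon> \<ominus> ?s"
  have fc: "(\<Oplus>t\<in>exps p. h t \<odot> xmone t) \<in> carrier A" for h
    by (rule finsum_closed) simp
  have v: "v \<in> carrier A" using Suc.prems by simp
  have d: "d = 4 * p - Suc n" using Suc.hyps(2) by simp
  obtain l' where l': "\<forall>t. l' t \<noteq> 0 \<longrightarrow> Suc n \<le> weight t"
      "\<epsilon> \<otimes> ?w \<otimes> \<epsilon> = (\<Oplus>t\<in>exps p. l' t \<odot> xmone t)"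
    using Suc.hyps(1)[OF d l(2)] by blast
  have se: "\<epsilon> \<otimes> ?s = ?s" "?s \<otimes> \<epsilon> = ?s"
  proof -
    have "\<epsilon> \<otimes> (l t \<odot> xmone t) = l t \<odot> xmone t" "(l t \<odot> xmone t) \<otimes> \<epsilon> = l t \<odot> xmone t" for t
    proof -
      have "\<epsilon> \<otimes> xmone t = xmone t"
        by (simp add: m_assoc[symmetric] eps_mon) (simp add: m_assoc)
      then show "\<epsilon> \<otimes> (l t \<odot> xmone t) = l t \<odot> xmone t" by (simp add: smult_mult_r)
      show "(l t \<odot> xmone t) \<otimes> \<epsilon> = l t \<odot> xmone t" by (simp add: smult_mult_l m_assoc)
    qed
    then show "\<epsilon> \<otimes> ?s = ?s" "?s \<otimes> \<epsilon> = ?s" by (simp_all add: finsum_rdistr finsum_ldistr)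
  qed
  have "\<epsilon> \<otimes> (\<epsilon> \<otimes> v \<otimes> \<epsilon>) \<otimes> \<epsilon> = (\<epsilon> \<otimes> \<epsilon>) \<otimes> v \<otimes> (\<epsilon> \<otimes> \<epsilon>)"
    using v eps_closed by (simp only: m_assoc m_closed)
  then have "\<epsilon> \<otimes> ?w \<otimes> \<epsilon> = ?w"
    using v fc se by (simp add: minus_eq r_distr l_distr r_minus l_minus)
  then have w: "?w = (\<Oplus>t\<in>exps p. l' t \<odot> xmone t)"
    using l'(2) by simp
  have "\<epsilon> \<otimes> v \<otimes> \<epsilon> = ?s \<oplus> ?w"
    using v fc by (intro plus_diff_cancel[symmetric]) simp_all
  also have "\<dots> = ?s \<oplus> (\<Oplus>t\<in>exps p. l' t \<odot> xmone t)" by (simp only: w)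
  also have "\<dots> = (\<Oplus>t\<in>exps p. (l t + 1 * l' t) \<odot> xmone t)"
    using fc[of l'] by (subst finsum_smult_add) auto
  finally have "\<epsilon> \<otimes> v \<otimes> \<epsilon> = (\<Oplus>t\<in>exps p. (l t + l' t) \<odot> xmone t)" by simp
  moreover have "\<forall>t. l t + l' t \<noteq> 0 \<longrightarrow> n \<le> weight t" using l(1) l'(1) by force
  ultimately show ?case by (intro exI[of _ "\<lambda>t. l t + l' t"]) simp
qed

end

text \<open>Negation and finite sums are derived operations that refer to the carrier, so unlike the
  basic operations they do not agree with those of the ambient algebra by definition.\<close>

lemma corner_a_inv:
  assumes "assoc_algebra A" "idempotent A e" "a \<in> carrier (corner_algebra A e)"
  shows "\<ominus>\<^bsub>corner_algebra A e\<^esub> a = \<ominus>\<^bsub>A\<^esub> a"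
proof -
  interpret A: assoc_algebra A by fact
  interpret C: assoc_algebra "corner_algebra A e" by (rule A.corner_algebra_algebra) fact
  have "a \<in> carrier A" using assms(3) A.in_corner_iff[OF assms(2)] by simp
  then show ?thesis
    using C.smult_minus_one[OF assms(3)] A.smult_minus_one by simp
qed

lemma corner_finsum:
  assumes "assoc_algebra A" "idempotent A e" "f \<in> T \<rightarrow> carrier (corner_algebra A e)"
  shows "(\<Oplus>\<^bsub>corner_algebra A e\<^esub>t\<in>T. f t) = (\<Oplus>\<^bsub>A\<^esub>t\<in>T. f t)"
proof -
  interpret A: assoc_algebra A by fact
  interpret C: assoc_algebra "corner_algebra A e" by (rule A.corner_algebra_algebra) fact
  have sub: "carrier (corner_algebra A e) \<subseteq> carrier A"
    using A.in_corner_iff[OF assms(2)] by blast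
  show ?thesis
    using assms(3)
  proof (induction T rule: infinite_finite_induct)
    case (insert t T)
    then have "f \<in> insert t T \<rightarrow> carrier A" using sub by auto
    with insert show ?case by (simp add: C.finsum_insert A.finsum_insert Pi_iff)
  qed simp_all
qed

context radical_algebra
begin

text \<open>A sum of homogeneous elements of mixed degrees, collected degree by degree into one
  representative in the Rees algebra.\<close>

lemma finsum_homog:
  assumes "finite T" "\<And>t. t \<in> T \<Longrightarrow> f t \<in> J (w t)"
  shows "(\<lambda>n. \<Oplus>t\<in>T. if w t = n then f t else \<zero>) \<in> carrier rees_algebra"
    and "(\<Oplus>\<^bsub>gr\<^esub>t\<in>T. homog (w t) (f t)) = symbol (\<lambda>n. \<Oplus>t\<in>T. if w t = n then f t else \<zero>)"
proof -
  interpret gr: assoc_algebra gr by (rule gr_algebra)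
  interpret R: assoc_algebra rees_algebra by (rule rees_algebra_algebra)
  have "(\<lambda>n. \<Oplus>t\<in>T. if w t = n then f t else \<zero>) \<in> carrier rees_algebra \<and>
    (\<Oplus>\<^bsub>gr\<^esub>t\<in>T. homog (w t) (f t)) = symbol (\<lambda>n. \<Oplus>t\<in>T. if w t = n then f t else \<zero>)"
    using assms
  proof (induction T rule: finite_induct)
    case empty
    then show ?case
      using algebra_hom_zero[OF rees_algebra_algebra gr_algebra symbol_hom] R.zero_closed by simp
  next
    case (insert t T)
    let ?q = "\<lambda>n. \<Oplus>t\<in>T. if w t = n then f t else \<zero>"
    let ?h = "\<lambda>n. if n = w t then f t else \<zero>"
    have IH: "?q \<in> carrier rees_algebra" "(\<Oplus>\<^bsub>gr\<^esub>t\<in>T. homog (w t) (f t)) = symbol ?q"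
      using insert by auto
    have h: "?h \<in> carrier rees_algebra" using homog_rees insert.prems by simp
    have ft: "f u \<in> carrier A" if "u \<in> insert t T" for u
      using insert.prems[OF that] by simp
    have eq: "(\<lambda>n. \<Oplus>u\<in>insert t T. if w u = n then f u else \<zero>) = ?h \<oplus>\<^bsub>rees_algebra\<^esub> ?q"
    proof
      fix n
      have "(\<Oplus>u\<in>insert t T. if w u = n then f u else \<zero>) =
          (if w t = n then f t else \<zero>) \<oplus> (\<Oplus>u\<in>T. if w u = n then f u else \<zero>)"
        using insert.hyps ft by (intro finsum_insert) auto
      then show "(\<Oplus>u\<in>insert t T. if w u = n then f u else \<zero>) = (?h \<oplus>\<^bsub>rees_algebra\<^esub> ?q) n"
        by auto
    qed
    have "(\<Oplus>\<^bsub>gr\<^esub>u\<in>insert t T. homog (w u) (f u)) =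
        homog (w t) (f t) \<oplus>\<^bsub>gr\<^esub> (\<Oplus>\<^bsub>gr\<^esub>u\<in>T. homog (w u) (f u))"
      using insert by (intro gr.finsum_insert) (auto intro: homog_closed)
    also have "\<dots> = symbol (?h \<oplus>\<^bsub>rees_algebra\<^esub> ?q)"
      unfolding IH(2) unfolding homog_def by (rule algebra_homD(3)[OF symbol_hom h IH(1), symmetric])
    finally show ?case
      unfolding eq using R.a_closed[OF h IH(1)] by blast
  qed
  then show "(\<lambda>n. \<Oplus>t\<in>T. if w t = n then f t else \<zero>) \<in> carrier rees_algebra"
    and "(\<Oplus>\<^bsub>gr\<^esub>t\<in>T. homog (w t) (f t)) = symbol (\<lambda>n. \<Oplus>t\<in>T. if w t = n then f t else \<zero>)"
    by blast+
qed

end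

context triple_radical_corner
begin

lemma span_corner:
  assumes "a \<in> carrier A"
  shows "\<epsilon> \<otimes> a \<otimes> \<epsilon> \<in> lspan A (exps p) xmone"
  using corner_eq_lincomb[of a 0] assms by (auto simp: lspan_def)

abbreviation "grcorner \<equiv> corner_algebra gr (homog 0 \<epsilon>)"

text \<open>The basis criterion is applied to the classes of x\<epsilon> and y\<epsilon> in degree 1
  and of z\<epsilon> in degree 2. Spanning holds degree by degree by
  \<open>corner_mod_radical_power\<close>; independence is lifted from \<open>A\<close> by
  \<open>corner_eq_lincomb\<close>.\<close>

theorem gr_corner_presentation:
  assumes indep: "\<And>l. (\<Oplus>t\<in>exps p. l t \<odot> xmone t) = \<zero> \<Longrightarrow> \<forall>t\<in>exps p. l t = 0"
  shows "algebra_isomorphic grcorner (presented_algebra TYPE('k) (skew_relations p \<sigma>))"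
proof -
  interpret gr: assoc_algebra gr by (rule gr_algebra)
  interpret R: assoc_algebra rees_algebra by (rule rees_algebra_algebra)
  have e: "idempotent gr (homog 0 \<epsilon>)" by (rule homog_idempotent[OF eps])
  interpret B: assoc_algebra grcorner by (rule gr.corner_algebra_algebra[OF e])
  note B_iff = gr.in_corner_iff[OF e]
  have in_B: "homog n (a \<otimes> \<epsilon>) \<in> carrier grcorner"
    if "a \<in> J n" "\<epsilon> \<otimes> a = a \<otimes> \<epsilon>" for n a
  proof -
    have a: "a \<in> carrier A" and ae: "a \<otimes> \<epsilon> \<in> J n"
      using that(1) by (simp_all add: radical_power_rmult)
    have "\<epsilon> \<otimes> (a \<otimes> \<epsilon>) = a \<otimes> \<epsilon>" "a \<otimes> \<epsilon> \<otimes> \<epsilon> = a \<otimes> \<epsilon>"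
      using a by (simp_all add: m_assoc[symmetric] that(2)) (simp_all add: m_assoc)
    then show ?thesis
      using ae by (simp add: B_iff homog_closed homog_mult)
  qed
  have mult_B: "homog m (a \<otimes> \<epsilon>) \<otimes>\<^bsub>grcorner\<^esub> homog n (b \<otimes> \<epsilon>) = homog (m + n) (a \<otimes> b \<otimes> \<epsilon>)"
    if "a \<in> J m" "b \<in> J n" "\<epsilon> \<otimes> b = b \<otimes> \<epsilon>" for m n a b
  proof -
    have ab: "a \<in> carrier A" "b \<in> carrier A" using that by simp_all
    have "a \<otimes> \<epsilon> \<otimes> (b \<otimes> \<epsilon>) = a \<otimes> ((\<epsilon> \<otimes> b) \<otimes> \<epsilon>)" using ab by (simp add: m_assoc)
    also have "\<dots> = a \<otimes> b \<otimes> \<epsilon>" unfolding that(3) using ab by (simp add: m_assoc)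
    finally show ?thesis
      using that(1,2) by (simp add: homog_mult radical_power_rmult)
  qed
  have pow_B: "homog m (a \<otimes> \<epsilon>) [^]\<^bsub>grcorner\<^esub> (n::nat) = homog (n * m) (a [^] n \<otimes> \<epsilon>)"
    if "a \<in> J m" "\<epsilon> \<otimes> a = a \<otimes> \<epsilon>" for m n a
  proof (induction n)
    case (Suc n)
    then show ?case
      using that mult_B[OF radical_power_pow[OF that(1), of n] that(1,2)]
      by (simp add: add.commute)
  qed simp
  have gens: "x \<in> J 1" "y \<in> J 1" "z \<in> J 2"
    unfolding radical_power_one jacobson using z_in by (simp_all add: rad_gens)
  define x' y' z' where "x' = homog 1 (x \<otimes> \<epsilon>)" and "y' = homog 1 (y \<otimes> \<epsilon>)"
    and "z' = homog 2 (z \<otimes> \<epsilon>)"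
  have xyz': "x' \<in> carrier grcorner" "y' \<in> carrier grcorner" "z' \<in> carrier grcorner"
    unfolding x'_def y'_def z'_def by (intro in_B gens eps_comm)+
  have m_in: "xmon t \<in> J (weight t)" for t by (rule mon_in_radical_power) simp
  have mon_B: "mono3 grcorner x' y' z' t = homog (weight t) (xmone t)" for t
  proof -
    obtain i j k where t: "t = (i, j, k)" by (cases t)
    have pows: "x [^] i \<in> J i" "y [^] j \<in> J j" "z [^] k \<in> J (k * 2)"
      using radical_power_pow[OF gens(1), of i] radical_power_pow[OF gens(2), of j]
        radical_power_pow[OF gens(3), of k] by simp_all
    have "\<epsilon> \<otimes> (y [^] j \<otimes> z [^] k) = y [^] j \<otimes> z [^] k \<otimes> \<epsilon>"
      using eps_mon[of "(0, j, k)"] by (simp add: mono3_def)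
    then have "mono3 grcorner x' y' z' t =
        homog (i + (j + k * 2)) (x [^] i \<otimes> (y [^] j \<otimes> z [^] k) \<otimes> \<epsilon>)"
      unfolding t mono3_def x'_def y'_def z'_def
      using pows radical_power_mult[OF pows(2,3)]
      by (simp add: pow_B gens eps_comm mult_B eps_pow del: One_nat_def corner_algebra_sel)
    then show ?thesis by (simp add: t mono3_def mult.commute add.assoc)
  qed
  have minus_B: "a \<ominus>\<^bsub>grcorner\<^esub> b = a \<ominus>\<^bsub>gr\<^esub> b" if "b \<in> carrier grcorner" for a b
    using corner_a_inv[OF gr_algebra e that] by (simp add: a_minus_def)
  have skew: "skew_triple grcorner x' y' z' \<sigma>"
  proof (rule B.skew_tripleI[OF xyz' sigma])
    have xy: "x \<otimes> y \<in> J 2" "y \<otimes> x \<in> J 2" "x \<otimes> z \<in> J 3" "z \<otimes> x \<in> J 3" "y \<otimes> z \<in> J 3" "z \<otimes> y \<in> J 3"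
      using radical_power_mult[OF gens(1) gens(2)] radical_power_mult[OF gens(2) gens(1)]
        radical_power_mult[OF gens(1) gens(3)] radical_power_mult[OF gens(3) gens(1)]
        radical_power_mult[OF gens(2) gens(3)] radical_power_mult[OF gens(3) gens(2)]
      by (simp_all del: One_nat_def)
    have prods: "x' \<otimes>\<^bsub>grcorner\<^esub> y' = homog 2 (x \<otimes> y \<otimes> \<epsilon>)" "y' \<otimes>\<^bsub>grcorner\<^esub> x' = homog 2 (y \<otimes> x \<otimes> \<epsilon>)"
      "x' \<otimes>\<^bsub>grcorner\<^esub> z' = homog 3 (x \<otimes> z \<otimes> \<epsilon>)" "z' \<otimes>\<^bsub>grcorner\<^esub> x' = homog 3 (z \<otimes> x \<otimes> \<epsilon>)"
      "y' \<otimes>\<^bsub>grcorner\<^esub> z' = homog 3 (y \<otimes> z \<otimes> \<epsilon>)" "z' \<otimes>\<^bsub>grcorner\<^esub> y' = homog 3 (z \<otimes> y \<otimes> \<epsilon>)"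
      unfolding x'_def y'_def z'_def
      by (simp_all add: mult_B gens eps_comm del: corner_algebra_sel One_nat_def)
    have in2: "x \<otimes> y \<otimes> \<epsilon> \<in> J 2" "\<sigma> \<odot> (y \<otimes> x \<otimes> \<epsilon>) \<in> J 2" "z \<otimes> \<epsilon> \<in> J 2"
      using xy gens by (simp_all add: radical_power_rmult radical_power_smult)
    have sB: "\<sigma> \<odot>\<^bsub>grcorner\<^esub> (y' \<otimes>\<^bsub>grcorner\<^esub> x') = homog 2 (\<sigma> \<odot> (y \<otimes> x \<otimes> \<epsilon>))"
      unfolding prods using xy by (simp add: homog_smult radical_power_rmult)
    have "x' \<otimes>\<^bsub>grcorner\<^esub> y' \<ominus>\<^bsub>grcorner\<^esub> \<sigma> \<odot>\<^bsub>grcorner\<^esub> (y' \<otimes>\<^bsub>grcorner\<^esub> x') \<ominus>\<^bsub>grcorner\<^esub> z' =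
        homog 2 (x \<otimes> y \<otimes> \<epsilon> \<ominus> \<sigma> \<odot> (y \<otimes> x \<otimes> \<epsilon>) \<ominus> z \<otimes> \<epsilon>)"
      unfolding minus_B[OF xyz'(3)] minus_B[OF B.smult_closed[OF B.m_closed[OF xyz'(2,1)]]]
      unfolding sB unfolding prods z'_def by (simp only: homog_minus in2 radical_power_minus)
    also have "x \<otimes> y \<otimes> \<epsilon> \<ominus> \<sigma> \<odot> (y \<otimes> x \<otimes> \<epsilon>) \<ominus> z \<otimes> \<epsilon> =
        (x \<otimes> y \<ominus> \<sigma> \<odot> (y \<otimes> x) \<ominus> z) \<otimes> \<epsilon>"
      by (simp add: minus_eq l_distr l_minus smult_mult_l)
    also have "homog 2 \<dots> = \<zero>\<^bsub>gr\<^esub>"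
    proof (subst homog_eq_zero_iff)
      have "(x \<otimes> y \<ominus> \<sigma> \<odot> (y \<otimes> x) \<ominus> z) \<otimes> \<epsilon> \<in> J 3"
        by (rule radical_power_rmult[OF xy_in eps_closed])
      then show "(x \<otimes> y \<ominus> \<sigma> \<odot> (y \<otimes> x) \<ominus> z) \<otimes> \<epsilon> \<in> J (Suc 2)"
        "(x \<otimes> y \<ominus> \<sigma> \<odot> (y \<otimes> x) \<ominus> z) \<otimes> \<epsilon> \<in> J 2"
        by (simp_all add: radical_power_le[of _ 3 2])
    qed
    finally show "x' \<otimes>\<^bsub>grcorner\<^esub> y' \<ominus>\<^bsub>grcorner\<^esub> \<sigma> \<odot>\<^bsub>grcorner\<^esub> (y' \<otimes>\<^bsub>grcorner\<^esub> x') \<ominus>\<^bsub>grcorner\<^esub> z' = \<zero>\<^bsub>grcorner\<^esub>"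
      by simp
    have "x \<otimes> z = \<sigma> \<odot> (z \<otimes> x)" "y \<otimes> z = \<sigma> \<odot> (z \<otimes> y)"
      by (simp_all add: zx zy smult_smult sigma)
    then have "x' \<otimes>\<^bsub>grcorner\<^esub> z' = \<sigma> \<odot>\<^bsub>grcorner\<^esub> (z' \<otimes>\<^bsub>grcorner\<^esub> x')"
      "y' \<otimes>\<^bsub>grcorner\<^esub> z' = \<sigma> \<odot>\<^bsub>grcorner\<^esub> (z' \<otimes>\<^bsub>grcorner\<^esub> y')"
      unfolding prods using xy
      by (simp_all add: smult_mult_l radical_power_rmult flip: homog_smult)
    then show "x' \<otimes>\<^bsub>grcorner\<^esub> z' \<ominus>\<^bsub>grcorner\<^esub> \<sigma> \<odot>\<^bsub>grcorner\<^esub> (z' \<otimes>\<^bsub>grcorner\<^esub> x') = \<zero>\<^bsub>grcorner\<^esub>"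
      "y' \<otimes>\<^bsub>grcorner\<^esub> z' \<ominus>\<^bsub>grcorner\<^esub> \<sigma> \<odot>\<^bsub>grcorner\<^esub> (z' \<otimes>\<^bsub>grcorner\<^esub> y') = \<zero>\<^bsub>grcorner\<^esub>"
      using B.m_closed[OF xyz'(3,1)] B.m_closed[OF xyz'(3,2)]
      by (simp_all add: B.minus_eq B.r_neg del: corner_algebra_sel)
  qed
  have pows_B: "x' [^]\<^bsub>grcorner\<^esub> p = \<zero>\<^bsub>grcorner\<^esub>" "y' [^]\<^bsub>grcorner\<^esub> p = \<zero>\<^bsub>grcorner\<^esub>"
    "z' [^]\<^bsub>grcorner\<^esub> p = \<zero>\<^bsub>grcorner\<^esub>"
    unfolding x'_def y'_def z'_def using gens
    by (simp_all add: pow_B eps_comm xp yp zp homog_zero del: One_nat_def)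
  have lin_B: "(\<Oplus>\<^bsub>grcorner\<^esub>t\<in>exps p. l t \<odot>\<^bsub>grcorner\<^esub> mono3 grcorner x' y' z' t) =
      symbol (\<lambda>n. \<Oplus>t\<in>exps p. if weight t = n then l t \<odot> xmone t else \<zero>)"
    and rees_lin: "(\<lambda>n. \<Oplus>t\<in>exps p. if weight t = n then l t \<odot> xmone t else \<zero>) \<in> carrier rees_algebra"
    for l
  proof -
    have me: "xmone t \<in> J (weight t)" for t by (simp add: m_in radical_power_rmult)
    have "homog (weight t) (xmone t) \<in> carrier grcorner" for t
      by (intro in_B m_in eps_mon)
    then have "(\<lambda>t. l t \<odot>\<^bsub>grcorner\<^esub> homog (weight t) (xmone t)) \<in> exps p \<rightarrow> carrier grcorner"
      by (intro funcsetI B.smult_closed)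
    then have "(\<Oplus>\<^bsub>grcorner\<^esub>t\<in>exps p. l t \<odot>\<^bsub>grcorner\<^esub> mono3 grcorner x' y' z' t) =
        (\<Oplus>\<^bsub>gr\<^esub>t\<in>exps p. l t \<odot>\<^bsub>grcorner\<^esub> mono3 grcorner x' y' z' t)"
      unfolding mon_B by (rule corner_finsum[OF gr_algebra e])
    also have "\<dots> = (\<Oplus>\<^bsub>gr\<^esub>t\<in>exps p. homog (weight t) (l t \<odot> xmone t))"
      by (simp add: mon_B homog_smult me)
    also have "\<dots> = symbol (\<lambda>n. \<Oplus>t\<in>exps p. if weight t = n then l t \<odot> xmone t else \<zero>)"
      by (rule finsum_homog(2)) (simp_all add: me radical_power_smult)
    finally show "(\<Oplus>\<^bsub>grcorner\<^esub>t\<in>exps p. l t \<odot>\<^bsub>grcorner\<^esub> mono3 grcorner x' y' z' t) =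
      symbol (\<lambda>n. \<Oplus>t\<in>exps p. if weight t = n then l t \<odot> xmone t else \<zero>)" .
    show "(\<lambda>n. \<Oplus>t\<in>exps p. if weight t = n then l t \<odot> xmone t else \<zero>) \<in> carrier rees_algebra"
      by (rule finsum_homog(1)) (simp_all add: me radical_power_smult)
  qed
  have er: "(\<lambda>m. if m = 0 then \<epsilon> else \<zero>) \<in> carrier rees_algebra"
    using homog_rees[of \<epsilon> 0] by simp
  have span: "b \<in> lspan grcorner (exps p) (mono3 grcorner x' y' z')" if b: "b \<in> carrier grcorner" for b
  proof -
    have b': "b \<in> carrier gr" "homog 0 \<epsilon> \<otimes>\<^bsub>gr\<^esub> b \<otimes>\<^bsub>gr\<^esub> homog 0 \<epsilon> = b"
      using b by (simp_all add: B_iff)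
    obtain q where q: "q \<in> carrier rees_algebra" "b = symbol q"
      using b'(1) symbol_surj by blast
    have qc: "q n \<in> J n" for n using q(1) by (simp add: in_rees_iff)
    have "\<forall>n. \<exists>l. (\<forall>t. l t \<noteq> 0 \<longrightarrow> weight t = n) \<and>
        \<epsilon> \<otimes> q n \<otimes> \<epsilon> \<ominus> (\<Oplus>t\<in>exps p. l t \<odot> xmone t) \<in> J (Suc n)"
      by (intro allI corner_mod_radical_power qc)
    from choice[OF this] obtain l where l': "\<forall>n. (\<forall>t. l n t \<noteq> 0 \<longrightarrow> weight t = n) \<and>
        \<epsilon> \<otimes> q n \<otimes> \<epsilon> \<ominus> (\<Oplus>t\<in>exps p. l n t \<odot> xmone t) \<in> J (Suc n)" ..
    have "\<forall>t. l n t \<noteq> 0 \<longrightarrow> weight t = n" for n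
      using spec[OF l', of n] by (rule conjunct1)
    note l1 = this[rule_format]
    have l2: "\<epsilon> \<otimes> q n \<otimes> \<epsilon> \<ominus> (\<Oplus>t\<in>exps p. l n t \<odot> xmone t) \<in> J (Suc n)" for n
      using spec[OF l', of n] by (rule conjunct2)
    \<comment> \<open>Degree n uses only monomials of weight n, so the coefficient functions found
      in the separate degrees have disjoint supports and glue to a single one.\<close>
    define h where "h = (\<lambda>t. l (weight t) t)"
    have h: "(\<Oplus>t\<in>exps p. l n t \<odot> xmone t) = (\<Oplus>t\<in>exps p. if weight t = n then h t \<odot> xmone t else \<zero>)" for n
    proof (rule finsum_cong')
      fix t assume "t \<in> exps p"
      show "l n t \<odot> xmone t = (if weight t = n then h t \<odot> xmone t else \<zero>)"
      proof (cases "weight t = n")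
        case False
        then have "l n t = 0" using l1[of n t] by blast
        with False show ?thesis by simp
      qed (simp add: h_def)
    qed simp_all
    let ?e = "\<lambda>m. if m = 0 then \<epsilon> else \<zero>"
    let ?q = "?e \<otimes>\<^bsub>rees_algebra\<^esub> q \<otimes>\<^bsub>rees_algebra\<^esub> ?e"
    have qr: "?q \<in> carrier rees_algebra" by (intro R.m_closed er q(1))
    have qn: "?q n = \<epsilon> \<otimes> q n \<otimes> \<epsilon>" for n
    proof -
      have c: "q i \<in> carrier A" for i by (rule radical_power_closed[OF qc])
      have "(\<Oplus>i\<in>{..n}. ?e i \<otimes> q (n - i)) = \<epsilon> \<otimes> q n" for n
      proof -
        have "(\<Oplus>i\<in>{..n}. ?e i \<otimes> q (n - i)) = (\<Oplus>i\<in>{..n}. if 0 = i then \<epsilon> \<otimes> q (n - i) else \<zero>)"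
          by (rule finsum_cong') (use c in auto)
        also have "\<dots> = \<epsilon> \<otimes> q (n - 0)"
          by (rule finsum_singleton) (use c in auto)
        finally show ?thesis by simp
      qed
      then have "?q n = (\<Oplus>i\<in>{..n}. (\<epsilon> \<otimes> q i) \<otimes> ?e (n - i))" by simp
      also have "\<dots> = (\<Oplus>i\<in>{..n}. if n = i then \<epsilon> \<otimes> q i \<otimes> \<epsilon> else \<zero>)"
        by (rule finsum_cong') (use c in auto)
      also have "\<dots> = \<epsilon> \<otimes> q n \<otimes> \<epsilon>"
        by (rule finsum_singleton) (use c in auto)
      finally show ?thesis .
    qed
    have "b = symbol ?q"
      using b'(2) q R.m_closed[OF er q(1)] er by (simp add: symbol_mult homog_def del: rees_sel)
    also have "symbol ?q = symbol (\<lambda>n. \<Oplus>t\<in>exps p. if weight t = n then h t \<odot> xmone t else \<zero>)"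
      using l2 by (subst symbol_eq_iff[OF qr rees_lin]) (simp add: qn h del: rees_sel)
    finally have "b = (\<Oplus>\<^bsub>grcorner\<^esub>t\<in>exps p. h t \<odot>\<^bsub>grcorner\<^esub> mono3 grcorner x' y' z' t)"
      unfolding lin_B .
    then show ?thesis
      unfolding lspan_def by blast
  qed
  have indep_B: "\<forall>t\<in>exps p. l t = 0"
    if "(\<Oplus>\<^bsub>grcorner\<^esub>t\<in>exps p. l t \<odot>\<^bsub>grcorner\<^esub> mono3 grcorner x' y' z' t) = \<zero>\<^bsub>grcorner\<^esub>" for l
  proof
    fix t0 assume t0: "t0 \<in> exps p"
    let ?s = "\<lambda>n. \<Oplus>t\<in>exps p. if weight t = n then l t \<odot> xmone t else \<zero>"
    define n where "n = weight t0"
    have fc: "(\<Oplus>t\<in>exps p. h t \<odot> xmone t) \<in> carrier A" for h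
      by (rule finsum_closed) simp
    have "symbol ?s = symbol (\<lambda>n. \<zero>)"
      using that lin_B[of l] algebra_hom_zero[OF rees_algebra_algebra gr_algebra symbol_hom]
      by simp
    then have "\<forall>n. ?s n \<ominus> \<zero> \<in> J (Suc n)"
      using symbol_eq_iff[OF rees_lin[of l] R.zero_closed] by simp
    moreover have s: "?s n = (\<Oplus>t\<in>exps p. (if weight t = n then l t else 0) \<odot> xmone t)"
      by (rule finsum_cong') auto
    ultimately have "(\<Oplus>t\<in>exps p. (if weight t = n then l t else 0) \<odot> xmone t) \<ominus> \<zero> \<in> J (Suc n)"
      by (metis (no_types, lifting))
    then have sJ: "(\<Oplus>t\<in>exps p. (if weight t = n then l t else 0) \<odot> xmone t) \<in> J (Suc n)"
      using fc[of "\<lambda>t. if weight t = n then l t else 0"] by (simp add: minus_eq)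
    let ?u = "\<Oplus>t\<in>exps p. (if weight t = n then l t else 0) \<odot> xmone t"
    obtain l' where l': "\<forall>t. l' t \<noteq> 0 \<longrightarrow> Suc n \<le> weight t"
        "\<epsilon> \<otimes> ?u \<otimes> \<epsilon> = (\<Oplus>t\<in>exps p. l' t \<odot> xmone t)"
      using corner_eq_lincomb[OF sJ] by blast
    have "\<epsilon> \<otimes> (r \<odot> xmone t) = r \<odot> xmone t" "(r \<odot> xmone t) \<otimes> \<epsilon> = r \<odot> xmone t" for r t
    proof -
      have "\<epsilon> \<otimes> xmone t = xmone t"
        by (simp add: m_assoc[symmetric] eps_mon) (simp add: m_assoc)
      then show "\<epsilon> \<otimes> (r \<odot> xmone t) = r \<odot> xmone t" by (simp add: smult_mult_r)
      show "(r \<odot> xmone t) \<otimes> \<epsilon> = r \<odot> xmone t" by (simp add: smult_mult_l m_assoc)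
    qed
    then have "\<epsilon> \<otimes> ?u \<otimes> \<epsilon> = ?u" by (simp add: finsum_rdistr finsum_ldistr)
    \<comment> \<open>The weight n part and its expansion in monomials of larger weight give a
      relation in \<open>A\<close>. At \<open>t0\<close>, whose weight is n, the expansion does not
      contribute.\<close>
    then have "(\<Oplus>t\<in>exps p. ((if weight t = n then l t else 0) + (- 1) * l' t) \<odot> xmone t) = \<zero>"
      using l'(2) fc by (subst finsum_smult_add) (auto simp: smult_minus_one r_neg)
    from indep[OF this] t0 have "l t0 - l' t0 = 0"
      by (auto simp: n_def)
    moreover have "l' t0 = 0" using l'(1)[rule_format, of t0] by (auto simp: n_def)
    ultimately show "l t0 = 0" by simp
  qed
  show ?thesis
    by (rule presented_algebra_of_basis[OF skew pows_B _ indep_B]) (use span in blast)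
qed

end

section \<open>Algebras generated by a Heisenberg group\<close>

lemma (in ring) diff_add_cancel_right:
  assumes "a \<in> carrier R" "b \<in> carrier R" "d \<in> carrier R"
  shows "(a \<oplus> d) \<ominus> (b \<oplus> d) = a \<ominus> b"
proof -
  have "(a \<oplus> d) \<ominus> (b \<oplus> d) = (a \<ominus> b) \<oplus> (d \<oplus> \<ominus> d)"
    using assms by (simp only: minus_eq minus_add a_ac a_inv_closed a_closed)
  then show ?thesis using assms by (simp add: r_neg)
qed

lemma (in ring) commutator_minus_one:
  assumes "a \<in> carrier R" "b \<in> carrier R"
  shows "(a \<ominus> \<one>) \<otimes> (b \<ominus> \<one>) \<ominus> (b \<ominus> \<one>) \<otimes> (a \<ominus> \<one>) = a \<otimes> b \<ominus> b \<otimes> a"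
proof -
  define u v where "u = a \<ominus> \<one>" and "v = b \<ominus> \<one>"
  have uv: "u \<in> carrier R" "v \<in> carrier R" "a = u \<oplus> \<one>" "b = v \<oplus> \<one>"
    using assms by (simp_all add: u_def v_def minus_eq a_assoc l_neg)
  have "a \<otimes> b \<ominus> b \<otimes> a = (u \<otimes> v \<oplus> (u \<oplus> (v \<oplus> \<one>))) \<ominus> (v \<otimes> u \<oplus> (u \<oplus> (v \<oplus> \<one>)))"
    unfolding uv(3,4) using uv(1,2) by (simp add: l_distr r_distr a_ac)
  also have "\<dots> = u \<otimes> v \<ominus> v \<otimes> u"
    using uv(1,2) by (intro diff_add_cancel_right) simp_all
  finally show ?thesis by (simp add: u_def v_def)
qed

context assoc_algebra
begin

text \<open>The coefficients are those of (T - 1)^n in k[T]. Identities of the commutative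
  polynomial ring can thus be carried over to one element of a noncommutative algebra.\<close>

lemma pow_minus_one:
  assumes "a \<in> carrier A"
  shows "(a \<ominus> \<one>) [^] (n::nat) = (\<Oplus>i\<in>{..n}. poly.coeff ([:- 1, 1:] ^ n) i \<odot> a [^] i)"
proof (induction n)
  case 0
  show ?case using assms by simp
next
  case (Suc n)
  let ?q = "[:- 1, 1:] ^ n :: 'k poly"
  have pow: "a [^] i \<in> carrier A" for i :: nat using assms by simp
  have deg: "Polynomial.degree ?q \<le> n"
    using degree_power_le[of "[:- 1, 1:] :: 'k poly" n] by simp
  have q: "[:- 1, 1:] ^ Suc n = pCons 0 ?q - ?q" by simp
  have fc: "(\<Oplus>i\<in>{..m}. f i \<odot> a [^] i) \<in> carrier A" for m :: nat and f
    by (rule finsum_closed) (simp add: pow)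
  have shift: "(\<Oplus>i\<in>{..Suc n}. poly.coeff (pCons 0 ?q) i \<odot> a [^] i) = (\<Oplus>i\<in>{..n}. poly.coeff ?q i \<odot> a [^] i) \<otimes> a"
  proof -
    have "(\<Oplus>i\<in>{..Suc n}. poly.coeff (pCons 0 ?q) i \<odot> a [^] i) = (\<Oplus>i\<in>{..n}. poly.coeff ?q i \<odot> a [^] Suc i)"
      using pow by (subst finsum_Suc2) (auto simp: fc simp del: nat_pow_Suc Group.nat_pow_Suc intro!: finsum_closed)
    also have "\<dots> = (\<Oplus>i\<in>{..n}. (poly.coeff ?q i \<odot> a [^] i) \<otimes> a)"
      using assms by (intro finsum_cong') (auto simp: smult_mult_l)
    also have "\<dots> = (\<Oplus>i\<in>{..n}. poly.coeff ?q i \<odot> a [^] i) \<otimes> a"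
      using assms by (intro finsum_ldistr[symmetric]) auto
    finally show ?thesis .
  qed
  have drop: "(\<Oplus>i\<in>{..Suc n}. poly.coeff ?q i \<odot> a [^] i) = (\<Oplus>i\<in>{..n}. poly.coeff ?q i \<odot> a [^] i)"
    using pow[of "Suc n"] pow coeff_eq_0[of ?q "Suc n"] deg fc[of "poly.coeff ?q" n]
    by (subst finsum_Suc) (auto simp del: nat_pow_Suc Group.nat_pow_Suc)
  have "(\<Oplus>i\<in>{..Suc n}. poly.coeff ([:- 1, 1:] ^ Suc n) i \<odot> a [^] i) =
      (\<Oplus>i\<in>{..Suc n}. (poly.coeff (pCons 0 ?q) i + (- 1) * poly.coeff ?q i) \<odot> a [^] i)"
    unfolding q by (simp del: finsum_Suc)
  also have "\<dots> = (\<Oplus>i\<in>{..Suc n}. poly.coeff (pCons 0 ?q) i \<odot> a [^] i) \<oplus>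
      (- 1) \<odot> (\<Oplus>i\<in>{..Suc n}. poly.coeff ?q i \<odot> a [^] i)"
    by (rule finsum_smult_add) (use pow in simp)
  also have "\<dots> = (\<Oplus>i\<in>{..n}. poly.coeff ?q i \<odot> a [^] i) \<otimes> (a \<ominus> \<one>)"
    unfolding shift drop using fc[of "poly.coeff ?q" n] assms
    by (simp add: smult_minus_one r_distr minus_eq r_minus)
  finally show ?case by (simp add: Suc.IH)
qed

lemma frobenius_minus_one:
  assumes "a \<in> carrier A" "prime p" "odd p" "CHAR('k) = p"
  shows "(a \<ominus> \<one>) [^] p = a [^] p \<ominus> \<one>"
proof -
  have p0: "p \<noteq> 0" "0 < p" using assms(2) by (auto dest: prime_gt_0_nat)
  have "CHAR('k poly) = p" using assms(4) by simp
  \<comment> \<open>The p-th power is additive on k[T]. Since p is odd, the constant term is -1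
    without appeal to the characteristic.\<close>
  then have "(Polynomial.monom 1 1 + (- 1) :: 'k poly) ^ p = Polynomial.monom 1 1 ^ p + (- 1) ^ p"
    using assms(2) by (intro freshmans_dream) auto
  also have "Polynomial.monom 1 1 + (- 1) = [:- 1, 1 :: 'k:]"
    by (simp add: monom_Suc monom_0 one_pCons)
  also have "(Polynomial.monom 1 1 :: 'k poly) ^ p = Polynomial.monom 1 p"
    by (simp add: monom_power)
  also have "(- 1 :: 'k poly) ^ p = - 1" using assms(3) by simp
  finally have eq: "[:- 1, 1:] ^ p = Polynomial.monom (1::'k) p + (- 1)" .
  have "poly.coeff ([:- 1, 1:] ^ p) i = (if i = p then 1 else 0) + (- 1) * (if i = 0 then 1 else 0 :: 'k)" for i
    unfolding eq using p0 by (simp add: coeff_1)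
  then have "(a \<ominus> \<one>) [^] p =
      (\<Oplus>i\<in>{..p}. ((if i = p then 1 else 0) + (- 1) * (if i = 0 then 1 else 0)) \<odot> a [^] i)"
    using pow_minus_one[OF assms(1), of p] by simp
  also have "\<dots> = (\<Oplus>i\<in>{..p}. (if i = p then 1 else 0) \<odot> a [^] i) \<oplus>
      (- 1) \<odot> (\<Oplus>i\<in>{..p}. (if i = 0 then 1 else 0) \<odot> a [^] i)"
    by (rule finsum_smult_add) (use assms(1) in simp)
  also have "\<dots> = a [^] p \<oplus> (- 1) \<odot> \<one>"
    using assms(1) by (subst (1 2) finsum_smult_delta) auto
  finally show ?thesis using assms(1) by (simp add: smult_minus_one minus_eq)
qed

definition half_diff :: "'a \<Rightarrow> 'a \<Rightarrow> 'a" where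
  "half_diff u v = (1 / 2) \<odot> (u \<ominus> v)"

lemma half_diff_closed [simp]: "\<lbrakk>u \<in> carrier A; v \<in> carrier A\<rbrakk> \<Longrightarrow> half_diff u v \<in> carrier A"
  by (simp add: half_diff_def)

text \<open>With v inverse to u, the difference u - v is the product of the commuting factors v and
  u^2 - 1, and (u^2 - 1)^p = u^(2p) - 1 = 0.\<close>

lemma half_diff_pow:
  assumes uv: "u \<in> carrier A" "v \<in> carrier A" "u \<otimes> v = \<one>" "v \<otimes> u = \<one>" "u [^] p = \<one>"
    and p: "prime p" "odd p" "CHAR('k) = p"
  shows "half_diff u v [^] p = \<zero>"
proof -
  let ?w = "u \<otimes> u \<ominus> \<one>"
  have vw: "v \<otimes> ?w = u \<ominus> v" "?w \<otimes> v = u \<ominus> v"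
  proof -
    have "v \<otimes> ?w = (v \<otimes> u) \<otimes> u \<ominus> v"
      using uv(1,2) by (simp add: minus_eq r_distr r_minus m_assoc)
    then show "v \<otimes> ?w = u \<ominus> v" using uv by simp
    have "?w \<otimes> v = u \<otimes> (u \<otimes> v) \<ominus> v"
      using uv(1,2) by (simp add: minus_eq l_distr l_minus m_assoc)
    then show "?w \<otimes> v = u \<ominus> v" using uv by simp
  qed
  have "(u \<ominus> v) [^] p = (v \<otimes> ?w) [^] p" by (simp add: vw)
  also have "\<dots> = v [^] p \<otimes> ?w [^] p"
    by (rule pow_mult_distrib) (use uv vw in auto)
  also have "?w [^] p = (u \<otimes> u) [^] p \<ominus> \<one>"
    using uv p by (intro frobenius_minus_one) auto
  also have "(u \<otimes> u) [^] p = \<one>"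
    using uv by (subst pow_mult_distrib) auto
  finally show ?thesis
    using uv by (simp add: half_diff_def smult_pow minus_eq r_neg)
qed

text \<open>The element u^2 - 1 is 2u times the half difference, hence so is (u^2)^m - 1 up to
  another factor. As u has odd exponent p, it is itself a power of u^2. With
  \<open>half_diff_factor\<close> this shows that half difference and u - 1 generate the same right
  ideal.\<close>

lemma half_diff_dvd:
  assumes uv: "u \<in> carrier A" "v \<in> carrier A" "u \<otimes> v = \<one>" "v \<otimes> u = \<one>" "u [^] (p::nat) = \<one>"
    and p: "odd p" and two: "(2 :: 'k) \<noteq> 0"
  shows "\<exists>a\<in>carrier A. u \<ominus> \<one> = half_diff u v \<otimes> a"
proof -
  let ?d = "half_diff u v"
  have comm: "u \<otimes> ?d = ?d \<otimes> u"
    using uv by (simp add: half_diff_def smult_mult_l smult_mult_r minus_eq l_distr r_distr l_minus r_minus)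
  have sq: "u \<otimes> u \<ominus> \<one> = ?d \<otimes> (2 \<odot> u)"
    using uv two by (simp add: half_diff_def smult_mult_l smult_mult_r smult_smult minus_eq l_distr l_minus)
  have "\<exists>a\<in>carrier A. (u \<otimes> u) [^] m \<ominus> \<one> = ?d \<otimes> a" for m :: nat
  proof (induction m)
    case 0
    show ?case using uv by (intro bexI[of _ \<zero>]) (simp_all add: minus_eq r_neg)
  next
    case (Suc m)
    then obtain a where a: "a \<in> carrier A" "(u \<otimes> u) [^] m \<ominus> \<one> = ?d \<otimes> a" by blast
    let ?w = "(u \<otimes> u) [^] m"
    have w: "?w \<in> carrier A" using uv by simp
    have "?w \<otimes> ?d = ?d \<otimes> ?w"
    proof (induction m)
      case (Suc m)
      have "(u \<otimes> u) \<otimes> ?d = ?d \<otimes> (u \<otimes> u)"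
        using uv comm half_diff_closed[of u v] by (metis m_assoc)
      then show ?case
        using uv Suc by (simp add: m_assoc) (simp add: m_assoc[symmetric])
    qed (use uv in simp)
    moreover have "?w \<otimes> (u \<otimes> u) \<ominus> \<one> = ?w \<otimes> (u \<otimes> u \<ominus> \<one>) \<oplus> (?w \<ominus> \<one>)"
      using w uv by (simp add: minus_eq r_distr r_minus a_assoc r_neg2 r_neg1)
    ultimately have "?w \<otimes> (u \<otimes> u) \<ominus> \<one> = ?d \<otimes> (?w \<otimes> (2 \<odot> u) \<oplus> a)"
      using w uv a by (simp add: sq r_distr m_assoc[symmetric])
    then show ?case using w uv a by (intro bexI[of _ "?w \<otimes> (2 \<odot> u) \<oplus> a"]) auto
  qed
  \<comment> \<open>Here m = (p + 1)/2, so that (u^2)^m = u^(p+1) = u.\<close>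
  moreover obtain m where m: "Suc p = m + m"
    using p by (metis evenE even_Suc mult_2)
  have "(u \<otimes> u) [^] m = u"
    using uv m[symmetric] by (subst pow_mult_distrib) (auto simp: nat_pow_mult)
  ultimately show ?thesis by metis
qed

lemma half_diff_commute:
  assumes "u \<in> carrier A" "v \<in> carrier A" "w \<in> carrier A" "u \<otimes> w = w \<otimes> u" "v \<otimes> w = w \<otimes> v"
  shows "half_diff u v \<otimes> w = w \<otimes> half_diff u v"
  using assms by (simp add: half_diff_def smult_mult_l smult_mult_r minus_eq l_distr r_distr l_minus r_minus)

lemma half_diff_skew_commute:
  assumes "u \<in> carrier A" "v \<in> carrier A" "w \<in> carrier A" "u \<otimes> w = w \<otimes> v" "v \<otimes> w = w \<otimes> u"
  shows "half_diff u v \<otimes> w = \<ominus> (w \<otimes> half_diff u v)"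
  using assms
  by (simp add: half_diff_def smult_mult_l smult_mult_r minus_eq l_distr r_distr l_minus r_minus
      smult_r_distr smult_minus_r minus_add a_comm)

lemma half_diff_factor:
  assumes "u \<in> carrier A" "v \<in> carrier A" "u \<otimes> v = \<one>"
  shows "half_diff u v = (u \<ominus> \<one>) \<otimes> ((1 / 2) \<odot> (\<one> \<oplus> v))"
proof -
  have "(u \<ominus> \<one>) \<otimes> (\<one> \<oplus> v) = u \<ominus> v"
    using assms by (simp add: minus_eq l_distr r_distr l_minus a_assoc r_neg1 r_neg2)
  then show ?thesis using assms by (simp add: half_diff_def smult_mult_r)
qed

text \<open>The half difference is u - 1 times (1 + v)/2, and (1 + v)/2 - 1 = (v - 1)/2. So it
  agrees with u - 1 up to a product of two elements of augmentation zero.\<close>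

lemma half_diff_approx:
  assumes "u \<in> carrier A" "v \<in> carrier A" "u \<otimes> v = \<one>" and two: "(2 :: 'k) \<noteq> 0"
  shows "half_diff u v \<ominus> (u \<ominus> \<one>) = (u \<ominus> \<one>) \<otimes> ((1 / 2) \<odot> (v \<ominus> \<one>))"
proof -
  have "(1 / 2) \<odot> (\<one> \<oplus> v) \<ominus> \<one> = (1 / 2) \<odot> (\<one> \<oplus> v) \<ominus> (2 * (1 / 2)) \<odot> \<one>"
    using two by simp
  also have "\<dots> = (1 / 2) \<odot> ((\<one> \<oplus> v) \<ominus> (2 \<odot> \<one>))"
    using assms by (simp add: smult_diff smult_smult mult.commute)
  also have "2 \<odot> \<one> = \<one> \<oplus> \<one>" using smult_l_distr[of \<one> 1 1] by simp
  also have "(\<one> \<oplus> v) \<ominus> (\<one> \<oplus> \<one>) = v \<ominus> \<one>"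
    using assms by algebra
  finally have "(1 / 2) \<odot> (\<one> \<oplus> v) \<ominus> \<one> = (1 / 2) \<odot> (v \<ominus> \<one>)" .
  then have "(u \<ominus> \<one>) \<otimes> ((1 / 2) \<odot> (v \<ominus> \<one>)) = (u \<ominus> \<one>) \<otimes> ((1 / 2) \<odot> (\<one> \<oplus> v) \<ominus> \<one>)" by simp
  also have "\<dots> = half_diff u v \<ominus> (u \<ominus> \<one>)"
    unfolding half_diff_factor[OF assms(1-3)] using assms by (simp add: minus_eq r_distr r_minus)
  finally show ?thesis by simp
qed

end

locale heis_algebra = assoc_algebra A for A :: "('k::field, 'a) module" (structure) +
  fixes g g' h h' c c' :: 'a and p :: nat
  assumes p: "prime p" "odd p" "CHAR('k) = p"
    and gens [simp]: "g \<in> carrier A" "g' \<in> carrier A" "h \<in> carrier A" "h' \<in> carrier A"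
      "c \<in> carrier A" "c' \<in> carrier A"
    and invs: "g \<otimes> g' = \<one>" "g' \<otimes> g = \<one>" "h \<otimes> h' = \<one>" "h' \<otimes> h = \<one>" "c \<otimes> c' = \<one>" "c' \<otimes> c = \<one>"
    and pows: "g [^] p = \<one>" "h [^] p = \<one>" "c [^] p = \<one>"
    and gh: "g \<otimes> h = h \<otimes> g \<otimes> c" and gc: "g \<otimes> c = c \<otimes> g" and hc: "h \<otimes> c = c \<otimes> h"
    and nontrivial: "\<one> \<noteq> \<zero>"
begin

inductive_set words :: "'a set" where
  one: "\<one> \<in> words"
| gen: "\<lbrakk>u \<in> {g, g', h, h', c, c'}; w \<in> words\<rbrakk> \<Longrightarrow> u \<otimes> w \<in> words"

lemma words_closed: "w \<in> words \<Longrightarrow> w \<in> carrier A"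
  by (induction rule: words.induct) auto

lemma words_mult: "\<lbrakk>v \<in> words; w \<in> words\<rbrakk> \<Longrightarrow> v \<otimes> w \<in> words"
proof (induction rule: words.induct)
  case (gen u v)
  then have "u \<in> carrier A" "v \<in> carrier A" "w \<in> carrier A" using words_closed by auto
  with gen show ?case by (simp add: m_assoc words.gen)
qed (simp add: words_closed)

lemma words_gens: "{g, g', h, h', c, c'} \<subseteq> words"
proof
  fix u assume "u \<in> {g, g', h, h', c, c'}"
  with words.gen[OF this words.one] show "u \<in> words" by auto
qed

definition "x = half_diff g g'"
definition "y = half_diff h h'"
definition "z = half_diff c c'"

lemma xyz_closed [simp]: "x \<in> carrier A" "y \<in> carrier A" "z \<in> carrier A"
  by (simp_all add: x_def y_def z_def)

lemma two: "(2 :: 'k) \<noteq> 0"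
proof
  assume "(2 :: 'k) = 0"
  then have "CHAR('k) dvd 2"
    using of_nat_eq_0_iff_char_dvd[of 2, where 'a = 'k] by simp
  then have "p = 2"
    using p by (metis primes_dvd_imp_eq two_is_prime_nat)
  then show False using p by simp
qed

lemma inverse_commute:
  assumes "u \<in> carrier A" "v \<in> carrier A" "u \<otimes> v = \<one>" "v \<otimes> u = \<one>" "a \<in> carrier A" "u \<otimes> a = a \<otimes> u"
  shows "v \<otimes> a = a \<otimes> v"
proof -
  have "v \<otimes> a = v \<otimes> (a \<otimes> u) \<otimes> v" using assms by (simp add: m_assoc)
  also have "\<dots> = (v \<otimes> u) \<otimes> a \<otimes> v" using assms(1,2,5) by (simp add: assms(6)[symmetric] m_assoc)
  finally show ?thesis using assms by simp
qed

end

text \<open>The assumption is linear spanning by the words in the generators and their inverses,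
  phrased as an induction rule.\<close>

locale heis_spanned = heis_algebra +
  assumes span: "\<lbrakk>a \<in> carrier A; P \<zero>;
    \<And>b r w. \<lbrakk>b \<in> carrier A; P b; w \<in> words\<rbrakk> \<Longrightarrow> P (b \<oplus> r \<odot> w)\<rbrakk> \<Longrightarrow> P a"
begin

lemma c_central:
  assumes "a \<in> carrier A"
  shows "c \<otimes> a = a \<otimes> c" "c' \<otimes> a = a \<otimes> c'"
proof -
  have c_gen: "c \<otimes> u = u \<otimes> c" if "u \<in> {g, g', h, h', c, c'}" for u
    using that inverse_commute[of g g' c] inverse_commute[of h h' c] gc hc invs by auto
  have "c \<otimes> w = w \<otimes> c" if "w \<in> words" for w
    using that
  proof (induction rule: words.induct)
    case (gen u w)
    then have uw: "u \<in> carrier A" "w \<in> carrier A" using words_closed by auto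
    have "c \<otimes> (u \<otimes> w) = (c \<otimes> u) \<otimes> w" using uw by (simp add: m_assoc)
    also have "\<dots> = u \<otimes> (c \<otimes> w)" using uw c_gen[OF gen.hyps(1)] by (simp add: m_assoc)
    finally show ?case using uw gen.IH by (simp add: m_assoc)
  qed simp
  then show 1: "c \<otimes> a = a \<otimes> c"
    by (rule_tac span[OF assms])
      (simp_all add: l_distr r_distr smult_mult_l smult_mult_r words_closed)
  show "c' \<otimes> a = a \<otimes> c'"
    using inverse_commute[of c c' a] assms 1 invs by simp
qed

lemma z_central: "a \<in> carrier A \<Longrightarrow> z \<otimes> a = a \<otimes> z"
  unfolding z_def by (rule half_diff_commute) (simp_all add: c_central)

text \<open>Since z is central, this is equality of ab and ba in the quotient by the two-sided ideal
  zA. That quotient turns out to be commutative: it corresponds to the abelian group P modulo its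
  centre.\<close>

definition comm_mod_z :: "'a \<Rightarrow> 'a \<Rightarrow> bool" where
  "comm_mod_z a b \<longleftrightarrow> (\<exists>d\<in>carrier A. a \<otimes> b = b \<otimes> a \<oplus> z \<otimes> d)"

lemma comm_mod_z_sym:
  assumes "a \<in> carrier A" "b \<in> carrier A" "comm_mod_z a b"
  shows "comm_mod_z b a"
proof -
  obtain d where d: "d \<in> carrier A" "a \<otimes> b = b \<otimes> a \<oplus> z \<otimes> d" using assms by (auto simp: comm_mod_z_def)
  have "b \<otimes> a = a \<otimes> b \<oplus> z \<otimes> (\<ominus> d)"
    using assms d by (simp add: d(2) r_minus a_assoc r_neg)
  then show ?thesis using d(1) by (auto simp: comm_mod_z_def)
qed

lemma comm_mod_z_mult:
  assumes "u \<in> carrier A" "v \<in> carrier A" "b \<in> carrier A" "comm_mod_z u b" "comm_mod_z v b"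
  shows "comm_mod_z (u \<otimes> v) b"
proof -
  obtain d where d: "d \<in> carrier A" "u \<otimes> b = b \<otimes> u \<oplus> z \<otimes> d" using assms by (auto simp: comm_mod_z_def)
  obtain e where e: "e \<in> carrier A" "v \<otimes> b = b \<otimes> v \<oplus> z \<otimes> e" using assms by (auto simp: comm_mod_z_def)
  have "u \<otimes> v \<otimes> b = (u \<otimes> b) \<otimes> v \<oplus> (u \<otimes> z) \<otimes> e"
    using assms(1-3) e by (simp add: m_assoc e(2) r_distr)
  also have "\<dots> = b \<otimes> (u \<otimes> v) \<oplus> z \<otimes> (d \<otimes> v \<oplus> u \<otimes> e)"
    using assms(1-3) d e by (simp add: d(2) z_central[symmetric] l_distr r_distr m_assoc a_assoc)
  finally show ?thesis using assms d e by (auto simp: comm_mod_z_def)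
qed

lemma comm_mod_z_inv:
  assumes "u \<in> carrier A" "v \<in> carrier A" "u \<otimes> v = \<one>" "v \<otimes> u = \<one>" "b \<in> carrier A" "comm_mod_z u b"
  shows "comm_mod_z v b"
proof -
  obtain d where d: "d \<in> carrier A" "u \<otimes> b = b \<otimes> u \<oplus> z \<otimes> d" using assms by (auto simp: comm_mod_z_def)
  have "b \<otimes> v = (v \<otimes> u) \<otimes> b \<otimes> v" using assms by simp
  also have "\<dots> = v \<otimes> (u \<otimes> b) \<otimes> v" using assms(1,2,5) by (simp add: m_assoc)
  also have "\<dots> = v \<otimes> b \<otimes> (u \<otimes> v) \<oplus> (v \<otimes> z) \<otimes> (d \<otimes> v)"
    using assms(1,2,5) d by (simp add: d(2) r_distr l_distr m_assoc)
  also have "\<dots> = v \<otimes> b \<oplus> z \<otimes> (v \<otimes> (d \<otimes> v))"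
    using assms d by (simp add: z_central[symmetric] m_assoc)
  finally have "comm_mod_z b v" using assms d by (auto simp: comm_mod_z_def)
  then show ?thesis using assms comm_mod_z_sym by blast
qed

lemma commute_comm_mod_z: "\<lbrakk>a \<in> carrier A; b \<in> carrier A; a \<otimes> b = b \<otimes> a\<rbrakk> \<Longrightarrow> comm_mod_z a b"
  unfolding comm_mod_z_def by (rule bexI[of _ \<zero>]) simp_all

lemma comm_mod_z_all:
  assumes b: "b \<in> carrier A" "comm_mod_z g b" "comm_mod_z h b" and "a \<in> carrier A"
  shows "comm_mod_z a b"
proof -
  have u_b: "comm_mod_z u b" if "u \<in> {g, g', h, h', c, c'}" for u
    using that b comm_mod_z_inv[of g g' b] comm_mod_z_inv[of h h' b] invs c_central[OF b(1)]
    by (auto intro: commute_comm_mod_z)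
  have "comm_mod_z w b" if "w \<in> words" for w
    using that
  proof (induction rule: words.induct)
    case one
    then show ?case using b by (intro commute_comm_mod_z) simp_all
  next
    case (gen u w)
    then have "u \<in> carrier A" "w \<in> carrier A" using words_closed by auto
    then show ?case
      using b(1) u_b[OF gen.hyps(1)] gen.IH by (rule comm_mod_z_mult)
  qed
  moreover have "comm_mod_z (a \<oplus> r \<odot> w) b"
    if "a \<in> carrier A" "comm_mod_z a b" "comm_mod_z w b" "w \<in> carrier A" for a r w
  proof -
    from that obtain d e where "d \<in> carrier A" "a \<otimes> b = b \<otimes> a \<oplus> z \<otimes> d"
        "e \<in> carrier A" "w \<otimes> b = b \<otimes> w \<oplus> z \<otimes> e"
      by (auto simp: comm_mod_z_def)
    then have "(a \<oplus> r \<odot> w) \<otimes> b = b \<otimes> (a \<oplus> r \<odot> w) \<oplus> z \<otimes> (d \<oplus> r \<odot> e)" "d \<oplus> r \<odot> e \<in> carrier A"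
      using that b by (simp_all add: l_distr r_distr smult_mult_l smult_mult_r smult_r_distr a_ac)
    then show ?thesis by (auto simp: comm_mod_z_def)
  qed
  moreover have "comm_mod_z \<zero> b" using b by (intro commute_comm_mod_z) simp_all
  ultimately show ?thesis
    by (rule_tac span[OF assms(4)]) (simp_all add: words_closed)
qed

text \<open>The commutator gh - hg is hg(c - 1), and c - 1 is a multiple of z by
  \<open>half_diff_dvd\<close>.\<close>

lemma g_h_comm: "comm_mod_z g h"
proof -
  obtain a where a: "a \<in> carrier A" "c \<ominus> \<one> = z \<otimes> a"
    using half_diff_dvd[of c c' p] invs pows p two by (auto simp: z_def)
  have "g \<otimes> h = h \<otimes> g \<oplus> h \<otimes> g \<otimes> (c \<ominus> \<one>)"
    by (simp add: gh minus_eq r_distr r_minus a_comm[of "h \<otimes> g"] a_assoc l_neg)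
  also have "\<dots> = h \<otimes> g \<oplus> (h \<otimes> g \<otimes> z) \<otimes> a" using a by (simp add: m_assoc)
  also have "\<dots> = h \<otimes> g \<oplus> z \<otimes> (h \<otimes> g \<otimes> a)"
    using a by (simp add: z_central[symmetric] m_assoc)
  finally show ?thesis using a by (auto simp: comm_mod_z_def)
qed

text \<open>Two passes: every element commutes modulo zA with g and with h; by symmetry g and h then
  commute with an arbitrary b, and so does every element.\<close>

lemma comm_mod_z:
  assumes "a \<in> carrier A" "b \<in> carrier A"
  shows "comm_mod_z a b"
proof -
  have "comm_mod_z d g" "comm_mod_z d h" if "d \<in> carrier A" for d
    using that comm_mod_z_sym[OF _ _ g_h_comm] comm_mod_z_all[of g d] comm_mod_z_all[of h d]
    by (simp_all add: g_h_comm commute_comm_mod_z)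
  then have "comm_mod_z g b" "comm_mod_z h b"
    using assms comm_mod_z_sym[of b g] comm_mod_z_sym[of b h] by simp_all
  then show ?thesis by (rule comm_mod_z_all[OF assms(2) _ _ assms(1)])
qed

end

sublocale heis_spanned \<subseteq> triple_radical A x y z 1 p
proof (intro triple_radical.intro triple_radical_axioms.intro assoc_algebra_axioms)
  fix a assume a: "a \<in> carrier A"
  show "\<exists>b\<in>carrier A. \<exists>c\<in>carrier A. a \<otimes> x = x \<otimes> b \<oplus> z \<otimes> c"
    using comm_mod_z[OF a xyz_closed(1)] a by (auto simp: comm_mod_z_def)
  show "\<exists>b\<in>carrier A. \<exists>c\<in>carrier A. a \<otimes> y = y \<otimes> b \<oplus> z \<otimes> c"
    using comm_mod_z[OF a xyz_closed(2)] a by (auto simp: comm_mod_z_def)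
  show "\<exists>b\<in>carrier A. a \<otimes> z = z \<otimes> b"
    using z_central[OF a] a by (intro bexI[of _ a]) simp_all
next
  show "\<exists>c\<in>carrier A. y \<otimes> x = 1 \<odot> (x \<otimes> y) \<oplus> z \<otimes> c"
    using comm_mod_z[OF xyz_closed(2,1)] by (simp add: comm_mod_z_def)
  show "x [^] p = \<zero>" "y [^] p = \<zero>" "z [^] p = \<zero>"
    unfolding x_def y_def z_def by (intro half_diff_pow; simp add: invs pows p)+
qed (simp_all add: z_central)

section \<open>The radical of a Heisenberg algebra and its lowest powers\<close>

context heis_spanned
begin

text \<open>By uw - 1 = u(w - 1) + (u - 1) it suffices to treat the generators, where
  \<open>half_diff_dvd\<close> applies.\<close>

lemma word_minus_one_in_rad:
  assumes "w \<in> words"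
  shows "w \<ominus> \<one> \<in> rad"
proof -
  have inv: "v \<ominus> \<one> \<in> rad" if "u \<ominus> \<one> \<in> rad" "u \<in> carrier A" "v \<in> carrier A" "v \<otimes> u = \<one>" for u v
  proof -
    have "(\<ominus> v) \<otimes> (u \<ominus> \<one>) \<in> rad" using that by (intro rad_lmult) auto
    also have "(\<ominus> v) \<otimes> (u \<ominus> \<one>) = v \<ominus> v \<otimes> u"
      using that(2,3) by (simp add: minus_eq r_distr r_minus l_minus a_comm)
    finally show ?thesis using that(4) by simp
  qed
  have "g \<ominus> \<one> \<in> rad" "h \<ominus> \<one> \<in> rad" "c \<ominus> \<one> \<in> rad"
    using half_diff_dvd[of g g' p] half_diff_dvd[of h h' p] half_diff_dvd[of c c' p]
      invs pows p two rad_gens(1-3) by (auto simp: x_def y_def z_def)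
  then have u_rad: "u \<ominus> \<one> \<in> rad" if "u \<in> {g, g', h, h', c, c'}" for u
    using that inv invs by auto
  show ?thesis
    using assms
  proof (induction rule: words.induct)
    case one
    then show ?case using rad_gens(1)[of \<zero>] by (simp add: minus_eq r_neg)
  next
    case (gen u w)
    then have uw: "u \<in> carrier A" "w \<in> carrier A" using words_closed by auto
    have "u \<otimes> (w \<ominus> \<one>) \<oplus> (u \<ominus> \<one>) \<in> rad"
      using gen.IH uw u_rad[OF gen.hyps(1)] by (intro rad_add rad_lmult)
    also have "u \<otimes> (w \<ominus> \<one>) \<oplus> (u \<ominus> \<one>) = u \<otimes> w \<ominus> \<one>"
      using uw by (simp add: minus_eq r_distr r_minus a_assoc r_neg1 r_neg2)
    finally show ?case .
  qed
qed

lemma scalar_mod_rad: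
  assumes "a \<in> carrier A"
  shows "\<exists>r. a \<ominus> r \<odot> \<one> \<in> rad"
proof (rule span[OF assms])
  show "\<exists>r. \<zero> \<ominus> r \<odot> \<one> \<in> rad"
    using rad_gens(1)[of \<zero>] by (intro exI[of _ 0]) (simp add: minus_eq)
  fix b s w assume b: "b \<in> carrier A" "\<exists>r. b \<ominus> r \<odot> \<one> \<in> rad" and w: "w \<in> words"
  then obtain r where r: "b \<ominus> r \<odot> \<one> \<in> rad" by blast
  have wc: "w \<in> carrier A" using w by (rule words_closed)
  have "(s \<odot> \<one>) \<otimes> (w \<ominus> \<one>) \<in> rad" using word_minus_one_in_rad[OF w] by (intro rad_lmult) auto
  then have "(b \<ominus> r \<odot> \<one>) \<oplus> s \<odot> (w \<ominus> \<one>) \<in> rad"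
    using r wc by (intro rad_add) (simp_all add: smult_mult_l)
  also have "(b \<ominus> r \<odot> \<one>) \<oplus> s \<odot> (w \<ominus> \<one>) = (b \<oplus> s \<odot> w) \<ominus> (r + s) \<odot> \<one>"
    using b wc by (simp add: minus_eq smult_r_distr smult_l_distr smult_minus_r minus_add a_ac)
  finally show "\<exists>r. (b \<oplus> s \<odot> w) \<ominus> r \<odot> \<one> \<in> rad" by blast
qed

lemma one_notin_rad: "\<one> \<notin> rad"
  using idempotent_in_rad[of \<one>] nontrivial by auto

text \<open>Every element is a scalar modulo \<open>rad\<close>, so the quotient is k and
  \<open>rad\<close> itself is a maximal left ideal; the annihilator criterion is used with
  \<epsilon> = 1.\<close>

lemma heis_jacobson: "jacobson_radical A = rad"
proof (rule jacobson_radical_eq_rad)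
  let ?L = "{a \<in> carrier A. a \<otimes> \<one> \<in> rad}"
  show "{?L} \<noteq> {}" by simp
  show "\<Inter>{?L} \<subseteq> rad" by auto
  fix L assume "L \<in> {?L}"
  moreover have "maximal_left_ideal ?L A"
  proof (rule maximal_left_ideal_annihilator[OF rad_ideal])
    fix b assume b: "b \<in> carrier A" "b \<otimes> \<one> \<notin> rad"
    obtain r where r: "b \<ominus> r \<odot> \<one> \<in> rad" using scalar_mod_rad[OF b(1)] by blast
    have "r \<noteq> 0" using r b by (auto simp: minus_eq)
    have "((1 / r) \<odot> \<one>) \<otimes> (b \<ominus> r \<odot> \<one>) \<in> rad" using r by (intro rad_lmult) auto
    also have "((1 / r) \<odot> \<one>) \<otimes> (b \<ominus> r \<odot> \<one>) = ((1 / r) \<odot> \<one>) \<otimes> (b \<otimes> \<one>) \<ominus> \<one>"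
      using b \<open>r \<noteq> 0\<close> by (simp add: smult_mult_l smult_diff smult_smult)
    finally show "\<exists>a\<in>carrier A. a \<otimes> (b \<otimes> \<one>) \<ominus> \<one> \<in> rad"
      by (intro bexI[of _ "(1 / r) \<odot> \<one>"]) auto
  qed (simp_all add: one_notin_rad)
  ultimately show "maximal_left_ideal L A" by blast
qed

end

sublocale heis_spanned \<subseteq> radical_algebra A
  by (intro radical_algebra.intro radical_algebra_axioms.intro assoc_algebra_axioms)
    (simp add: heis_jacobson rad_ideal)

context heis_spanned
begin

lemma gen_minus_one: "g \<ominus> \<one> \<in> J 1" "h \<ominus> \<one> \<in> J 1" "g' \<ominus> \<one> \<in> J 1" "h' \<ominus> \<one> \<in> J 1" "c' \<ominus> \<one> \<in> J 1"
  unfolding radical_power_one heis_jacobson using word_minus_one_in_rad words_gens by auto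

text \<open>Up to the unit hg, c - 1 is the commutator of g and h, which is also the commutator of
  the radical elements g - 1 and h - 1.\<close>

lemma c_minus_one: "c \<ominus> \<one> \<in> J 2"
proof -
  have "(g \<ominus> \<one>) \<otimes> (h \<ominus> \<one>) \<ominus> (h \<ominus> \<one>) \<otimes> (g \<ominus> \<one>) \<in> J (1 + 1)"
    by (intro radical_power_minus[OF radical_power_mult radical_power_mult] gen_minus_one)
  moreover have "(g \<ominus> \<one>) \<otimes> (h \<ominus> \<one>) \<ominus> (h \<ominus> \<one>) \<otimes> (g \<ominus> \<one>) = g \<otimes> h \<ominus> h \<otimes> g"
    by (rule commutator_minus_one) simp_all
  moreover have "g' \<otimes> (h' \<otimes> (g \<otimes> h \<ominus> h \<otimes> g)) = c \<ominus> \<one>"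
  proof -
    have "g' \<otimes> (h' \<otimes> (h \<otimes> g \<otimes> a)) = a" if "a \<in> carrier A" for a
    proof -
      have "g' \<otimes> (h' \<otimes> (h \<otimes> g \<otimes> a)) = g' \<otimes> ((h' \<otimes> h) \<otimes> (g \<otimes> a))" using that by (simp add: m_assoc)
      also have "\<dots> = g' \<otimes> (g \<otimes> a)" using that by (simp add: invs)
      also have "\<dots> = (g' \<otimes> g) \<otimes> a" using that by (simp add: m_assoc)
      finally show ?thesis using that invs by simp
    qed
    moreover have "g \<otimes> h \<ominus> h \<otimes> g = h \<otimes> g \<otimes> (c \<ominus> \<one>)"
      by (simp add: gh minus_eq r_distr r_minus)
    ultimately show ?thesis by simp
  qed
  ultimately show ?thesis
    by (metis radical_power_lmult gens one_add_one)
qed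

lemma z_in_radical_power: "z \<in> J 2" and z_approx: "z \<ominus> (c \<ominus> \<one>) \<in> J 3"
  and x_approx: "x \<ominus> (g \<ominus> \<one>) \<in> J 2" and y_approx: "y \<ominus> (h \<ominus> \<one>) \<in> J 2"
proof -
  show "z \<in> J 2"
    unfolding z_def using invs
    by (subst half_diff_factor) (auto intro: radical_power_rmult c_minus_one)
  have "(c \<ominus> \<one>) \<otimes> ((1 / 2) \<odot> (c' \<ominus> \<one>)) \<in> J (2 + 1)"
    by (intro radical_power_mult c_minus_one radical_power_smult gen_minus_one)
  then show "z \<ominus> (c \<ominus> \<one>) \<in> J 3"
    unfolding z_def using invs two by (subst half_diff_approx) (auto simp del: One_nat_def)
  have "(g \<ominus> \<one>) \<otimes> ((1 / 2) \<odot> (g' \<ominus> \<one>)) \<in> J (1 + 1)"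
    by (intro radical_power_mult radical_power_smult gen_minus_one)
  then show "x \<ominus> (g \<ominus> \<one>) \<in> J 2"
    unfolding x_def using invs two by (subst half_diff_approx) (auto simp del: One_nat_def)
  have "(h \<ominus> \<one>) \<otimes> ((1 / 2) \<odot> (h' \<ominus> \<one>)) \<in> J (1 + 1)"
    by (intro radical_power_mult radical_power_smult gen_minus_one)
  then show "y \<ominus> (h \<ominus> \<one>) \<in> J 2"
    unfolding y_def using invs two by (subst half_diff_approx) (auto simp del: One_nat_def)
qed

lemma radical_power_diff_trans:
  assumes "u \<ominus> v \<in> J n" "v \<ominus> w \<in> J n" "u \<in> carrier A" "v \<in> carrier A" "w \<in> carrier A"
  shows "u \<ominus> w \<in> J n"
proof -
  have "u \<ominus> w = (u \<ominus> v) \<oplus> (v \<ominus> w)"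
    using assms(3-5) by (simp add: minus_eq a_assoc r_neg1 r_neg2)
  then show ?thesis using radical_power_plus[OF assms(1,2)] by simp
qed

lemma radical_power_diff_mult:
  assumes "u \<ominus> u' \<in> J 2" "v \<ominus> v' \<in> J 2" "u' \<in> J 1" "v \<in> J 1" "u \<in> carrier A" "v' \<in> carrier A"
  shows "u \<otimes> v \<ominus> u' \<otimes> v' \<in> J 3"
proof -
  have c: "u' \<in> carrier A" "v \<in> carrier A" using assms radical_power_closed by blast+
  have "(u \<ominus> u') \<otimes> v \<in> J (2 + 1)" "u' \<otimes> (v \<ominus> v') \<in> J (1 + 2)"
    by (intro radical_power_mult assms)+
  then have "(u \<ominus> u') \<otimes> v \<oplus> u' \<otimes> (v \<ominus> v') \<in> J 3"
    by (intro radical_power_plus) (simp_all del: One_nat_def)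
  moreover have "(u \<ominus> u') \<otimes> v \<oplus> u' \<otimes> (v \<ominus> v') = u \<otimes> v \<ominus> u' \<otimes> v'"
    using assms(5,6) c by (simp add: minus_eq l_distr r_distr l_minus r_minus a_assoc r_neg1 r_neg2)
  ultimately show ?thesis by simp
qed

text \<open>Modulo \<open>J 3\<close>, xy - yx agrees with the commutator of g - 1 and h - 1, which
  is hg(c - 1); as hg - 1 is in the radical and c - 1 in \<open>J 2\<close>, this agrees with c - 1
  and so with z.\<close>

lemma commutator_approx: "(x \<otimes> y \<ominus> y \<otimes> x) \<ominus> z \<in> J 3"
proof -
  have xy1: "x \<in> J 1" "y \<in> J 1"
    unfolding radical_power_one heis_jacobson by (rule rad_gens)+
  let ?a = "g \<ominus> \<one>" and ?b = "h \<ominus> \<one>" and ?c = "c \<ominus> \<one>"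
  have "x \<otimes> y \<ominus> ?a \<otimes> ?b \<in> J 3" "y \<otimes> x \<ominus> ?b \<otimes> ?a \<in> J 3"
    by (rule radical_power_diff_mult; simp add: x_approx y_approx gen_minus_one xy1 del: One_nat_def)+
  then have "(x \<otimes> y \<ominus> ?a \<otimes> ?b) \<ominus> (y \<otimes> x \<ominus> ?b \<otimes> ?a) \<in> J 3"
    by (rule radical_power_minus)
  also have "(x \<otimes> y \<ominus> ?a \<otimes> ?b) \<ominus> (y \<otimes> x \<ominus> ?b \<otimes> ?a) =
      (x \<otimes> y \<ominus> y \<otimes> x) \<ominus> (?a \<otimes> ?b \<ominus> ?b \<otimes> ?a)"
    by (simp add: minus_eq[of "_ \<otimes> _"] minus_eq[of "_ \<oplus> _"] minus_add minus_minus a_ac)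
  also have "?a \<otimes> ?b \<ominus> ?b \<otimes> ?a = g \<otimes> h \<ominus> h \<otimes> g"
    by (rule commutator_minus_one) simp_all
  also have "g \<otimes> h \<ominus> h \<otimes> g = h \<otimes> g \<otimes> ?c"
    by (simp add: gh minus_eq r_distr r_minus)
  finally have 1: "(x \<otimes> y \<ominus> y \<otimes> x) \<ominus> h \<otimes> g \<otimes> ?c \<in> J 3" .
  have "h \<otimes> g \<in> words" using words_gens by (intro words_mult) auto
  then have "(h \<otimes> g \<ominus> \<one>) \<in> J 1"
    unfolding radical_power_one heis_jacobson by (rule word_minus_one_in_rad)
  then have "(h \<otimes> g \<ominus> \<one>) \<otimes> ?c \<in> J (1 + 2)"
    by (rule radical_power_mult[OF _ c_minus_one])
  moreover have "(h \<otimes> g \<ominus> \<one>) \<otimes> ?c = h \<otimes> g \<otimes> ?c \<ominus> ?c"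
    by (simp add: minus_eq[of "h \<otimes> g"] l_distr l_minus) (simp add: minus_eq)
  ultimately have 2: "h \<otimes> g \<otimes> ?c \<ominus> ?c \<in> J 3" by (simp del: One_nat_def)
  have "\<ominus> (z \<ominus> ?c) \<in> J 3" by (rule radical_power_uminus[OF z_approx])
  then have 3: "?c \<ominus> z \<in> J 3"
    by (simp add: minus_eq minus_add minus_minus a_comm)
  show ?thesis
    by (rule radical_power_diff_trans[OF 1 radical_power_diff_trans[OF 2 3]]) simp_all
qed

end

section \<open>Matrix algebras over skew triples\<close>

lemma (in ring) basic_idempotent_one:
  assumes "primitive_idempotent R \<one>"
  shows "basic_idempotent R \<one>"
proof -
  have "isomorphic_projectives R \<one> \<one>"
    by (rule isomorphic_projectives_conj[of \<one> \<one>]) simp_all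
  then show ?thesis
    using assms unfolding basic_idempotent_def
    by (intro exI[of _ "{\<one>}"]) (auto simp: complete_primitive_idempotents_def)
qed

lemma (in ring) basic_idempotent_pair:
  assumes prim: "primitive_idempotent R a" "primitive_idempotent R b"
    and sum: "a \<oplus> b = \<one>" and iso: "isomorphic_projectives R b a"
  shows "basic_idempotent R a"
proof -
  have a: "a \<in> carrier R" "a \<otimes> a = a" "a \<noteq> \<zero>" and b: "b \<in> carrier R"
    using prim by (auto simp: primitive_idempotent_def idempotent_def)
  have b_eq: "b = \<one> \<ominus> a"
    using a(1) b by (simp add: sum[symmetric] minus_eq a_comm[of a] a_assoc r_neg)
  have orth: "a \<otimes> b = \<zero>" "b \<otimes> a = \<zero>"
    unfolding b_eq using a by (simp_all add: minus_eq l_distr r_distr l_minus r_minus r_neg)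
  then have "a \<noteq> b" using a by auto
  have refl: "isomorphic_projectives R a a"
    by (rule isomorphic_projectives_conj[of \<one> \<one>]) (simp_all add: a)
  have "(\<Oplus>f\<in>{a, b}. f) = a \<oplus> b"
    using a b \<open>a \<noteq> b\<close> by (simp add: finsum_insert)
  then have "complete_primitive_idempotents R {a, b}"
    using prim orth sum by (auto simp: complete_primitive_idempotents_def orthogonal_def)
  then show ?thesis
    unfolding basic_idempotent_def using iso refl a(1)
    by (intro exI[of _ "{a, b}"] exI[of _ "{a}"]) auto
qed

text \<open>S and T satisfy the relations of the quaternion algebra, commute with the triple and
  span the algebra modulo \<open>rad\<close>. Once -1 has a square root in k, they generate a copy
  of the 2 by 2 matrices.\<close>

locale block_algebra = triple_radical A x y z "- 1" p
  for A :: "('k::field, 'a) module" (structure) and x y z p +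
  fixes S T :: 'a
  assumes ST [simp]: "S \<in> carrier A" "T \<in> carrier A"
    and SS: "S \<otimes> S = \<ominus> \<one>" and TT: "T \<otimes> T = \<ominus> \<one>" and TS: "T \<otimes> S = \<ominus> (S \<otimes> T)"
    and S_comm: "S \<otimes> x = x \<otimes> S" "S \<otimes> y = y \<otimes> S" "S \<otimes> z = z \<otimes> S"
    and T_comm: "T \<otimes> x = x \<otimes> T" "T \<otimes> y = y \<otimes> T" "T \<otimes> z = z \<otimes> T"
    and quaternion_span: "a \<in> carrier A \<Longrightarrow>
      \<exists>\<alpha> \<beta> \<gamma> \<delta>. a \<ominus> (\<alpha> \<odot> \<one> \<oplus> (\<beta> \<odot> S \<oplus> (\<gamma> \<odot> T \<oplus> \<delta> \<odot> (S \<otimes> T)))) \<in> rad"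
    and two: "(2 :: 'k) \<noteq> 0" and nontrivial: "\<one> \<noteq> \<zero>"
begin

text \<open>For \<iota>^2 = -1 this is the idempotent projecting onto the eigenspace on which S acts
  as -\<iota>. The complementary idempotent is \<open>eps (- \<iota>)\<close>, and T interchanges
  the two.\<close>

definition eps :: "'k \<Rightarrow> 'a" where
  "eps \<iota> = (1 / 2) \<odot> (\<one> \<oplus> \<iota> \<odot> S)"

lemma eps_closed [simp]: "eps \<iota> \<in> carrier A"
  by (simp add: eps_def)

lemma S_eps: "\<iota> * \<iota> = - 1 \<Longrightarrow> S \<otimes> eps \<iota> = (- \<iota>) \<odot> eps \<iota>"
  by (simp add: eps_def smult_mult_r r_distr SS smult_r_distr smult_minus_r smult_minus_l smult_smult
      minus_minus mult.commute a_comm)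

lemma eps_comm: "u \<in> carrier A \<Longrightarrow> S \<otimes> u = u \<otimes> S \<Longrightarrow> eps \<iota> \<otimes> u = u \<otimes> eps \<iota>"
  by (simp add: eps_def smult_mult_r smult_mult_l r_distr l_distr)

lemma half_add: "a \<in> carrier A \<Longrightarrow> (1 / 2) \<odot> (a \<oplus> a) = a"
  using two smult_l_distr[of a "1 / 2" "1 / 2"] by (simp add: smult_r_distr)

lemma eps_idem:
  assumes "\<iota> * \<iota> = - 1"
  shows "eps \<iota> \<otimes> eps \<iota> = eps \<iota>"
proof -
  have "eps \<iota> \<otimes> eps \<iota> = (1 / 2) \<odot> (eps \<iota> \<oplus> \<iota> \<odot> (S \<otimes> eps \<iota>))"
    by (subst eps_def) (simp add: smult_mult_l l_distr)
  also have "\<iota> \<odot> (S \<otimes> eps \<iota>) = eps \<iota>"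
    using assms by (simp add: S_eps smult_smult)
  finally show ?thesis by (simp add: half_add)
qed

lemma T_eps: "T \<otimes> eps \<iota> = eps (- \<iota>) \<otimes> T"
  by (simp add: eps_def smult_mult_r smult_mult_l r_distr l_distr l_minus TS smult_minus_l smult_minus_r)

lemma eps_sum: "eps \<iota> \<oplus> eps (- \<iota>) = \<one>"
proof -
  have "eps \<iota> \<oplus> eps (- \<iota>) = (1 / 2) \<odot> (\<one> \<oplus> (\<iota> \<odot> S \<oplus> (\<one> \<oplus> \<ominus> (\<iota> \<odot> S))))"
    by (simp add: eps_def smult_minus_l smult_r_distr[symmetric] a_assoc)
  also have "\<iota> \<odot> S \<oplus> (\<one> \<oplus> \<ominus> (\<iota> \<odot> S)) = \<one>"
    by (simp add: a_comm[of \<one>] r_neg1 r_neg2 a_assoc[symmetric] r_neg)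
  finally show ?thesis by (simp add: half_add)
qed

lemma eps_neg: "eps (- \<iota>) = \<one> \<ominus> eps \<iota>"
  using eps_sum[of \<iota>] by (simp add: eps_sum[of \<iota>, symmetric] minus_eq a_comm[of "eps \<iota>"] a_assoc r_neg)

lemma eps_orth: "\<iota> * \<iota> = - 1 \<Longrightarrow> eps \<iota> \<otimes> eps (- \<iota>) = \<zero>"
  by (simp add: eps_neg minus_eq r_distr r_minus eps_idem r_neg)

lemma eps_T_eps:
  assumes "\<iota> * \<iota> = - 1"
  shows "eps \<iota> \<otimes> (T \<otimes> eps \<iota>) = \<zero>"
proof -
  have "eps \<iota> \<otimes> (eps (- \<iota>) \<otimes> T) = (eps \<iota> \<otimes> eps (- \<iota>)) \<otimes> T"
    by (simp add: m_assoc)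
  then show ?thesis using assms by (simp add: T_eps eps_orth)
qed

lemma eps_neq_zero: "eps \<iota> \<noteq> \<zero>"
proof
  assume "eps \<iota> = \<zero>"
  then have "eps (- \<iota>) = \<one>" "T \<otimes> eps \<iota> = \<zero>" by (simp_all add: eps_neg minus_eq)
  then have "T = \<zero>" using T_eps[of \<iota>] by simp
  then have "\<ominus> \<one> = \<zero>" using TT by simp
  then show False using nontrivial by (metis minus_minus minus_zero one_closed)
qed

lemma eps_notin_rad: "\<iota> * \<iota> = - 1 \<Longrightarrow> eps \<iota> \<notin> rad"
  using idempotent_in_rad[of "eps \<iota>"] eps_neq_zero eps_idem by blast

text \<open>Modulo the radical the left module generated by \<open>eps \<iota>\<close> is spanned by
  it and its image under T, because S acts on these two by the scalars -\<iota> and \<iota>.\<close>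

lemma mult_eps_mod_rad:
  assumes \<iota>: "\<iota> * \<iota> = (- 1 :: 'k)" and b: "b \<in> carrier A"
  shows "\<exists>\<alpha> \<beta>. b \<otimes> eps \<iota> \<ominus> (\<alpha> \<odot> eps \<iota> \<oplus> \<beta> \<odot> (T \<otimes> eps \<iota>)) \<in> rad"
proof -
  let ?e = "eps \<iota>"
  obtain \<alpha> \<beta> \<gamma> \<delta> where r: "b \<ominus> (\<alpha> \<odot> \<one> \<oplus> (\<beta> \<odot> S \<oplus> (\<gamma> \<odot> T \<oplus> \<delta> \<odot> (S \<otimes> T)))) \<in> rad"
    using quaternion_span[OF b] by blast
  have "S \<otimes> (T \<otimes> ?e) = \<ominus> (T \<otimes> (S \<otimes> ?e))"
    using TS by (simp add: m_assoc[symmetric] l_minus)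
  then have STe: "S \<otimes> (T \<otimes> ?e) = \<iota> \<odot> (T \<otimes> ?e)"
    by (simp add: S_eps[OF \<iota>] smult_mult_r smult_minus_l r_minus minus_minus)
  have "(b \<ominus> (\<alpha> \<odot> \<one> \<oplus> (\<beta> \<odot> S \<oplus> (\<gamma> \<odot> T \<oplus> \<delta> \<odot> (S \<otimes> T))))) \<otimes> ?e \<in> rad"
    by (rule rad_rmult[OF r]) simp
  also have "(b \<ominus> (\<alpha> \<odot> \<one> \<oplus> (\<beta> \<odot> S \<oplus> (\<gamma> \<odot> T \<oplus> \<delta> \<odot> (S \<otimes> T))))) \<otimes> ?e =
      b \<otimes> ?e \<ominus> (\<alpha> \<odot> ?e \<oplus> ((\<beta> * (- \<iota>)) \<odot> ?e \<oplus> (\<gamma> \<odot> (T \<otimes> ?e) \<oplus> (\<delta> * \<iota>) \<odot> (T \<otimes> ?e))))"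
    using b by (simp add: minus_eq l_distr l_minus smult_mult_l m_assoc STe S_eps[OF \<iota>] smult_smult)
  also have "\<alpha> \<odot> ?e \<oplus> ((\<beta> * (- \<iota>)) \<odot> ?e \<oplus> (\<gamma> \<odot> (T \<otimes> ?e) \<oplus> (\<delta> * \<iota>) \<odot> (T \<otimes> ?e))) =
      (\<alpha> + \<beta> * (- \<iota>)) \<odot> ?e \<oplus> (\<gamma> + \<delta> * \<iota>) \<odot> (T \<otimes> ?e)"
    by (simp only: smult_l_distr a_assoc a_closed eps_closed m_closed smult_closed ST)
  finally show ?thesis by blast
qed

lemma eps_local:
  assumes \<iota>: "\<iota> * \<iota> = (- 1 :: 'k)" and a: "a \<in> carrier A"
  shows "\<exists>r. eps \<iota> \<otimes> a \<otimes> eps \<iota> \<ominus> r \<odot> eps \<iota> \<in> rad"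
proof -
  let ?e = "eps \<iota>"
  obtain \<alpha> \<beta> where r: "a \<otimes> ?e \<ominus> (\<alpha> \<odot> ?e \<oplus> \<beta> \<odot> (T \<otimes> ?e)) \<in> rad"
    using mult_eps_mod_rad[OF assms] by blast
  have "?e \<otimes> (a \<otimes> ?e \<ominus> (\<alpha> \<odot> ?e \<oplus> \<beta> \<odot> (T \<otimes> ?e))) \<in> rad"
    by (rule rad_lmult[OF r]) simp
  also have "?e \<otimes> (a \<otimes> ?e \<ominus> (\<alpha> \<odot> ?e \<oplus> \<beta> \<odot> (T \<otimes> ?e))) = ?e \<otimes> a \<otimes> ?e \<ominus> \<alpha> \<odot> ?e"
    using a by (simp add: minus_eq r_distr r_minus smult_mult_r eps_idem[OF \<iota>] eps_T_eps[OF \<iota>] m_assoc)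
  finally show ?thesis by blast
qed

text \<open>The module A\<epsilon> modulo the radical is simple with basis \<epsilon>, T\<epsilon>.
  From \<alpha>\<epsilon> + \<beta>T\<epsilon> one recovers \<epsilon> with \<epsilon>/\<alpha>,
  which kills T\<epsilon>, if \<alpha> is nonzero, and otherwise with -T/\<beta>, since T^2 =
  -1.\<close>

lemma eps_maximal_left_ideal:
  assumes \<iota>: "\<iota> * \<iota> = (- 1 :: 'k)"
  shows "maximal_left_ideal {a \<in> carrier A. a \<otimes> eps \<iota> \<in> rad} A"
proof (rule maximal_left_ideal_annihilator[OF rad_ideal eps_closed eps_idem[OF \<iota>] eps_notin_rad[OF \<iota>]])
  let ?e = "eps \<iota>"
  fix b assume b: "b \<in> carrier A" "b \<otimes> ?e \<notin> rad"
  obtain \<alpha> \<beta> where r: "b \<otimes> ?e \<ominus> (\<alpha> \<odot> ?e \<oplus> \<beta> \<odot> (T \<otimes> ?e)) \<in> rad"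
    using mult_eps_mod_rad[OF \<iota> b(1)] by blast
  show "\<exists>a\<in>carrier A. a \<otimes> (b \<otimes> ?e) \<ominus> ?e \<in> rad"
  proof (cases "\<alpha> = 0")
    case False
    let ?a = "(1 / \<alpha>) \<odot> ?e"
    have "?a \<otimes> (b \<otimes> ?e \<ominus> (\<alpha> \<odot> ?e \<oplus> \<beta> \<odot> (T \<otimes> ?e))) \<in> rad"
      by (rule rad_lmult[OF r]) simp
    also have "?a \<otimes> (b \<otimes> ?e \<ominus> (\<alpha> \<odot> ?e \<oplus> \<beta> \<odot> (T \<otimes> ?e))) = ?a \<otimes> (b \<otimes> ?e) \<ominus> ?e"
      using b False
      by (simp add: minus_eq r_distr r_minus smult_mult_r smult_mult_l eps_idem[OF \<iota>] eps_T_eps[OF \<iota>]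
          smult_smult)
    finally show ?thesis by (intro bexI[of _ ?a]) simp_all
  next
    case True
    have "\<beta> \<noteq> 0"
    proof
      assume "\<beta> = 0"
      then show False using r b True by (simp add: minus_eq)
    qed
    let ?a = "(- 1 / \<beta>) \<odot> T"
    have TTe: "T \<otimes> (T \<otimes> ?e) = \<ominus> ?e" using TT by (simp add: m_assoc[symmetric] l_minus)
    have "?a \<otimes> (b \<otimes> ?e \<ominus> (\<alpha> \<odot> ?e \<oplus> \<beta> \<odot> (T \<otimes> ?e))) \<in> rad"
      by (rule rad_lmult[OF r]) simp
    also have "?a \<otimes> (b \<otimes> ?e \<ominus> (\<alpha> \<odot> ?e \<oplus> \<beta> \<odot> (T \<otimes> ?e))) = ?a \<otimes> (b \<otimes> ?e) \<ominus> ?e"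
    proof -
      have "?a \<otimes> (\<alpha> \<odot> ?e \<oplus> \<beta> \<odot> (T \<otimes> ?e)) = ((- 1 / \<beta>) * \<beta>) \<odot> (\<ominus> ?e)"
        using True by (simp add: smult_mult_r smult_mult_l TTe smult_smult mult.commute)
      also have "\<dots> = ?e" using \<open>\<beta> \<noteq> 0\<close> by (simp add: smult_minus_one minus_minus)
      finally have "?a \<otimes> (\<alpha> \<odot> ?e \<oplus> \<beta> \<odot> (T \<otimes> ?e)) = ?e" .
      then show ?thesis using b by (simp add: minus_eq r_distr r_minus del: smult_mult_l)
    qed
    finally show ?thesis by (intro bexI[of _ ?a]) simp_all
  qed
qed

text \<open>The two idempotents \<open>eps \<iota>\<close> and \<open>eps (- \<iota>)\<close> add up
  to 1, so an element in both annihilators lies in \<open>rad\<close>.\<close>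

lemma block_jacobson:
  assumes \<iota>: "\<iota> * \<iota> = (- 1 :: 'k)"
  shows "jacobson_radical A = rad"
proof (rule jacobson_radical_eq_rad)
  let ?L = "\<lambda>\<iota>. {a \<in> carrier A. a \<otimes> eps \<iota> \<in> rad}"
  show "{?L \<iota>, ?L (- \<iota>)} \<noteq> {}" by simp
  show "maximal_left_ideal L A" if "L \<in> {?L \<iota>, ?L (- \<iota>)}" for L
    using that eps_maximal_left_ideal[of \<iota>] eps_maximal_left_ideal[of "- \<iota>"] \<iota> by auto
  show "\<Inter>{?L \<iota>, ?L (- \<iota>)} \<subseteq> rad"
  proof
    fix a assume "a \<in> \<Inter>{?L \<iota>, ?L (- \<iota>)}"
    then have a: "a \<in> carrier A" "a \<otimes> eps \<iota> \<in> rad" "a \<otimes> eps (- \<iota>) \<in> rad" by auto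
    have "a \<otimes> (eps \<iota> \<oplus> eps (- \<iota>)) \<in> rad"
      using rad_add[OF a(2,3)] a(1) by (simp add: r_distr)
    then show "a \<in> rad" using a(1) by (simp add: eps_sum)
  qed
qed

text \<open>A central f acts on \<epsilon> as a scalar r modulo the radical. Conjugation by T gives
  the same r on the complementary idempotent, so f is r modulo the radical. Then r is 0 or 1, and f
  or 1 - f is an idempotent in a nil ideal.\<close>

lemma central_idempotent_trivial:
  assumes \<iota>: "\<iota> * \<iota> = (- 1 :: 'k)" and f: "f \<in> carrier A" "f \<otimes> f = f"
    and central: "\<And>a. a \<in> carrier A \<Longrightarrow> f \<otimes> a = a \<otimes> f"
  shows "f = \<zero> \<or> f = \<one>"
proof -
  let ?e = "eps \<iota>" and ?e' = "eps (- \<iota>)"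
  obtain r where "?e \<otimes> f \<otimes> ?e \<ominus> r \<odot> ?e \<in> rad" using eps_local[OF \<iota> f(1)] by blast
  moreover have "?e \<otimes> f \<otimes> ?e = f \<otimes> ?e"
    using f(1) central[of ?e] by (simp add: m_assoc eps_idem[OF \<iota>] flip: central)
  ultimately have fe: "f \<otimes> ?e \<ominus> r \<odot> ?e \<in> rad" by simp
  have "T \<otimes> (f \<otimes> ?e \<ominus> r \<odot> ?e) \<otimes> (\<ominus> T) \<in> rad"
    by (intro rad_rmult rad_lmult fe) simp_all
  also have "T \<otimes> (f \<otimes> ?e \<ominus> r \<odot> ?e) \<otimes> (\<ominus> T) = f \<otimes> ?e' \<ominus> r \<odot> ?e'"
  proof -
    have TeT: "T \<otimes> ?e \<otimes> (\<ominus> T) = ?e'"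
      by (simp add: T_eps m_assoc r_minus TT minus_minus)
    have "T \<otimes> (f \<otimes> ?e \<ominus> r \<odot> ?e) \<otimes> (\<ominus> T) = f \<otimes> (T \<otimes> ?e \<otimes> (\<ominus> T)) \<ominus> r \<odot> (T \<otimes> ?e \<otimes> (\<ominus> T))"
    proof -
      have "T \<otimes> (f \<otimes> ?e) = f \<otimes> (T \<otimes> ?e)" using f(1) central[of T] by (simp flip: m_assoc)
      then show ?thesis
        using f(1) by (simp add: minus_eq r_distr l_distr r_minus l_minus smult_mult_r smult_mult_l m_assoc
            smult_minus_r minus_add minus_minus)
    qed
    then show ?thesis by (simp add: TeT)
  qed
  finally have fe': "f \<otimes> ?e' \<ominus> r \<odot> ?e' \<in> rad" .
  have "(f \<otimes> ?e \<ominus> r \<odot> ?e) \<oplus> (f \<otimes> ?e' \<ominus> r \<odot> ?e') = f \<otimes> (?e \<oplus> ?e') \<ominus> r \<odot> (?e \<oplus> ?e')"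
    using f(1) by (simp add: minus_eq r_distr smult_r_distr minus_add a_ac)
  then have fr: "f \<ominus> r \<odot> \<one> \<in> rad"
    using rad_add[OF fe fe'] f(1) by (simp add: eps_sum)
  define d where "d = f \<ominus> r \<odot> \<one>"
  have d: "d \<in> rad" "d \<in> carrier A" "f = d \<oplus> r \<odot> \<one>"
    using fr f(1) by (simp_all add: d_def minus_eq a_assoc l_neg)
  \<comment> \<open>By f^2 = f the product (f - r)(f + r - 1) is the scalar r - r^2, which therefore
    lies in the radical.\<close>
  have "d \<otimes> (f \<oplus> (r - 1) \<odot> \<one>) \<in> rad" using d f(1) by (intro rad_rmult) auto
  also have "d \<otimes> (f \<oplus> (r - 1) \<odot> \<one>) = (r - r * r) \<odot> \<one>"
  proof -
    have "d \<otimes> (f \<oplus> (r - 1) \<odot> \<one>) = d \<otimes> f \<oplus> (r - 1) \<odot> d"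
      using d f(1) by (simp add: r_distr smult_mult_r)
    also have "d \<otimes> f = f \<ominus> r \<odot> f"
      using f by (simp add: d_def minus_eq l_distr l_minus smult_mult_l)
    also have "(r - 1) \<odot> d = (r - 1) \<odot> f \<ominus> ((r - 1) * r) \<odot> \<one>"
      using f(1) by (simp add: d_def smult_diff smult_smult)
    also have "f \<ominus> r \<odot> f = \<ominus> ((r - 1) \<odot> f)"
      using f(1) by (simp add: smult_l_diff minus_eq minus_add a_comm minus_minus)
    also have "\<ominus> ((r - 1) \<odot> f) \<oplus> ((r - 1) \<odot> f \<ominus> ((r - 1) * r) \<odot> \<one>) = \<ominus> (((r - 1) * r) \<odot> \<one>)"
      using f(1) by (simp add: minus_eq r_neg1 r_neg2)
    also have "\<dots> = (r - r * r) \<odot> \<one>" by (simp add: smult_minus_l[symmetric] algebra_simps)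
    finally show ?thesis .
  qed
  finally have *: "(r - r * r) \<odot> \<one> \<in> rad" .
  have "r - r * r = 0"
  proof (rule ccontr)
    assume "r - r * r \<noteq> 0"
    then have "(1 / (r - r * r)) \<odot> ((r - r * r) \<odot> \<one>) = \<one>" by (simp add: smult_smult)
    moreover have "(1 / (r - r * r)) \<odot> ((r - r * r) \<odot> \<one>) \<in> rad"
      by (rule ideal_smult_closed[OF rad_ideal *])
    ultimately have "\<one> \<in> rad" by simp
    then show False using idempotent_in_rad[of \<one>] nontrivial by simp
  qed
  then have "r = 0 \<or> r = 1" by (simp add: mult_cancel_left1)
  then show ?thesis
  proof
    assume "r = 0"
    then have "f \<in> rad" using fr f(1) by (simp add: minus_eq)
    then show ?thesis using idempotent_in_rad[of f] f(2) by blast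
  next
    assume "r = 1"
    then have "f \<ominus> \<one> \<in> rad" using fr by simp
    then have 1: "(f \<ominus> \<one>) \<otimes> (\<ominus> \<one>) \<in> rad" by (rule rad_rmult) simp
    have 2: "(f \<ominus> \<one>) \<otimes> (\<ominus> \<one>) = \<one> \<ominus> f"
      using f(1) by (simp add: minus_eq r_minus minus_add minus_minus a_comm)
    have "(\<one> \<ominus> f) \<otimes> (\<one> \<ominus> f) = \<one> \<ominus> f"
      using f by (simp add: minus_eq l_distr r_distr l_minus r_minus minus_minus l_neg r_neg)
    then have "\<one> \<ominus> f = \<zero>" using idempotent_in_rad 1 2 by simp
    then show ?thesis using f(1) minus_eq_zero_iff[of \<one> f] by simp
  qed
qed

text \<open>In the graded algebra 1 is the sum of the classes of \<open>eps \<iota>\<close> and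
  \<open>eps (- \<iota>)\<close>. Both are primitive and the class of T conjugates one into the
  other, so one of them is a basic idempotent and its corner has the required presentation.\<close>

theorem block_basic_algebra:
  assumes \<iota>: "\<iota> * \<iota> = (- 1 :: 'k)"
    and z_in: "z \<in> radical_power A 2"
    and xy_in: "(x \<otimes> y \<ominus> (- 1) \<odot> (y \<otimes> x)) \<ominus> z \<in> radical_power A 3"
    and indep: "\<And>l. (\<Oplus>t\<in>exps p. l t \<odot> xmon t) = \<zero> \<Longrightarrow> \<forall>t\<in>exps p. l t = 0"
  shows "is_basic_algebra_of (presented_algebra TYPE('k) (skew_relations p (- 1))) (graded_algebra A)"
proof -
  have idem: "idempotent A (eps \<iota>)" "idempotent A (eps (- \<iota>))"
    using eps_idem[of \<iota>] eps_idem[of "- \<iota>"] \<iota> by (simp_all add: idempotent_def)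
  interpret C: triple_radical_corner A x y z "- 1" p "eps \<iota>"
    using eps_local[OF \<iota>]
    by unfold_locales
      (simp_all add: block_jacobson[OF \<iota>] z_in xy_in idem eps_comm S_comm)
  have Te: "T \<otimes> eps \<iota> \<otimes> (\<ominus> T) = eps (- \<iota>)"
    by (simp add: T_eps m_assoc r_minus TT minus_minus)
  have T_mon: "T \<otimes> xmon t = xmon t \<otimes> T" for t
  proof -
    have pow: "T \<otimes> u [^] (n::nat) = u [^] n \<otimes> T" if "u \<in> carrier A" "T \<otimes> u = u \<otimes> T" for u n
      using skew_commute_pow[of T u 1 1 n] that by simp
    obtain i j k where t: "t = (i, j, k)" by (cases t)
    have "T \<otimes> xmon t = (T \<otimes> x [^] i) \<otimes> (y [^] j \<otimes> z [^] k)" by (simp add: t mono3_def m_assoc)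
    also have "\<dots> = x [^] i \<otimes> (T \<otimes> (y [^] j \<otimes> z [^] k))" by (simp add: pow T_comm m_assoc)
    also have "T \<otimes> (y [^] j \<otimes> z [^] k) = (T \<otimes> y [^] j) \<otimes> z [^] k" by (simp add: m_assoc)
    also have "\<dots> = y [^] j \<otimes> (T \<otimes> z [^] k)" by (simp add: pow T_comm m_assoc)
    also have "x [^] i \<otimes> (y [^] j \<otimes> (T \<otimes> z [^] k)) = xmon t \<otimes> T"
      by (simp add: t mono3_def pow T_comm m_assoc)
    finally show ?thesis .
  qed
  \<comment> \<open>A combination of monomials commutes with T. If it is killed by one of the two
    idempotents, conjugation by T shows that the other kills it too, so it is zero.\<close>
  have indep_eps: "\<forall>t\<in>exps p. l t = 0"
    if "(\<Oplus>t\<in>exps p. l t \<odot> (xmon t \<otimes> eps \<iota>)) = \<zero>" for l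
  proof -
    have fc: "(\<Oplus>t\<in>exps p. l t \<odot> xmon t) \<in> carrier A" by (rule finsum_closed) simp
    have e: "(\<Oplus>t\<in>exps p. l t \<odot> xmon t) \<otimes> eps \<iota> = \<zero>"
      using that by (simp add: finsum_ldistr smult_mult_l)
    have comm: "T \<otimes> (\<Oplus>t\<in>exps p. l t \<odot> xmon t) = (\<Oplus>t\<in>exps p. l t \<odot> xmon t) \<otimes> T"
      by (simp add: finsum_ldistr finsum_rdistr smult_mult_l smult_mult_r T_mon)
    have "(\<Oplus>t\<in>exps p. l t \<odot> xmon t) \<otimes> eps (- \<iota>) = (\<Oplus>t\<in>exps p. l t \<odot> xmon t) \<otimes> T \<otimes> eps \<iota> \<otimes> (\<ominus> T)"
      unfolding Te[symmetric] using fc by (simp add: m_assoc)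
    also have "\<dots> = T \<otimes> ((\<Oplus>t\<in>exps p. l t \<odot> xmon t) \<otimes> eps \<iota>) \<otimes> (\<ominus> T)"
      unfolding comm[symmetric] using fc by (simp add: m_assoc)
    also have "\<dots> = \<zero>" by (simp add: e)
    finally have "(\<Oplus>t\<in>exps p. l t \<odot> xmon t) \<otimes> (eps \<iota> \<oplus> eps (- \<iota>)) = \<zero>"
      using fc e by (simp add: r_distr)
    then have "(\<Oplus>t\<in>exps p. l t \<odot> xmon t) = \<zero>" using fc by (simp add: eps_sum)
    then show ?thesis by (rule indep)
  qed
  interpret gr: assoc_algebra "graded_algebra A" by (rule C.gr_algebra)
  have prim: "primitive_idempotent (graded_algebra A) (C.homog 0 (eps \<kappa>))" if \<kappa>: "\<kappa> * \<kappa> = - 1" for \<kappa>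
    using eps_local[OF \<kappa>] eps_notin_rad[OF \<kappa>] eps_idem[OF \<kappa>]
    by (intro C.homog_primitive) (simp_all add: idempotent_def block_jacobson[OF \<iota>])
  have "isomorphic_projectives (graded_algebra A) (C.homog 0 (eps (- \<iota>))) (C.homog 0 (eps \<iota>))"
  proof (rule gr.isomorphic_projectives_conj)
    show "C.homog 0 T \<in> carrier (graded_algebra A)" "C.homog 0 (\<ominus> T) \<in> carrier (graded_algebra A)"
      "C.homog 0 (eps (- \<iota>)) \<in> carrier (graded_algebra A)"
      "C.homog 0 (eps \<iota>) \<in> carrier (graded_algebra A)"
      by (simp_all add: C.homog_closed)
    show "C.homog 0 T \<otimes>\<^bsub>graded_algebra A\<^esub> C.homog 0 (\<ominus> T) = \<one>\<^bsub>graded_algebra A\<^esub>"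
      "C.homog 0 (\<ominus> T) \<otimes>\<^bsub>graded_algebra A\<^esub> C.homog 0 T = \<one>\<^bsub>graded_algebra A\<^esub>"
      by (simp_all add: C.homog_mult r_minus l_minus TT minus_minus C.homog_one)
    show "C.homog 0 T \<otimes>\<^bsub>graded_algebra A\<^esub> C.homog 0 (eps (- \<iota>)) =
        C.homog 0 (eps \<iota>) \<otimes>\<^bsub>graded_algebra A\<^esub> C.homog 0 T"
      using T_eps[of "- \<iota>"] by (simp add: C.homog_mult)
  qed
  moreover have "C.homog 0 (eps \<iota>) \<oplus>\<^bsub>graded_algebra A\<^esub> C.homog 0 (eps (- \<iota>)) = \<one>\<^bsub>graded_algebra A\<^esub>"
    using C.homog_add[of "eps \<iota>" 0 "eps (- \<iota>)"] by (simp add: eps_sum C.homog_one)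
  ultimately have "basic_idempotent (graded_algebra A) (C.homog 0 (eps \<iota>))"
    using prim[of \<iota>] prim[of "- \<iota>"] \<iota> by (intro gr.basic_idempotent_pair) simp_all
  moreover have "algebra_isomorphic (corner_algebra (graded_algebra A) (C.homog 0 (eps \<iota>)))
      (presented_algebra TYPE('k) (skew_relations p (- 1)))"
    by (rule C.gr_corner_presentation) (rule indep_eps)
  ultimately show ?thesis unfolding is_basic_algebra_of_def by blast
qed

end

section \<open>Extending a Heisenberg algebra by a twisted Klein four group\<close>

text \<open>\<open>K\<close> stands for kG and \<open>B\<close> for its subalgebra kP. The
  conditions \<open>decompose\<close> and \<open>decompose_unique\<close> say that Ke is free as a
  left module over \<open>B\<close> on e, se, te, ste. Since the square of s acts as -1 on e, only
  the four classes of H modulo its centre remain, with twisted products.\<close>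

locale q8_extension = assoc_algebra K for K :: "('k::field, 'a) module" (structure) +
  fixes B :: "('k, 'a) module" and g g' h h' c c' s t e :: 'a and p :: nat
  assumes B: "heis_spanned B g g' h h' c c' p"
    and B_sub: "carrier B \<subseteq> carrier K"
    and B_ops: "mult B = mult K" "add B = add K" "one B = one K" "zero B = zero K"
      "module.smult B = module.smult K"
    and ste [simp]: "s \<in> carrier K" "t \<in> carrier K" "e \<in> carrier K"
    and ee: "e \<otimes> e = e" and e_central: "a \<in> carrier K \<Longrightarrow> a \<otimes> e = e \<otimes> a"
    and ss: "s \<otimes> s \<otimes> e = \<ominus> e" and tt: "t \<otimes> t \<otimes> e = \<ominus> e"
    and ts: "t \<otimes> s \<otimes> e = \<ominus> (s \<otimes> t \<otimes> e)"
    and g_s: "g \<otimes> s = s \<otimes> g'" "g' \<otimes> s = s \<otimes> g" and g_t: "g \<otimes> t = t \<otimes> g" "g' \<otimes> t = t \<otimes> g'"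
    and h_s: "h \<otimes> s = s \<otimes> h" "h' \<otimes> s = s \<otimes> h'" and h_t: "h \<otimes> t = t \<otimes> h'" "h' \<otimes> t = t \<otimes> h"
    and c_s: "c \<otimes> s = s \<otimes> c'" "c' \<otimes> s = s \<otimes> c" and c_t: "c \<otimes> t = t \<otimes> c'" "c' \<otimes> t = t \<otimes> c"
    and decompose: "a \<in> carrier K \<Longrightarrow> \<exists>b1\<in>carrier B. \<exists>b2\<in>carrier B. \<exists>b3\<in>carrier B. \<exists>b4\<in>carrier B.
      a \<otimes> e = b1 \<otimes> e \<oplus> (b2 \<otimes> (s \<otimes> e) \<oplus> (b3 \<otimes> (t \<otimes> e) \<oplus> b4 \<otimes> (s \<otimes> t \<otimes> e)))"
    and decompose_unique: "\<lbrakk>b1 \<in> carrier B; b2 \<in> carrier B; b3 \<in> carrier B; b4 \<in> carrier B;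
      b1 \<otimes> e \<oplus> (b2 \<otimes> (s \<otimes> e) \<oplus> (b3 \<otimes> (t \<otimes> e) \<oplus> b4 \<otimes> (s \<otimes> t \<otimes> e))) = \<zero>\<rbrakk>
      \<Longrightarrow> b1 = \<zero> \<and> b2 = \<zero> \<and> b3 = \<zero> \<and> b4 = \<zero>"
    and B_indep: "\<And>l. (\<Oplus>\<^bsub>B\<^esub>t\<in>exps p. l t \<odot>\<^bsub>B\<^esub> mono3 B (heis_algebra.x B g g') (heis_algebra.y B h h')
      (heis_algebra.z B c c') t) = \<zero>\<^bsub>B\<^esub> \<Longrightarrow> \<forall>t\<in>exps p. l t = 0"

sublocale q8_extension \<subseteq> B: heis_spanned B g g' h h' c c' p
  by (rule B)

context q8_extension
begin

lemma B_closed [simp]: "b \<in> carrier B \<Longrightarrow> b \<in> carrier K"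
  using B_sub by blast

lemma B_minus: "\<lbrakk>a \<in> carrier B; b \<in> carrier B\<rbrakk> \<Longrightarrow> a \<ominus>\<^bsub>B\<^esub> b = a \<ominus> b"
  using B.smult_minus_one[of b] smult_minus_one[of b]
  by (simp add: B.minus_eq minus_eq B_ops flip: B.smult_minus_one)

lemma B_pow: "a [^]\<^bsub>B\<^esub> (n::nat) = a [^] n"
  by (simp add: nat_pow_def B_ops)

lemma B_finsum: "f \<in> T \<rightarrow> carrier B \<Longrightarrow> (\<Oplus>\<^bsub>B\<^esub>t\<in>T. f t) = (\<Oplus>t\<in>T. f t)"
proof (induction T rule: infinite_finite_induct)
  case (insert t T)
  have "f t \<in> carrier K" "f \<in> T \<rightarrow> carrier K" using insert.prems B_closed by blast+
  with insert show ?case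
    by (simp add: B.finsum_insert finsum_insert B_ops Pi_iff)
qed (simp_all add: B_ops)

section \<open>The quaternion algebra inside the block and its action on x, y, z\<close>

definition "S = s \<otimes> e"
definition "T = t \<otimes> e"

abbreviation "x \<equiv> B.x"
abbreviation "y \<equiv> B.y"
abbreviation "z \<equiv> B.z"

lemma S_closed [simp]: "S \<in> carrier K" and T_closed [simp]: "T \<in> carrier K"
  by (simp_all add: S_def T_def)

lemma ST_eq: "S \<otimes> T = s \<otimes> t \<otimes> e"
proof -
  have "S \<otimes> T = s \<otimes> (e \<otimes> t) \<otimes> e" by (simp add: S_def T_def m_assoc)
  also have "\<dots> = s \<otimes> t \<otimes> (e \<otimes> e)" by (simp add: m_assoc e_central[of t, symmetric])
  finally show ?thesis by (simp add: ee)
qed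

lemma e_ST: "S \<otimes> e = S" "T \<otimes> e = T" "e \<otimes> S = S" "e \<otimes> T = T"
proof -
  show 1: "S \<otimes> e = S" "T \<otimes> e = T" by (simp_all add: S_def T_def m_assoc ee)
  show "e \<otimes> S = S" "e \<otimes> T = T" using 1 e_central[of S] e_central[of T] by simp_all
qed

lemma quaternion: "S \<otimes> S = \<ominus> e" "T \<otimes> T = \<ominus> e" "T \<otimes> S = \<ominus> (S \<otimes> T)"
proof -
  have *: "(u \<otimes> e) \<otimes> (v \<otimes> e) = u \<otimes> v \<otimes> e" if "u \<in> carrier K" "v \<in> carrier K" for u v
  proof -
    have "(u \<otimes> e) \<otimes> (v \<otimes> e) = u \<otimes> (e \<otimes> v) \<otimes> e" using that by (simp add: m_assoc)
    also have "\<dots> = u \<otimes> v \<otimes> (e \<otimes> e)" using that by (simp add: m_assoc e_central[OF that(2), symmetric])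
    finally show ?thesis by (simp add: ee)
  qed
  show "S \<otimes> S = \<ominus> e" "T \<otimes> T = \<ominus> e" "T \<otimes> S = \<ominus> (S \<otimes> T)"
    by (simp_all add: S_def T_def * ss tt ts)
qed

lemma xyz_half_diff: "x = half_diff g g'" "y = half_diff h h'" "z = half_diff c c'"
  by (simp_all add: B.x_def B.y_def B.z_def B.half_diff_def half_diff_def B_minus B_ops)

lemma xyz_ST: "x \<otimes> S = \<ominus> (S \<otimes> x)" "x \<otimes> T = T \<otimes> x" "y \<otimes> S = S \<otimes> y" "y \<otimes> T = \<ominus> (T \<otimes> y)"
  "z \<otimes> S = \<ominus> (S \<otimes> z)" "z \<otimes> T = \<ominus> (T \<otimes> z)"
proof -
  have minus: "u \<otimes> (v \<otimes> e) = \<ominus> (v \<otimes> e \<otimes> u)"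
    if "u \<in> carrier K" "v \<in> carrier K" "u \<otimes> v = \<ominus> (v \<otimes> u)" for u v
  proof -
    have "u \<otimes> (v \<otimes> e) = (u \<otimes> v) \<otimes> e" using that(1,2) by (simp add: m_assoc)
    also have "\<dots> = \<ominus> (v \<otimes> (u \<otimes> e))" using that by (simp add: l_minus m_assoc)
    also have "u \<otimes> e = e \<otimes> u" using that by (simp add: e_central)
    finally show ?thesis using that(1,2) by (simp add: m_assoc)
  qed
  have plus: "u \<otimes> (v \<otimes> e) = v \<otimes> e \<otimes> u"
    if "u \<in> carrier K" "v \<in> carrier K" "u \<otimes> v = v \<otimes> u" for u v
  proof -
    have "u \<otimes> (v \<otimes> e) = (u \<otimes> v) \<otimes> e" using that(1,2) by (simp add: m_assoc)
    also have "\<dots> = v \<otimes> (u \<otimes> e)" using that by (simp add: m_assoc)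
    also have "u \<otimes> e = e \<otimes> u" using that by (simp add: e_central)
    finally show ?thesis using that(1,2) by (simp add: m_assoc)
  qed
  show "x \<otimes> S = \<ominus> (S \<otimes> x)" "z \<otimes> S = \<ominus> (S \<otimes> z)" "y \<otimes> T = \<ominus> (T \<otimes> y)" "z \<otimes> T = \<ominus> (T \<otimes> z)"
    unfolding S_def T_def using g_s h_t c_s c_t
    by (auto intro!: minus half_diff_skew_commute simp: xyz_half_diff)
  show "x \<otimes> T = T \<otimes> x" "y \<otimes> S = S \<otimes> y"
    unfolding S_def T_def using g_t h_s
    by (auto intro!: plus half_diff_commute simp: xyz_half_diff)
qed

abbreviation "C \<equiv> corner_algebra K e"

lemma e_idempotent: "idempotent K e"
  by (simp add: idempotent_def ee)

lemma in_C_iff: "a \<in> carrier C \<longleftrightarrow> a \<in> carrier K \<and> a \<otimes> e = a"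
  using in_corner_iff[OF e_idempotent] e_central by auto

lemma C_closed: "w \<in> carrier C \<Longrightarrow> w \<in> carrier K" and C_e: "w \<in> carrier C \<Longrightarrow> w \<otimes> e = w"
  and C_e': "w \<in> carrier C \<Longrightarrow> e \<otimes> w = w"
  using in_corner_iff[OF e_idempotent] by auto

lemma C_mult: "\<lbrakk>b \<in> carrier K; w \<in> carrier C\<rbrakk> \<Longrightarrow> b \<otimes> w \<in> carrier C"
  by (simp add: in_C_iff m_assoc)

lemma S_in_C: "S \<in> carrier C" "T \<in> carrier C" "e \<in> carrier C"
  by (simp_all add: in_C_iff e_ST ee)

text \<open>The factor is chosen to cancel the signs: x anticommutes with S and commutes with T, and
  so does T up to itself; S plays this role for y; both x-like signs occur for z, matched by ST.
  Every product therefore commutes with S and with T.\<close>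

definition "xx = x \<otimes> T"
definition "yy = y \<otimes> S"
definition "zz = z \<otimes> (S \<otimes> T)"

lemma XYZ_in_C: "xx \<in> carrier C" "yy \<in> carrier C" "zz \<in> carrier C"
  by (simp_all add: xx_def yy_def zz_def C_mult S_in_C)

lemma XYZ_closed [simp]: "xx \<in> carrier K" "yy \<in> carrier K" "zz \<in> carrier K"
  by (simp_all add: xx_def yy_def zz_def)

text \<open>Each commutation rule is repeated with a trailing factor, so that it also fires inside
  right-nested products. Rewriting then collects S and T on the left with the right sign.\<close>

lemma assoc_rules:
  assumes "w \<in> carrier K"
  shows "x \<otimes> (S \<otimes> w) = \<ominus> (S \<otimes> (x \<otimes> w))" "x \<otimes> (T \<otimes> w) = T \<otimes> (x \<otimes> w)"
    "y \<otimes> (S \<otimes> w) = S \<otimes> (y \<otimes> w)" "y \<otimes> (T \<otimes> w) = \<ominus> (T \<otimes> (y \<otimes> w))"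
    "z \<otimes> (S \<otimes> w) = \<ominus> (S \<otimes> (z \<otimes> w))" "z \<otimes> (T \<otimes> w) = \<ominus> (T \<otimes> (z \<otimes> w))"
    "S \<otimes> (S \<otimes> w) = \<ominus> (e \<otimes> w)" "T \<otimes> (T \<otimes> w) = \<ominus> (e \<otimes> w)" "T \<otimes> (S \<otimes> w) = \<ominus> (S \<otimes> (T \<otimes> w))"
    "S \<otimes> (e \<otimes> w) = S \<otimes> w" "T \<otimes> (e \<otimes> w) = T \<otimes> w" "e \<otimes> (S \<otimes> w) = S \<otimes> w" "e \<otimes> (T \<otimes> w) = T \<otimes> w"
    "z \<otimes> (x \<otimes> w) = x \<otimes> (z \<otimes> w)" "z \<otimes> (y \<otimes> w) = y \<otimes> (z \<otimes> w)"
proof -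
  have zc: "z \<otimes> x = x \<otimes> z" "z \<otimes> y = y \<otimes> z"
    using B.z_central[of x] B.z_central[of y] by (simp_all add: B_ops)
  note a = m_assoc[symmetric]
  show "x \<otimes> (S \<otimes> w) = \<ominus> (S \<otimes> (x \<otimes> w))" "x \<otimes> (T \<otimes> w) = T \<otimes> (x \<otimes> w)"
    "y \<otimes> (S \<otimes> w) = S \<otimes> (y \<otimes> w)" "y \<otimes> (T \<otimes> w) = \<ominus> (T \<otimes> (y \<otimes> w))"
    "z \<otimes> (S \<otimes> w) = \<ominus> (S \<otimes> (z \<otimes> w))" "z \<otimes> (T \<otimes> w) = \<ominus> (T \<otimes> (z \<otimes> w))"
    "S \<otimes> (S \<otimes> w) = \<ominus> (e \<otimes> w)" "T \<otimes> (T \<otimes> w) = \<ominus> (e \<otimes> w)" "T \<otimes> (S \<otimes> w) = \<ominus> (S \<otimes> (T \<otimes> w))"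
    "S \<otimes> (e \<otimes> w) = S \<otimes> w" "T \<otimes> (e \<otimes> w) = T \<otimes> w" "e \<otimes> (S \<otimes> w) = S \<otimes> w" "e \<otimes> (T \<otimes> w) = T \<otimes> w"
    "z \<otimes> (x \<otimes> w) = x \<otimes> (z \<otimes> w)" "z \<otimes> (y \<otimes> w) = y \<otimes> (z \<otimes> w)"
    using assms by (simp_all add: a xyz_ST quaternion e_ST zc l_minus)
qed

lemma z_xy: "z \<otimes> x = x \<otimes> z" "z \<otimes> y = y \<otimes> z"
  using B.z_central[of x] B.z_central[of y] by (simp_all add: B_ops)

lemmas skew_rules = assoc_rules xyz_ST quaternion e_ST z_xy m_assoc l_minus r_minus minus_minus

lemma XYZ_commute:
  "S \<otimes> xx = xx \<otimes> S" "S \<otimes> yy = yy \<otimes> S" "S \<otimes> zz = zz \<otimes> S"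
  "T \<otimes> xx = xx \<otimes> T" "T \<otimes> yy = yy \<otimes> T" "T \<otimes> zz = zz \<otimes> T"
  by (simp_all add: xx_def yy_def zz_def skew_rules)

text \<open>On the block S and T are invertible, with squares -e, so multiples of x, y, z are
  multiples of \<open>xx\<close>, \<open>yy\<close>, \<open>zz\<close> and the two triples generate
  the same right ideal.\<close>

lemma XYZ_factor:
  assumes "w \<in> carrier C"
  shows "x \<otimes> w = xx \<otimes> (\<ominus> (T \<otimes> w))" "y \<otimes> w = yy \<otimes> (\<ominus> (S \<otimes> w))" "z \<otimes> w = zz \<otimes> (T \<otimes> (S \<otimes> w))"
proof -
  have w: "w \<in> carrier K" "e \<otimes> w = w" using assms C_closed C_e' by auto
  have "xx \<otimes> (\<ominus> (T \<otimes> w)) = x \<otimes> (\<ominus> (T \<otimes> (T \<otimes> w)))"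
    using w(1) by (simp add: xx_def m_assoc r_minus)
  also have "T \<otimes> (T \<otimes> w) = \<ominus> w" using w by (simp add: assoc_rules)
  finally show "x \<otimes> w = xx \<otimes> (\<ominus> (T \<otimes> w))" using w(1) by (simp add: minus_minus)
  have "yy \<otimes> (\<ominus> (S \<otimes> w)) = y \<otimes> (\<ominus> (S \<otimes> (S \<otimes> w)))"
    using w(1) by (simp add: yy_def m_assoc r_minus)
  also have SS: "S \<otimes> (S \<otimes> w) = \<ominus> w" using w by (simp add: assoc_rules)
  finally show "y \<otimes> w = yy \<otimes> (\<ominus> (S \<otimes> w))" using w(1) by (simp add: minus_minus)
  have "zz \<otimes> (T \<otimes> (S \<otimes> w)) = z \<otimes> (S \<otimes> (T \<otimes> (T \<otimes> (S \<otimes> w))))"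
    using w(1) by (simp add: zz_def m_assoc)
  also have "T \<otimes> (T \<otimes> (S \<otimes> w)) = \<ominus> (S \<otimes> w)"
    using w(1) by (simp add: assoc_rules(8) assoc_rules(12))
  finally show "z \<otimes> w = zz \<otimes> (T \<otimes> (S \<otimes> w))" using w(1) SS by (simp add: r_minus minus_minus)
qed

lemma C_algebra: "assoc_algebra C"
  by (rule corner_algebra_algebra[OF e_idempotent])

lemma C_uminus: "a \<in> carrier C \<Longrightarrow> \<ominus> a \<in> carrier C"
  and C_plus: "\<lbrakk>a \<in> carrier C; b \<in> carrier C\<rbrakk> \<Longrightarrow> a \<oplus> b \<in> carrier C"
  and C_smult: "a \<in> carrier C \<Longrightarrow> r \<odot> a \<in> carrier C"
  by (auto simp: in_C_iff l_minus l_distr smult_mult_l)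

lemma C_minus: "b \<in> carrier C \<Longrightarrow> a \<ominus>\<^bsub>C\<^esub> b = a \<ominus> b"
  using corner_a_inv[OF assoc_algebra_axioms e_idempotent] by (simp add: a_minus_def)

lemma decompose_C:
  assumes "a \<in> carrier C"
  obtains b1 b2 b3 b4 where "b1 \<in> carrier B" "b2 \<in> carrier B" "b3 \<in> carrier B" "b4 \<in> carrier B"
    "a = b1 \<otimes> e \<oplus> (b2 \<otimes> S \<oplus> (b3 \<otimes> T \<oplus> b4 \<otimes> (S \<otimes> T)))"
proof -
  have "a \<in> carrier K" "a \<otimes> e = a" using assms in_C_iff by auto
  with decompose[of a] that show ?thesis
    unfolding ST_eq by (auto simp: S_def T_def)
qed

lemma C_cases:
  assumes "a \<in> carrier C"
    and add: "\<And>u v. \<lbrakk>u \<in> carrier C; v \<in> carrier C; P u; P v\<rbrakk> \<Longrightarrow> P (u \<oplus> v)"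
    and base: "\<And>b w. \<lbrakk>b \<in> carrier B; w \<in> {e, S, T, S \<otimes> T}\<rbrakk> \<Longrightarrow> P (b \<otimes> w)"
  shows "P a"
proof -
  obtain b1 b2 b3 b4 where b: "b1 \<in> carrier B" "b2 \<in> carrier B" "b3 \<in> carrier B" "b4 \<in> carrier B"
      "a = b1 \<otimes> e \<oplus> (b2 \<otimes> S \<oplus> (b3 \<otimes> T \<oplus> b4 \<otimes> (S \<otimes> T)))"
    using decompose_C[OF assms(1)] .
  have "b \<otimes> w \<in> carrier C" if "b \<in> carrier B" "w \<in> {e, S, T, S \<otimes> T}" for b w
    using that by (auto intro!: C_mult S_in_C)
  then show ?thesis
    unfolding b(5) using b(1-4) by (intro add base C_plus) auto
qed

lemma quaternion_in_C: "w \<in> {e, S, T, S \<otimes> T} \<Longrightarrow> w \<in> carrier C"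
  by (auto intro: S_in_C C_mult)

lemma quaternion_commute:
  assumes "w \<in> {e, S, T, S \<otimes> T}" "v \<in> carrier C" "S \<otimes> v = v \<otimes> S" "T \<otimes> v = v \<otimes> T"
  shows "w \<otimes> v = v \<otimes> w"
proof -
  have v: "v \<in> carrier K" using assms(2) C_closed by auto
  have "S \<otimes> T \<otimes> v = S \<otimes> (v \<otimes> T)" using v assms(4) by (simp add: m_assoc)
  also have "\<dots> = (S \<otimes> v) \<otimes> T" using v by (simp add: m_assoc)
  also have "\<dots> = (v \<otimes> S) \<otimes> T" by (simp only: assms(3))
  finally have "S \<otimes> T \<otimes> v = v \<otimes> (S \<otimes> T)" using v by (simp add: m_assoc)
  then show ?thesis
    using assms C_e C_e' by auto
qed

text \<open>Elements of the block are sums of products bw with b in \<open>B\<close> and w a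
  quaternion unit. As w commutes with V, it can be carried to the right, and only the coefficient b
  in front of V remains to be moved.\<close>

lemma right_mult_rule:
  assumes a: "a \<in> carrier C" and V: "V \<in> {xx, yy, zz}"
    and base: "\<And>b w. \<lbrakk>b \<in> carrier B; w \<in> carrier C\<rbrakk> \<Longrightarrow>
      \<exists>b'\<in>carrier C. \<exists>d\<in>carrier C. b \<otimes> V \<otimes> w = V \<otimes> b' \<oplus> zz \<otimes> d"
  shows "\<exists>b\<in>carrier C. \<exists>d\<in>carrier C. a \<otimes> V = V \<otimes> b \<oplus> zz \<otimes> d"
proof (rule C_cases[OF a])
  have Vc: "V \<in> carrier K" using V by auto
  fix b w assume b: "b \<in> carrier B" and w: "w \<in> {e, S, T, S \<otimes> T}"
  have wc: "w \<in> carrier K" using w by auto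
  have "w \<otimes> V = V \<otimes> w"
    using V XYZ_commute XYZ_in_C by (intro quaternion_commute[OF w]) auto
  then have "b \<otimes> w \<otimes> V = b \<otimes> V \<otimes> w" using b wc Vc by (simp add: m_assoc)
  then show "\<exists>b'\<in>carrier C. \<exists>d\<in>carrier C. b \<otimes> w \<otimes> V = V \<otimes> b' \<oplus> zz \<otimes> d"
    using base[OF b quaternion_in_C[OF w]] by simp
next
  have Vc: "V \<in> carrier K" using V by auto
  fix u v assume uv: "u \<in> carrier C" "v \<in> carrier C"
    "\<exists>b\<in>carrier C. \<exists>d\<in>carrier C. u \<otimes> V = V \<otimes> b \<oplus> zz \<otimes> d"
    "\<exists>b\<in>carrier C. \<exists>d\<in>carrier C. v \<otimes> V = V \<otimes> b \<oplus> zz \<otimes> d"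
  then obtain b d b' d' where bd: "b \<in> carrier C" "d \<in> carrier C" "b' \<in> carrier C" "d' \<in> carrier C"
      "u \<otimes> V = V \<otimes> b \<oplus> zz \<otimes> d" "v \<otimes> V = V \<otimes> b' \<oplus> zz \<otimes> d'"
    by blast
  have "(u \<oplus> v) \<otimes> V = V \<otimes> (b \<oplus> b') \<oplus> zz \<otimes> (d \<oplus> d')"
    using uv(1,2) bd C_closed Vc by (simp add: l_distr r_distr a_ac)
  then show "\<exists>b\<in>carrier C. \<exists>d\<in>carrier C. (u \<oplus> v) \<otimes> V = V \<otimes> b \<oplus> zz \<otimes> d"
    using bd C_plus by blast
qed

lemma X_rule: "a \<in> carrier C \<Longrightarrow> \<exists>b\<in>carrier C. \<exists>d\<in>carrier C. a \<otimes> xx = xx \<otimes> b \<oplus> zz \<otimes> d"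
proof (rule right_mult_rule)
  fix b w assume b: "b \<in> carrier B" and w: "w \<in> carrier C"
  obtain b' d where bd: "b' \<in> carrier B" "d \<in> carrier B" "b \<otimes> x = x \<otimes> b' \<oplus> z \<otimes> d"
    using B.ax[OF b] by (auto simp: B_ops)
  have wK: "w \<in> carrier K" using w by (rule C_closed)
  have "b \<otimes> xx \<otimes> w = (b \<otimes> x) \<otimes> (T \<otimes> w)" using b wK by (simp add: xx_def m_assoc)
  also have "\<dots> = x \<otimes> (b' \<otimes> (T \<otimes> w)) \<oplus> z \<otimes> (d \<otimes> (T \<otimes> w))"
    using bd wK by (simp add: l_distr m_assoc)
  also have "x \<otimes> (b' \<otimes> (T \<otimes> w)) = xx \<otimes> (\<ominus> (T \<otimes> (b' \<otimes> (T \<otimes> w))))"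
    using bd w by (intro XYZ_factor C_mult) auto
  also have "z \<otimes> (d \<otimes> (T \<otimes> w)) = zz \<otimes> (T \<otimes> (S \<otimes> (d \<otimes> (T \<otimes> w))))"
    using bd w by (intro XYZ_factor C_mult) auto
  finally have eq: "b \<otimes> xx \<otimes> w = xx \<otimes> (\<ominus> (T \<otimes> (b' \<otimes> (T \<otimes> w)))) \<oplus> zz \<otimes> (T \<otimes> (S \<otimes> (d \<otimes> (T \<otimes> w))))" .
  have m1: "\<ominus> (T \<otimes> (b' \<otimes> (T \<otimes> w))) \<in> carrier C" and m2: "T \<otimes> (S \<otimes> (d \<otimes> (T \<otimes> w))) \<in> carrier C"
    using bd w by (auto intro!: C_uminus C_mult)
  show "\<exists>b'\<in>carrier C. \<exists>d\<in>carrier C. b \<otimes> xx \<otimes> w = xx \<otimes> b' \<oplus> zz \<otimes> d"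
    using eq m1 m2 by blast
qed auto

lemma Y_rule: "a \<in> carrier C \<Longrightarrow> \<exists>b\<in>carrier C. \<exists>d\<in>carrier C. a \<otimes> yy = yy \<otimes> b \<oplus> zz \<otimes> d"
proof (rule right_mult_rule)
  fix b w assume b: "b \<in> carrier B" and w: "w \<in> carrier C"
  obtain b' d where bd: "b' \<in> carrier B" "d \<in> carrier B" "b \<otimes> y = y \<otimes> b' \<oplus> z \<otimes> d"
    using B.ay[OF b] by (auto simp: B_ops)
  have wK: "w \<in> carrier K" using w by (rule C_closed)
  have "b \<otimes> yy \<otimes> w = (b \<otimes> y) \<otimes> (S \<otimes> w)" using b wK by (simp add: yy_def m_assoc)
  also have "\<dots> = y \<otimes> (b' \<otimes> (S \<otimes> w)) \<oplus> z \<otimes> (d \<otimes> (S \<otimes> w))"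
    using bd wK by (simp add: l_distr m_assoc)
  also have "y \<otimes> (b' \<otimes> (S \<otimes> w)) = yy \<otimes> (\<ominus> (S \<otimes> (b' \<otimes> (S \<otimes> w))))"
    using bd w by (intro XYZ_factor C_mult) auto
  also have "z \<otimes> (d \<otimes> (S \<otimes> w)) = zz \<otimes> (T \<otimes> (S \<otimes> (d \<otimes> (S \<otimes> w))))"
    using bd w by (intro XYZ_factor C_mult) auto
  finally have eq: "b \<otimes> yy \<otimes> w = yy \<otimes> (\<ominus> (S \<otimes> (b' \<otimes> (S \<otimes> w)))) \<oplus> zz \<otimes> (T \<otimes> (S \<otimes> (d \<otimes> (S \<otimes> w))))" .
  have m1: "\<ominus> (S \<otimes> (b' \<otimes> (S \<otimes> w))) \<in> carrier C" and m2: "T \<otimes> (S \<otimes> (d \<otimes> (S \<otimes> w))) \<in> carrier C"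
    using bd w by (auto intro!: C_uminus C_mult)
  show "\<exists>b'\<in>carrier C. \<exists>d\<in>carrier C. b \<otimes> yy \<otimes> w = yy \<otimes> b' \<oplus> zz \<otimes> d"
    using eq m1 m2 by blast
qed auto

lemma Z_rule:
  assumes "a \<in> carrier C"
  shows "\<exists>b\<in>carrier C. a \<otimes> zz = zz \<otimes> b"
proof -
  \<comment> \<open>For V = \<open>zz\<close> the two terms of the rule are both multiples of
    \<open>zz\<close>; they are merged at the end.\<close>
  have "\<exists>b\<in>carrier C. \<exists>d\<in>carrier C. a \<otimes> zz = zz \<otimes> b \<oplus> zz \<otimes> d"
  proof (rule right_mult_rule[OF assms])
    fix b w assume b: "b \<in> carrier B" and w: "w \<in> carrier C"
    have wK: "w \<in> carrier K" using w by (rule C_closed)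
    have "b \<otimes> z = z \<otimes> b" using B.z_central[OF b] by (simp add: B_ops)
    then have "b \<otimes> zz \<otimes> w = z \<otimes> (b \<otimes> (S \<otimes> (T \<otimes> w)))"
      using b wK by (simp add: zz_def m_assoc[symmetric])
    also have "\<dots> = zz \<otimes> (T \<otimes> (S \<otimes> (b \<otimes> (S \<otimes> (T \<otimes> w)))))"
      using b w by (intro XYZ_factor C_mult) auto
    also have "\<dots> = zz \<otimes> (T \<otimes> (S \<otimes> (b \<otimes> (S \<otimes> (T \<otimes> w))))) \<oplus> zz \<otimes> \<zero>"
      using b wK by simp
    finally have eq: "b \<otimes> zz \<otimes> w = \<dots>" .
    have "\<zero> \<in> carrier C" by (simp add: in_C_iff)
    moreover have "T \<otimes> (S \<otimes> (b \<otimes> (S \<otimes> (T \<otimes> w)))) \<in> carrier C"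
      using b w by (auto intro!: C_mult)
    ultimately show "\<exists>b'\<in>carrier C. \<exists>d\<in>carrier C. b \<otimes> zz \<otimes> w = zz \<otimes> b' \<oplus> zz \<otimes> d"
      using eq by blast
  qed simp
  then obtain b d where "b \<in> carrier C" "d \<in> carrier C" "a \<otimes> zz = zz \<otimes> b \<oplus> zz \<otimes> d" by blast
  then show ?thesis
    using C_closed by (intro bexI[of _ "b \<oplus> d"]) (auto simp: r_distr C_plus)
qed

text \<open>The unit of the corner is e, so the powers differ from those in \<open>K\<close> at
  exponent 0; the factor e accounts for that.\<close>

lemma C_pow: "u \<in> carrier C \<Longrightarrow> u [^]\<^bsub>C\<^esub> (n::nat) = e \<otimes> u [^] n"
proof (induction n)
  case (Suc n)
  then show ?case using C_closed by (simp add: m_assoc)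
qed simp

lemma C_triple_radical: "triple_radical C xx yy zz (- 1) p"
proof (intro triple_radical.intro triple_radical_axioms.intro C_algebra)
  fix a assume "a \<in> carrier C"
  then show "\<exists>b\<in>carrier C. \<exists>d\<in>carrier C. a \<otimes>\<^bsub>C\<^esub> xx = xx \<otimes>\<^bsub>C\<^esub> b \<oplus>\<^bsub>C\<^esub> zz \<otimes>\<^bsub>C\<^esub> d"
    "\<exists>b\<in>carrier C. \<exists>d\<in>carrier C. a \<otimes>\<^bsub>C\<^esub> yy = yy \<otimes>\<^bsub>C\<^esub> b \<oplus>\<^bsub>C\<^esub> zz \<otimes>\<^bsub>C\<^esub> d"
    "\<exists>b\<in>carrier C. a \<otimes>\<^bsub>C\<^esub> zz = zz \<otimes>\<^bsub>C\<^esub> b"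
    using X_rule Y_rule Z_rule by simp_all
next
  obtain d where d: "d \<in> carrier B" "x \<otimes> y = y \<otimes> x \<oplus> z \<otimes> d"
    using B.comm_mod_z[of x y] by (auto simp: B.comm_mod_z_def B_ops)
  have "yy \<otimes> xx = (- 1) \<odot> (xx \<otimes> yy) \<oplus> zz \<otimes> (d \<otimes> e)"
  proof -
    \<comment> \<open>Here the sign appears: carrying S and T to the front yields opposite signs in
      the two orders, so commuting x and y become anticommuting \<open>xx\<close> and
      \<open>yy\<close>.\<close>
    have YX: "yy \<otimes> xx = \<ominus> (S \<otimes> (T \<otimes> (y \<otimes> x)))" and XY: "xx \<otimes> yy = S \<otimes> (T \<otimes> (x \<otimes> y))"
      by (simp_all add: xx_def yy_def skew_rules)
    have "zz \<otimes> (d \<otimes> e) = S \<otimes> (T \<otimes> (z \<otimes> (d \<otimes> e)))"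
      using d by (simp add: zz_def skew_rules)
    also have "z \<otimes> (d \<otimes> e) = e \<otimes> (z \<otimes> d)"
      using d e_central[of "z \<otimes> d"] by (simp add: m_assoc)
    also have "S \<otimes> (T \<otimes> (e \<otimes> (z \<otimes> d))) = S \<otimes> (T \<otimes> (z \<otimes> d))"
      using d by (simp add: assoc_rules)
    finally show ?thesis
      using d(1) by (simp add: YX XY smult_minus_one d(2) r_distr minus_add a_assoc l_neg)
  qed
  moreover have "d \<otimes> e \<in> carrier C" using d by (intro C_mult S_in_C) simp
  ultimately show "\<exists>c\<in>carrier C. yy \<otimes>\<^bsub>C\<^esub> xx = (- 1) \<odot>\<^bsub>C\<^esub> (xx \<otimes>\<^bsub>C\<^esub> yy) \<oplus>\<^bsub>C\<^esub> zz \<otimes>\<^bsub>C\<^esub> c"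
    by auto
  show "zz \<otimes>\<^bsub>C\<^esub> xx = (- 1) \<odot>\<^bsub>C\<^esub> (xx \<otimes>\<^bsub>C\<^esub> zz)" "zz \<otimes>\<^bsub>C\<^esub> yy = (- 1) \<odot>\<^bsub>C\<^esub> (yy \<otimes>\<^bsub>C\<^esub> zz)"
    by (simp_all add: xx_def yy_def zz_def skew_rules smult_minus_one)
  have pows: "x [^] p = \<zero>" "y [^] p = \<zero>" "z [^] p = \<zero>"
    using B.xp B.yp B.zp by (simp_all add: B_pow B_ops)
  have "xx [^] p = x [^] p \<otimes> T [^] p" "yy [^] p = y [^] p \<otimes> S [^] p" "zz [^] p = z [^] p \<otimes> (S \<otimes> T) [^] p"
    unfolding xx_def yy_def zz_def
    by (rule pow_mult_distrib; simp add: skew_rules)+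
  then show "xx [^]\<^bsub>C\<^esub> p = \<zero>\<^bsub>C\<^esub>" "yy [^]\<^bsub>C\<^esub> p = \<zero>\<^bsub>C\<^esub>" "zz [^]\<^bsub>C\<^esub> p = \<zero>\<^bsub>C\<^esub>"
    by (simp_all add: C_pow XYZ_in_C pows)
qed (simp_all add: XYZ_in_C)

end

sublocale q8_extension \<subseteq> C: triple_radical C xx yy zz "- 1" p
  by (rule C_triple_radical)

context q8_extension
begin

lemma B_rad_mult:
  assumes "r \<in> B.rad" "w \<in> carrier C"
  shows "r \<otimes> w \<in> C.rad"
proof -
  obtain a b d where r: "a \<in> carrier B" "b \<in> carrier B" "d \<in> carrier B"
      "r = x \<otimes> a \<oplus> (y \<otimes> b \<oplus> z \<otimes> d)"
    using assms(1) by (auto simp: B.rad_def B_ops)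
  have w: "w \<in> carrier K" using assms(2) by (rule C_closed)
  have C: "a \<otimes> w \<in> carrier C" "b \<otimes> w \<in> carrier C" "d \<otimes> w \<in> carrier C"
    using r assms(2) by (auto intro: C_mult)
  have "x \<otimes> (a \<otimes> w) \<in> C.rad" "y \<otimes> (b \<otimes> w) \<in> C.rad" "z \<otimes> (d \<otimes> w) \<in> C.rad"
    using C.rad_gens(1)[OF C_uminus[OF C_mult[OF T_closed C(1)]]]
      C.rad_gens(2)[OF C_uminus[OF C_mult[OF S_closed C(2)]]]
      C.rad_gens(3)[OF C_mult[OF T_closed C_mult[OF S_closed C(3)]]]
    by (simp_all add: XYZ_factor[OF C(1)] XYZ_factor[OF C(2)] XYZ_factor[OF C(3)])
  then have "x \<otimes> (a \<otimes> w) \<oplus> (y \<otimes> (b \<otimes> w) \<oplus> z \<otimes> (d \<otimes> w)) \<in> C.rad"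
    using C.rad_add by simp
  then show ?thesis using r w by (simp add: l_distr m_assoc)
qed

lemma e_neq_zero: "e \<noteq> \<zero>"
proof
  assume e: "e = \<zero>"
  have "\<one> \<in> carrier B" "\<zero> \<in> carrier B"
    using B.one_closed B.zero_closed by (simp_all add: B_ops)
  from decompose_unique[OF this(1) this(2) this(2) this(2)] e have "\<one> = \<zero>" by simp
  then show False using B.nontrivial by (simp add: B_ops)
qed

text \<open>Each of the four coefficients from \<open>B\<close> is a scalar modulo the radical of
  \<open>B\<close>, and \<open>B_rad_mult\<close> puts the remainders into the radical of the
  block.\<close>

lemma C_block: "block_algebra C xx yy zz p S T"
proof (intro block_algebra.intro block_algebra_axioms.intro C_triple_radical)
  have uminus: "\<ominus>\<^bsub>C\<^esub> u = \<ominus> u" if "u \<in> carrier C" for u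
    using corner_a_inv[OF assoc_algebra_axioms e_idempotent that] .
  show "S \<otimes>\<^bsub>C\<^esub> S = \<ominus>\<^bsub>C\<^esub> \<one>\<^bsub>C\<^esub>" "T \<otimes>\<^bsub>C\<^esub> T = \<ominus>\<^bsub>C\<^esub> \<one>\<^bsub>C\<^esub>"
    "T \<otimes>\<^bsub>C\<^esub> S = \<ominus>\<^bsub>C\<^esub> (S \<otimes>\<^bsub>C\<^esub> T)"
    by (simp_all add: uminus quaternion S_in_C C_mult)
  show "\<one>\<^bsub>C\<^esub> \<noteq> \<zero>\<^bsub>C\<^esub>" by (simp add: e_neq_zero)
next
  fix a assume a: "a \<in> carrier C"
  obtain b1 b2 b3 b4 where b: "b1 \<in> carrier B" "b2 \<in> carrier B" "b3 \<in> carrier B" "b4 \<in> carrier B"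
      "a = b1 \<otimes> e \<oplus> (b2 \<otimes> S \<oplus> (b3 \<otimes> T \<oplus> b4 \<otimes> (S \<otimes> T)))"
    using decompose_C[OF a] .
  have scalar: "\<exists>r. b \<ominus> r \<odot> \<one> \<in> B.rad" if "b \<in> carrier B" for b
    using B.scalar_mod_rad[OF that] B.smult_closed[OF B.one_closed] that
    by (simp add: B_minus B_ops)
  obtain r1 where r1: "b1 \<ominus> r1 \<odot> \<one> \<in> B.rad" using scalar[OF b(1)] ..
  obtain r2 where r2: "b2 \<ominus> r2 \<odot> \<one> \<in> B.rad" using scalar[OF b(2)] ..
  obtain r3 where r3: "b3 \<ominus> r3 \<odot> \<one> \<in> B.rad" using scalar[OF b(3)] ..
  obtain r4 where r4: "b4 \<ominus> r4 \<odot> \<one> \<in> B.rad" using scalar[OF b(4)] ..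
  let ?v = "r1 \<odot> e \<oplus> (r2 \<odot> S \<oplus> (r3 \<odot> T \<oplus> r4 \<odot> (S \<otimes> T)))"
  have "(b1 \<ominus> r1 \<odot> \<one>) \<otimes> e \<oplus> ((b2 \<ominus> r2 \<odot> \<one>) \<otimes> S \<oplus>
      ((b3 \<ominus> r3 \<odot> \<one>) \<otimes> T \<oplus> (b4 \<ominus> r4 \<odot> \<one>) \<otimes> (S \<otimes> T))) \<in> C.rad"
    using C.rad_add[OF B_rad_mult[OF r1] C.rad_add[OF B_rad_mult[OF r2]
        C.rad_add[OF B_rad_mult[OF r3] B_rad_mult[OF r4]]]] S_in_C C_mult[OF S_closed S_in_C(2)]
    by simp
  also have "(b1 \<ominus> r1 \<odot> \<one>) \<otimes> e \<oplus> ((b2 \<ominus> r2 \<odot> \<one>) \<otimes> S \<oplus>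
      ((b3 \<ominus> r3 \<odot> \<one>) \<otimes> T \<oplus> (b4 \<ominus> r4 \<odot> \<one>) \<otimes> (S \<otimes> T))) = a \<ominus> ?v"
    using b(1-4) unfolding b(5)
    by (simp add: minus_eq l_distr l_minus smult_mult_l minus_add a_ac)
  finally have "a \<ominus> ?v \<in> C.rad" .
  moreover have "?v \<in> carrier C"
    by (intro C_plus C_smult C_mult S_in_C) simp
  ultimately have "a \<ominus>\<^bsub>C\<^esub> ?v \<in> C.rad" by (simp add: C_minus)
  then show "\<exists>\<alpha> \<beta> \<gamma> \<delta>. a \<ominus>\<^bsub>C\<^esub> (\<alpha> \<odot>\<^bsub>C\<^esub> \<one>\<^bsub>C\<^esub> \<oplus>\<^bsub>C\<^esub> (\<beta> \<odot>\<^bsub>C\<^esub> S \<oplus>\<^bsub>C\<^esub> (\<gamma> \<odot>\<^bsub>C\<^esub> T \<oplus>\<^bsub>C\<^esub> \<delta> \<odot>\<^bsub>C\<^esub> (S \<otimes>\<^bsub>C\<^esub> T)))) \<in> C.rad"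
    unfolding corner_algebra_sel by blast
qed (simp_all add: S_in_C XYZ_commute B.two)

end

sublocale q8_extension \<subseteq> C: block_algebra C xx yy zz p S T
  by (rule C_block)

context q8_extension
begin

text \<open>This transports orders of vanishing from kP to the block, in particular that z lies in
  the square of the radical and xy - yx - z in its cube.\<close>

lemma B_radical_power_mult:
  assumes jac: "jacobson_radical C = C.rad"
  shows "\<lbrakk>r \<in> B.J n; w \<in> carrier C\<rbrakk> \<Longrightarrow> r \<otimes> w \<in> radical_power C n"
proof (induction n arbitrary: r w)
  case 0
  then show ?case by (simp add: C_mult)
next
  case (Suc n)
  interpret RC: radical_algebra C
    by (intro radical_algebra.intro radical_algebra_axioms.intro C_algebra) (simp add: jac C.rad_ideal)
  have "r \<in> ideal_prod B (B.J n) B.rad"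
    using Suc.prems(1) by (simp add: radical_power.simps(2) B.heis_jacobson)
  then have "r \<otimes> w \<in> radical_power C (Suc n) \<and> r \<in> carrier K"
  proof (induction rule: ideal_prod.induct)
    case (prod i j)
    have c: "i \<in> carrier K" "j \<in> carrier K" "w \<in> carrier K"
      using prod B.radical_power_closed B.rad_closed Suc.prems(2) C_closed by auto
    have jw: "j \<otimes> w \<in> C.rad" by (rule B_rad_mult[OF prod(2) Suc.prems(2)])
    \<comment> \<open>The idempotent e is inserted between i and j, because i alone does not belong
      to the corner algebra.\<close>
    have "i \<otimes> j \<otimes> w = i \<otimes> (j \<otimes> (e \<otimes> w))"
      using c C_e'[OF Suc.prems(2)] by (simp add: m_assoc)
    also have "j \<otimes> (e \<otimes> w) = e \<otimes> (j \<otimes> w)"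
      using c by (simp add: m_assoc[symmetric] e_central)
    also have "i \<otimes> (e \<otimes> (j \<otimes> w)) = (i \<otimes> e) \<otimes> (j \<otimes> w)"
      using c by (simp add: m_assoc)
    also have "\<dots> \<in> radical_power C (Suc n)"
      using ideal_prod.prod[OF Suc.IH[OF prod(1) S_in_C(3)] jw, of C]
      by (simp add: radical_power.simps(2) jac)
    finally show ?case using c by (simp add: B_ops)
  next
    case (sum r1 r2)
    then have "(r1 \<otimes> w) \<oplus>\<^bsub>C\<^esub> (r2 \<otimes> w) \<in> radical_power C (Suc n)"
      by (intro RC.radical_power_plus) simp_all
    with sum show ?case
      using C_closed[OF Suc.prems(2)] by (simp add: B_ops l_distr)
  qed
  then show ?case ..
qed

text \<open>Units of the quaternion algebra up to nonzero scalars. The signs from reordering are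
  absorbed in the scalars and need not be tracked.\<close>

definition quaternion_multiples :: "'a set" where
  "quaternion_multiples = {r \<odot> u | r u. r \<noteq> 0 \<and> u \<in> {e, S, T, S \<otimes> T}}"

lemma quaternion_multiplesI: "\<lbrakk>r \<noteq> 0; u \<in> {e, S, T, S \<otimes> T}\<rbrakk> \<Longrightarrow> r \<odot> u \<in> quaternion_multiples"
  unfolding quaternion_multiples_def by blast

lemma quaternion_multiples_closed: "v \<in> quaternion_multiples \<Longrightarrow> v \<in> carrier K"
  by (auto simp: quaternion_multiples_def)

lemma quaternion_multiples_smult:
  assumes "v \<in> quaternion_multiples" "r \<noteq> 0"
  shows "r \<odot> v \<in> quaternion_multiples"
proof -
  obtain q u where qu: "v = q \<odot> u" "q \<noteq> 0" "u \<in> {e, S, T, S \<otimes> T}"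
    using assms(1) unfolding quaternion_multiples_def by blast
  then have "u \<in> carrier K" by auto
  then have "r \<odot> v = (r * q) \<odot> u" using qu by (simp add: smult_smult)
  then show ?thesis using qu assms(2) by (simp add: quaternion_multiplesI)
qed

lemma quaternion_multiples_mult:
  assumes "v \<in> quaternion_multiples"
  shows "S \<otimes> v \<in> quaternion_multiples" "T \<otimes> v \<in> quaternion_multiples"
proof -
  obtain q u where qu: "v = q \<odot> u" "q \<noteq> 0" and u: "u \<in> {e, S, T, S \<otimes> T}"
    using assms unfolding quaternion_multiples_def by blast
  have uc: "u \<in> carrier K" using u by auto
  have pm: "w \<in> quaternion_multiples \<and> \<ominus> w \<in> quaternion_multiples" if "w \<in> {e, S, T, S \<otimes> T}" for w
  proof -
    have "w \<in> carrier K" using that by auto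
    then show ?thesis
      using quaternion_multiplesI[OF _ that, of 1] quaternion_multiplesI[OF _ that, of "- 1"]
      by (simp add: smult_minus_one)
  qed
  have prods: "S \<otimes> (S \<otimes> T) = \<ominus> T" "T \<otimes> (S \<otimes> T) = S"
    by (simp_all add: skew_rules)
  have pm': "w \<in> quaternion_multiples" "\<ominus> w \<in> quaternion_multiples" if "w \<in> {e, S, T, S \<otimes> T}" for w
    using pm[OF that] by auto
  have "S \<otimes> u \<in> quaternion_multiples \<and> T \<otimes> u \<in> quaternion_multiples"
    using u by (elim insertE emptyE; simp only: prods quaternion e_ST; intro conjI pm'; simp)
  then have "q \<odot> (S \<otimes> u) \<in> quaternion_multiples" "q \<odot> (T \<otimes> u) \<in> quaternion_multiples"
    using qu(2) quaternion_multiples_smult by auto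
  then show "S \<otimes> v \<in> quaternion_multiples" "T \<otimes> v \<in> quaternion_multiples"
    using uc by (simp_all add: qu(1) smult_mult_r)
qed

lemma mono3_C_eq:
  "\<exists>u\<in>quaternion_multiples. mono3 C xx yy zz m = mono3 K x y z m \<otimes> u"
proof -
  obtain i j k where t: "m = (i, j, k)" by (cases m)
  have one: "(- 1 :: 'k) ^ n \<noteq> 0" for n :: nat by simp
  have skew: "T \<otimes> z [^] n = (- 1) ^ n \<odot> (z [^] n \<otimes> T)" "S \<otimes> z [^] n = (- 1) ^ n \<odot> (z [^] n \<otimes> S)"
    "T \<otimes> y [^] n = (- 1) ^ n \<odot> (y [^] n \<otimes> T)" "S \<otimes> y [^] n = y [^] n \<otimes> S" "T \<otimes> x [^] n = x [^] n \<otimes> T"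
    for n :: nat
  proof -
    have m: "u \<otimes> v = (- 1) \<odot> (v \<otimes> u)" if "v \<otimes> u = \<ominus> (u \<otimes> v)" "u \<in> carrier K" "v \<in> carrier K" for u v
      using that by (simp add: smult_minus_one minus_minus)
    show "T \<otimes> z [^] n = (- 1) ^ n \<odot> (z [^] n \<otimes> T)" "S \<otimes> z [^] n = (- 1) ^ n \<odot> (z [^] n \<otimes> S)"
      "T \<otimes> y [^] n = (- 1) ^ n \<odot> (y [^] n \<otimes> T)"
      using skew_commute_pow[OF _ _ m[OF xyz_ST(6)], of 1 n] skew_commute_pow[OF _ _ m[OF xyz_ST(5)], of 1 n]
        skew_commute_pow[OF _ _ m[OF xyz_ST(4)], of 1 n] by simp_all
    show "S \<otimes> y [^] n = y [^] n \<otimes> S" "T \<otimes> x [^] n = x [^] n \<otimes> T"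
      using skew_commute_pow[of S y 1 1 n] skew_commute_pow[of T x 1 1 n] xyz_ST by simp_all
  qed
  have Z: "\<exists>u\<in>quaternion_multiples. zz [^]\<^bsub>C\<^esub> k = z [^] k \<otimes> u" for k :: nat
  proof (induction k)
    case 0
    have "1 \<odot> e \<in> quaternion_multiples" by (rule quaternion_multiplesI) simp_all
    then show ?case by (intro bexI[of _ e]) simp_all
  next
    case (Suc k)
    then obtain u where u: "u \<in> quaternion_multiples" "zz [^]\<^bsub>C\<^esub> k = z [^] k \<otimes> u" by blast
    have uc: "u \<in> carrier K" using u(1) by (rule quaternion_multiples_closed)
    have "zz [^]\<^bsub>C\<^esub> Suc k = zz \<otimes> zz [^]\<^bsub>C\<^esub> k"
      using C.nat_pow_Suc2[OF XYZ_in_C(3), of k] by simp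
    also have "\<dots> = z \<otimes> (S \<otimes> ((T \<otimes> z [^] k) \<otimes> u))" using uc unfolding u(2) by (simp add: zz_def m_assoc)
    also have "\<dots> = (- 1) ^ k \<odot> (z \<otimes> ((S \<otimes> z [^] k) \<otimes> (T \<otimes> u)))"
      using uc by (simp add: skew(1) smult_mult_l smult_mult_r m_assoc)
    also have "\<dots> = ((- 1) ^ k * (- 1) ^ k) \<odot> (z \<otimes> z [^] k \<otimes> (S \<otimes> (T \<otimes> u)))"
      using uc by (simp add: skew(2) smult_mult_l smult_mult_r smult_smult m_assoc)
    also have "\<dots> = z [^] Suc k \<otimes> (S \<otimes> (T \<otimes> u))"
      using uc by (simp add: nat_pow_Suc2 power_mult_distrib[symmetric] del: nat_pow_Suc Group.nat_pow_Suc)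
    finally show ?case using quaternion_multiples_mult u(1) by blast
  qed
  have Y: "\<exists>u\<in>quaternion_multiples. yy [^]\<^bsub>C\<^esub> j \<otimes> zz [^]\<^bsub>C\<^esub> k = y [^] j \<otimes> z [^] k \<otimes> u" for j :: nat
  proof (induction j)
    case 0
    obtain u where u: "u \<in> quaternion_multiples" "zz [^]\<^bsub>C\<^esub> k = z [^] k \<otimes> u" using Z by blast
    have zk: "zz [^]\<^bsub>C\<^esub> k \<in> carrier C" using C.nat_pow_closed[OF XYZ_in_C(3)] .
    have "yy [^]\<^bsub>C\<^esub> (0::nat) \<otimes> zz [^]\<^bsub>C\<^esub> k = zz [^]\<^bsub>C\<^esub> k"
      using C_e'[OF zk] by simp
    then show ?case
      using u quaternion_multiples_closed by (intro bexI[of _ u]) simp_all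
  next
    case (Suc j)
    then obtain u where u: "u \<in> quaternion_multiples"
      "yy [^]\<^bsub>C\<^esub> j \<otimes> zz [^]\<^bsub>C\<^esub> k = y [^] j \<otimes> z [^] k \<otimes> u" by blast
    have uc: "u \<in> carrier K" using u(1) by (rule quaternion_multiples_closed)
    have zk: "zz [^]\<^bsub>C\<^esub> k \<in> carrier K" "yy [^]\<^bsub>C\<^esub> j \<in> carrier K"
      using C_closed C.nat_pow_closed[OF XYZ_in_C(3)] C.nat_pow_closed[OF XYZ_in_C(2)] by blast+
    have "yy [^]\<^bsub>C\<^esub> Suc j \<otimes> zz [^]\<^bsub>C\<^esub> k = yy \<otimes> (yy [^]\<^bsub>C\<^esub> j \<otimes> zz [^]\<^bsub>C\<^esub> k)"
      using C.nat_pow_Suc2[OF XYZ_in_C(2), of j] zk by (simp add: m_assoc)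
    also have "\<dots> = y \<otimes> ((S \<otimes> y [^] j) \<otimes> (z [^] k \<otimes> u))"
      using uc unfolding u(2) by (simp add: yy_def m_assoc)
    also have "\<dots> = y \<otimes> y [^] j \<otimes> ((S \<otimes> z [^] k) \<otimes> u)"
      using uc by (simp add: skew(4) m_assoc)
    also have "\<dots> = y [^] Suc j \<otimes> z [^] k \<otimes> ((- 1) ^ k \<odot> (S \<otimes> u))"
      using uc by (simp add: skew(2) smult_mult_l smult_mult_r m_assoc nat_pow_Suc2
          del: nat_pow_Suc Group.nat_pow_Suc)
    finally show ?case using quaternion_multiples_mult(1)[OF u(1)] quaternion_multiples_smult one by blast
  qed
  have "\<exists>u\<in>quaternion_multiples. xx [^]\<^bsub>C\<^esub> i \<otimes> (yy [^]\<^bsub>C\<^esub> j \<otimes> zz [^]\<^bsub>C\<^esub> k) = x [^] i \<otimes> (y [^] j \<otimes> z [^] k) \<otimes> u"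
    for i :: nat
  proof (induction i)
    case 0
    obtain u where u: "u \<in> quaternion_multiples"
      "yy [^]\<^bsub>C\<^esub> j \<otimes> zz [^]\<^bsub>C\<^esub> k = y [^] j \<otimes> z [^] k \<otimes> u" using Y by blast
    have zk: "yy [^]\<^bsub>C\<^esub> j \<otimes> zz [^]\<^bsub>C\<^esub> k \<in> carrier C"
      using C.m_closed[OF C.nat_pow_closed[OF XYZ_in_C(2)] C.nat_pow_closed[OF XYZ_in_C(3)]] by simp
    have "xx [^]\<^bsub>C\<^esub> (0::nat) \<otimes> (yy [^]\<^bsub>C\<^esub> j \<otimes> zz [^]\<^bsub>C\<^esub> k) = yy [^]\<^bsub>C\<^esub> j \<otimes> zz [^]\<^bsub>C\<^esub> k"
      using C_e'[OF zk] by simp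
    then show ?case
      using u quaternion_multiples_closed by (intro bexI[of _ u]) simp_all
  next
    case (Suc i)
    then obtain u where u: "u \<in> quaternion_multiples"
      "xx [^]\<^bsub>C\<^esub> i \<otimes> (yy [^]\<^bsub>C\<^esub> j \<otimes> zz [^]\<^bsub>C\<^esub> k) = x [^] i \<otimes> (y [^] j \<otimes> z [^] k) \<otimes> u" by blast
    have uc: "u \<in> carrier K" using u(1) by (rule quaternion_multiples_closed)
    have zk: "zz [^]\<^bsub>C\<^esub> k \<in> carrier K" "yy [^]\<^bsub>C\<^esub> j \<in> carrier K" "xx [^]\<^bsub>C\<^esub> i \<in> carrier K"
      using C_closed C.nat_pow_closed[OF XYZ_in_C(3)] C.nat_pow_closed[OF XYZ_in_C(2)]
        C.nat_pow_closed[OF XYZ_in_C(1)] by blast+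
    have "xx [^]\<^bsub>C\<^esub> Suc i \<otimes> (yy [^]\<^bsub>C\<^esub> j \<otimes> zz [^]\<^bsub>C\<^esub> k) =
        xx \<otimes> (xx [^]\<^bsub>C\<^esub> i \<otimes> (yy [^]\<^bsub>C\<^esub> j \<otimes> zz [^]\<^bsub>C\<^esub> k))"
      using C.nat_pow_Suc2[OF XYZ_in_C(1), of i] zk by (simp add: m_assoc)
    also have "\<dots> = x \<otimes> ((T \<otimes> x [^] i) \<otimes> (y [^] j \<otimes> (z [^] k \<otimes> u)))"
      using uc unfolding u(2) by (simp add: xx_def m_assoc)
    also have "\<dots> = x \<otimes> x [^] i \<otimes> ((T \<otimes> y [^] j) \<otimes> (z [^] k \<otimes> u))"
      using uc by (simp add: skew(5) m_assoc)
    also have "\<dots> = (- 1) ^ j \<odot> (x \<otimes> x [^] i \<otimes> (y [^] j \<otimes> ((T \<otimes> z [^] k) \<otimes> u)))"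
      using uc by (simp add: skew(3) smult_mult_l smult_mult_r m_assoc)
    also have "\<dots> = x [^] Suc i \<otimes> (y [^] j \<otimes> z [^] k) \<otimes> (((- 1) ^ j * (- 1) ^ k) \<odot> (T \<otimes> u))"
      using uc by (simp add: skew(1) smult_mult_l smult_mult_r smult_smult m_assoc nat_pow_Suc2
          del: nat_pow_Suc Group.nat_pow_Suc)
    finally show ?case
      using quaternion_multiples_smult[OF quaternion_multiples_mult(2)[OF u(1)], of "(- 1) ^ j * (- 1) ^ k"]
      by auto
  qed
  then show ?thesis by (simp add: t mono3_def)
qed

lemma mono3_in_B: "mono3 K x y z m \<in> carrier B" and mono3_B: "mono3 B x y z m = mono3 K x y z m"
proof -
  show "mono3 B x y z m = mono3 K x y z m"
    by (simp add: mono3_def B_pow B_ops)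
  then show "mono3 K x y z m \<in> carrier B" using B.mon_closed[of m] by simp
qed

text \<open>The monomials are sorted by the quaternion unit they carry. Freeness over
  \<open>B\<close> separates the four partial sums, and each of them is a relation between monomials
  of \<open>B\<close>, where independence is known.\<close>

lemma C_mono3_indep:
  assumes zero: "(\<Oplus>\<^bsub>C\<^esub>m\<in>exps p. l m \<odot>\<^bsub>C\<^esub> mono3 C xx yy zz m) = \<zero>\<^bsub>C\<^esub>"
  shows "\<forall>m\<in>exps p. l m = 0"
proof -
  let ?M = "mono3 K x y z"
  define W where "W = (\<lambda>i::nat. if i = 0 then e else if i = 1 then S else if i = 2 then T else S \<otimes> T)"
  have W: "W i \<in> carrier K" for i by (simp add: W_def)
  have M: "?M m \<in> carrier K" for m using mono3_in_B by simp
  have "\<exists>rn. fst rn \<noteq> 0 \<and> snd rn \<in> {0, 1, 2, 3} \<and> mono3 C xx yy zz m = fst rn \<odot> (?M m \<otimes> W (snd rn))" for m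
  proof -
    obtain u where u: "u \<in> quaternion_multiples" "mono3 C xx yy zz m = ?M m \<otimes> u"
      using mono3_C_eq by blast
    then obtain q w where qw: "u = q \<odot> w" "q \<noteq> 0" "w \<in> {e, S, T, S \<otimes> T}"
      unfolding quaternion_multiples_def by blast
    have "\<exists>i\<in>{0, 1, 2, 3}. w = W i" using qw(3) by (auto simp: W_def)
    then obtain i where i: "i \<in> {0, 1, 2, 3}" "w = W i" by blast
    have "mono3 C xx yy zz m = q \<odot> (?M m \<otimes> W i)"
      unfolding u(2) qw(1) i(2) using M W by (simp add: smult_mult_r)
    then show ?thesis using qw(2) i(1) by (intro exI[of _ "(q, i)"]) simp
  qed
  then have "\<forall>m. \<exists>rn. fst rn \<noteq> 0 \<and> snd rn \<in> {0, 1, 2, 3} \<and> mono3 C xx yy zz m = fst rn \<odot> (?M m \<otimes> W (snd rn))"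
    by (rule allI)
  from choice[OF this] obtain rn where
    "\<forall>m. fst (rn m) \<noteq> 0 \<and> snd (rn m) \<in> {0, 1, 2, 3} \<and> mono3 C xx yy zz m = fst (rn m) \<odot> (?M m \<otimes> W (snd (rn m)))" ..
  note rn = spec[OF this]
  define r n where "r = (\<lambda>m. fst (rn m))" and "n = (\<lambda>m. snd (rn m))"
  have r: "r m \<noteq> 0" and n: "n m \<in> {0, 1, 2, 3}" and rnm: "mono3 C xx yy zz m = r m \<odot> (?M m \<otimes> W (n m))" for m
    unfolding r_def n_def using rn by blast+
  define b where "b = (\<lambda>i. \<Oplus>m\<in>exps p. (if n m = i then l m * r m else 0) \<odot> ?M m)"
  define F where "F = (\<lambda>i m. (if n m = i then l m * r m else 0) \<odot> ?M m \<otimes> W i)"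
  have F: "F i m \<in> carrier K" for i m using M W by (simp add: F_def)
  have bB: "b i = (\<Oplus>\<^bsub>B\<^esub>m\<in>exps p. (if n m = i then l m * r m else 0) \<odot>\<^bsub>B\<^esub> mono3 B x y z m)" for i
  proof -
    have "(\<lambda>m. (if n m = i then l m * r m else 0) \<odot> ?M m) \<in> exps p \<rightarrow> carrier B"
      using B.smult_closed[OF mono3_in_B] by (simp add: B_ops)
    from B_finsum[OF this] show ?thesis by (simp add: b_def mono3_B B_ops)
  qed
  have b_in: "b i \<in> carrier B" for i
    unfolding bB by (rule B.finsum_closed) (auto intro: B.smult_closed)
  have bW: "b i \<otimes> W i = (\<Oplus>m\<in>exps p. F i m)" for i
    unfolding b_def F_def by (rule finsum_ldistr) (use M W in auto)
  have "\<zero> = (\<Oplus>m\<in>exps p. l m \<odot> mono3 C xx yy zz m)"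
    using zero corner_finsum[OF assoc_algebra_axioms e_idempotent, of "\<lambda>m. l m \<odot> mono3 C xx yy zz m" "exps p"]
      C.mon_closed C_smult by simp
  \<comment> \<open>Exactly one of the four values \<open>n m\<close> occurs for each m, so three of
    the four summands have coefficient zero.\<close>
  also have "\<dots> = (\<Oplus>m\<in>exps p. F 0 m \<oplus> (F 1 m \<oplus> (F 2 m \<oplus> F 3 m)))"
  proof (rule finsum_cong')
    fix m assume "m \<in> exps p"
    have "n m = 0 \<or> n m = 1 \<or> n m = 2 \<or> n m = 3" using n[of m] by simp
    then show "l m \<odot> mono3 C xx yy zz m = F 0 m \<oplus> (F 1 m \<oplus> (F 2 m \<oplus> F 3 m))"
      using M[of m] W by (elim disjE) (simp_all add: rnm F_def smult_mult_l smult_smult)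
  qed (use F in auto)
  also have "\<dots> = (\<Oplus>m\<in>exps p. F 0 m) \<oplus> ((\<Oplus>m\<in>exps p. F 1 m) \<oplus>
      ((\<Oplus>m\<in>exps p. F 2 m) \<oplus> (\<Oplus>m\<in>exps p. F 3 m)))"
    using F by (simp add: finsum_addf)
  also have "\<dots> = b 0 \<otimes> W 0 \<oplus> (b 1 \<otimes> W 1 \<oplus> (b 2 \<otimes> W 2 \<oplus> b 3 \<otimes> W 3))"
    by (simp only: bW)
  finally have "b 0 \<otimes> e \<oplus> (b 1 \<otimes> (s \<otimes> e) \<oplus> (b 2 \<otimes> (t \<otimes> e) \<oplus> b 3 \<otimes> (s \<otimes> t \<otimes> e))) = \<zero>"
    unfolding ST_eq[symmetric] by (simp add: W_def S_def T_def)
  from decompose_unique[OF b_in b_in b_in b_in this]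
  have "b 0 = \<zero>" "b 1 = \<zero>" "b 2 = \<zero>" "b 3 = \<zero>" by auto
  then have b0: "b (n m) = \<zero>" for m using n[of m] by auto
  show ?thesis
  proof
    fix m assume m: "m \<in> exps p"
    have "(\<Oplus>\<^bsub>B\<^esub>m'\<in>exps p. (if n m' = n m then l m' * r m' else 0) \<odot>\<^bsub>B\<^esub> mono3 B x y z m') = \<zero>\<^bsub>B\<^esub>"
      using b0[of m] unfolding bB by (simp add: B_ops)
    from B_indep[OF this] m have "l m * r m = 0" by auto
    then show "l m = 0" using r[of m] by simp
  qed
qed

theorem corner_basic_algebra:
  assumes \<iota>: "\<iota> * \<iota> = (- 1 :: 'k)"
  shows "is_basic_algebra_of (presented_algebra TYPE('k) (skew_relations p (- 1))) (graded_algebra C)"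
proof (rule C.block_basic_algebra[OF \<iota>])
  note jac = C.block_jacobson[OF \<iota>]
  have ST: "S \<otimes> T \<in> carrier C" by (intro C_mult S_in_C) simp
  show "zz \<in> radical_power C 2"
    unfolding zz_def by (rule B_radical_power_mult[OF jac B.z_in_radical_power ST])
  have "x \<otimes> y \<ominus> y \<otimes> x \<ominus> z \<in> B.J 3"
  proof -
    have "x \<otimes>\<^bsub>B\<^esub> y \<ominus>\<^bsub>B\<^esub> y \<otimes>\<^bsub>B\<^esub> x = x \<otimes> y \<ominus> y \<otimes> x"
      using B_minus[OF B.m_closed B.m_closed] by (simp add: B_ops)
    moreover have "x \<otimes>\<^bsub>B\<^esub> y \<ominus>\<^bsub>B\<^esub> y \<otimes>\<^bsub>B\<^esub> x \<in> carrier B" by simp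
    ultimately show ?thesis using B.commutator_approx by (simp add: B_minus)
  qed
  from B_radical_power_mult[OF jac this ST]
  have "(x \<otimes> y \<ominus> y \<otimes> x \<ominus> z) \<otimes> (S \<otimes> T) \<in> radical_power C 3" .
  \<comment> \<open>The commutator relation times ST is the anticommutator relation for
    \<open>xx\<close>, \<open>yy\<close>, \<open>zz\<close>.\<close>
  also have "(x \<otimes> y \<ominus> y \<otimes> x \<ominus> z) \<otimes> (S \<otimes> T) = xx \<otimes> yy \<ominus> (- 1) \<odot> (yy \<otimes> xx) \<ominus> zz"
  proof -
    have "xx \<otimes> yy = x \<otimes> y \<otimes> (S \<otimes> T)" "(- 1) \<odot> (yy \<otimes> xx) = y \<otimes> x \<otimes> (S \<otimes> T)"
      by (simp_all add: xx_def yy_def skew_rules smult_minus_one)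
    then show ?thesis by (simp add: zz_def minus_eq l_distr l_minus)
  qed
  also have "\<dots> = (xx \<otimes>\<^bsub>C\<^esub> yy \<ominus>\<^bsub>C\<^esub> (- 1) \<odot>\<^bsub>C\<^esub> (yy \<otimes>\<^bsub>C\<^esub> xx)) \<ominus>\<^bsub>C\<^esub> zz"
    using C_minus[OF C_smult[OF C_mult[OF XYZ_closed(2) XYZ_in_C(1)]]] C_minus[OF XYZ_in_C(3)]
    by simp
  finally show "(xx \<otimes>\<^bsub>C\<^esub> yy \<ominus>\<^bsub>C\<^esub> (- 1) \<odot>\<^bsub>C\<^esub> (yy \<otimes>\<^bsub>C\<^esub> xx)) \<ominus>\<^bsub>C\<^esub> zz \<in> radical_power C 3" .
qed (rule C_mono3_indep)

text \<open>A summand f of a central orthogonal decomposition of e lies in the corner and is a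
  central idempotent there, hence 0 or e.\<close>

theorem e_block_idempotent: 
  assumes \<iota>: "\<iota> * \<iota> = (- 1 :: 'k)"
  shows "block_idempotent K e"
proof -
  have "f = \<zero> \<or> f' = \<zero>"
    if f: "idempotent K f" "central K f" and f': "idempotent K f'" and orth: "orthogonal K f f'"
      and sum: "e = f \<oplus> f'" for f f'
  proof -
    have fc: "f \<in> carrier K" "f \<otimes> f = f" "f' \<in> carrier K" "f \<otimes> f' = \<zero>"
      using f f' orth by (auto simp: idempotent_def orthogonal_def)
    have fe: "f \<otimes> e = f" unfolding sum using fc by (simp add: r_distr)
    have "f = \<zero>\<^bsub>C\<^esub> \<or> f = \<one>\<^bsub>C\<^esub>"
    proof (rule C.central_idempotent_trivial[OF \<iota>])
      show "f \<in> carrier C" using fc fe by (simp add: in_C_iff)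
      show "f \<otimes>\<^bsub>C\<^esub> f = f" using fc by simp
      show "f \<otimes>\<^bsub>C\<^esub> a = a \<otimes>\<^bsub>C\<^esub> f" if "a \<in> carrier C" for a
        using f(2) C_closed[OF that] by (simp add: central_def)
    qed
    then show ?thesis
    proof
      assume "f = \<one>\<^bsub>C\<^esub>"
      then have "e \<oplus> f' = e" using sum by simp
      then have "f' = \<zero>" using fc by (metis add.l_cancel_one ste(3))
      then show ?thesis ..
    qed simp
  qed
  then show ?thesis
    using e_idempotent e_neq_zero by (auto simp: block_idempotent_def central_def e_central)
qed

end

section \<open>The group algebras\<close>

text \<open>A spanning family with no more members than the dimension is independent. Elements are
  encoded as polynomials by an injective numbering of the monoid, so that the exchange bound for
  vector spaces applies: if one member were redundant, as many independent monomials as the monoid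
  has elements would lie in the span of fewer vectors.\<close>

lemma (in monoid) spanning_independent:
  fixes f :: "'t \<Rightarrow> 'a \<Rightarrow> 'k::field" and l :: "'t \<Rightarrow> 'k"
  assumes Q: "finite (carrier G)" and T: "finite T" "card T \<le> card (carrier G)"
    and f: "f \<in> T \<rightarrow> carrier (monoid_algebra k G)"
    and span: "carrier (monoid_algebra k G) \<subseteq> lspan (monoid_algebra k G) T f"
    and zero: "(\<Oplus>\<^bsub>monoid_algebra k G\<^esub>t\<in>T. l t \<odot>\<^bsub>monoid_algebra k G\<^esub> f t) = \<zero>\<^bsub>monoid_algebra k G\<^esub>"
  shows "\<forall>t\<in>T. l t = 0"
proof (rule ccontr)
  interpret K: assoc_algebra "monoid_algebra k G" by (rule monoid_algebra_algebra)
  interpret vs: vector_space "Polynomial.smult :: 'k \<Rightarrow> 'k poly \<Rightarrow> 'k poly"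
    by unfold_locales (simp_all add: smult_add_right smult_add_left)
  assume "\<not> (\<forall>t\<in>T. l t = 0)"
  then obtain t0 where t0: "t0 \<in> T" "l t0 \<noteq> 0" by blast
  obtain ix :: "'a \<Rightarrow> nat" where ix: "inj_on ix (carrier G)"
    using finite_imp_inj_to_nat_seg[OF Q] by blast
  define \<phi> :: "('a \<Rightarrow> 'k) \<Rightarrow> 'k poly" where
    "\<phi> a = (\<Sum>u\<in>carrier G. Polynomial.monom (a u) (ix u))" for a
  have coeff_ix: "(\<Sum>w\<in>carrier G. poly.coeff (Polynomial.monom (a w) (ix w)) (ix u)) = a u"
    if "u \<in> carrier G" for a u
  proof -
    have "(\<Sum>w\<in>carrier G. poly.coeff (Polynomial.monom (a w) (ix w)) (ix u)) =
        (\<Sum>w\<in>carrier G. if w = u then a u else 0)"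
      by (intro sum.cong) (use ix that in \<open>auto simp: inj_on_eq_iff\<close>)
    then show ?thesis using Q that by simp
  qed
  have lin: "(\<Oplus>\<^bsub>monoid_algebra k G\<^esub>t\<in>T. m t \<odot>\<^bsub>monoid_algebra k G\<^esub> f t) = (\<lambda>u. \<Sum>t\<in>T. m t * f t u)" for m
  proof -
    have "(\<lambda>t. m t \<odot>\<^bsub>monoid_algebra k G\<^esub> f t) \<in> T \<rightarrow> carrier (monoid_algebra k G)"
      using f by (auto simp: Pi_iff intro!: K.smult_closed simp del: monoid_algebra_sel)
    from monoid_algebra_finsum[OF T(1) this] show ?thesis by simp
  qed
  have \<phi>_lin: "\<phi> (\<lambda>u. \<Sum>t\<in>T. m t * f t u) = (\<Sum>t\<in>T. Polynomial.smult (m t) (\<phi> (f t)))" for m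
  proof -
    have "Polynomial.monom (\<Sum>t\<in>T. m t * f t u) n = (\<Sum>t\<in>T. Polynomial.smult (m t) (Polynomial.monom (f t u) n))" for u n
      by (rule poly_eqI) (simp add: coeff_sum)
    then have "\<phi> (\<lambda>u. \<Sum>t\<in>T. m t * f t u) =
        (\<Sum>u\<in>carrier G. \<Sum>t\<in>T. Polynomial.smult (m t) (Polynomial.monom (f t u) (ix u)))"
      unfolding \<phi>_def by simp
    also have "\<dots> = (\<Sum>t\<in>T. \<Sum>u\<in>carrier G. Polynomial.smult (m t) (Polynomial.monom (f t u) (ix u)))"
      by (rule sum.swap)
    finally show ?thesis unfolding \<phi>_def vs.scale_sum_right .
  qed
  let ?B = "(\<lambda>t. \<phi> (f t)) ` (T - {t0})"
  have base: "\<phi> (f t) \<in> vs.span ?B" if "t \<in> T - {t0}" for t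
    using that by (intro vs.span_base) simp
  have "(\<lambda>u. \<Sum>t\<in>T. l t * f t u) = (\<lambda>u. 0)" using zero lin[of l] by simp
  then have "(\<Sum>t\<in>T. Polynomial.smult (l t) (\<phi> (f t))) = \<phi> (\<lambda>u. 0)" using \<phi>_lin[of l] by simp
  then have "(\<Sum>t\<in>T. Polynomial.smult (l t) (\<phi> (f t))) = 0" by (simp add: \<phi>_def)
  then have "Polynomial.smult (l t0) (\<phi> (f t0)) + (\<Sum>t\<in>T - {t0}. Polynomial.smult (l t) (\<phi> (f t))) = 0"
    using sum.remove[OF T(1) t0(1), of "\<lambda>t. Polynomial.smult (l t) (\<phi> (f t))"] by simp
  then have "Polynomial.smult (l t0) (\<phi> (f t0)) = - (\<Sum>t\<in>T - {t0}. Polynomial.smult (l t) (\<phi> (f t)))"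
    by (simp only: eq_neg_iff_add_eq_0)
  also have "\<dots> \<in> vs.span ?B"
    by (intro vs.span_neg vs.span_sum vs.span_scale base)
  finally have "Polynomial.smult (inverse (l t0)) (Polynomial.smult (l t0) (\<phi> (f t0))) \<in> vs.span ?B"
    by (rule vs.span_scale)
  then have "\<phi> (f t0) \<in> vs.span ?B" using t0(2) by simp
  then have fB: "\<phi> (f t) \<in> vs.span ?B" if "t \<in> T" for t
    using base that by (cases "t = t0") auto
  have all: "\<phi> a \<in> vs.span ?B" if "a \<in> carrier (monoid_algebra k G)" for a
  proof -
    have "a \<in> lspan (monoid_algebra k G) T f" using span that by blast
    then obtain m where "a = (\<lambda>u. \<Sum>t\<in>T. m t * f t u)"
      unfolding lspan_def lin by blast
    then show ?thesis
      unfolding \<phi>_lin[symmetric] by (simp only: \<phi>_lin) (intro vs.span_sum vs.span_scale fB)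
  qed
  let ?d = "\<lambda>u. Polynomial.monom (1 :: 'k) (ix u)"
  let ?D = "?d ` carrier G"
  have inj: "inj_on ?d (carrier G)"
  proof (rule inj_onI)
    fix u v assume "u \<in> carrier G" "v \<in> carrier G" "?d u = ?d v"
    then show "u = v" using inj_onD[OF ix] by (metis degree_monom_eq zero_neq_one)
  qed
  have "vs.independent ?D"
  proof (rule vs.independent_if_scalars_zero)
    show "finite ?D" using Q by simp
    fix m :: "'k poly \<Rightarrow> 'k" and d
    assume sum0: "(\<Sum>v\<in>?D. Polynomial.smult (m v) v) = 0" and "d \<in> ?D"
    then obtain u where u: "u \<in> carrier G" "d = ?d u" by blast
    have "0 = poly.coeff (\<Sum>v\<in>?D. Polynomial.smult (m v) v) (ix u)" by (simp add: sum0)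
    also have "\<dots> = (\<Sum>w\<in>carrier G. poly.coeff (Polynomial.monom (m (?d w)) (ix w)) (ix u))"
      by (simp add: sum.reindex[OF inj] coeff_sum smult_monom)
    also have "\<dots> = m d" using u by (simp only: coeff_ix)
    finally show "m d = 0" by simp
  qed
  moreover have "?d u \<in> vs.span ?B" if "u \<in> carrier G" for u
  proof -
    have "\<phi> (single u) = (\<Sum>w\<in>carrier G. if w = u then ?d u else 0)"
      unfolding \<phi>_def by (intro sum.cong) (auto simp: single_def)
    then have "\<phi> (single u) = ?d u" using Q that by simp
    with all[OF single_in_monoid_algebra[OF that]] show ?thesis by simp
  qed
  then have "?D \<subseteq> vs.span ?B" by blast
  ultimately have "card ?D \<le> card ?B"
    using vs.independent_span_bound[of ?B ?D] T(1) by simp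
  also have "card ?B \<le> card (T - {t0})" by (rule card_image_le) (use T(1) in simp)
  also have "\<dots> < card T" using T(1) t0(1) by (metis card_Diff1_less)
  finally show False using T(2) card_image[OF inj] by simp
qed

context heis_spanned
begin

lemma triple_radical_corner_one: "triple_radical_corner A x y z 1 p \<one>"
proof unfold_locales
  show "x \<otimes> y \<ominus> 1 \<odot> (y \<otimes> x) \<ominus> z \<in> J 3" using commutator_approx by simp
  show "idempotent A \<one>" by (simp add: idempotent_def)
  show "\<exists>r. \<one> \<otimes> a \<otimes> \<one> \<ominus> r \<odot> \<one> \<in> rad" if "a \<in> carrier A" for a
    using scalar_mod_rad[OF that] that by simp
qed (simp_all add: heis_jacobson z_in_radical_power)

lemma carrier_lspan: "carrier A \<subseteq> lspan A (exps p) (mono3 A x y z)"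
proof
  interpret T: triple_radical_corner A x y z 1 p \<one> by (rule triple_radical_corner_one)
  fix a assume "a \<in> carrier A"
  then show "a \<in> lspan A (exps p) (mono3 A x y z)"
    using T.span_corner[of a] by (simp add: lspan_def)
qed

end

text \<open>Modulo the radical such an algebra is k, so 1 is a primitive and basic idempotent of the
  graded algebra, which is its own basic algebra.\<close>

lemma heis_basic_algebra:
  fixes A :: "('k::field, 'a) module" (structure)
  assumes "heis_spanned A g g' h h' c c' p"
    and indep: "\<And>l. (\<Oplus>t\<in>exps p. l t \<odot> mono3 A (heis_algebra.x A g g') (heis_algebra.y A h h')
      (heis_algebra.z A c c') t) = \<zero> \<Longrightarrow> \<forall>t\<in>exps p. l t = 0"
  shows "is_basic_algebra_of (presented_algebra TYPE('k) (skew_relations p 1)) (graded_algebra A)"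
proof -
  interpret heis_spanned A g g' h h' c c' p by fact
  interpret T: triple_radical_corner A x y z 1 p \<one> by (rule triple_radical_corner_one)
  interpret gr: assoc_algebra gr by (rule gr_algebra)
  have "primitive_idempotent gr (homog 0 \<one>)"
    using T.eps one_notin_rad T.eps_local
    by (intro homog_primitive) (simp_all add: heis_jacobson)
  then have "basic_idempotent gr (homog 0 \<one>)"
    unfolding homog_one by (rule gr.basic_idempotent_one)
  moreover have "algebra_isomorphic (corner_algebra gr (homog 0 \<one>))
      (presented_algebra TYPE('k) (skew_relations p 1))"
    using indep by (intro T.gr_corner_presentation) simp
  ultimately show ?thesis unfolding is_basic_algebra_of_def by blast
qed

lemma (in group) monoid_algebra_mult_single:
  assumes "b \<in> carrier (monoid_algebra k G)" "u \<in> carrier G" "w \<in> carrier G"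
  shows "(b \<otimes>\<^bsub>monoid_algebra k G\<^esub> single u) w = b (w \<otimes> inv u)"
proof -
  let ?S = "{v. b v \<noteq> 0}"
  have fin: "finite ?S" "?S \<subseteq> carrier G" using assms(1) by (auto simp: in_monoid_algebra_iff)
  have "(b \<otimes>\<^bsub>monoid_algebra k G\<^esub> single u) w =
      (\<Sum>v\<in>?S. \<Sum>v'\<in>{u}. if v \<otimes> v' = w then b v * single u v' else 0)"
    by (rule monoid_algebra_mult) (use fin in \<open>auto simp: single_def\<close>)
  also have "\<dots> = (\<Sum>v\<in>?S. if v = w \<otimes> inv u then b (w \<otimes> inv u) else 0)"
  proof (rule sum.cong)
    fix v assume "v \<in> ?S"
    then have "v \<in> carrier G" using fin by blast
    then have "v \<otimes> u = w \<longleftrightarrow> v = w \<otimes> inv u"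
      using assms by (metis inv_solve_right)
    then show "(\<Sum>v'\<in>{u}. if v \<otimes> v' = w then b v * single u v' else 0) =
        (if v = w \<otimes> inv u then b (w \<otimes> inv u) else 0)"
      by (simp add: single_def)
  qed simp
  also have "\<dots> = b (w \<otimes> inv u)" using fin by simp
  finally show ?thesis .
qed

lemma single_pow:
  fixes n :: nat
  shows "single u [^]\<^bsub>monoid_algebra k M\<^esub> n = single (u [^]\<^bsub>M\<^esub> n)"
proof (induction n)
  case (Suc n)
  then show ?case by (simp add: single_mult_single)
qed simp

text \<open>The formula for the product does not mention the carrier, so kP and kG share their
  operations literally.\<close>

lemma monoid_algebra_mult_carrier:
  "mult (monoid_algebra k (M\<lparr>carrier := Q\<rparr>)) = mult (monoid_algebra k M)"
  by (simp add: monoid_algebra_def)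

text \<open>From here on group algebra elements are handled by ring laws; unfolding them to
  functions is requested only where coefficients are compared.\<close>

declare monoid_algebra_sel [simp del]

section \<open>The group G and the structure of H\<close>

locale q8_setup =
  fixes k :: "'k::alg_closed_field itself" and p :: nat and G :: "('g, 'b) monoid_scheme" (structure)
    and P H :: "'g set" and g h c s t :: 'g
  assumes p: "prime p" "odd p" "CHAR('k) = p"
    and setting: "extraspecial_quaternion_setup p G P H g h c s t"

sublocale q8_setup \<subseteq> group G
  using setting by (simp add: extraspecial_quaternion_setup_def)

context q8_setup
begin

lemma gens [simp]: "g \<in> carrier G" "h \<in> carrier G" "c \<in> carrier G" "s \<in> carrier G" "t \<in> carrier G"
  using setting by (auto simp: extraspecial_quaternion_setup_def)

lemma P_eq: "P = generate G {g, h, c}" and H_eq: "H = generate G {s, t}"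
  and card_P: "card P = p ^ 3" and card_H: "card H = 8"
  and P_normal: "P \<lhd> G" and PH: "P \<inter> H = {\<one>}" and P_H: "P <#> H = carrier G"
  by (insert setting[unfolded extraspecial_quaternion_setup_def]) ((elim conjE, assumption)+)

lemma cancel [simp]:
  assumes "u \<in> carrier G" "w \<in> carrier G"
  shows "u \<otimes> (inv u \<otimes> w) = w" "inv u \<otimes> (u \<otimes> w) = w"
  using assms by (simp_all add: m_assoc[symmetric])

lemma gens_P [simp]: "g \<in> P" "h \<in> P" "c \<in> P" and gens_H [simp]: "s \<in> H" "t \<in> H"
  unfolding P_eq H_eq by (auto intro: generate.incl)

lemma P_subgroup: "subgroup P G"
  by (rule normal_imp_subgroup[OF P_normal])

lemma H_subgroup: "subgroup H G"
  unfolding H_eq by (rule generate_is_subgroup) simp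

lemma P_closed: "q \<in> P \<Longrightarrow> q \<in> carrier G"
  by (rule subgroup.mem_carrier[OF P_subgroup])

lemma H_closed: "u \<in> H \<Longrightarrow> u \<in> carrier G"
  by (rule subgroup.mem_carrier[OF H_subgroup])

lemma conj_imp:
  assumes "inv u \<otimes> a \<otimes> u = b" "u \<in> carrier G" "a \<in> carrier G"
  shows "a \<otimes> u = u \<otimes> b" "inv a \<otimes> u = u \<otimes> inv b"
proof -
  have b: "b \<in> carrier G" using assms by auto
  have "u \<otimes> (inv u \<otimes> a \<otimes> u) = a \<otimes> u" using assms(2,3) by (simp add: m_assoc[symmetric])
  then show 1: "a \<otimes> u = u \<otimes> b" using assms(1) by simp
  have "inv a \<otimes> u = inv a \<otimes> (u \<otimes> b) \<otimes> inv b" using assms(2,3) b by (simp add: m_assoc)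
  also have "\<dots> = inv a \<otimes> (a \<otimes> u) \<otimes> inv b" by (simp only: 1)
  also have "\<dots> = u \<otimes> inv b" using assms(2,3) b by (simp add: m_assoc[symmetric])
  finally show "inv a \<otimes> u = u \<otimes> inv b" .
qed

lemma gh: "g \<otimes> h = h \<otimes> g \<otimes> c"
proof -
  have "c = inv g \<otimes> inv h \<otimes> g \<otimes> h"
    using setting by (simp add: extraspecial_quaternion_setup_def)
  then have "h \<otimes> g \<otimes> c = h \<otimes> g \<otimes> (inv g \<otimes> inv h \<otimes> g \<otimes> h)" by simp
  also have "\<dots> = h \<otimes> (g \<otimes> inv g) \<otimes> inv h \<otimes> g \<otimes> h" by (simp add: m_assoc)
  finally show ?thesis by simp
qed

lemma comm_one:
  assumes "inv a \<otimes> inv b \<otimes> a \<otimes> b = \<one>" "a \<in> carrier G" "b \<in> carrier G"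
  shows "a \<otimes> b = b \<otimes> a"
proof -
  have "b \<otimes> a \<otimes> (inv a \<otimes> inv b \<otimes> a \<otimes> b) = b \<otimes> (a \<otimes> inv a) \<otimes> inv b \<otimes> a \<otimes> b"
    using assms(2,3) by (simp add: m_assoc del: r_inv)
  then show ?thesis using assms by simp
qed

lemma gc: "g \<otimes> c = c \<otimes> g" and hc: "h \<otimes> c = c \<otimes> h"
  using setting by (auto intro!: comm_one simp: extraspecial_quaternion_setup_def)

lemma pows: "g [^] p = \<one>" "h [^] p = \<one>" "c [^] p = \<one>"
  using setting by (simp_all add: extraspecial_quaternion_setup_def)

lemma g_s: "g \<otimes> s = s \<otimes> inv g" "inv g \<otimes> s = s \<otimes> g"
  and g_t: "g \<otimes> t = t \<otimes> g" "inv g \<otimes> t = t \<otimes> inv g"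
  and h_s: "h \<otimes> s = s \<otimes> h" "inv h \<otimes> s = s \<otimes> inv h"
  and h_t: "h \<otimes> t = t \<otimes> inv h" "inv h \<otimes> t = t \<otimes> h"
proof -
  have *: "inv s \<otimes> g \<otimes> s = inv g" "inv t \<otimes> g \<otimes> t = g" "inv s \<otimes> h \<otimes> s = h" "inv t \<otimes> h \<otimes> t = inv h"
    using setting by (simp_all add: extraspecial_quaternion_setup_def)
  show "g \<otimes> s = s \<otimes> inv g" "inv g \<otimes> s = s \<otimes> g" "g \<otimes> t = t \<otimes> g" "inv g \<otimes> t = t \<otimes> inv g"
    "h \<otimes> s = s \<otimes> h" "inv h \<otimes> s = s \<otimes> inv h" "h \<otimes> t = t \<otimes> inv h" "inv h \<otimes> t = t \<otimes> h"
    using conj_imp[OF *(1)] conj_imp[OF *(2)] conj_imp[OF *(3)] conj_imp[OF *(4)] by simp_all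
qed

lemma c_eq: "c = inv g \<otimes> (inv h \<otimes> (g \<otimes> h))"
  using setting by (auto simp: extraspecial_quaternion_setup_def m_assoc)

text \<open>The two right-hand sides are what conjugation by s and by t makes of the commutator c:
  the first replaces g by its inverse, the second h. Both equal c^-1 because c commutes with g and
  h.\<close>

lemma inv_c_eq: "inv c = g \<otimes> (inv h \<otimes> (inv g \<otimes> h))" "inv c = inv g \<otimes> (h \<otimes> (g \<otimes> inv h))"
proof -
  have "g \<otimes> (inv h \<otimes> (inv g \<otimes> h)) = inv (inv h \<otimes> (g \<otimes> h \<otimes> inv g))"
    by (simp add: inv_mult_group m_assoc)
  also have "g \<otimes> h \<otimes> inv g = h \<otimes> c"
    using gh gc by (simp add: m_assoc)
  also have "inv h \<otimes> (h \<otimes> c) = c" by (simp add: m_assoc[symmetric])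
  finally show "inv c = g \<otimes> (inv h \<otimes> (inv g \<otimes> h))" by simp
  have "inv g \<otimes> (h \<otimes> (g \<otimes> inv h)) = inv (h \<otimes> (inv g \<otimes> (inv h \<otimes> g)))"
    by (simp add: inv_mult_group m_assoc)
  also have "h \<otimes> (inv g \<otimes> (inv h \<otimes> g)) = c"
  proof -
    have "inv h \<otimes> (g \<otimes> h) = g \<otimes> c"
      using gh by (simp add: m_assoc)
    then have "inv h \<otimes> g = g \<otimes> c \<otimes> inv h"
      by (metis gens(1-3) inv_closed inv_solve_right m_assoc m_closed)
    then have "h \<otimes> (inv g \<otimes> (inv h \<otimes> g)) = h \<otimes> (inv g \<otimes> (g \<otimes> c \<otimes> inv h))" by simp
    also have "\<dots> = h \<otimes> c \<otimes> inv h" by (simp add: m_assoc)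
    also have "\<dots> = c" by (simp only: hc) (simp add: m_assoc)
    finally show ?thesis by simp
  qed
  finally show "inv c = inv g \<otimes> (h \<otimes> (g \<otimes> inv h))" by simp
qed

lemma c_s: "c \<otimes> s = s \<otimes> inv c" "inv c \<otimes> s = s \<otimes> c"
  and c_t: "c \<otimes> t = t \<otimes> inv c" "inv c \<otimes> t = t \<otimes> c"
proof -
  have "c \<otimes> s = inv g \<otimes> (inv h \<otimes> (g \<otimes> (h \<otimes> s)))"
    by (subst c_eq) (simp add: m_assoc)
  also have "\<dots> = inv g \<otimes> (inv h \<otimes> (g \<otimes> s \<otimes> h))" by (simp add: h_s m_assoc)
  also have "\<dots> = inv g \<otimes> (inv h \<otimes> s \<otimes> (inv g \<otimes> h))" by (simp add: g_s m_assoc)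
  also have "\<dots> = inv g \<otimes> s \<otimes> (inv h \<otimes> (inv g \<otimes> h))" by (simp add: h_s m_assoc)
  also have "\<dots> = s \<otimes> inv c" by (simp add: g_s m_assoc inv_c_eq(1))
  finally show cs: "c \<otimes> s = s \<otimes> inv c" .
  have "c \<otimes> t = inv g \<otimes> (inv h \<otimes> (g \<otimes> (h \<otimes> t)))"
    by (subst c_eq) (simp add: m_assoc)
  also have "\<dots> = inv g \<otimes> (inv h \<otimes> (g \<otimes> t \<otimes> inv h))" by (simp add: h_t m_assoc)
  also have "\<dots> = inv g \<otimes> (inv h \<otimes> t \<otimes> (g \<otimes> inv h))" by (simp add: g_t m_assoc)
  also have "\<dots> = inv g \<otimes> t \<otimes> (h \<otimes> (g \<otimes> inv h))" by (simp add: h_t m_assoc)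
  also have "\<dots> = t \<otimes> inv c" by (simp add: g_t m_assoc inv_c_eq(2))
  finally show ct: "c \<otimes> t = t \<otimes> inv c" .
  have inv': "inv c \<otimes> u = u \<otimes> c" if "c \<otimes> u = u \<otimes> inv c" "u \<in> carrier G" for u
  proof -
    have "inv c \<otimes> u = inv c \<otimes> (u \<otimes> inv c) \<otimes> c" using that(2) by (simp add: m_assoc)
    also have "\<dots> = inv c \<otimes> (c \<otimes> u) \<otimes> c" by (simp only: that(1))
    also have "\<dots> = u \<otimes> c" using that(2) by (simp add: m_assoc[symmetric])
    finally show ?thesis .
  qed
  show "inv c \<otimes> s = s \<otimes> c" "inv c \<otimes> t = t \<otimes> c" using inv'[OF cs] inv'[OF ct] by simp_all
qed

lemma comm_generate:
  assumes "\<And>u. u \<in> S \<Longrightarrow> u \<otimes> z = z \<otimes> u" "S \<subseteq> carrier G" "z \<in> carrier G" "w \<in> generate G S"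
  shows "w \<in> carrier G \<and> w \<otimes> z = z \<otimes> w"
  using assms(4)
proof (induction rule: generate.induct)
  case (incl u)
  then show ?case using assms(1,2) by blast
next
  case (inv u)
  then have u: "u \<in> carrier G" "u \<otimes> z = z \<otimes> u" using assms(1,2) by blast+
  have "inv z \<otimes> u \<otimes> z = u" using u assms(3) by (simp add: m_assoc)
  then have "inv u \<otimes> z = z \<otimes> inv u" using assms(3) u(1) by (rule conj_imp(2))
  then show ?case using u by simp
next
  case (eng u v)
  then have uv: "u \<in> carrier G" "v \<in> carrier G" "u \<otimes> z = z \<otimes> u" "v \<otimes> z = z \<otimes> v" by simp_all
  have "u \<otimes> v \<otimes> z = u \<otimes> z \<otimes> v" using uv(1,2,4) assms(3) by (simp add: m_assoc)
  also have "\<dots> = z \<otimes> u \<otimes> v" by (simp only: uv(3))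
  also have "\<dots> = z \<otimes> (u \<otimes> v)" using uv(1,2) assms(3) by (simp add: m_assoc)
  finally show ?case using eng by simp
qed (use assms(3) in simp)

definition "z2 = s \<otimes> s"

lemma z2_closed [simp]: "z2 \<in> carrier G" by (simp add: z2_def)

lemma s_pow_2: "s [^] (2::nat) = z2"
  by (simp add: z2_def numeral_2_eq_2)

lemma t_t: "t \<otimes> t = z2"
proof -
  have "t \<otimes> t = t [^] (2::nat)" by (simp add: numeral_2_eq_2)
  then show ?thesis
    using setting s_pow_2 by (simp add: extraspecial_quaternion_setup_def)
qed

lemma z2_z2: "z2 \<otimes> z2 = \<one>"
proof -
  have "s [^] (2 + 2 :: nat) = z2 \<otimes> z2"
    by (subst nat_pow_mult[symmetric]) (simp_all add: s_pow_2)
  then show ?thesis using setting by (simp add: extraspecial_quaternion_setup_def)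
qed

lemma s_z2: "s \<otimes> z2 = z2 \<otimes> s" and t_z2: "t \<otimes> z2 = z2 \<otimes> t"
  by (simp add: z2_def m_assoc) (simp add: t_t[symmetric] m_assoc)

lemma inv_s: "inv s = s \<otimes> z2" and inv_t: "inv t = t \<otimes> z2"
  using z2_z2 by (auto intro!: inv_equality simp: s_z2 t_z2 m_assoc t_t simp flip: z2_def)

lemma t_s: "t \<otimes> s = s \<otimes> t \<otimes> z2"
proof -
  have "t \<otimes> s = inv s \<otimes> t" using setting by (simp add: extraspecial_quaternion_setup_def)
  then show ?thesis by (simp add: inv_s m_assoc t_z2)
qed

text \<open>Conjugation by s fixes or inverts each generator of P, so its square acts trivially on
  P; and s^2 = t^2 commutes with s and t.\<close>

lemma z2_central: "w \<in> carrier G \<Longrightarrow> w \<otimes> z2 = z2 \<otimes> w"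
proof -
  assume "w \<in> carrier G"
  then obtain q u where qu: "q \<in> P" "u \<in> H" "w = q \<otimes> u"
    unfolding P_H[symmetric] set_mult_def by blast
  have "v \<otimes> z2 = z2 \<otimes> v" if "v \<otimes> s = s \<otimes> v'" "v' \<otimes> s = s \<otimes> v" "v \<in> carrier G" "v' \<in> carrier G" for v v'
  proof -
    have "v \<otimes> z2 = v \<otimes> s \<otimes> s" using that(3) by (simp add: z2_def m_assoc)
    also have "\<dots> = s \<otimes> (v' \<otimes> s)" using that(4) by (simp add: that(1) m_assoc)
    also have "\<dots> = z2 \<otimes> v" using that(3) by (simp add: that(2) z2_def m_assoc)
    finally show ?thesis .
  qed
  from this[OF g_s] this[OF h_s(1) h_s(1)] this[OF c_s]
  have gens_z2: "g \<otimes> z2 = z2 \<otimes> g" "h \<otimes> z2 = z2 \<otimes> h" "c \<otimes> z2 = z2 \<otimes> c" by simp_all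
  have q: "q \<otimes> z2 = z2 \<otimes> q" "q \<in> carrier G"
    using comm_generate[of "{g, h, c}" z2 q] gens_z2 qu(1) by (auto simp: P_eq)
  have u: "u \<otimes> z2 = z2 \<otimes> u" "u \<in> carrier G"
    using comm_generate[of "{s, t}" z2 u] qu(2) s_z2 t_z2 by (simp_all add: H_eq) blast+
  have "w \<otimes> z2 = q \<otimes> z2 \<otimes> u" using q(2) u by (simp add: qu(3) m_assoc)
  also have "\<dots> = z2 \<otimes> w" using q(2) u(2) by (simp add: q(1) qu(3) m_assoc)
  finally show ?thesis .
qed

text \<open>Representatives of H modulo the central subgroup generated by \<open>z2\<close>.\<close>

definition "U = {\<one>, s, t, s \<otimes> t}"

lemma U_H: "U \<subseteq> H" and z2_H: "z2 \<in> H"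
  using subgroup.one_closed[OF H_subgroup] subgroup.m_closed[OF H_subgroup]
  by (auto simp: U_def z2_def)

text \<open>The eight listed products are closed under left multiplication by s and t and contain 1,
  so they exhaust H. As H has order 8, they are distinct; the presentation alone would not give
  that.\<close>

lemma H_list: "H = set [\<one>, s, t, s \<otimes> t, z2, s \<otimes> z2, t \<otimes> z2, s \<otimes> t \<otimes> z2]" (is "_ = set ?L")
  and H_distinct: "distinct [\<one>, s, t, s \<otimes> t, z2, s \<otimes> z2, t \<otimes> z2, s \<otimes> t \<otimes> z2]"
proof -
  have assoc: "a \<otimes> (b \<otimes> w) = d \<otimes> w"
    if "a \<otimes> b = d" "a \<in> carrier G" "b \<in> carrier G" "w \<in> carrier G" for a b d w
  proof -
    have "a \<otimes> (b \<otimes> w) = a \<otimes> b \<otimes> w" using that(2-4) by (simp add: m_assoc)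
    then show ?thesis by (simp only: that(1))
  qed
  have zz: "w \<otimes> z2 \<otimes> z2 = w" if "w \<in> carrier G" for w
    using that by (simp add: m_assoc z2_z2)
  have st: "s \<otimes> t \<in> carrier G" by simp
  have s_s: "s \<otimes> s = z2" by (simp add: z2_def)
  have s_tab: "s \<otimes> (s \<otimes> t) = t \<otimes> z2" "s \<otimes> (s \<otimes> z2) = \<one>" "s \<otimes> (t \<otimes> z2) = s \<otimes> t \<otimes> z2"
    "s \<otimes> (s \<otimes> t \<otimes> z2) = t"
  proof -
    show 1: "s \<otimes> (s \<otimes> t) = t \<otimes> z2" using assoc[OF s_s, of t] by (simp add: t_z2)
    show "s \<otimes> (s \<otimes> z2) = \<one>" using assoc[OF s_s, of z2] by (simp add: z2_z2)
    show "s \<otimes> (t \<otimes> z2) = s \<otimes> t \<otimes> z2" by (simp add: m_assoc)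
    have "s \<otimes> (s \<otimes> t \<otimes> z2) = s \<otimes> (s \<otimes> t) \<otimes> z2" by (simp add: m_assoc)
    then show "s \<otimes> (s \<otimes> t \<otimes> z2) = t" by (simp only: 1 zz gens)
  qed
  have t_tab: "t \<otimes> (s \<otimes> t) = s" "t \<otimes> (s \<otimes> z2) = s \<otimes> t" "t \<otimes> (t \<otimes> z2) = \<one>"
    "t \<otimes> (s \<otimes> t \<otimes> z2) = s \<otimes> z2"
  proof -
    have "t \<otimes> (s \<otimes> t) = s \<otimes> t \<otimes> z2 \<otimes> t" by (rule assoc[OF t_s]) simp_all
    also have "\<dots> = s \<otimes> t \<otimes> (t \<otimes> z2)" by (simp only: t_z2) (simp add: m_assoc)
    also have "\<dots> = s \<otimes> (t \<otimes> t) \<otimes> z2" by (simp add: m_assoc)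
    also have "\<dots> = s" by (simp only: t_t zz gens)
    finally show 1: "t \<otimes> (s \<otimes> t) = s" .
    have "t \<otimes> (s \<otimes> z2) = s \<otimes> t \<otimes> z2 \<otimes> z2" by (rule assoc[OF t_s]) simp_all
    then show "t \<otimes> (s \<otimes> z2) = s \<otimes> t" by (simp only: zz st)
    show "t \<otimes> (t \<otimes> z2) = \<one>" using assoc[OF t_t, of z2] by (simp add: z2_z2)
    have "t \<otimes> (s \<otimes> t \<otimes> z2) = t \<otimes> (s \<otimes> t) \<otimes> z2" by (simp add: m_assoc)
    then show "t \<otimes> (s \<otimes> t \<otimes> z2) = s \<otimes> z2" by (simp only: 1)
  qed
  note tab = s_s t_t t_s s_tab t_tab r_one l_one z2_z2 zz gens z2_closed st
  have step: "s \<otimes> v \<in> set ?L \<and> t \<otimes> v \<in> set ?L \<and> v \<otimes> z2 \<in> set ?L" if "v \<in> set ?L" for v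
  proof -
    from that have "v = \<one> \<or> v = s \<or> v = t \<or> v = s \<otimes> t \<or> v = z2 \<or> v = s \<otimes> z2 \<or> v = t \<otimes> z2 \<or> v = s \<otimes> t \<otimes> z2"
      by (simp only: list.set insert_iff empty_iff simp_thms)
    then show ?thesis
      by (elim disjE) (simp_all only: tab list.set insert_iff simp_thms)
  qed
  have V: "v \<in> carrier G" if "v \<in> set ?L" for v
  proof -
    have "set ?L \<subseteq> carrier G" by simp
    with that show ?thesis by (rule subsetD[rotated])
  qed
  have "\<forall>v\<in>set ?L. w \<otimes> v \<in> set ?L" if "w \<in> H" for w
    using that unfolding H_eq
  proof (induction rule: generate.induct)
    case one
    show ?case
    proof
      fix v assume v: "v \<in> set ?L"
      with V[OF v] show "\<one> \<otimes> v \<in> set ?L" by (simp only: l_one)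
    qed
  next
    case (incl u)
    then consider "u = s" | "u = t" by blast
    then show ?case by cases (use step in blast)+
  next
    case (inv u)
    \<comment> \<open>The inverses of s and t are s and t times the central \<open>z2\<close>, which
      can be moved to the far end, where the list is stable under it.\<close>
    have *: "s \<otimes> z2 \<otimes> v \<in> set ?L \<and> t \<otimes> z2 \<otimes> v \<in> set ?L" if v: "v \<in> set ?L" for v
    proof -
      have "w \<otimes> z2 \<otimes> v = w \<otimes> (v \<otimes> z2)" if "w \<in> carrier G" for w
        using that V[OF v] by (simp only: z2_central[OF V[OF v]]) (simp add: m_assoc)
      then have "s \<otimes> z2 \<otimes> v = s \<otimes> (v \<otimes> z2)" "t \<otimes> z2 \<otimes> v = t \<otimes> (v \<otimes> z2)" by simp_all
      moreover have "v \<otimes> z2 \<in> set ?L" using step[OF v] by blast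
      ultimately show ?thesis using step[of "v \<otimes> z2"] by (simp only: simp_thms)
    qed
    from inv consider "u = s" | "u = t" by blast
    then show ?case
    proof cases
      case 1
      show ?thesis unfolding 1 inv_s using * by blast
    next
      case 2
      show ?thesis unfolding 2 inv_t using * by blast
    qed
  next
    case (eng u v)
    show ?case
    proof
      fix w assume w: "w \<in> set ?L"
      have "u \<in> carrier G" "v \<in> carrier G" using eng.hyps H_closed unfolding H_eq by blast+
      then have "u \<otimes> v \<otimes> w = u \<otimes> (v \<otimes> w)" using V[OF w] by (simp add: m_assoc)
      moreover have "u \<otimes> (v \<otimes> w) \<in> set ?L" using eng.IH w by blast
      ultimately show "u \<otimes> v \<otimes> w \<in> set ?L" by (simp only:)
    qed
  qed
  moreover have "\<one> \<in> set ?L" by (simp only: list.set insert_iff simp_thms)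
  ultimately have "w \<otimes> \<one> \<in> set ?L" if "w \<in> H" for w using that by blast
  then have "w \<in> set ?L" if "w \<in> H" for w using that H_closed[OF that] by (metis r_one)
  then have "H \<subseteq> set ?L" by blast
  moreover have "set ?L \<subseteq> H"
    by (simp add: subgroup.m_closed[OF H_subgroup] subgroup.one_closed[OF H_subgroup] z2_H)
  ultimately show H: "H = set ?L" by blast
  have "card (set ?L) = length ?L" unfolding H[symmetric] by (simp add: card_H)
  then show "distinct ?L" by (rule card_distinct)
qed

lemma one_z2: "\<one> \<noteq> z2"
  using H_distinct by (simp only: distinct.simps list.set insert_iff de_Morgan_disj simp_thms)

lemma U_distinct: "\<one> \<noteq> s" "\<one> \<noteq> t" "\<one> \<noteq> s \<otimes> t" "s \<noteq> t" "s \<noteq> s \<otimes> t" "t \<noteq> s \<otimes> t"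
  using H_distinct by (simp_all only: distinct.simps list.set insert_iff de_Morgan_disj simp_thms)

lemma U_z2:
  assumes "u \<in> U" "v \<in> U"
  shows "v \<noteq> u \<otimes> z2"
proof -
  have "u = \<one> \<or> u = s \<or> u = t \<or> u = s \<otimes> t" "v = \<one> \<or> v = s \<or> v = t \<or> v = s \<otimes> t"
    using assms by (simp_all only: U_def insert_iff empty_iff simp_thms)
  then show ?thesis
    using H_distinct
    by (elim disjE) (simp_all only: distinct.simps list.set insert_iff empty_iff de_Morgan_disj simp_thms l_one z2_closed)
qed

lemma H_cases:
  assumes "w \<in> H"
  obtains u where "u \<in> U" "w = u" | u where "u \<in> U" "w = u \<otimes> z2"
proof -
  have U: "\<one> \<in> U" "s \<in> U" "t \<in> U" "s \<otimes> t \<in> U" by (simp_all add: U_def)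
  have z2: thesis if "w = z2"
    by (rule \<open>\<And>u. \<lbrakk>u \<in> U; w = u \<otimes> z2\<rbrakk> \<Longrightarrow> thesis\<close>[OF U(1)]) (simp only: that l_one z2_closed)
  from assms have "w = \<one> \<or> w = s \<or> w = t \<or> w = s \<otimes> t \<or> w = z2 \<or> w = s \<otimes> z2 \<or> w = t \<otimes> z2 \<or> w = s \<otimes> t \<otimes> z2"
    by (simp only: H_list list.set insert_iff empty_iff simp_thms)
  then show thesis
  proof (elim disjE)
  qed (erule that(1)[OF U(1)] | erule that(1)[OF U(2)] | erule that(1)[OF U(3)] |
      erule that(1)[OF U(4)] | erule z2 | erule that(2)[OF U(2)] | erule that(2)[OF U(3)] | erule that(2)[OF U(4)])+
qed

section \<open>The group algebra of P\<close>

abbreviation "GP \<equiv> G\<lparr>carrier := P\<rparr>"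
abbreviation "KG \<equiv> monoid_algebra k G"
abbreviation "KP \<equiv> monoid_algebra k GP"

lemma GP_group: "group GP"
  using subgroup.subgroup_is_group[OF P_subgroup is_group] .

lemma KP_algebra: "assoc_algebra KP"
  using group.is_monoid[OF GP_group] by (rule monoid.monoid_algebra_algebra)

lemma KP_KG: "carrier KP \<subseteq> carrier KG"
proof
  fix a assume a: "a \<in> carrier KP"
  have "a u = 0" if "u \<notin> carrier G" for u
    using a that P_closed[of u] by (auto simp: in_monoid_algebra_iff)
  then show "a \<in> carrier KG" using a by (simp add: in_monoid_algebra_iff)
qed

lemma KP_ops: "mult KP = mult KG" "add KP = add KG" "one KP = one KG" "zero KP = zero KG"
  "module.smult KP = module.smult KG"
  by (simp_all add: monoid_algebra_mult_carrier monoid_algebra_sel)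

lemma KP_heis_algebra:
  "heis_algebra KP (single g) (single (inv g)) (single h) (single (inv h)) (single c) (single (inv c)) p"
proof -
  interpret KP: assoc_algebra KP by (rule KP_algebra)
  have inv_P: "inv g \<in> P" "inv h \<in> P" "inv c \<in> P"
    using subgroup.m_inv_closed[OF P_subgroup] by simp_all
  have pow: "u [^]\<^bsub>GP\<^esub> n = u [^] n" for u and n :: nat by (simp add: nat_pow_def)
  have "\<one>\<^bsub>KP\<^esub> \<one> \<noteq> \<zero>\<^bsub>KP\<^esub> \<one>" by (simp add: monoid_algebra_sel single_def)
  then have nz: "\<one>\<^bsub>KP\<^esub> \<noteq> \<zero>\<^bsub>KP\<^esub>" by metis
  have one: "\<one>\<^bsub>KP\<^esub> = single \<one>" by (simp add: monoid_algebra_sel)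
  show ?thesis
    using inv_P p nz
    by unfold_locales (simp_all add: one single_mult_single single_pow pow pows gh gc hc)
qed

lemma KP_heis:
  "heis_spanned KP (single g) (single (inv g)) (single h) (single (inv h)) (single c) (single (inv c)) p"
proof -
  interpret heis_algebra KP "single g" "single (inv g)" "single h" "single (inv h)" "single c" "single (inv c)" p
    by (rule KP_heis_algebra)
  have words: "single q \<in> words" if "q \<in> P" for q
  proof -
    have "q \<in> generate G {g, h, c}" using that by (simp only: P_eq)
    then show ?thesis
    proof (induction rule: generate.induct)
    case one
    show ?case using words.one by (simp add: monoid_algebra_sel)
  next
    case (eng u v)
    then show ?case using words_mult[of "single u" "single v"] by (simp add: single_mult_single)
    qed (use words_gens in auto)
  qed
  show ?thesis
  proof unfold_locales
    fix a Q
    assume a: "a \<in> carrier KP" and Q0: "Q \<zero>\<^bsub>KP\<^esub>"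
      and QS: "\<And>b r w. \<lbrakk>b \<in> carrier KP; Q b; w \<in> words\<rbrakk> \<Longrightarrow> Q (b \<oplus>\<^bsub>KP\<^esub> r \<odot>\<^bsub>KP\<^esub> w)"
    from a show "Q a"
    proof (induction rule: monoid_algebra_induct)
      case zero
      show ?case using Q0 by (simp add: monoid_algebra_sel)
    next
      case (add b r u)
      have "single u \<in> words" using add.hyps by (intro words) simp
      from QS[OF add.hyps(1) add.IH this, of r] show ?case by (simp add: monoid_algebra_sel)
    qed
  qed
qed

text \<open>The p^3 ordered monomials span kP, whose dimension is p^3.\<close>

lemma KP_indep:
  assumes "(\<Oplus>\<^bsub>KP\<^esub>m\<in>exps p. l m \<odot>\<^bsub>KP\<^esub> mono3 KP (heis_algebra.x KP (single g) (single (inv g)))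
      (heis_algebra.y KP (single h) (single (inv h))) (heis_algebra.z KP (single c) (single (inv c))) m) = \<zero>\<^bsub>KP\<^esub>"
  shows "\<forall>m\<in>exps p. l m = 0"
proof -
  interpret heis_spanned KP "single g" "single (inv g)" "single h" "single (inv h)" "single c" "single (inv c)" p
    by (rule KP_heis)
  interpret GP: group GP by (rule GP_group)
  have "p ^ 3 > 0" using p(1) by (simp add: prime_gt_0_nat)
  then have "finite P" using card_P by (metis card_gt_0_iff)
  moreover have "card (exps p) = p ^ 3" by (simp add: exps_def card_cartesian_product power3_eq_cube)
  ultimately have fin: "finite (carrier GP)" "card (exps p) \<le> card (carrier GP)"
    using card_P by simp_all
  have mono: "mono3 KP x y z \<in> exps p \<rightarrow> carrier KP"
    by (auto simp: mono3_def)
  show ?thesis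
    by (rule GP.spanning_independent[OF fin(1) finite_exps fin(2) mono carrier_lspan assms])
qed

theorem KP_basic_algebra:
  "is_basic_algebra_of (presented_algebra TYPE('k) (skew_relations p 1)) (graded_algebra KP)"
  using KP_heis KP_indep by (rule heis_basic_algebra)

section \<open>The idempotent e and the decomposition of the block over kP\<close>

abbreviation e :: "'g \<Rightarrow> 'k" where "e \<equiv> nonprincipal_idempotent k G s"

lemma KG_algebra: "assoc_algebra KG"
  by (rule monoid_algebra_algebra)

end

sublocale q8_setup \<subseteq> KG: assoc_algebra "monoid_algebra k G"
  by (rule KG_algebra)

context q8_setup
begin

lemma KG_induct [consumes 1, case_names zero add]:
  assumes "a \<in> carrier KG" "Q \<zero>\<^bsub>KG\<^esub>"
    and "\<And>b r u. \<lbrakk>b \<in> carrier KG; u \<in> carrier G; Q b\<rbrakk> \<Longrightarrow> Q (b \<oplus>\<^bsub>KG\<^esub> r \<odot>\<^bsub>KG\<^esub> single u)"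
  shows "Q a"
  using assms(1)
proof (induction rule: monoid_algebra_induct)
  case zero
  then show ?case using assms(2) by (simp add: monoid_algebra_sel)
next
  case (add b r u)
  then show ?case using assms(3)[of b u r] by (simp add: monoid_algebra_sel)
qed

lemma KG_minus_apply:
  "\<lbrakk>a \<in> carrier KG; b \<in> carrier KG\<rbrakk> \<Longrightarrow> (a \<ominus>\<^bsub>KG\<^esub> b) w = a w - b w"
  by (simp add: KG.minus_eq monoid_algebra_a_inv monoid_algebra_sel)

lemma KG_smult_apply: "(r \<odot>\<^bsub>KG\<^esub> a) w = r * a w"
  by (simp add: monoid_algebra_sel)

lemma two_nz: "(2 :: 'k) \<noteq> 0"
proof
  assume "(2 :: 'k) = 0"
  then have "of_nat 2 = (0 :: 'k)" by simp
  then have "p dvd 2" using p(3) by (simp only: of_nat_eq_0_iff_char_dvd)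
  then have "p \<le> 2" by (rule dvd_imp_le) simp
  then have "p = 2" using prime_ge_2_nat[OF p(1)] by simp
  with p(2) show False by simp
qed

lemma e_eq: "e = (1 / 2) \<odot>\<^bsub>KG\<^esub> (\<one>\<^bsub>KG\<^esub> \<ominus>\<^bsub>KG\<^esub> single z2)"
  by (simp add: nonprincipal_idempotent_def Let_def s_pow_2)

lemma e_closed [simp]: "e \<in> carrier KG"
  by (simp add: e_eq)

lemma mult_e: "a \<in> carrier KG \<Longrightarrow> a \<otimes>\<^bsub>KG\<^esub> e = (1 / 2) \<odot>\<^bsub>KG\<^esub> (a \<ominus>\<^bsub>KG\<^esub> a \<otimes>\<^bsub>KG\<^esub> single z2)"
  by (simp add: e_eq KG.smult_mult_r KG.minus_eq KG.r_distr KG.r_minus)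

lemma Z_central: "a \<in> carrier KG \<Longrightarrow> a \<otimes>\<^bsub>KG\<^esub> single z2 = single z2 \<otimes>\<^bsub>KG\<^esub> a"
proof (induction rule: KG_induct)
  case (add b r u)
  then show ?case
    by (simp add: KG.l_distr KG.r_distr KG.smult_mult_l KG.smult_mult_r single_mult_single z2_central)
qed simp

lemma e_central: "a \<in> carrier KG \<Longrightarrow> a \<otimes>\<^bsub>KG\<^esub> e = e \<otimes>\<^bsub>KG\<^esub> a"
  by (simp add: mult_e Z_central) (simp add: e_eq KG.smult_mult_l KG.minus_eq KG.l_distr KG.l_minus)

text \<open>The central involution acts as -1 on the block, which is what turns the relations of H
  into those of the quaternion algebra.\<close>

lemma Z_e: "single z2 \<otimes>\<^bsub>KG\<^esub> e = \<ominus>\<^bsub>KG\<^esub> e"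
proof -
  have "single z2 \<otimes>\<^bsub>KG\<^esub> single z2 = \<one>\<^bsub>KG\<^esub>"
    by (simp add: single_mult_single z2_z2 monoid_algebra_sel)
  then have "single z2 \<otimes>\<^bsub>KG\<^esub> e = (1 / 2) \<odot>\<^bsub>KG\<^esub> (single z2 \<ominus>\<^bsub>KG\<^esub> \<one>\<^bsub>KG\<^esub>)" by (simp add: mult_e)
  also have "\<dots> = (1 / 2) \<odot>\<^bsub>KG\<^esub> (\<ominus>\<^bsub>KG\<^esub> (\<one>\<^bsub>KG\<^esub> \<ominus>\<^bsub>KG\<^esub> single z2))"
    by (simp add: KG.minus_eq KG.minus_add KG.a_comm)
  finally show ?thesis by (simp add: e_eq KG.smult_minus_r)
qed

lemma e_e: "e \<otimes>\<^bsub>KG\<^esub> e = e"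
proof -
  have "e \<otimes>\<^bsub>KG\<^esub> e = (1 / 2) \<odot>\<^bsub>KG\<^esub> (e \<oplus>\<^bsub>KG\<^esub> e)"
    by (subst mult_e) (simp_all add: Z_central Z_e KG.minus_eq)
  also have "\<dots> = (1 / 2 + 1 / 2) \<odot>\<^bsub>KG\<^esub> e" by (simp only: KG.smult_l_distr KG.smult_r_distr e_closed)
  also have "(1 / 2 + 1 / 2 :: 'k) = 1" using two_nz by (simp add: add_divide_distrib[symmetric])
  finally show ?thesis by simp
qed

lemma quaternion_relations:
  "single s \<otimes>\<^bsub>KG\<^esub> single s \<otimes>\<^bsub>KG\<^esub> e = \<ominus>\<^bsub>KG\<^esub> e"
  "single t \<otimes>\<^bsub>KG\<^esub> single t \<otimes>\<^bsub>KG\<^esub> e = \<ominus>\<^bsub>KG\<^esub> e"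
  "single t \<otimes>\<^bsub>KG\<^esub> single s \<otimes>\<^bsub>KG\<^esub> e = \<ominus>\<^bsub>KG\<^esub> (single s \<otimes>\<^bsub>KG\<^esub> single t \<otimes>\<^bsub>KG\<^esub> e)"
proof -
  show "single s \<otimes>\<^bsub>KG\<^esub> single s \<otimes>\<^bsub>KG\<^esub> e = \<ominus>\<^bsub>KG\<^esub> e"
    "single t \<otimes>\<^bsub>KG\<^esub> single t \<otimes>\<^bsub>KG\<^esub> e = \<ominus>\<^bsub>KG\<^esub> e"
    by (simp_all add: single_mult_single t_t Z_e flip: z2_def)
  have "single t \<otimes>\<^bsub>KG\<^esub> single s \<otimes>\<^bsub>KG\<^esub> e = single (s \<otimes> t) \<otimes>\<^bsub>KG\<^esub> single z2 \<otimes>\<^bsub>KG\<^esub> e"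
    by (simp add: single_mult_single t_s)
  also have "\<dots> = single (s \<otimes> t) \<otimes>\<^bsub>KG\<^esub> (\<ominus>\<^bsub>KG\<^esub> e)" by (simp add: KG.m_assoc Z_e)
  finally show "single t \<otimes>\<^bsub>KG\<^esub> single s \<otimes>\<^bsub>KG\<^esub> e = \<ominus>\<^bsub>KG\<^esub> (single s \<otimes>\<^bsub>KG\<^esub> single t \<otimes>\<^bsub>KG\<^esub> e)"
    by (simp add: single_mult_single KG.r_minus)
qed

lemma U_closed: "u \<in> U \<Longrightarrow> u \<in> carrier G"
  using U_H H_closed by blast

text \<open>An element of kP is supported on P, and since P and H meet trivially, q v u^-1 lies in P
  only for v = u.\<close>

lemma KP_apply:
  assumes "b \<in> carrier KP" "q \<in> P" "u \<in> H" "v \<in> H"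
  shows "b (q \<otimes> v \<otimes> inv u) = (if v = u then b q else 0)"
proof (cases "v = u")
  case True
  then show ?thesis using assms P_closed H_closed by (simp add: m_assoc)
next
  case False
  have cl: "q \<in> carrier G" "u \<in> carrier G" "v \<in> carrier G" using assms P_closed H_closed by blast+
  have "q \<otimes> v \<otimes> inv u \<notin> P"
  proof
    assume "q \<otimes> v \<otimes> inv u \<in> P"
    then have "inv q \<otimes> (q \<otimes> v \<otimes> inv u) \<in> P"
      using assms(2) subgroup.m_closed[OF P_subgroup] subgroup.m_inv_closed[OF P_subgroup] by blast
    then have "v \<otimes> inv u \<in> P" using cl by (simp add: m_assoc)
    moreover have "v \<otimes> inv u \<in> H"
      using assms subgroup.m_closed[OF H_subgroup] subgroup.m_inv_closed[OF H_subgroup] by blast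
    ultimately have "v \<otimes> inv u = \<one>" using PH by blast
    then have "v \<otimes> inv u \<otimes> u = u" using cl by simp
    then have "v = u" using cl by (simp add: m_assoc)
    with False show False ..
  qed
  with False assms(1) show ?thesis by (simp add: in_monoid_algebra_iff)
qed

text \<open>Up to the factor 1/2 the coefficient b can be read off on the coset Pu. The contribution
  of the second half of e sits on the coset of u times \<open>z2\<close>, which no representative
  from \<open>U\<close> meets.\<close>

lemma coset_apply:
  assumes "b \<in> carrier KP" "q \<in> P" "u \<in> U" "v \<in> U"
  shows "(b \<otimes>\<^bsub>KG\<^esub> (single u \<otimes>\<^bsub>KG\<^esub> e)) (q \<otimes> v) = (if v = u then b q / 2 else 0)"
proof -
  have b: "b \<in> carrier KG" using assms(1) KP_KG by blast
  have cl: "u \<in> carrier G" "v \<in> carrier G" "q \<in> carrier G"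
    using assms U_closed P_closed by blast+
  have H: "u \<in> H" "v \<in> H" "u \<otimes> z2 \<in> H"
    using assms(3,4) U_H z2_H subgroup.m_closed[OF H_subgroup] by blast+
  have "b \<otimes>\<^bsub>KG\<^esub> (single u \<otimes>\<^bsub>KG\<^esub> e) = (b \<otimes>\<^bsub>KG\<^esub> single u) \<otimes>\<^bsub>KG\<^esub> e"
    using b cl by (simp add: KG.m_assoc)
  also have "\<dots> = (1 / 2) \<odot>\<^bsub>KG\<^esub> (b \<otimes>\<^bsub>KG\<^esub> single u \<ominus>\<^bsub>KG\<^esub> b \<otimes>\<^bsub>KG\<^esub> single (u \<otimes> z2))"
    using b cl by (subst mult_e) (simp_all add: KG.m_assoc single_mult_single)
  finally have "(b \<otimes>\<^bsub>KG\<^esub> (single u \<otimes>\<^bsub>KG\<^esub> e)) (q \<otimes> v) =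
      1 / 2 * ((b \<otimes>\<^bsub>KG\<^esub> single u) (q \<otimes> v) - (b \<otimes>\<^bsub>KG\<^esub> single (u \<otimes> z2)) (q \<otimes> v))"
    using b cl by (simp add: KG_smult_apply KG_minus_apply)
  also have "\<dots> = (if v = u then b q / 2 else 0)"
    using b cl assms H U_z2[OF assms(3,4)]
    by (simp add: monoid_algebra_mult_single KP_apply)
  finally show ?thesis .
qed

abbreviation combine :: "('g \<Rightarrow> 'k) \<Rightarrow> ('g \<Rightarrow> 'k) \<Rightarrow> ('g \<Rightarrow> 'k) \<Rightarrow> ('g \<Rightarrow> 'k) \<Rightarrow> ('g \<Rightarrow> 'k)" where
  "combine b1 b2 b3 b4 \<equiv> b1 \<otimes>\<^bsub>KG\<^esub> e \<oplus>\<^bsub>KG\<^esub> (b2 \<otimes>\<^bsub>KG\<^esub> (single s \<otimes>\<^bsub>KG\<^esub> e) \<oplus>\<^bsub>KG\<^esub>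
     (b3 \<otimes>\<^bsub>KG\<^esub> (single t \<otimes>\<^bsub>KG\<^esub> e) \<oplus>\<^bsub>KG\<^esub> b4 \<otimes>\<^bsub>KG\<^esub> (single s \<otimes>\<^bsub>KG\<^esub> single t \<otimes>\<^bsub>KG\<^esub> e)))"

lemma one_e: "e = single \<one> \<otimes>\<^bsub>KG\<^esub> e"
  by (rule KG.l_one[OF e_closed, symmetric, unfolded monoid_algebra_sel])

text \<open>Evaluating at q, qs, qt, qst isolates one of the four coefficients each time.\<close>

lemma combine_unique:
  assumes b: "b1 \<in> carrier KP" "b2 \<in> carrier KP" "b3 \<in> carrier KP" "b4 \<in> carrier KP"
    and zero: "combine b1 b2 b3 b4 = \<zero>\<^bsub>KG\<^esub>"
  shows "b1 = \<zero>\<^bsub>KG\<^esub> \<and> b2 = \<zero>\<^bsub>KG\<^esub> \<and> b3 = \<zero>\<^bsub>KG\<^esub> \<and> b4 = \<zero>\<^bsub>KG\<^esub>"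
proof -
  have U: "\<one> \<in> U" "s \<in> U" "t \<in> U" "s \<otimes> t \<in> U" by (simp_all add: U_def)
  have sum: "combine b1 b2 b3 b4 w = (b1 \<otimes>\<^bsub>KG\<^esub> (single \<one> \<otimes>\<^bsub>KG\<^esub> e)) w + ((b2 \<otimes>\<^bsub>KG\<^esub> (single s \<otimes>\<^bsub>KG\<^esub> e)) w +
      ((b3 \<otimes>\<^bsub>KG\<^esub> (single t \<otimes>\<^bsub>KG\<^esub> e)) w + (b4 \<otimes>\<^bsub>KG\<^esub> (single (s \<otimes> t) \<otimes>\<^bsub>KG\<^esub> e)) w))" for w
    by (simp only: one_e[symmetric] single_mult_single) (simp add: monoid_algebra_sel)
  have "combine b1 b2 b3 b4 (q \<otimes> v) = 0" for q v
    by (subst zero) (simp add: monoid_algebra_sel)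
  note ev = this[unfolded sum]
  note ne = U_distinct U_distinct[THEN not_sym]
  have "b1 q = 0 \<and> b2 q = 0 \<and> b3 q = 0 \<and> b4 q = 0" if q: "q \<in> P" for q
  proof -
    have E: "(if v = \<one> then b1 q / 2 else 0) + ((if v = s then b2 q / 2 else 0) +
        ((if v = t then b3 q / 2 else 0) + (if v = s \<otimes> t then b4 q / 2 else 0))) = 0" if "v \<in> U" for v
      using ev[of q v] unfolding coset_apply[OF b(1) q U(1) that] coset_apply[OF b(2) q U(2) that]
        coset_apply[OF b(3) q U(3) that] coset_apply[OF b(4) q U(4) that] .
    show ?thesis
      using E[OF U(1)] E[OF U(2)] E[OF U(3)] E[OF U(4)]
      by (simp only: ne simp_thms if_True if_False add_0_left add_0_right divide_eq_0_iff two_nz)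
  qed
  moreover have "b1 q = 0 \<and> b2 q = 0 \<and> b3 q = 0 \<and> b4 q = 0" if "q \<notin> P" for q
    using b that by (simp add: in_monoid_algebra_iff)
  ultimately have "b1 q = 0 \<and> b2 q = 0 \<and> b3 q = 0 \<and> b4 q = 0" for q by blast
  then show ?thesis by (simp add: monoid_algebra_sel fun_eq_iff)
qed

lemma combine_lin:
  assumes "b1 \<in> carrier KG" "b2 \<in> carrier KG" "b3 \<in> carrier KG" "b4 \<in> carrier KG"
    "d1 \<in> carrier KG" "d2 \<in> carrier KG" "d3 \<in> carrier KG" "d4 \<in> carrier KG"
  shows "combine b1 b2 b3 b4 \<oplus>\<^bsub>KG\<^esub> r \<odot>\<^bsub>KG\<^esub> combine d1 d2 d3 d4 =
    combine (b1 \<oplus>\<^bsub>KG\<^esub> r \<odot>\<^bsub>KG\<^esub> d1) (b2 \<oplus>\<^bsub>KG\<^esub> r \<odot>\<^bsub>KG\<^esub> d2) (b3 \<oplus>\<^bsub>KG\<^esub> r \<odot>\<^bsub>KG\<^esub> d3) (b4 \<oplus>\<^bsub>KG\<^esub> r \<odot>\<^bsub>KG\<^esub> d4)"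
  using assms by (simp add: KG.l_distr KG.smult_mult_l KG.smult_r_distr KG.a_ac)

definition "combinations = {combine b1 b2 b3 b4 | b1 b2 b3 b4.
   b1 \<in> carrier KP \<and> b2 \<in> carrier KP \<and> b3 \<in> carrier KP \<and> b4 \<in> carrier KP}"

lemma combinationsI:
  "\<lbrakk>b1 \<in> carrier KP; b2 \<in> carrier KP; b3 \<in> carrier KP; b4 \<in> carrier KP\<rbrakk> \<Longrightarrow> combine b1 b2 b3 b4 \<in> combinations"
  unfolding combinations_def by blast

lemma combinations_lin:
  assumes "a \<in> combinations" "d \<in> combinations"
  shows "a \<oplus>\<^bsub>KG\<^esub> r \<odot>\<^bsub>KG\<^esub> d \<in> combinations"
proof -
  interpret KP: assoc_algebra KP by (rule KP_algebra)
  have cl: "b \<oplus>\<^bsub>KG\<^esub> r \<odot>\<^bsub>KG\<^esub> b' \<in> carrier KP" if "b \<in> carrier KP" "b' \<in> carrier KP" for b b'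
    using KP.a_closed[OF that(1) KP.smult_closed[OF that(2), of r]] by (simp add: KP_ops)
  obtain b1 b2 b3 b4 where b: "b1 \<in> carrier KP" "b2 \<in> carrier KP" "b3 \<in> carrier KP" "b4 \<in> carrier KP"
    "a = combine b1 b2 b3 b4" using assms(1) unfolding combinations_def by blast
  obtain d1 d2 d3 d4 where d: "d1 \<in> carrier KP" "d2 \<in> carrier KP" "d3 \<in> carrier KP" "d4 \<in> carrier KP"
    "d = combine d1 d2 d3 d4" using assms(2) unfolding combinations_def by blast
  have "a \<oplus>\<^bsub>KG\<^esub> r \<odot>\<^bsub>KG\<^esub> d =
    combine (b1 \<oplus>\<^bsub>KG\<^esub> r \<odot>\<^bsub>KG\<^esub> d1) (b2 \<oplus>\<^bsub>KG\<^esub> r \<odot>\<^bsub>KG\<^esub> d2) (b3 \<oplus>\<^bsub>KG\<^esub> r \<odot>\<^bsub>KG\<^esub> d3) (b4 \<oplus>\<^bsub>KG\<^esub> r \<odot>\<^bsub>KG\<^esub> d4)"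
    unfolding b(5) d(5)
    by (rule combine_lin) (use b(1-4) d(1-4) in \<open>blast intro: subsetD[OF KP_KG]\<close>)+
  also have "\<dots> \<in> combinations" by (intro combinationsI cl b(1-4) d(1-4))
  finally show ?thesis .
qed

text \<open>Write w = qv with q in P and v in H. Up to \<open>z2\<close>, which only changes the
  sign in front of e, v is one of the four representatives.\<close>

lemma single_mult_e_combination:
  assumes "w \<in> carrier G"
  shows "single w \<otimes>\<^bsub>KG\<^esub> e \<in> combinations"
proof -
  interpret KP: assoc_algebra KP by (rule KP_algebra)
  obtain q v where qv: "q \<in> P" "v \<in> H" "w = q \<otimes> v"
    using assms unfolding P_H[symmetric] set_mult_def by blast
  have cl: "q \<in> carrier G" "v \<in> carrier G" using qv P_closed H_closed by blast+
  have zero: "\<zero>\<^bsub>KG\<^esub> \<in> carrier KP" using KP.zero_closed by (simp add: KP_ops)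
  have q: "single q \<in> carrier KP" "single q \<in> carrier KG" using qv(1) cl by simp_all
  have zero_comb: "\<zero>\<^bsub>KG\<^esub> \<in> combinations"
    using combinationsI[OF zero zero zero zero] by simp
  have base: "single q \<otimes>\<^bsub>KG\<^esub> (single u \<otimes>\<^bsub>KG\<^esub> e) \<in> combinations" if "u \<in> U" for u
  proof -
    from that consider "u = \<one>" | "u = s" | "u = t" | "u = s \<otimes> t" unfolding U_def by blast
    then show ?thesis
    proof cases
      case 1
      then show ?thesis using combinationsI[OF q(1) zero zero zero] q(2) by (simp add: one_e[symmetric])
    next
      case 2
      then show ?thesis using combinationsI[OF zero q(1) zero zero] q(2) by simp
    next
      case 3
      then show ?thesis using combinationsI[OF zero zero q(1) zero] q(2) by simp
    next
      case 4
      then show ?thesis using combinationsI[OF zero zero zero q(1)] q(2) by (simp add: single_mult_single)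
    qed
  qed
  have w: "single w \<otimes>\<^bsub>KG\<^esub> e = single q \<otimes>\<^bsub>KG\<^esub> (single v \<otimes>\<^bsub>KG\<^esub> e)"
    using cl q(2) by (simp add: qv(3) KG.m_assoc[symmetric] single_mult_single)
  from qv(2) show ?thesis
  proof (cases rule: H_cases)
    case (1 u)
    show ?thesis using base[OF 1(1)] unfolding w 1(2) .
  next
    case (2 u)
    then have u: "u \<in> carrier G" using U_closed by blast
    have "single v \<otimes>\<^bsub>KG\<^esub> e = single u \<otimes>\<^bsub>KG\<^esub> (single z2 \<otimes>\<^bsub>KG\<^esub> e)"
      using u by (simp add: 2 KG.m_assoc[symmetric] single_mult_single)
    also have "\<dots> = \<ominus>\<^bsub>KG\<^esub> (single u \<otimes>\<^bsub>KG\<^esub> e)" using u by (simp add: Z_e KG.r_minus)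
    finally have "single w \<otimes>\<^bsub>KG\<^esub> e = \<zero>\<^bsub>KG\<^esub> \<oplus>\<^bsub>KG\<^esub> (- 1) \<odot>\<^bsub>KG\<^esub> (single q \<otimes>\<^bsub>KG\<^esub> (single u \<otimes>\<^bsub>KG\<^esub> e))"
      using u q(2) by (simp add: w KG.r_minus KG.smult_minus_one)
    then show ?thesis using combinations_lin[OF zero_comb base[OF 2(1)]] by simp
  qed
qed

lemma mult_e_combination: "a \<in> carrier KG \<Longrightarrow> a \<otimes>\<^bsub>KG\<^esub> e \<in> combinations"
proof (induction rule: KG_induct)
  case zero
  interpret KP: assoc_algebra KP by (rule KP_algebra)
  have zero: "\<zero>\<^bsub>KG\<^esub> \<in> carrier KP" using KP.zero_closed by (simp add: KP_ops)
  show ?case using combinationsI[OF zero zero zero zero] by simp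
next
  case (add b r u)
  then have "(b \<oplus>\<^bsub>KG\<^esub> r \<odot>\<^bsub>KG\<^esub> single u) \<otimes>\<^bsub>KG\<^esub> e = b \<otimes>\<^bsub>KG\<^esub> e \<oplus>\<^bsub>KG\<^esub> r \<odot>\<^bsub>KG\<^esub> (single u \<otimes>\<^bsub>KG\<^esub> e)"
    by (simp add: KG.l_distr KG.smult_mult_l)
  then show ?case using combinations_lin[OF add.IH single_mult_e_combination[OF add.hyps(2)]] by simp
qed

lemma q8_extension:
  "q8_extension KG KP (single g) (single (inv g)) (single h) (single (inv h)) (single c) (single (inv c))
     (single s) (single t) e p"
proof (intro q8_extension.intro q8_extension_axioms.intro)
  fix a assume "a \<in> carrier KG"
  from mult_e_combination[OF this]
  show "\<exists>b1\<in>carrier KP. \<exists>b2\<in>carrier KP. \<exists>b3\<in>carrier KP. \<exists>b4\<in>carrier KP. a \<otimes>\<^bsub>KG\<^esub> e = combine b1 b2 b3 b4"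
    unfolding combinations_def by blast
next
  fix b1 b2 b3 b4
  assume "b1 \<in> carrier KP" "b2 \<in> carrier KP" "b3 \<in> carrier KP" "b4 \<in> carrier KP"
    "combine b1 b2 b3 b4 = \<zero>\<^bsub>KG\<^esub>"
  then show "b1 = \<zero>\<^bsub>KG\<^esub> \<and> b2 = \<zero>\<^bsub>KG\<^esub> \<and> b3 = \<zero>\<^bsub>KG\<^esub> \<and> b4 = \<zero>\<^bsub>KG\<^esub>"
    by (rule combine_unique)
qed (rule KG_algebra KP_heis KP_KG e_e quaternion_relations KP_ops e_closed e_central KP_indep | assumption |
    simp add: single_mult_single g_s g_t h_s h_t c_s c_t)+

lemma augmentation_e: "augmentation e = 0"
proof -
  have e: "e w = 1 / 2 * (single \<one> w - single z2 w)" for w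
  proof -
    have "e w = 1 / 2 * (\<one>\<^bsub>KG\<^esub> \<ominus>\<^bsub>KG\<^esub> single z2) w"
      unfolding e_eq by (rule KG_smult_apply)
    also have "(\<one>\<^bsub>KG\<^esub> \<ominus>\<^bsub>KG\<^esub> single z2) w = \<one>\<^bsub>KG\<^esub> w - single z2 w"
      by (rule KG_minus_apply) simp_all
    finally show ?thesis by (simp add: monoid_algebra_sel)
  qed
  have "augmentation e = (\<Sum>w\<in>{\<one>, z2}. e w)"
    unfolding augmentation_def
    by (rule sum.mono_neutral_left) (auto simp: e single_def)
  also have "\<dots> = 0" using one_z2 one_z2[THEN not_sym] by (simp add: e single_def)
  finally show ?thesis .
qed

end

theorem theorem1p2:
  fixes p :: nat
    and G :: "('g, 'b) monoid_scheme"
    and P H :: "'g set"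
    and g h c s t :: 'g
    and e :: "'g \<Rightarrow> 'k::alg_closed_field"
  assumes "prime p" and "odd p" and "CHAR('k) = p"
    and "extraspecial_quaternion_setup p G P H g h c s t"
    and "e = nonprincipal_idempotent TYPE('k) G s"
  shows "is_basic_algebra_of
           (presented_algebra TYPE('k) (commutator_relations TYPE('k) p))
           (graded_algebra (monoid_algebra TYPE('k) (G\<lparr>carrier := P\<rparr>)))
       \<and> nonprincipal_block_idempotent TYPE('k) G e
       \<and> is_basic_algebra_of
           (presented_algebra TYPE('k) (anticommutator_relations TYPE('k) p))
           (graded_algebra (corner_algebra (monoid_algebra TYPE('k) G) e))"
proof -
  interpret q8_setup "TYPE('k)" p G P H g h c s t
    using assms(1-4) by (rule q8_setup.intro)
  interpret q8_extension "monoid_algebra TYPE('k) G" "monoid_algebra TYPE('k) (G\<lparr>carrier := P\<rparr>)"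
    "single g" "single (inv\<^bsub>G\<^esub> g)" "single h" "single (inv\<^bsub>G\<^esub> h)" "single c" "single (inv\<^bsub>G\<^esub> c)"
    "single s" "single t" e p
    unfolding assms(5) by (rule q8_extension)
  \<comment> \<open>A root of -1 exists because k is algebraically closed; it splits the quaternion
    algebra kHe into 2 by 2 matrices.\<close>
  obtain \<iota> :: 'k where \<iota>: "\<iota> * \<iota> = - 1"
    using nth_root_exists[of 2 "- 1 :: 'k"] by (auto simp: power2_eq_square)
  have "augmentation e = 0" unfolding assms(5) by (rule augmentation_e)
  then show ?thesis
    unfolding nonprincipal_block_idempotent_def commutator_relations_eq anticommutator_relations_eq
    by (intro conjI KP_basic_algebra corner_basic_algebra[OF \<iota>] e_block_idempotent[OF \<iota>])
qed

end
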